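(* Let $\Omega,\Omega'$ be bounded open subsets of $\mathbb R^n$ with $\Omega\Subset\Omega'$ and $\vartheta\in W^{s,G}(\Omega,\Omega')\cap L^g_s(\mathbb R^n)$. Suppose that $\psi:\Omega\to[-\infty,\infty]$ is locally H\"older continuous in $\Omega$ or $\psi\equiv-\infty$. Then the solution $u$ to the obstacle problem in $\mathcal K_{\psi,\vartheta}(\Omega,\Omega')$ has a representative which is locally H\"older continuous in $\Omega$.
   Context: Fix $n\in\mathbb N$, $s\in(0,1)$, $\Lambda\ge1$. $G(t)=\int_0^tg$ is a differentiable Young function with $g=G'$ strictly increasing, $G(1)=1$, and $1<p\le q$ with $pG(t)\le tg(t)\le qG(t)$ for $t\ge0$. $k$ measurable with $\Lambda^{-1}\le k(x,y)=k(y,x)\le\Lambda$ a.e. $D^su(x,y)=(u(x)-u(y))/|x-y|^s$. $\|u\|_{L^G(\Omega)}=\inf\{\lambda>0:\int_\Omega G(|u|/\lambda)\le1\}$. $W^{s,G}(\Omega,\Omega')$: measurable $u$ with $\int_\Omega G(|u|)<\infty$ and $\int_\Omega\int_{\Omega'}G(|D^su|)|x-y|^{-n}dydx<\infty$, normed by $\|u\|_{L^G(\Omega)}+\inf\{\lambda>0:\int_\Omega\int_{\Omega'}G(|D^su|/\lambda)|x-y|^{-n}\le1\}$; $W^{s,G}_0(\Omega,\Omega')$ is the closure of $C_c^\infty(\Omega)$. $L^g_s(\mathbb R^n)$: measurable $u$ with $g(|u|)$ locally integrable and $\int g(|u(x)|/(1+|x|)^s)(1+|x|)^{-n-s}dx<\infty$.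 $\mathcal E(u,v)=\int\int g(|D^su|)\frac{D^su}{|D^su|}D^sv\frac{k(x,y)}{|x-y|^n}dydx$. $\mathcal K_{\psi,\vartheta}(\Omega,\Omega')=\{u\in W^{s,G}(\Omega,\Omega'):u\ge\psi\text{ a.e. in }\Omega,\ u-\vartheta\in W^{s,G}_0(\Omega,\Omega')\}$; the solution to the obstacle problem is $u\in\mathcal K_{\psi,\vartheta}(\Omega,\Omega')$ with $\mathcal E(u,v-u)\ge0$ for all $v\in\mathcal K_{\psi,\vartheta}(\Omega,\Omega')$. *)

theory Defs
  imports "HOL-Analysis.Analysis"
begin

definition young_function :: "(real \<Rightarrow> real) \<Rightarrow> bool" where
  "young_function G \<longleftrightarrow> G 0 = 0 \<and> convex_on {0..} G \<and> (\<forall>t>0. G t > 0)"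

definition growth_fun :: "(real \<Rightarrow> real) \<Rightarrow> (real \<Rightarrow> real) \<Rightarrow> real \<Rightarrow> real \<Rightarrow> bool" where
  "growth_fun G g p q \<longleftrightarrow>
     young_function G \<and>
     (\<forall>t\<ge>0. (G has_real_derivative g t) (at t within {0..})) \<and>
     (\<forall>t\<ge>0. (g has_integral G t) {0..t}) \<and>
     strict_mono_on {0..} g \<and>
     G 1 = 1 \<and> 1 < p \<and> p \<le> q \<and>
     (\<forall>t\<ge>0. p * G t \<le> t * g t \<and> t * g t \<le> q * G t)"

definition Ds :: "real \<Rightarrow> ('a::euclidean_space \<Rightarrow> real) \<Rightarrow> 'a \<Rightarrow> 'a \<Rightarrow> real" where
  "Ds s u x y = (u x - u y) / (norm (x - y) powr s)"

definition modular_L :: "(real \<Rightarrow> real) \<Rightarrow> 'a::euclidean_space set \<Rightarrow> ('a \<Rightarrow> real) \<Rightarrow> ennreal" where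
  "modular_L G \<Omega> u = (\<integral>\<^sup>+ x. indicator \<Omega> x * ennreal (G \<bar>u x\<bar>) \<partial>lebesgue)"

definition modular_W :: "real \<Rightarrow> (real \<Rightarrow> real) \<Rightarrow> 'a::euclidean_space set \<Rightarrow> 'a set
    \<Rightarrow> ('a \<Rightarrow> real) \<Rightarrow> ennreal" where
  "modular_W s G \<Omega> \<Omega>' u =
     (\<integral>\<^sup>+ z. indicator (\<Omega> \<times> \<Omega>') z *
        ennreal (G \<bar>Ds s u (fst z) (snd z)\<bar> / norm (fst z - snd z) ^ DIM('a))
      \<partial>(lebesgue \<Otimes>\<^sub>M lebesgue))"

definition lux_L :: "(real \<Rightarrow> real) \<Rightarrow> 'a::euclidean_space set \<Rightarrow> ('a \<Rightarrow> real) \<Rightarrow> real" where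
  "lux_L G \<Omega> u = Inf {c. c > 0 \<and> modular_L G \<Omega> (\<lambda>x. u x / c) \<le> 1}"

definition lux_W :: "real \<Rightarrow> (real \<Rightarrow> real) \<Rightarrow> 'a::euclidean_space set \<Rightarrow> 'a set
    \<Rightarrow> ('a \<Rightarrow> real) \<Rightarrow> real" where
  "lux_W s G \<Omega> \<Omega>' u = Inf {c. c > 0 \<and> modular_W s G \<Omega> \<Omega>' (\<lambda>x. u x / c) \<le> 1}"

definition norm_W :: "real \<Rightarrow> (real \<Rightarrow> real) \<Rightarrow> 'a::euclidean_space set \<Rightarrow> 'a set
    \<Rightarrow> ('a \<Rightarrow> real) \<Rightarrow> real" where
  "norm_W s G \<Omega> \<Omega>' u = lux_L G \<Omega> u + lux_W s G \<Omega> \<Omega>' u"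

definition in_W :: "real \<Rightarrow> (real \<Rightarrow> real) \<Rightarrow> 'a::euclidean_space set \<Rightarrow> 'a set
    \<Rightarrow> ('a \<Rightarrow> real) \<Rightarrow> bool" where
  "in_W s G \<Omega> \<Omega>' u \<longleftrightarrow> u \<in> borel_measurable lebesgue \<and>
     modular_L G \<Omega> u < \<infinity> \<and> modular_W s G \<Omega> \<Omega>' u < \<infinity>"

fun iter_dd :: "'a::euclidean_space list \<Rightarrow> ('a \<Rightarrow> real) \<Rightarrow> 'a \<Rightarrow> real" where
  "iter_dd [] f = f"
| "iter_dd (v # vs) f = (\<lambda>x. frechet_derivative (iter_dd vs f) (at x) v)"

definition smooth_fun :: "('a::euclidean_space \<Rightarrow> real) \<Rightarrow> bool" where
  "smooth_fun f \<longleftrightarrow> (\<forall>vs x. iter_dd vs f differentiable (at x))"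

definition test_fun :: "'a::euclidean_space set \<Rightarrow> ('a \<Rightarrow> real) \<Rightarrow> bool" where
  "test_fun \<Omega> \<phi> \<longleftrightarrow> smooth_fun \<phi> \<and> compact (closure {x. \<phi> x \<noteq> 0}) \<and>
     closure {x. \<phi> x \<noteq> 0} \<subseteq> \<Omega>"

definition in_W0 :: "real \<Rightarrow> (real \<Rightarrow> real) \<Rightarrow> 'a::euclidean_space set \<Rightarrow> 'a set
    \<Rightarrow> ('a \<Rightarrow> real) \<Rightarrow> bool" where
  "in_W0 s G \<Omega> \<Omega>' w \<longleftrightarrow> in_W s G \<Omega> \<Omega>' w \<and>
     (AE x in lebesgue. x \<notin> \<Omega> \<longrightarrow> w x = 0) \<and>
     (\<exists>\<phi>. (\<forall>k. test_fun \<Omega> (\<phi> k)) \<and>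
        (\<lambda>k. norm_W s G \<Omega> \<Omega>' (\<lambda>x. w x - \<phi> k x)) \<longlonglongrightarrow> 0)"

definition in_tail :: "(real \<Rightarrow> real) \<Rightarrow> real \<Rightarrow> ('a::euclidean_space \<Rightarrow> real) \<Rightarrow> bool" where
  "in_tail g s u \<longleftrightarrow> u \<in> borel_measurable lebesgue \<and>
     (\<forall>K. compact K \<longrightarrow> (\<integral>\<^sup>+ x. indicator K x * ennreal (g \<bar>u x\<bar>) \<partial>lebesgue) < \<infinity>) \<and>
     (\<integral>\<^sup>+ x. ennreal (g (\<bar>u x\<bar> / (1 + norm x) powr s) * (1 + norm x) powr (- (real DIM('a) + s)))
        \<partial>lebesgue) < \<infinity>"

definition energy_integrand :: "real \<Rightarrow> (real \<Rightarrow> real) \<Rightarrow> ('a::euclidean_space \<Rightarrow> 'a \<Rightarrow> real)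
    \<Rightarrow> ('a \<Rightarrow> real) \<Rightarrow> ('a \<Rightarrow> real) \<Rightarrow> 'a \<times> 'a \<Rightarrow> real" where
  "energy_integrand s g k u v z =
     g \<bar>Ds s u (fst z) (snd z)\<bar> * sgn (Ds s u (fst z) (snd z)) * Ds s v (fst z) (snd z)
     * k (fst z) (snd z) / norm (fst z - snd z) ^ DIM('a)"

definition energy :: "real \<Rightarrow> (real \<Rightarrow> real) \<Rightarrow> ('a::euclidean_space \<Rightarrow> 'a \<Rightarrow> real)
    \<Rightarrow> ('a \<Rightarrow> real) \<Rightarrow> ('a \<Rightarrow> real) \<Rightarrow> real" where
  "energy s g k u v = (\<integral> z. energy_integrand s g k u v z \<partial>(lebesgue \<Otimes>\<^sub>M lebesgue))"

definition obstacle_set :: "real \<Rightarrow> (real \<Rightarrow> real) \<Rightarrow> 'a::euclidean_space set \<Rightarrow> 'a set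
    \<Rightarrow> ('a \<Rightarrow> ereal) \<Rightarrow> ('a \<Rightarrow> real) \<Rightarrow> ('a \<Rightarrow> real) set" where
  "obstacle_set s G \<Omega> \<Omega>' \<psi> \<theta> = {u. in_W s G \<Omega> \<Omega>' u \<and>
     (AE x in lebesgue. x \<in> \<Omega> \<longrightarrow> \<psi> x \<le> ereal (u x)) \<and>
     in_W0 s G \<Omega> \<Omega>' (\<lambda>x. u x - \<theta> x)}"

definition obstacle_solution :: "real \<Rightarrow> (real \<Rightarrow> real) \<Rightarrow> (real \<Rightarrow> real)
    \<Rightarrow> ('a::euclidean_space \<Rightarrow> 'a \<Rightarrow> real) \<Rightarrow> 'a set \<Rightarrow> 'a set
    \<Rightarrow> ('a \<Rightarrow> ereal) \<Rightarrow> ('a \<Rightarrow> real) \<Rightarrow> ('a \<Rightarrow> real) \<Rightarrow> bool" where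
  "obstacle_solution s G g k \<Omega> \<Omega>' \<psi> \<theta> u \<longleftrightarrow>
     u \<in> obstacle_set s G \<Omega> \<Omega>' \<psi> \<theta> \<and>
     (\<forall>v \<in> obstacle_set s G \<Omega> \<Omega>' \<psi> \<theta>.
        integrable (lebesgue \<Otimes>\<^sub>M lebesgue) (energy_integrand s g k u (\<lambda>x. v x - u x)) \<and>
        energy s g k u (\<lambda>x. v x - u x) \<ge> 0)"

definition locally_holder_on :: "'a::euclidean_space set \<Rightarrow> ('a \<Rightarrow> real) \<Rightarrow> bool" where
  "locally_holder_on \<Omega> f \<longleftrightarrow>
     (\<forall>K. compact K \<and> K \<subseteq> \<Omega> \<longrightarrow>
        (\<exists>\<alpha> C. 0 < \<alpha> \<and> \<alpha> \<le> 1 \<and>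
           (\<forall>x\<in>K. \<forall>y\<in>K. \<bar>f x - f y\<bar> \<le> C * norm (x - y) powr \<alpha>)))"

end

theory Submission
  imports Defs
begin

text \<open>
  The solution is treated by De Giorgi's level set method, in a form that avoids fractional
  Sobolev embeddings. Testing with a power of a cutoff times \<open>(u - l)\<^sub>+\<close> and keeping, on the left, only
  the interaction between the super-level set \<open>{u > l}\<close> and the sub-level set \<open>{u \<le> l}\<close> gives a
  Caccioppoli inequality whose left-hand side already controls the modular of \<open>(u - l)\<^sub>+\<close> as soon as
  \<open>{u > l}\<close> occupies little of the ball: around each point of \<open>{u > l}\<close>, half of a small ball lies in the
  sub-level set. This yields local boundedness and, starting from a half-measure sub-level set, a
  decrease of the upper bound. The test functions are admissible for \<open>-u\<close> at every level, and for \<open>u\<close> at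
  levels \<open>l \<ge> sup \<psi>\<close> on the ball. At lower levels the Hoelder continuity of \<open>\<psi>\<close> bounds \<open>u\<close> from below
  by \<open>l\<close> minus a power of the radius, so that the oscillation decays geometrically in either case.
\<close>

section \<open>Growth functions\<close>

text \<open>What replaces the Sobolev gain is a free choice of radius. A point at height h above the
  level, facing half of a ball of radius \<rho> below it, contributes G (h / \<rho>^s), which
  exceeds G (h / R^s) by at least the factor (R/\<rho>)^(s p). Small super-level sets permit a small
  \<rho>, and prescribing \<rho> geometrically along the iteration beats the geometrically growing
  Caccioppoli constants without a nonlinear recursion. \<open>G\<close> is not homogeneous, so
  heights cannot be rescaled to one. Tails are therefore always compared with g (H / R^s) / R^s for
  a height H tied to the current oscillation, and the tail constant must be fixed before the small
  parameter \<delta> of the growth lemma. Two obstacles come from the setting. The boundary class is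
  a closure of smooth functions in a Luxemburg norm, so truncations have to be mollified, and norm
  and modular convergence have to be linked. The solution is only Lebesgue measurable, so the
  estimates are carried out for a Borel representative with iterated integrals over
  \<open>lborel\<close>.\<close>

text \<open>\<open>N\<close> is an integer upper growth exponent (\<open>q\<close> rounded up), so that powers of cutoffs are ordinary powers.\<close>

locale growth =
  fixes G g :: "real \<Rightarrow> real" and p :: real and N :: nat
  assumes G_deriv: "0 \<le> t \<Longrightarrow> (G has_real_derivative g t) (at t within {0..})"
    and G_zero [simp]: "G 0 = 0"
    and G_pos: "0 < t \<Longrightarrow> 0 < G t"
    and g_strict: "strict_mono_on {0..} g"
    and G_one [simp]: "G 1 = 1"
    and p_gt_1: "1 < p" and p_le_N: "p \<le> real N"
    and pG_le: "0 \<le> t \<Longrightarrow> p * G t \<le> t * g t"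
    and tg_le: "0 \<le> t \<Longrightarrow> t * g t \<le> real N * G t"
begin

lemma N_gt_1: "1 < real N" using p_gt_1 p_le_N by linarith

lemma N_pos [simp]: "0 < N" using N_gt_1 by simp

lemma G_nonneg: "0 \<le> t \<Longrightarrow> 0 \<le> G t"
  using G_pos[of t] by (cases "t = 0") auto

lemma G_deriv_at: "0 < t \<Longrightarrow> (G has_real_derivative g t) (at t)"
  using G_deriv[of t] at_within_interior[of t "{0::real..}"] by simp

text \<open>The growth conditions say that the logarithmic derivative of \<open>G\<close> lies
  between p/t and N/t, so \<open>ln (G x) - p * ln x\<close> and \<open>N * ln x - ln (G x)\<close>
  are nondecreasing; exponentiating gives the two power bounds.\<close>

lemma G_scale_aux:
  assumes "0 < a" "a \<le> b"
  shows "(b/a) powr p * G a \<le> G b" "G b \<le> (b/a) ^ N * G a"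
proof -
  have ab: "0 < b" using assms by simp
  have "ln (G a) - p * ln a \<le> ln (G b) - p * ln b"
  proof (rule DERIV_nonneg_imp_nondecreasing[OF assms(2)])
    fix x assume x: "a \<le> x" "x \<le> b"
    hence x0: "0 < x" using assms by simp
    have "((\<lambda>x. ln (G x) - p * ln x) has_real_derivative g x / G x - p / x) (at x)"
      using G_pos[OF x0] x0
      by (auto intro!: derivative_eq_intros G_deriv_at simp: field_simps)
    moreover have "0 \<le> g x / G x - p / x"
      using pG_le[of x] G_pos[OF x0] x0 by (simp add: field_simps)
    ultimately show "\<exists>y. ((\<lambda>x. ln (G x) - p * ln x) has_real_derivative y) (at x) \<and> 0 \<le> y" by blast
  qed
  hence "p * (ln b - ln a) + ln (G a) \<le> ln (G b)" by (simp add: algebra_simps)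
  hence "exp (p * (ln b - ln a) + ln (G a)) \<le> exp (ln (G b))" by simp
  thus "(b/a) powr p * G a \<le> G b"
    using G_pos[OF assms(1)] G_pos[OF ab] assms ab by (simp add: exp_add powr_def ln_div)
  have "N * ln a - ln (G a) \<le> N * ln b - ln (G b)"
  proof (rule DERIV_nonneg_imp_nondecreasing[OF assms(2)])
    fix x assume x: "a \<le> x" "x \<le> b"
    hence x0: "0 < x" using assms by simp
    have "((\<lambda>x. N * ln x - ln (G x)) has_real_derivative N / x - g x / G x) (at x)"
      using G_pos[OF x0] x0
      by (auto intro!: derivative_eq_intros G_deriv_at simp: field_simps)
    moreover have "0 \<le> N / x - g x / G x"
      using tg_le[of x] G_pos[OF x0] x0 by (simp add: field_simps)
    ultimately show "\<exists>y. ((\<lambda>x. N * ln x - ln (G x)) has_real_derivative y) (at x) \<and> 0 \<le> y" by blast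
  qed
  hence "ln (G b) \<le> N * (ln b - ln a) + ln (G a)" by (simp add: algebra_simps)
  hence "exp (ln (G b)) \<le> exp (N * (ln b - ln a) + ln (G a))" by simp
  also have "\<dots> = (b/a) powr N * G a"
    using G_pos[OF assms(1)] assms ab by (simp add: exp_add powr_def ln_div)
  also have "(b/a) powr N = (b/a)^N" using assms ab by (intro powr_realpow) simp
  finally show "G b \<le> (b/a) ^ N * G a" using G_pos[OF ab] by simp
qed

lemma G_scale_lower: "1 \<le> l \<Longrightarrow> 0 \<le> t \<Longrightarrow> l powr p * G t \<le> G (l * t)"
  using G_scale_aux(1)[of t "l*t"] mult_right_mono[of 1 l t] by (cases "t = 0") auto

lemma G_scale_upper: "1 \<le> l \<Longrightarrow> 0 \<le> t \<Longrightarrow> G (l * t) \<le> l ^ N * G t"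
  using G_scale_aux(2)[of t "l*t"] mult_right_mono[of 1 l t] by (cases "t = 0") auto

lemma G_scale_small:
  assumes "0 \<le> l" "l \<le> 1" "0 \<le> t" shows "G (l * t) \<le> l powr p * G t"
proof (cases "l = 0")
  case False
  hence l: "0 < l" using assms by simp
  have "(1/l) powr p * G (l*t) \<le> G ((1/l) * (l*t))"
    using assms l by (intro G_scale_lower) auto
  thus ?thesis using l by (simp add: powr_divide field_simps)
qed simp

lemma G_scale_small_lower:
  assumes "0 \<le> l" "l \<le> 1" "0 \<le> t" shows "l ^ N * G t \<le> G (l * t)"
proof (cases "l = 0")
  case False
  hence l: "0 < l" using assms by simp
  have "G ((1/l) * (l*t)) \<le> (1/l) ^ N * G (l*t)"
    using assms l by (intro G_scale_upper) auto
  thus ?thesis using l by (simp add: power_divide field_simps)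
qed (simp add: zero_power)

lemma G_mono: assumes "0 \<le> a" "a \<le> b" shows "G a \<le> G b"
proof (cases "a = 0")
  case True thus ?thesis using G_nonneg[of b] assms by simp
next
  case False
  hence "1 * G a \<le> (b/a) powr p * G a"
    using assms G_nonneg[of a] p_gt_1 by (intro mult_right_mono ge_one_powr_ge_zero) (auto simp: field_simps)
  also have "\<dots> \<le> G b" using False assms by (intro G_scale_aux) auto
  finally show ?thesis by simp
qed

lemma g_mono: "0 \<le> a \<Longrightarrow> a \<le> b \<Longrightarrow> g a \<le> g b"
  using strict_mono_onD[OF g_strict, of a b] by (cases "a = b") auto

text \<open>Since G 1 = 1, scaling gives G t \<le> t^p near 0, and p > 1 forces the right difference
  quotient at 0 to vanish. Only a one-sided derivative is available there.\<close>

lemma g_zero [simp]: "g 0 = 0"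
proof -
  have "((\<lambda>t. (G t - G 0) / (t - 0)) \<longlongrightarrow> g 0) (at 0 within {0..})"
    using G_deriv[of 0] by (simp only: has_field_derivative_iff)
  hence 1: "((\<lambda>t. (G t - G 0) / (t - 0)) \<longlongrightarrow> g 0) (at_right 0)"
    by (rule tendsto_within_subset) auto
  have "((\<lambda>t. (G t - G 0) / (t - 0)) \<longlongrightarrow> 0) (at_right 0)"
  proof (rule tendsto_sandwich[OF _ _ tendsto_const[of 0]])
    show "\<forall>\<^sub>F t in at_right 0. 0 \<le> (G t - G 0) / (t - 0)"
      using G_nonneg by (auto simp: eventually_at_filter)
    have "\<forall>\<^sub>F t in at_right 0. t \<in> {0<..<1::real}"
      by (rule eventually_at_rightI[of _ 1]) auto
    thus "\<forall>\<^sub>F t in at_right 0. (G t - G 0) / (t - 0) \<le> t powr (p - 1)"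
    proof (eventually_elim, goal_cases)
      case (1 t)
      have "G t \<le> t powr p" using G_scale_small[of t 1] 1 by simp
      thus ?case using 1 by (simp add: powr_diff field_simps)
    qed
    show "((\<lambda>t. t powr (p - 1)) \<longlongrightarrow> 0) (at_right (0::real))"
      using p_gt_1 by (auto intro!: tendsto_eq_intros simp: eventually_at_filter)
  qed
  from tendsto_unique[OF _ 1 this] show ?thesis by simp
qed

lemma g_nonneg: "0 \<le> t \<Longrightarrow> 0 \<le> g t"
  using g_mono[of 0 t] by simp

lemma G_le_tg: "0 \<le> t \<Longrightarrow> G t \<le> t * g t"
  using pG_le[of t] G_nonneg[of t] p_gt_1 mult_right_mono[of 1 p "G t"] by simp

text \<open>Comparability of t g(t) with G(t) transfers scaling from \<open>G\<close> to
  \<open>g\<close> at the cost of a factor N. The exponent stays N instead of N - 1 because the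
  spare factor \<open>l\<close> is dropped using l \<ge> 1.\<close>

lemma g_scale_upper:
  assumes "1 \<le> l" "0 \<le> t" shows "g (l * t) \<le> real N * l ^ N * g t"
proof (cases "t = 0")
  case False
  hence t: "0 < t" using assms by simp
  have "l * t * g (l*t) \<le> N * G (l*t)" using assms by (intro tg_le) auto
  also have "\<dots> \<le> N * (l^N * G t)" using assms by (intro mult_left_mono G_scale_upper) auto
  also have "\<dots> \<le> N * (l^N * (t * g t))" using assms by (intro mult_left_mono G_le_tg) auto
  finally have "l * g (l*t) \<le> N * l^N * g t" using t by (simp add: field_simps)
  moreover have "1 * g (l*t) \<le> l * g (l*t)" using assms by (intro mult_right_mono g_nonneg) auto
  ultimately show ?thesis by simp
qed simp

lemma g_scale_lower:
  assumes "1 \<le> l" "0 \<le> t" shows "l powr (p-1) * g t \<le> real N * g (l * t)"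
proof (cases "t = 0")
  case False
  hence t: "0 < t" using assms by simp
  have l: "0 < l" using assms by simp
  have "l powr p * (t * g t) \<le> l powr p * (N * G t)" using assms by (intro mult_left_mono tg_le) auto
  also have "\<dots> = N * (l powr p * G t)" by simp
  also have "\<dots> \<le> N * G (l*t)" using assms by (intro mult_left_mono G_scale_lower) auto
  also have "\<dots> \<le> N * (l*t*g(l*t))" using assms by (intro mult_left_mono G_le_tg) auto
  finally show ?thesis using t l by (simp add: powr_diff field_simps)
qed simp

text \<open>The positive power p - 1 of a small factor is the source of smallness in the growth
  lemma.\<close>

lemma g_scale_small:
  assumes "0 \<le> l" "l \<le> 1" "0 \<le> t" shows "g (l * t) \<le> real N * l powr (p-1) * g t"
proof (cases "l = 0")
  case False
  hence l: "0 < l" using assms by simp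
  have "(1/l) powr (p-1) * g (l*t) \<le> N * g ((1/l) * (l*t))"
    using assms l by (intro g_scale_lower) auto
  thus ?thesis using l by (simp add: powr_divide field_simps)
qed simp

lemma G_add:
  assumes "0 \<le> a" "0 \<le> b" shows "G (a + b) \<le> 2^N * (G a + G b)"
proof -
  have "G (a + b) \<le> G (2 * max a b)" using assms by (intro G_mono) auto
  also have "\<dots> \<le> 2^N * G (max a b)" using assms by (intro G_scale_upper) auto
  also have "G (max a b) \<le> G a + G b" using G_nonneg assms by (auto simp: max_def)
  finally show ?thesis by simp
qed

lemma G_abs_add: "G \<bar>a + b\<bar> \<le> 2^N * (G \<bar>a\<bar> + G \<bar>b\<bar>)"
  using G_add[of "\<bar>a\<bar>" "\<bar>b\<bar>"] G_mono[of "\<bar>a+b\<bar>" "\<bar>a\<bar>+\<bar>b\<bar>"] abs_triangle_ineq[of a b] by linarith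

lemma g_add:
  assumes "0 \<le> a" "0 \<le> b" shows "g (a + b) \<le> real N * 2^N * (g a + g b)"
proof -
  have "g (a + b) \<le> g (2 * max a b)" using assms by (intro g_mono) auto
  also have "\<dots> \<le> real N * 2^N * g (max a b)" using assms by (intro g_scale_upper) auto
  also have "g (max a b) \<le> g a + g b" using g_nonneg assms by (auto simp: max_def)
  finally show ?thesis by simp
qed

lemma g_le_G: assumes "0 \<le> t" shows "g t \<le> real N * (1 + G t)"
proof (cases "t \<le> 1")
  case True
  hence "g t \<le> g 1" using assms g_mono by simp
  also have "\<dots> \<le> N" using tg_le[of 1] by simp
  also have "\<dots> \<le> N * (1 + G t)" using G_nonneg[OF assms] by (simp add: field_simps)
  finally show ?thesis .
next
  case False
  have "1 * g t \<le> t * g t" using False g_nonneg[of t] by (intro mult_right_mono) auto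
  also have "\<dots> \<le> N * G t" using assms by (rule tg_le)
  finally show ?thesis by (simp add: algebra_simps)
qed

lemma G_ge_self: assumes "1 \<le> t" shows "t \<le> G t"
proof -
  have "t powr 1 \<le> t powr p" using assms p_gt_1 by (intro powr_mono) auto
  also have "\<dots> \<le> G t" using G_scale_lower[of t 1] assms by simp
  finally show ?thesis using assms by simp
qed

lemma g_ge_powr: assumes "1 \<le> t" shows "t powr (p-1) \<le> g t"
proof -
  have "1 * t powr p \<le> p * G t" using G_scale_lower[of t 1] assms p_gt_1 by (intro mult_mono) auto
  also have "\<dots> \<le> t * g t" using assms by (intro pG_le) auto
  finally show ?thesis using assms by (simp add: powr_diff field_simps)
qed

lemma g_pos: "0 < t \<Longrightarrow> 0 < g t"
  using strict_mono_onD[OF g_strict, of 0 t] by simp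

text \<open>Lets a tail bound that is fixed in advance be absorbed by taking the height, or the
  initial oscillation, large.\<close>

lemma g_unbounded: "\<exists>t0>0. \<forall>t\<ge>t0. B \<le> g t"
proof (intro exI conjI allI impI)
  define t0 where "t0 = max 1 (\<bar>B\<bar> powr (1/(p-1)))"
  show "0 < t0" by (simp add: t0_def)
  fix t assume t: "t0 \<le> t"
  have "B \<le> (\<bar>B\<bar> powr (1/(p-1))) powr (p-1)"
    using p_gt_1 by (cases "B = 0") (auto simp: powr_powr)
  also have "\<dots> \<le> t powr (p-1)" using t p_gt_1 by (intro powr_mono2) (auto simp: t0_def)
  also have "\<dots> \<le> g t" using t by (intro g_ge_powr) (auto simp: t0_def)
  finally show "B \<le> g t" .
qed

text \<open>Convexity of \<open>G\<close> in tangent form, read off from the monotonicity of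
  \<open>g\<close> by the mean value theorem; in this form it integrates to Jensen's
  inequality.\<close>

lemma G_tangent:
  assumes "0 \<le> a" "0 \<le> b" shows "G a + g a * (b - a) \<le> G b"
proof -
  have mvt: "\<exists>z. x < z \<and> z < y \<and> G y - G x = (y - x) * g z" if "0 \<le> x" "x < y" for x y
  proof -
    have "\<exists>z\<in>{x<..<y}. G y - G x = g z * (y - x)"
    proof (rule mvt_simple[OF that(2), where f = G and f' = "\<lambda>z h. g z * h"])
      fix z assume "x \<le> z" "z \<le> y"
      thus "(G has_derivative (\<lambda>h. g z * h)) (at z within {x..y})"
        using that G_deriv[of z] unfolding has_field_derivative_def
        by (auto intro: has_derivative_subset)
    qed
    then obtain z where "z \<in> {x<..<y}" "G y - G x = g z * (y - x)" by blast
    thus ?thesis by (intro exI[of _ z]) (simp add: mult.commute)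
  qed
  consider "a = b" | "a < b" | "b < a" by linarith
  thus ?thesis
  proof cases
    case 2
    then obtain z where z: "a < z" "z < b" "G b - G a = (b - a) * g z" using mvt assms by blast
    have "(b - a) * g a \<le> (b - a) * g z" using z assms 2 by (intro mult_left_mono g_mono) auto
    thus ?thesis using z by (simp add: algebra_simps)
  next
    case 3
    then obtain z where z: "b < z" "z < a" "G a - G b = (a - b) * g z" using mvt assms by blast
    have "(a - b) * g z \<le> (a - b) * g a" using z assms 3 by (intro mult_left_mono g_mono) auto
    thus ?thesis using z by (simp add: algebra_simps)
  qed auto
qed

text \<open>\<open>G\<close> is monotone only on the half-line, so measurability is taken from its
  extension to the left by a constant.\<close>

lemma G_comp_measurable [measurable (raw)]:
  assumes "f \<in> borel_measurable M" shows "(\<lambda>x. G \<bar>f x\<bar>) \<in> borel_measurable M"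
proof -
  have "mono (\<lambda>t. G (max 0 t))" by (intro monoI G_mono) auto
  hence [measurable]: "(\<lambda>t. G (max 0 t)) \<in> borel_measurable borel" by (rule borel_measurable_mono)
  have "(\<lambda>x. G (max 0 \<bar>f x\<bar>)) \<in> borel_measurable M" using assms by measurable
  thus ?thesis by simp
qed

lemma g_comp_measurable [measurable (raw)]:
  assumes "f \<in> borel_measurable M" shows "(\<lambda>x. g \<bar>f x\<bar>) \<in> borel_measurable M"
proof -
  have "mono (\<lambda>t. g (max 0 t))" by (intro monoI g_mono) auto
  hence [measurable]: "(\<lambda>t. g (max 0 t)) \<in> borel_measurable borel" by (rule borel_measurable_mono)
  have "(\<lambda>x. g (max 0 \<bar>f x\<bar>)) \<in> borel_measurable M" using assms by measurable
  thus ?thesis by simp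
qed

end

lemma growth_fun_imp_growth:
  assumes "growth_fun G g p q" shows "growth G g p (nat \<lceil>q\<rceil>)"
proof
  have pq: "1 < p" "p \<le> q" using assms by (auto simp: growth_fun_def)
  have qN: "q \<le> real (nat \<lceil>q\<rceil>)" using pq by linarith
  show "p \<le> real (nat \<lceil>q\<rceil>)" using pq(2) qN by (rule order_trans)
  fix t :: real assume "0 \<le> t"
  moreover from this have "0 \<le> G t"
    using assms by (cases "t = 0") (auto simp: growth_fun_def young_function_def less_imp_le)
  ultimately show "t * g t \<le> real (nat \<lceil>q\<rceil>) * G t"
    using assms qN mult_right_mono[of q "real (nat \<lceil>q\<rceil>)" "G t"]
    by (auto simp: growth_fun_def intro: order_trans)
qed (use assms in \<open>auto simp: growth_fun_def young_function_def\<close>)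

lemma ennreal_le_suminf: "f j \<le> (\<Sum>j. f j)" for f :: "nat \<Rightarrow> ennreal"
  using sum_le_suminf[of f "{j}"] by simp

section \<open>Radial integrals\<close>

text \<open>Dyadic annuli: on each one the kernel is bounded by a constant, the annulus is enlarged
  to the ball containing it, and the contributions form a geometric series of ratio 2^(-b). Only an
  upper bound is wanted, so polar coordinates can be avoided.\<close>

lemma nn_integral_ball_radial:
  fixes R b :: real
  assumes b: "0 < b" and R: "0 < R"
  shows "(\<integral>\<^sup>+h. indicator (ball 0 R) h * ennreal (norm (h::'a::euclidean_space) powr (b - real DIM('a))) \<partial>lborel)
    \<le> ennreal (unit_ball_vol DIM('a) * 2 ^ DIM('a) / (1 - 2 powr (-b)) * R powr b)"
proof -
  let ?n = "DIM('a)"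
  let ?f = "\<lambda>h::'a. indicator (ball 0 R) h * ennreal (norm h powr (b - real ?n))"
  define F where "F j h = ennreal ((R/2^j) powr b * (R/2^(j+1)) powr (- real ?n)) * indicator (ball 0 (R/2^j)) h" for j :: nat and h :: 'a
  have [measurable]: "F j \<in> borel_measurable lborel" for j
    unfolding F_def by (intro borel_measurable_times_ennreal borel_measurable_const borel_measurable_indicator) auto
  have le: "?f h \<le> (\<Sum>j. F j h)" for h
  proof (cases "h = 0 \<or> norm h \<ge> R")
    case False
    hence h: "0 < norm h" "norm h < R" by auto
    have "\<exists>j. R/2^(j+1) \<le> norm h \<and> norm h < R/2^j"
    proof -
      have "(\<lambda>j. R * (1/2)^j) \<longlonglongrightarrow> R * 0" by (intro tendsto_intros LIMSEQ_power_zero) auto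
      hence "\<forall>\<^sub>F j in sequentially. R * (1/2)^j < norm h"
        using h(1) by (intro order_tendstoD(2)[where y=0]) auto
      then obtain k where k: "R * (1/2)^k < norm h" by (auto simp: eventually_sequentially)
      define P where "P j \<longleftrightarrow> R / 2^j \<le> norm h" for j
      have Pk: "P k" using k by (simp add: P_def power_divide)
      define m where "m = (LEAST j. P j)"
      have Pm: "P m" unfolding m_def using Pk by (rule LeastI)
      moreover have "m \<noteq> 0" using Pm h by (intro notI) (auto simp: P_def)
      then obtain i where i: "m = Suc i" by (cases m) auto
      have "\<not> P i" using not_less_Least[of i P] i by (simp add: m_def)
      thus ?thesis using Pm i by (intro exI[of _ i]) (auto simp: P_def)
    qed
    then obtain j where j: "R/2^(j+1) \<le> norm h" "norm h < R/2^j" by auto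
    \<comment> \<open>The factors norm^b and norm^(-n) are monotone in opposite directions and are
      bounded at opposite ends of the annulus, so the sign of b - n does not matter.\<close>
    have "norm h powr (b - ?n) = norm h powr b * norm h powr (- real ?n)"
      by (simp add: powr_add[symmetric])
    also have "\<dots> \<le> (R/2^j) powr b * (R/2^(j+1)) powr (- real ?n)"
      using j R b by (intro mult_mono powr_mono2 powr_mono2') auto
    finally have "?f h \<le> F j h" using h j by (auto simp: F_def indicator_def intro!: ennreal_leI)
    also have "\<dots> \<le> (\<Sum>j. F j h)"
      by (rule ennreal_le_suminf)
    finally show ?thesis .
  qed (auto simp: indicator_def)
  have "nn_integral lborel ?f \<le> (\<integral>\<^sup>+h. (\<Sum>j. F j h) \<partial>lborel)" by (rule nn_integral_mono) (rule le)
  also have "\<dots> = (\<Sum>j. \<integral>\<^sup>+h. F j h \<partial>lborel)" by (rule nn_integral_suminf) measurable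
  also have "\<dots> = (\<Sum>j. ennreal (unit_ball_vol ?n * 2 ^ ?n * R powr b * (2 powr (-b))^j))"
  proof (intro suminf_cong)
    fix j
    have "(\<integral>\<^sup>+h. F j h \<partial>lborel) = ennreal ((R/2^j) powr b * (R/2^(j+1)) powr (- real ?n)
        * (unit_ball_vol ?n * (R/2^j)^?n))"
      unfolding F_def using R by ( subst nn_integral_cmult_indicator) (auto simp: emeasure_ball ennreal_mult'')
    also have "(R/2^j) powr b * (R/2^(j+1)) powr (- real ?n) * (unit_ball_vol ?n * (R/2^j)^?n)
      = unit_ball_vol ?n * 2 ^ ?n * R powr b * (2 powr (-b))^j"
    proof -
      have "(R/2^(j+1)) powr (- real ?n) = 1 / (R/2^(j+1))^?n"
        using R by (subst powr_minus) (simp add: powr_realpow inverse_eq_divide)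
      moreover have "(R/2^j) powr b = R powr b * (2 powr (-b))^j"
      proof -
        have "(2^j) powr b = (2 powr b)^j" by (simp add: powr_realpow[symmetric] powr_powr mult.commute)
        thus ?thesis using R by (simp add: powr_divide powr_minus power_inverse field_simps)
      qed
      ultimately show ?thesis using R by (simp add: power_divide power_mult_distrib field_simps)
    qed
    finally show "(\<integral>\<^sup>+h. F j h \<partial>lborel) = ennreal (unit_ball_vol ?n * 2 ^ ?n * R powr b * (2 powr (-b))^j)" .
  qed
  also have "\<dots> = ennreal (\<Sum>j. unit_ball_vol ?n * 2 ^ ?n * R powr b * (2 powr (-b))^j)"
    using b by (intro suminf_ennreal2 summable_mult summable_geometric) (auto simp: powr_less_one)
  also have "(\<Sum>j. unit_ball_vol ?n * 2 ^ ?n * R powr b * (2 powr (-b))^j)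
     = unit_ball_vol DIM('a) * 2 ^ DIM('a) / (1 - 2 powr (-b)) * R powr b"
    using b by (subst suminf_mult) (auto simp: powr_less_one suminf_geometric intro!: summable_geometric)
  finally show ?thesis .
qed

lemma nn_integral_exterior_radial:
  fixes R b :: real
  assumes b: "0 < b" and R: "0 < R"
  shows "(\<integral>\<^sup>+h. indicator (- ball 0 R) h * ennreal (norm (h::'a::euclidean_space) powr (- b - real DIM('a))) \<partial>lborel)
    \<le> ennreal (unit_ball_vol DIM('a) * 2 ^ DIM('a) / (1 - 2 powr (-b)) * R powr (-b))"
proof -
  let ?n = "DIM('a)"
  let ?f = "\<lambda>h::'a. indicator (- ball 0 R) h * ennreal (norm h powr (- b - real ?n))"
  define F where "F j h = ennreal ((R*2^j) powr (- b - ?n)) * indicator (ball 0 (R*2^(j+1))) h" for j :: nat and h :: 'a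
  have [measurable]: "F j \<in> borel_measurable lborel" for j
    unfolding F_def by (intro borel_measurable_times_ennreal borel_measurable_const borel_measurable_indicator) auto
  have le: "?f h \<le> (\<Sum>j. F j h)" for h
  proof (cases "norm h < R")
    case False
    hence h: "R \<le> norm h" by auto
    have "\<exists>j. R*2^j \<le> norm h \<and> norm h < R*2^(j+1)"
    proof -
      obtain k where k: "norm h / R < 2^k" using real_arch_pow[of 2 "norm h / R"] by auto
      define P where "P j \<longleftrightarrow> norm h < R * 2^j" for j
      have Pk: "P k" using k R by (simp add: P_def field_simps)
      define m where "m = (LEAST j. P j)"
      have Pm: "P m" unfolding m_def using Pk by (rule LeastI)
      moreover have "m \<noteq> 0" using Pm h by (intro notI) (auto simp: P_def)
      then obtain i where i: "m = Suc i" by (cases m) auto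
      have "\<not> P i" using not_less_Least[of i P] i by (simp add: m_def)
      thus ?thesis using Pm i by (intro exI[of _ i]) (auto simp: P_def)
    qed
    then obtain j where j: "R*2^j \<le> norm h" "norm h < R*2^(j+1)" by auto
    have "norm h powr (- b - ?n) \<le> (R*2^j) powr (- b - ?n)"
      using j R b by (intro powr_mono2') auto
    hence "?f h \<le> F j h" using h j by (auto simp: F_def indicator_def intro!: ennreal_leI)
    also have "\<dots> \<le> (\<Sum>j. F j h)"
      by (rule ennreal_le_suminf)
    finally show ?thesis .
  qed (auto simp: indicator_def)
  have "nn_integral lborel ?f \<le> (\<integral>\<^sup>+h. (\<Sum>j. F j h) \<partial>lborel)" by (rule nn_integral_mono) (rule le)
  also have "\<dots> = (\<Sum>j. \<integral>\<^sup>+h. F j h \<partial>lborel)" by (rule nn_integral_suminf) measurable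
  also have "\<dots> = (\<Sum>j. ennreal (unit_ball_vol ?n * 2 ^ ?n * R powr (-b) * (2 powr (-b))^j))"
  proof (intro suminf_cong)
    fix j
    have "(\<integral>\<^sup>+h. F j h \<partial>lborel) = ennreal ((R*2^j) powr (- b - ?n)
        * (unit_ball_vol ?n * (R*2^(j+1))^?n))"
      unfolding F_def using R by ( subst nn_integral_cmult_indicator) (auto simp: emeasure_ball ennreal_mult'')
    also have "(R*2^j) powr (- b - ?n) * (unit_ball_vol ?n * (R*2^(j+1))^?n)
      = unit_ball_vol ?n * 2 ^ ?n * R powr (-b) * (2 powr (-b))^j"
    proof -
      have "(R*2^j) powr (- b - ?n) = R powr (-b) * (2 powr (-b))^j / (R*2^j)^?n"
      proof -
        have "(2^j) powr (-b) = (2 powr (-b))^j" by (simp add: powr_realpow[symmetric] powr_powr mult.commute)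
        thus ?thesis using R by (simp add: powr_diff powr_realpow powr_mult power_mult_distrib)
      qed
      thus ?thesis using R by (simp add: power_mult_distrib field_simps)
    qed
    finally show "(\<integral>\<^sup>+h. F j h \<partial>lborel) = ennreal (unit_ball_vol ?n * 2 ^ ?n * R powr (-b) * (2 powr (-b))^j)" .
  qed
  also have "\<dots> = ennreal (\<Sum>j. unit_ball_vol ?n * 2 ^ ?n * R powr (-b) * (2 powr (-b))^j)"
    using b by (intro suminf_ennreal2 summable_mult summable_geometric) (auto simp: powr_less_one)
  also have "(\<Sum>j. unit_ball_vol ?n * 2 ^ ?n * R powr (-b) * (2 powr (-b))^j)
     = unit_ball_vol DIM('a) * 2 ^ DIM('a) / (1 - 2 powr (-b)) * R powr (-b)"
    using b by (subst suminf_mult) (auto simp: powr_less_one suminf_geometric intro!: summable_geometric)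
  finally show ?thesis .
qed

section \<open>Mollification\<close>

text \<open>The functions \<open>bexp m\<close> are closed under differentiation up to linear combinations; hence the algebra below is closed under directional derivatives.\<close>

definition bexp :: "nat \<Rightarrow> real \<Rightarrow> real" where
  "bexp m t = (if t > 0 then (1/t)^m * exp (- (1/t)) else 0)"

lemma bexp_tendsto_0: "((\<lambda>t. bexp m t) \<longlongrightarrow> 0) (at_right 0)"
proof -
  have "((\<lambda>t::real. (inverse t)^m / exp (inverse t)) \<longlongrightarrow> 0) (at_right 0)"
    by (rule filterlim_compose[OF tendsto_power_div_exp_0 filterlim_inverse_at_top_right])
  moreover have "\<forall>\<^sub>F t::real in at_right 0. (inverse t)^m / exp (inverse t) = bexp m t"
    by (rule eventually_at_rightI[of _ 1]) (auto simp: bexp_def inverse_eq_divide exp_minus)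
  ultimately show ?thesis by (rule Lim_transform_eventually)
qed

lemma bexp_has_derivative:
  "(bexp m has_real_derivative bexp (m+2) t - real m * bexp (m+1) t) (at t)"
proof -
  consider "t > 0" | "t < 0" | "t = 0" by linarith
  thus ?thesis
  proof cases
    case 1
    have "((\<lambda>t. (1/t)^m * exp (- (1/t))) has_real_derivative bexp (m+2) t - real m * bexp (m+1) t) (at t)"
    proof -
      have "((\<lambda>t. (1/t)^m * exp (- (1/t))) has_real_derivative
        real m * (1/t)^(m-1) * (- ((1/t)^2)) * exp (- (1/t)) + (1/t)^m * (exp (- (1/t)) * (1/t)^2)) (at t)"
      proof -
        have r: "((\<lambda>t. r t ^ m * exp (- r t)) has_real_derivative
            real m * r t ^ (m-1) * r' * exp (- r t) + r t ^ m * (exp (- r t) * (- r'))) (at t)"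
          if "(r has_real_derivative r') (at t)" for r r'
          using that by (auto intro!: derivative_eq_intros)
        have "((\<lambda>t. 1/t) has_real_derivative - ((1/t)^2)) (at t)"
          using 1 by (auto intro!: derivative_eq_intros simp: power2_eq_square)
        from r[OF this] show ?thesis by simp
      qed
      moreover have "real m * (1/t)^(m-1) * (- ((1/t)^2)) * exp (- (1/t)) + (1/t)^m * (exp (- (1/t)) * (1/t)^2)
        = bexp (m+2) t - real m * bexp (m+1) t"
      proof -
        have "real m * (1/t)^(m-1) * (- ((1/t)^2)) = - (real m * (1/t)^(m+1))"
          by (cases m) (auto simp: power2_eq_square)
        moreover have "(1/t)^m * (exp (- (1/t)) * (1/t)^2) = (1/t)^(m+2) * exp (- (1/t))"
          by (simp only: power_add) (simp only: mult_ac)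
        ultimately show ?thesis using 1 by (simp only: bexp_def) simp
      qed
      ultimately show ?thesis by (rule DERIV_cong)
    qed
    thus ?thesis
      by (rule has_field_derivative_transform_within_open[where S = "{0<..}"])
         (use 1 in \<open>auto simp: bexp_def\<close>)
  next
    case 2
    have "((\<lambda>t. 0) has_real_derivative bexp (m+2) t - real m * bexp (m+1) t) (at t)"
      using 2 by (simp add: bexp_def)
    thus ?thesis
      by (rule has_field_derivative_transform_within_open[where S = "{..<0}"])
         (use 2 in \<open>auto simp: bexp_def\<close>)
  next
    case 3
    have "((\<lambda>h. (bexp m (0 + h) - bexp m 0) / h) \<longlongrightarrow> 0) (at 0)"
    proof (rule filterlim_split_at_real)
      show "((\<lambda>h. (bexp m (0 + h) - bexp m 0) / h) \<longlongrightarrow> 0) (at_left 0)"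
        by (rule Lim_transform_eventually[OF tendsto_const[of 0]])
           (auto intro!: eventually_at_leftI[of "-1"] simp: bexp_def)
      \<comment> \<open>For h > 0 the difference quotient of \<open>bexp m\<close> at 0 is
        \<open>bexp (Suc m)\<close> itself, so flatness at 0 gives the derivative.\<close>
      show "((\<lambda>h. (bexp m (0 + h) - bexp m 0) / h) \<longlongrightarrow> 0) (at_right 0)"
        by (rule Lim_transform_eventually[OF bexp_tendsto_0[of "Suc m"]])
           (auto intro!: eventually_at_rightI[of _ 1] simp: bexp_def)
    qed
    moreover have "bexp (m+2) 0 - real m * bexp (m+1) 0 = 0" by (simp add: bexp_def)
    ultimately show ?thesis unfolding 3 DERIV_def by simp
  qed
qed

inductive_set bump_alg :: "real \<Rightarrow> ('a::euclidean_space \<Rightarrow> real) set" for c :: real where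
  const: "(\<lambda>x. a) \<in> bump_alg c"
| coord: "(\<lambda>x. x \<bullet> v) \<in> bump_alg c"
| bump: "(\<lambda>x. bexp m (1 - c * (x \<bullet> x))) \<in> bump_alg c"
| plus: "f \<in> bump_alg c \<Longrightarrow> h \<in> bump_alg c \<Longrightarrow> (\<lambda>x. f x + h x) \<in> bump_alg c"
| times: "f \<in> bump_alg c \<Longrightarrow> h \<in> bump_alg c \<Longrightarrow> (\<lambda>x. f x * h x) \<in> bump_alg c"

text \<open>Smoothness is stated through iterated directional derivatives, so a class of
  differentiable functions stable under them consists of smooth functions; no formula for higher
  derivatives is needed.\<close>

lemma bump_alg_derivative:
  assumes "f \<in> bump_alg c"
  shows "\<exists>D. (\<forall>x. (f has_derivative D x) (at x)) \<and> (\<forall>v. (\<lambda>x. D x v) \<in> bump_alg c)"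
  using assms
proof induction
  case (const a)
  show ?case by (rule exI[of _ "\<lambda>x v. 0"]) (auto intro: bump_alg.const)
next
  case (coord v)
  show ?case
    by (rule exI[of _ "\<lambda>x w. w \<bullet> v"]) (auto intro!: bump_alg.const derivative_eq_intros)
next
  case (bump m)
  define D :: "'a \<Rightarrow> 'a \<Rightarrow> real" where "D = (\<lambda>x v. (bexp (m+2) (1 - c * (x \<bullet> x)) +
    (- real m) * bexp (m+1) (1 - c * (x \<bullet> x))) * ((- 2 * c) * (x \<bullet> v)))"
  have "((\<lambda>x. bexp m (1 - c * (x \<bullet> x))) has_derivative D x) (at x)" for x
  proof -
    have "((\<lambda>x. 1 - c * (x \<bullet> x)) has_derivative (\<lambda>v. (- 2 * c) * (x \<bullet> v))) (at x)"
      by (auto intro!: derivative_eq_intros simp: inner_commute algebra_simps)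
    from has_derivative_compose[OF this bexp_has_derivative[of m, unfolded has_field_derivative_def]]
    show ?thesis by (simp add: D_def algebra_simps)
  qed
  moreover have "(\<lambda>x. D x v) \<in> bump_alg c" for v
    unfolding D_def by (intro bump_alg.intros)
  ultimately show ?case by blast
next
  case (plus f h)
  then obtain D E where D: "\<forall>x. (f has_derivative D x) (at x)" "\<forall>v. (\<lambda>x. D x v) \<in> bump_alg c"
    "\<forall>x. (h has_derivative E x) (at x)" "\<forall>v. (\<lambda>x. E x v) \<in> bump_alg c" by blast
  thus ?case
    by (intro exI[of _ "\<lambda>x v. D x v + E x v"]) (auto intro!: bump_alg.plus has_derivative_add)
next
  case (times f h)
  then obtain D E where D: "\<forall>x. (f has_derivative D x) (at x)" "\<forall>v. (\<lambda>x. D x v) \<in> bump_alg c"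
    "\<forall>x. (h has_derivative E x) (at x)" "\<forall>v. (\<lambda>x. E x v) \<in> bump_alg c" by blast
  thus ?case using times.hyps
    by (intro exI[of _ "\<lambda>x v. f x * E x v + D x v * h x"])
       (auto intro!: bump_alg.plus bump_alg.times has_derivative_mult)
qed

lemma bump_alg_frechet:
  assumes "f \<in> bump_alg c"
  shows "f differentiable at x" "(\<lambda>x. frechet_derivative f (at x) v) \<in> bump_alg c"
proof -
  obtain D where D: "\<And>x. (f has_derivative D x) (at x)" "\<And>v. (\<lambda>x. D x v) \<in> bump_alg c"
    using bump_alg_derivative[OF assms] by blast
  show "f differentiable at x" using D(1) by (auto simp: differentiable_def)
  have "frechet_derivative f (at x) = D x" for x using frechet_derivative_at[OF D(1)] by simp
  thus "(\<lambda>x. frechet_derivative f (at x) v) \<in> bump_alg c" using D(2) by simp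
qed

lemma bump_alg_iter_dd: "f \<in> bump_alg c \<Longrightarrow> iter_dd vs f \<in> bump_alg c"
  by (induction vs) (auto intro: bump_alg_frechet)

lemma bump_alg_smooth: "f \<in> bump_alg c \<Longrightarrow> smooth_fun f"
  unfolding smooth_fun_def using bump_alg_iter_dd bump_alg_frechet(1) by blast

lemma iter_dd_append: "iter_dd (us @ vs) f = iter_dd us (iter_dd vs f)"
  by (induction us) auto

text \<open>Bounded support without reference to an open set: the class is stable under directional
  derivatives and yields uniform bounds for all of them.\<close>

definition smooth_bdd :: "('a::euclidean_space \<Rightarrow> real) \<Rightarrow> bool" where
  "smooth_bdd f \<longleftrightarrow> smooth_fun f \<and> (\<exists>R. \<forall>x. norm x > R \<longrightarrow> f x = 0)"

lemma smooth_bdd_differentiable: "smooth_bdd f \<Longrightarrow> f differentiable at x"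
  unfolding smooth_bdd_def smooth_fun_def by (metis iter_dd.simps(1))

lemma smooth_bdd_has_derivative: "smooth_bdd f \<Longrightarrow> (f has_derivative frechet_derivative f (at x)) (at x)"
  using smooth_bdd_differentiable frechet_derivative_works by blast

lemma smooth_bdd_dd:
  assumes "smooth_bdd f" shows "smooth_bdd (\<lambda>x. frechet_derivative f (at x) v)"
proof -
  have "iter_dd (us @ [v]) f differentiable (at x)" for us x
    using assms unfolding smooth_bdd_def smooth_fun_def by blast
  hence "smooth_fun (\<lambda>x. frechet_derivative f (at x) v)"
    unfolding smooth_fun_def iter_dd_append by simp
  moreover obtain R where R: "\<And>x. norm x > R \<Longrightarrow> f x = 0" using assms by (auto simp: smooth_bdd_def)
  have "frechet_derivative f (at x) v = 0" if "norm x > R" for x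
  proof -
    have "frechet_derivative f (at x) = frechet_derivative (\<lambda>x. 0) (at x)"
    proof (rule frechet_derivative_transform_within_open[where X = "- cball 0 R"])
      show "f differentiable at x" using assms by (rule smooth_bdd_differentiable)
    qed (use that R in \<open>auto\<close>)
    thus ?thesis by simp
  qed
  ultimately show ?thesis unfolding smooth_bdd_def by blast
qed

lemma smooth_bdd_continuous: "smooth_bdd f \<Longrightarrow> continuous_on S f"
  by (meson smooth_bdd_differentiable continuous_at_imp_continuous_on differentiable_imp_continuous_within)

lemma smooth_bdd_measurable: "smooth_bdd f \<Longrightarrow> f \<in> borel_measurable borel"
  by (rule borel_measurable_continuous_onI) (rule smooth_bdd_continuous)

lemma smooth_bdd_bounded:
  assumes "smooth_bdd f" shows "\<exists>B\<ge>0. \<forall>x. \<bar>f x\<bar> \<le> B"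
proof -
  obtain R where R: "\<And>x. norm x > R \<Longrightarrow> f x = 0" using assms by (auto simp: smooth_bdd_def)
  have "compact (f ` cball 0 R)"
    by (intro compact_continuous_image smooth_bdd_continuous[OF assms] compact_cball)
  hence "bounded (f ` cball 0 R)" by (rule compact_imp_bounded)
  then obtain B where "\<forall>y\<in>f ` cball 0 R. norm y \<le> B"
    unfolding bounded_iff by blast
  hence B: "\<And>x. x \<in> cball 0 R \<Longrightarrow> \<bar>f x\<bar> \<le> B" by auto
  show ?thesis
  proof (intro exI[of _ "max 0 B"] conjI allI)
    fix x show "\<bar>f x\<bar> \<le> max 0 B"
      using B[of x] R[of x] by (cases "norm x \<le> R") (auto simp: le_max_iff_disj)
  qed simp
qed

lemma frechet_derivative_coords:
  assumes "f differentiable at x"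
  shows "frechet_derivative f (at x) h = (\<Sum>b\<in>Basis. (h \<bullet> b) *\<^sub>R frechet_derivative f (at x) (b::'a::euclidean_space))"
proof -
  interpret linear "frechet_derivative f (at x)" using assms by (rule linear_frechet_derivative)
  have "frechet_derivative f (at x) (\<Sum>b\<in>Basis. (h \<bullet> b) *\<^sub>R b)
    = (\<Sum>b\<in>Basis. (h \<bullet> b) *\<^sub>R frechet_derivative f (at x) b)"
    unfolding sum scale ..
  thus ?thesis unfolding euclidean_representation .
qed

lemma coord_sum_bound:
  fixes h :: "'a::euclidean_space" and a :: "'a \<Rightarrow> real"
  assumes "\<And>b. b \<in> Basis \<Longrightarrow> \<bar>a b\<bar> \<le> B b"
  shows "\<bar>\<Sum>b\<in>Basis. (h \<bullet> b) *\<^sub>R a b\<bar> \<le> (\<Sum>b\<in>Basis. B b) * norm h"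
proof -
  have "\<bar>\<Sum>b\<in>Basis. (h \<bullet> b) *\<^sub>R a b\<bar> \<le> (\<Sum>b\<in>Basis. \<bar>(h \<bullet> b) *\<^sub>R a b\<bar>)" by (rule sum_abs)
  also have "\<dots> \<le> (\<Sum>b\<in>Basis. norm h * B b)"
    using assms by (intro sum_mono) (auto simp: abs_mult intro!: mult_mono Basis_le_norm)
  also have "\<dots> = (\<Sum>b\<in>Basis. B b) * norm h"
    unfolding sum_distrib_left[symmetric] by (rule mult.commute)
  finally show ?thesis .
qed

lemma smooth_bdd_lipschitz:
  fixes f :: "'a::euclidean_space \<Rightarrow> real"
  assumes "smooth_bdd f" shows "\<exists>L\<ge>0. \<forall>x y. \<bar>f x - f y\<bar> \<le> L * norm (x - y)"
proof -
  have "\<forall>b. \<exists>B\<ge>0. \<forall>x. \<bar>frechet_derivative f (at x) b\<bar> \<le> B"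
    using smooth_bdd_bounded[OF smooth_bdd_dd[OF assms]] by blast
  then obtain B where B: "\<And>b. B b \<ge> 0" "\<And>b x. \<bar>frechet_derivative f (at x) b\<bar> \<le> B b" by metis
  have "norm (f x - f y) \<le> (\<Sum>b\<in>Basis. B b) * norm (x - y)" for x y
  proof (rule differentiable_bound[of UNIV f "\<lambda>x. frechet_derivative f (at x)"])
    fix x :: 'a
    show "(f has_derivative frechet_derivative f (at x)) (at x within UNIV)"
      using smooth_bdd_has_derivative[OF assms] by simp
    show "onorm (frechet_derivative f (at x)) \<le> (\<Sum>b\<in>Basis. B b)"
      by (rule onorm_le, subst frechet_derivative_coords[OF smooth_bdd_differentiable[OF assms]])
         (unfold real_norm_def, rule coord_sum_bound, rule B)
  qed auto
  thus ?thesis using B(1) by (intro exI[of _ "\<Sum>b\<in>Basis. B b"]) (auto intro: sum_nonneg)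
qed

text \<open>Mean value bound for \<open>f\<close> minus its linearisation at x: the derivative of
  the difference is small on the ball of radius |h| because directional derivatives are again
  Lipschitz. The constant is uniform in x, as differentiation under the integral requires.\<close>

lemma smooth_bdd_taylor:
  fixes f :: "'a::euclidean_space \<Rightarrow> real"
  assumes "smooth_bdd f"
  shows "\<exists>C\<ge>0. \<forall>x h. \<bar>f (x + h) - f x - frechet_derivative f (at x) h\<bar> \<le> C * (norm h)\<^sup>2"
proof -
  have "\<forall>b. \<exists>B\<ge>0. \<forall>x y. \<bar>frechet_derivative f (at x) b - frechet_derivative f (at y) b\<bar> \<le> B * norm (x - y)"
    using smooth_bdd_lipschitz[OF smooth_bdd_dd[OF assms]] by blast
  then obtain B where B: "\<And>b. B b \<ge> 0"
    "\<And>b x y. \<bar>frechet_derivative f (at x) b - frechet_derivative f (at y) b\<bar> \<le> B b * norm (x - y)" by metis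
  let ?S = "\<Sum>b\<in>Basis. B b"
  have "\<bar>f (x + h) - f x - frechet_derivative f (at x) h\<bar> \<le> ?S * (norm h)\<^sup>2" for x h
  proof -
    interpret D: linear "frechet_derivative f (at x)"
      using smooth_bdd_differentiable[OF assms] by (rule linear_frechet_derivative)
    define \<phi> where "\<phi> y = f y - frechet_derivative f (at x) y" for y
    have "norm (\<phi> (x + h) - \<phi> x) \<le> (?S * norm h) * norm ((x + h) - x)"
    proof (rule differentiable_bound[of "cball x (norm h)" \<phi>
          "\<lambda>y v. frechet_derivative f (at y) v - frechet_derivative f (at x) v"])
      fix y assume y: "y \<in> cball x (norm h)"
      have bl: "bounded_linear (frechet_derivative f (at x))"
        using smooth_bdd_has_derivative[OF assms] by (rule has_derivative_bounded_linear)
      show "(\<phi> has_derivative (\<lambda>v. frechet_derivative f (at y) v - frechet_derivative f (at x) v))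
           (at y within cball x (norm h))"
        unfolding \<phi>_def
        by (intro has_derivative_diff has_derivative_at_withinI[OF smooth_bdd_has_derivative[OF assms]]
            bounded_linear_imp_has_derivative bl)
      show "onorm (\<lambda>v. frechet_derivative f (at y) v - frechet_derivative f (at x) v) \<le> ?S * norm h"
      proof (rule onorm_le)
        fix v
        have "\<bar>frechet_derivative f (at y) v - frechet_derivative f (at x) v\<bar>
          = \<bar>\<Sum>b\<in>Basis. (v \<bullet> b) *\<^sub>R (frechet_derivative f (at y) b - frechet_derivative f (at x) b)\<bar>"
          unfolding scaleR_diff_right sum_subtractf
          by (subst (1 2) frechet_derivative_coords[OF smooth_bdd_differentiable[OF assms]]) simp
        also have "\<dots> \<le> (\<Sum>b\<in>Basis. B b * norm h) * norm v"
        proof (rule coord_sum_bound)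
          fix b :: 'a
          have "B b * norm (y - x) \<le> B b * norm h"
            using y B(1) by (intro mult_left_mono) (auto simp: dist_norm norm_minus_commute)
          thus "\<bar>frechet_derivative f (at y) b - frechet_derivative f (at x) b\<bar> \<le> B b * norm h"
            using B(2)[of y b x] by linarith
        qed
        finally show "norm (frechet_derivative f (at y) v - frechet_derivative f (at x) v) \<le> ?S * norm h * norm v"
          by (simp add: sum_distrib_right)
      qed
    qed (auto simp: dist_norm)
    thus ?thesis by (simp add: \<phi>_def D.add power2_eq_square algebra_simps)
  qed
  thus ?thesis using B(1) by (intro exI[of _ ?S]) (auto intro: sum_nonneg)
qed

section \<open>Convolution and differentiation under the integral\<close>

definition conv :: "('a::euclidean_space \<Rightarrow> real) \<Rightarrow> ('a \<Rightarrow> real) \<Rightarrow> 'a \<Rightarrow> real" where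
  "conv f w x = (\<integral>y. f (x - y) * w y \<partial>lborel)"

lemma conv_integrable:
  assumes f: "smooth_bdd f" and w: "integrable lborel w"
  shows "integrable lborel (\<lambda>y. f (x - y) * w y)"
proof -
  obtain B where B: "\<And>x. \<bar>f x\<bar> \<le> B" using smooth_bdd_bounded[OF f] by blast
  have [measurable]: "f \<in> borel_measurable borel" using f by (rule smooth_bdd_measurable)
  have [measurable]: "w \<in> borel_measurable borel" using w borel_measurable_integrable by fastforce
  have "integrable lborel (\<lambda>y. B * w y)" using w by simp
  thus ?thesis
  proof (rule Bochner_Integration.integrable_bound)
    show "AE y in lborel. norm (f (x - y) * w y) \<le> norm (B * w y)"
    proof (rule AE_I2)
      fix y
      have "\<bar>f (x - y)\<bar> \<le> \<bar>B\<bar>" using B[of "x - y"] by simp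
      from mult_right_mono[OF this, of "\<bar>w y\<bar>"]
      show "norm (f (x - y) * w y) \<le> norm (B * w y)" by (simp add: abs_mult)
    qed
  qed measurable
qed

text \<open>The uniform quadratic Taylor remainder is integrated against |w|, which bounds the error
  by C |h|^2 times the L1 norm of w; no limit theorem is involved. The derivative is written in
  coordinates so that its bounded linearity is immediate.\<close>

lemma conv_has_derivative:
  fixes f :: "'a::euclidean_space \<Rightarrow> real"
  assumes f: "smooth_bdd f" and w: "integrable lborel w"
  shows "(conv f w has_derivative (\<lambda>h. \<Sum>b\<in>Basis. (h \<bullet> b) *\<^sub>R conv (\<lambda>x. frechet_derivative f (at x) b) w x)) (at x)"
    (is "(_ has_derivative ?D) _")
proof -
  obtain C where C: "C \<ge> 0" "\<And>x h. \<bar>f (x + h) - f x - frechet_derivative f (at x) h\<bar> \<le> C * (norm h)\<^sup>2"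
    using smooth_bdd_taylor[OF f] by blast
  define I where "I = (\<integral>y. \<bar>w y\<bar> \<partial>lborel)"
  have bd: "\<bar>conv f w (x + h) - conv f w x - ?D h\<bar> \<le> C * (norm h)\<^sup>2 * I" for h
  proof -
    have int: "integrable lborel (\<lambda>y. frechet_derivative f (at (x - y)) b * w y)" for b
      using conv_integrable[OF smooth_bdd_dd[OF f] w] .
    have D: "?D h = (\<integral>y. frechet_derivative f (at (x - y)) h * w y \<partial>lborel)"
    proof -
      have "(\<integral>y. frechet_derivative f (at (x - y)) h * w y \<partial>lborel)
         = (\<integral>y. (\<Sum>b\<in>Basis. (h \<bullet> b) * (frechet_derivative f (at (x - y)) b * w y)) \<partial>lborel)"
        by (subst frechet_derivative_coords[OF smooth_bdd_differentiable[OF f]])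
           (simp add: sum_distrib_right mult.assoc)
      also have "\<dots> = (\<Sum>b\<in>Basis. (h \<bullet> b) * (\<integral>y. frechet_derivative f (at (x - y)) b * w y \<partial>lborel))"
        using int by (subst Bochner_Integration.integral_sum) auto
      finally show ?thesis by (simp add: conv_def)
    qed
    define Q where "Q y = f (x + h - y) * w y - f (x - y) * w y - frechet_derivative f (at (x - y)) h * w y" for y
    have intQ: "integrable lborel Q" unfolding Q_def
      by (intro Bochner_Integration.integrable_diff int conv_integrable[OF f w])
    have "conv f w (x + h) - conv f w x - ?D h = (\<integral>y. Q y \<partial>lborel)"
      unfolding D unfolding conv_def Q_def
      by (simp only: Bochner_Integration.integral_diff Bochner_Integration.integrable_diff int conv_integrable[OF f w])
    also have "\<bar>\<integral>y. Q y \<partial>lborel\<bar> \<le> (\<integral>y. \<bar>Q y\<bar> \<partial>lborel)"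
      using integral_abs_bound[of lborel Q] .
    also have "\<dots> \<le> (\<integral>y. C * (norm h)\<^sup>2 * \<bar>w y\<bar> \<partial>lborel)"
    proof (rule integral_mono)
      fix y
      have "\<bar>Q y\<bar> = \<bar>f ((x - y) + h) - f (x - y) - frechet_derivative f (at (x - y)) h\<bar> * \<bar>w y\<bar>"
        unfolding Q_def abs_mult[symmetric] by (simp add: algebra_simps)
      also have "\<dots> \<le> C * (norm h)\<^sup>2 * \<bar>w y\<bar>" by (intro mult_right_mono C(2)) auto
      finally show "\<bar>Q y\<bar> \<le> C * (norm h)\<^sup>2 * \<bar>w y\<bar>" .
    qed (use intQ w in auto)
    also have "\<dots> = C * (norm h)\<^sup>2 * I" by (simp add: I_def)
    finally show ?thesis .
  qed
  show ?thesis unfolding has_derivative_at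
  proof
    show "bounded_linear ?D"
      by (intro bounded_linear_sum bounded_linear_scaleR_left[THEN bounded_linear_compose] bounded_linear_inner_left)
    show "(\<lambda>h. norm (conv f w (x + h) - conv f w x - ?D h) / norm h) \<midarrow>0\<rightarrow> 0"
    proof (rule tendsto_sandwich[OF _ _ tendsto_const[of 0]])
      show "\<forall>\<^sub>F h in at 0. norm (conv f w (x + h) - conv f w x - ?D h) / norm h \<le> C * I * norm h"
      proof (intro always_eventually allI)
        fix h
        have "\<bar>conv f w (x + h) - conv f w x - ?D h\<bar> \<le> (C * I * norm h) * norm h"
          using bd[of h] by (simp only: power2_eq_square mult_ac)
        thus "norm (conv f w (x + h) - conv f w x - ?D h) / norm h \<le> C * I * norm h"
          unfolding real_norm_def by (cases "h = 0") (simp_all only: divide_le_eq, auto)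
      qed
      have "((\<lambda>h::'a. C * I * norm h) \<longlongrightarrow> C * I * norm (0::'a)) (at 0)" by (intro tendsto_intros)
      thus "((\<lambda>h::'a. C * I * norm h) \<longlongrightarrow> 0) (at 0)" by simp
    qed auto
  qed
qed

lemma conv_frechet:
  assumes "smooth_bdd f" "integrable lborel w"
  shows "frechet_derivative (conv f w) (at x) v = conv (\<lambda>x. frechet_derivative f (at x) v) w x"
proof -
  have int: "integrable lborel (\<lambda>y. frechet_derivative f (at (x - y)) b * w y)" for b
    using conv_integrable[OF smooth_bdd_dd[OF assms(1)] assms(2)] .
  have "frechet_derivative (conv f w) (at x) v
     = (\<Sum>b\<in>Basis. (v \<bullet> b) * (\<integral>y. frechet_derivative f (at (x - y)) b * w y \<partial>lborel))"
    unfolding frechet_derivative_at[OF conv_has_derivative[OF assms], symmetric]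
    by (simp only: conv_def real_scaleR_def)
  also have "\<dots> = (\<integral>y. (\<Sum>b\<in>Basis. (v \<bullet> b) * (frechet_derivative f (at (x - y)) b * w y)) \<partial>lborel)"
    using int by (subst Bochner_Integration.integral_sum) auto
  also have "\<dots> = (\<integral>y. frechet_derivative f (at (x - y)) v * w y \<partial>lborel)"
    by (rule Bochner_Integration.integral_cong[OF refl],
        subst frechet_derivative_coords[OF smooth_bdd_differentiable[OF assms(1)], of _ v])
       (simp add: sum_distrib_right mult.assoc)
  finally show ?thesis by (simp add: conv_def)
qed

text \<open>All derivatives fall on the smooth kernel, so a merely integrable w has a smooth
  convolution.\<close>

lemma conv_iter_dd:
  assumes "smooth_bdd f" "integrable lborel w"
  shows "smooth_bdd (iter_dd vs f) \<and> iter_dd vs (conv f w) = conv (iter_dd vs f) w"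
proof (induction vs)
  case (Cons v vs)
  hence IH: "smooth_bdd (iter_dd vs f)" "iter_dd vs (conv f w) = conv (iter_dd vs f) w" by auto
  show ?case
    by (simp add: IH(2) smooth_bdd_dd[OF IH(1)] conv_frechet[OF IH(1) assms(2)])
qed (use assms in auto)

lemma conv_smooth:
  assumes "smooth_bdd f" "integrable lborel w" shows "smooth_fun (conv f w)"
  unfolding smooth_fun_def
proof (intro allI)
  fix vs x
  show "iter_dd vs (conv f w) differentiable at x"
    using conv_iter_dd[OF assms, of vs] conv_has_derivative[of "iter_dd vs f" w x] assms(2)
    by (auto simp: differentiable_def)
qed

lemma mollifier_exists:
  assumes "0 < e"
  shows "\<exists>\<rho> :: 'a::euclidean_space \<Rightarrow> real. smooth_bdd \<rho> \<and> (\<forall>x. 0 \<le> \<rho> x) \<and> (\<forall>x. norm x > e \<longrightarrow> \<rho> x = 0)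
     \<and> integrable lborel \<rho> \<and> (\<integral>x. \<rho> x \<partial>lborel) = 1"
proof -
  \<comment> \<open>With this c the argument 1 - c |x|^2 of the profile is positive exactly on the
    open ball of radius e.\<close>
  define c where "c = 1 / e\<^sup>2"
  define \<beta> :: "'a \<Rightarrow> real" where "\<beta> x = bexp 0 (1 - c * (x \<bullet> x))" for x
  have c: "0 < c" using assms by (simp add: c_def)
  have alg: "\<beta> \<in> bump_alg c" unfolding \<beta>_def by (rule bump_alg.bump)
  have z: "\<beta> x = 0" if "norm x > e" for x
  proof -
    have "e\<^sup>2 < (norm x)\<^sup>2" using that assms by (intro power_strict_mono) auto
    hence "1 < c * (x \<bullet> x)" using assms by (simp add: c_def power2_norm_eq_inner field_simps)
    thus ?thesis by (simp add: \<beta>_def bexp_def)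
  qed
  have sm: "smooth_bdd \<beta>" using bump_alg_smooth[OF alg] z unfolding smooth_bdd_def by blast
  have nn: "0 \<le> \<beta> x" for x by (simp add: \<beta>_def bexp_def)
  have [measurable]: "\<beta> \<in> borel_measurable borel" using sm by (rule smooth_bdd_measurable)
  obtain B where B: "\<And>x. \<bar>\<beta> x\<bar> \<le> B" using smooth_bdd_bounded[OF sm] by blast
  have int: "integrable lborel \<beta>"
  proof (rule Bochner_Integration.integrable_bound)
    show "integrable lborel (\<lambda>x::'a. B * indicator (cball 0 e) x)"
      by (intro integrable_mult_right integrable_real_indicator) (auto simp: emeasure_bounded_finite[unfolded infinity_ennreal_def])
    show "AE x in lborel. norm (\<beta> x) \<le> norm (B * indicator (cball 0 e) x)"
    proof (rule AE_I2)
      fix x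
      show "norm (\<beta> x) \<le> norm (B * indicator (cball 0 e) x)"
        using B[of x] z[of x] by (cases "norm x \<le> e") (auto simp: indicator_def)
    qed
  qed measurable
  define I where "I = (\<integral>x. \<beta> x \<partial>lborel)"
  have "0 < I"
  proof (rule ccontr)
    assume "\<not> 0 < I"
    moreover have "0 \<le> I" unfolding I_def using nn by (intro Bochner_Integration.integral_nonneg) auto
    ultimately have "I = 0" by simp
    hence ae: "AE x in lborel. \<beta> x = 0" unfolding I_def
      using integral_nonneg_eq_0_iff_AE[OF int] nn by auto
    have nz: "\<beta> x \<noteq> 0" if "x \<in> ball 0 e" for x
    proof -
      have "(norm x)\<^sup>2 < e\<^sup>2" using that assms by (intro power_strict_mono) auto
      hence "c * (x \<bullet> x) < 1" using assms by (simp add: c_def power2_norm_eq_inner field_simps)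
      thus ?thesis by (simp add: \<beta>_def bexp_def)
    qed
    from ae have "AE x in lborel. x \<notin> ball (0::'a) e"
      by (rule eventually_mono) (use nz in blast)
    hence "emeasure lborel (ball (0::'a) e) = 0"
      by (subst (asm) AE_iff_measurable[OF _ refl]) (auto simp: ball_def)
    thus False using assms unit_ball_vol_pos[of "real DIM('a)"] by (simp add: emeasure_ball)
  qed
  \<comment> \<open>Constants belong to the algebra, so normalising the mass to one preserves
    smoothness.\<close>
  have "(\<lambda>x. (1/I) * \<beta> x) \<in> bump_alg c" using alg by (intro bump_alg.intros)
  hence "smooth_bdd (\<lambda>x. (1/I) * \<beta> x)" using z bump_alg_smooth unfolding smooth_bdd_def by (metis mult_zero_right)
  thus ?thesis using \<open>0 < I\<close> nn z int
    by (intro exI[of _ "\<lambda>x. (1/I) * \<beta> x"]) (auto simp: I_def[symmetric])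
qed

section \<open>Approximation by test functions\<close>

lemma nn_integral_lborel_shift:
  fixes f :: "'a::euclidean_space \<Rightarrow> ennreal"
  assumes [measurable]: "f \<in> borel_measurable borel"
  shows "(\<integral>\<^sup>+x. f (x + a) \<partial>lborel) = (\<integral>\<^sup>+x. f x \<partial>lborel)"
proof -
  have "(\<integral>\<^sup>+x. f x \<partial>lborel) = (\<integral>\<^sup>+x. f x \<partial>(distr lborel borel ((+) a)))"
    by (simp only: lborel_distr_plus)
  also have "\<dots> = (\<integral>\<^sup>+x. f (a + x) \<partial>lborel)" by (subst nn_integral_distr) auto
  finally show ?thesis by (simp add: add.commute)
qed

lemma nn_integral_lborel_shift_minus:
  fixes f :: "'a::euclidean_space \<Rightarrow> ennreal"
  assumes [measurable]: "f \<in> borel_measurable borel"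
  shows "(\<integral>\<^sup>+x. f (x - a) \<partial>lborel) = (\<integral>\<^sup>+x. f x \<partial>lborel)"
  using nn_integral_lborel_shift[OF assms, of "- a"] by simp

lemma distr_lborel_reflect: "distr lborel borel (\<lambda>x. a - x) = (lborel :: 'a::euclidean_space measure)"
  using lborel_affine[of "-1" a] by (simp add: density_1)

lemma ennreal_tendsto_0I:
  fixes a :: "nat \<Rightarrow> ennreal"
  assumes "\<And>e. 0 < e \<Longrightarrow> \<forall>\<^sub>F i in sequentially. a i \<le> ennreal e"
  shows "a \<longlonglongrightarrow> 0"
proof (rule order_tendstoI)
  fix c :: ennreal assume c: "0 < c"
  then obtain e :: real where e: "0 < e" "ennreal e < c"
    by (metis dense ennreal_cases ennreal_less_zero_iff less_top_ennreal top.not_eq_extremum order_less_trans)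
  show "\<forall>\<^sub>F i in sequentially. a i < c"
    using assms[OF e(1)] by (rule eventually_mono) (use e(2) in \<open>auto intro: order_le_less_trans\<close>)
qed auto

lemma ennreal_tendsto_0D:
  fixes a :: "nat \<Rightarrow> ennreal"
  assumes "a \<longlonglongrightarrow> 0" "0 < e"
  shows "\<forall>\<^sub>F i in sequentially. a i \<le> ennreal e"
  using order_tendstoD(2)[OF assms(1), of "ennreal e"] assms(2) by (auto elim!: eventually_mono)

section \<open>Continuity of translations in L1 along a null sequence\<close>

definition L1_trans_cont :: "(nat \<Rightarrow> 'a::euclidean_space) \<Rightarrow> ('a \<Rightarrow> real) \<Rightarrow> bool" where
  "L1_trans_cont z w \<longleftrightarrow> (\<lambda>i. \<integral>\<^sup>+x. ennreal \<bar>w (x - z i) - w x\<bar> \<partial>lborel) \<longlonglongrightarrow> 0"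

text \<open>Three-term splitting: translation leaves the integral of the error f - h unchanged, so
  translation continuity passes to L1 limits.\<close>

lemma L1_trans_cont_approx:
  fixes f :: "'a::euclidean_space \<Rightarrow> real"
  assumes [measurable]: "f \<in> borel_measurable borel"
    and ap: "\<And>e. 0 < e \<Longrightarrow> \<exists>h \<in> borel_measurable borel. L1_trans_cont z h
       \<and> (\<integral>\<^sup>+x. ennreal \<bar>f x - h x\<bar> \<partial>lborel) \<le> ennreal e"
  shows "L1_trans_cont z f"
  unfolding L1_trans_cont_def
proof (rule ennreal_tendsto_0I)
  fix e :: real assume e: "0 < e"
  then obtain h where [measurable]: "h \<in> borel_measurable borel" and h: "L1_trans_cont z h"
    "(\<integral>\<^sup>+x. ennreal \<bar>f x - h x\<bar> \<partial>lborel) \<le> ennreal (e/3)" using ap[of "e/3"] by auto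
  have "\<forall>\<^sub>F i in sequentially. (\<integral>\<^sup>+x. ennreal \<bar>h (x - z i) - h x\<bar> \<partial>lborel) \<le> ennreal (e/3)"
    using h(1) e unfolding L1_trans_cont_def by (intro ennreal_tendsto_0D) auto
  thus "\<forall>\<^sub>F i in sequentially. (\<integral>\<^sup>+x. ennreal \<bar>f (x - z i) - f x\<bar> \<partial>lborel) \<le> ennreal e"
  proof eventually_elim
    case (elim i)
    have "(\<integral>\<^sup>+x. ennreal \<bar>f (x - z i) - f x\<bar> \<partial>lborel) \<le>
      (\<integral>\<^sup>+x. ennreal \<bar>h (x - z i) - h x\<bar> + (ennreal \<bar>f (x - z i) - h (x - z i)\<bar> + ennreal \<bar>f x - h x\<bar>) \<partial>lborel)"
      by (intro nn_integral_mono) (simp flip: ennreal_plus)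
    also have "\<dots> = (\<integral>\<^sup>+x. ennreal \<bar>h (x - z i) - h x\<bar> \<partial>lborel)
      + ((\<integral>\<^sup>+x. ennreal \<bar>f (x - z i) - h (x - z i)\<bar> \<partial>lborel) + (\<integral>\<^sup>+x. ennreal \<bar>f x - h x\<bar> \<partial>lborel))"
      by (subst nn_integral_add, measurable)+
    also have "(\<integral>\<^sup>+x. ennreal \<bar>f (x - z i) - h (x - z i)\<bar> \<partial>lborel) = (\<integral>\<^sup>+x. ennreal \<bar>f x - h x\<bar> \<partial>lborel)"
      by (rule nn_integral_lborel_shift_minus[of "\<lambda>x. ennreal \<bar>f x - h x\<bar>"]) measurable
    also have "(\<integral>\<^sup>+x. ennreal \<bar>h (x - z i) - h x\<bar> \<partial>lborel) + ((\<integral>\<^sup>+x. ennreal \<bar>f x - h x\<bar> \<partial>lborel) + (\<integral>\<^sup>+x. ennreal \<bar>f x - h x\<bar> \<partial>lborel))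
       \<le> ennreal (e/3) + (ennreal (e/3) + ennreal (e/3))" by (intro add_mono elim h(2))
    also have "\<dots> = ennreal e" using e by (simp flip: ennreal_plus)
    finally show ?case .
  qed
qed

text \<open>Openness keeps each point of U inside U after a small shift, so the indicator of the
  part of U that leaves U tends to 0 pointwise, dominated by the indicator of U. The other half of
  the symmetric difference becomes an integral of the same kind after a change of variables, with
  the opposite shift.\<close>

lemma L1_trans_cont_open:
  fixes U :: "'a::euclidean_space set"
  assumes U: "open U" "emeasure lborel U < \<infinity>" and z: "z \<longlonglongrightarrow> 0"
  shows "L1_trans_cont z (indicator U)"
proof -
  have [measurable]: "U \<in> sets borel" using U(1) by simp
  have ev: "\<forall>\<^sub>F i in sequentially. x + c *\<^sub>R z i \<in> U" if "x \<in> U" for x and c :: real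
  proof -
    have "(\<lambda>i. x + c *\<^sub>R z i) \<longlonglongrightarrow> x + c *\<^sub>R 0" by (intro tendsto_intros z)
    thus ?thesis using topological_tendstoD[of _ "x + c *\<^sub>R 0" sequentially U] U(1) that by simp
  qed
  have lim: "(\<lambda>i. \<integral>\<^sup>+x. indicator U x * indicator (- U) (x + c *\<^sub>R z i) \<partial>lborel) \<longlonglongrightarrow> 0" for c :: real
  proof -
    have "(\<lambda>i. \<integral>\<^sup>+x. indicator U x * indicator (- U) (x + c *\<^sub>R z i) \<partial>lborel) \<longlonglongrightarrow> (\<integral>\<^sup>+(x::'a). 0 \<partial>lborel)"
    proof (rule nn_integral_dominated_convergence[where w = "indicator U"])
      show "(\<integral>\<^sup>+ x. indicator U x \<partial>lborel) < \<infinity>" using U by simp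
      show "AE x in lborel. (\<lambda>i. indicator U x * indicator (- U) (x + c *\<^sub>R z i)) \<longlonglongrightarrow> (0::ennreal)"
      proof (intro AE_I2)
        fix x :: 'a
        show "(\<lambda>i. indicator U x * indicator (- U) (x + c *\<^sub>R z i)) \<longlonglongrightarrow> (0::ennreal)"
        proof (cases "x \<in> U")
          case True
          show ?thesis
          proof (rule Lim_transform_eventually[OF tendsto_const[of 0]])
            show "\<forall>\<^sub>F i in sequentially. 0 = indicator U x * (indicator (- U) (x + c *\<^sub>R z i) :: ennreal)"
              using ev[OF True, of c] by (rule eventually_mono) simp
          qed
        qed simp
      qed
    qed (auto simp: indicator_def)
    thus ?thesis by simp
  qed
  have "(\<lambda>i. (\<integral>\<^sup>+x. indicator U x * indicator (- U) (x + 1 *\<^sub>R z i) \<partial>lborel)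
     + (\<integral>\<^sup>+x. indicator U x * indicator (- U) (x + (-1) *\<^sub>R z i) \<partial>lborel)) \<longlonglongrightarrow> 0 + 0"
    by (intro tendsto_add lim)
  moreover have "(\<integral>\<^sup>+x. indicator U x * indicator (- U) (x + 1 *\<^sub>R z i) \<partial>lborel)
     + (\<integral>\<^sup>+x. indicator U x * indicator (- U) (x + (-1) *\<^sub>R z i) \<partial>lborel)
     = (\<integral>\<^sup>+x. ennreal \<bar>indicator U (x - z i) - indicator U x\<bar> \<partial>lborel)" for i
  proof -
    have "(\<integral>\<^sup>+x. indicator U x * indicator (- U) (x + 1 *\<^sub>R z i) \<partial>lborel)
      = (\<integral>\<^sup>+x. indicator U (x - z i) * (indicator (- U) x :: ennreal) \<partial>lborel)"
      using nn_integral_lborel_shift_minus[of "\<lambda>x. indicator U x * indicator (- U) (x + z i)" "z i"] by simp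
    hence "(\<integral>\<^sup>+x. indicator U x * indicator (- U) (x + 1 *\<^sub>R z i) \<partial>lborel)
     + (\<integral>\<^sup>+x. indicator U x * indicator (- U) (x + (-1) *\<^sub>R z i) \<partial>lborel)
     = (\<integral>\<^sup>+x. indicator U (x - z i) * indicator (- U) x + indicator U x * indicator (- U) (x + (-1) *\<^sub>R z i) \<partial>lborel)"
      by (simp only:) (subst nn_integral_add, auto)
    also have "\<dots> = (\<integral>\<^sup>+x. ennreal \<bar>indicator U (x - z i) - indicator U x\<bar> \<partial>lborel)"
      by (intro nn_integral_cong) (auto simp: indicator_def)
    finally show ?thesis .
  qed
  ultimately show ?thesis unfolding L1_trans_cont_def by simp
qed

text \<open>Outer regularity approximates a Borel set of finite measure by open sets in L1.\<close>

lemma L1_trans_cont_indicator: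
  fixes A :: "'a::euclidean_space set"
  assumes A[measurable]: "A \<in> sets borel" and fin: "emeasure lborel A < \<infinity>" and z: "z \<longlonglongrightarrow> 0"
  shows "L1_trans_cont z (indicator A)"
proof (rule L1_trans_cont_approx)
  fix e :: real assume e: "0 < e"
  have "A \<in> sets lebesgue" using A by simp
  then obtain U where U: "open U" "A \<subseteq> U" "emeasure lebesgue (U - A) < ennreal e"
    using sets_lebesgue_outer_open[OF _ e] by metis
  have [measurable]: "U \<in> sets borel" using U(1) by simp
  have ea: "emeasure lborel (U - A) < ennreal e" using U(3) by (subst (asm) emeasure_completion) auto
  have "emeasure lborel U = emeasure lborel A + emeasure lborel (U - A)"
    using U(2) by (subst plus_emeasure) (auto simp: Un_absorb1)
  also have "\<dots> < \<infinity>" using fin ea by (simp add: order_less_trans)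
  finally have finU: "emeasure lborel U < \<infinity>" .
  have "(\<integral>\<^sup>+x. ennreal \<bar>indicator A x - indicator U x\<bar> \<partial>lborel) = (\<integral>\<^sup>+x. indicator (U - A) x \<partial>lborel)"
    using U(2) by (intro nn_integral_cong) (auto simp: indicator_def)
  also have "\<dots> \<le> ennreal e" using ea by simp
  finally show "\<exists>h\<in>borel_measurable borel. L1_trans_cont z h \<and> (\<integral>\<^sup>+x. ennreal \<bar>indicator A x - h x\<bar> \<partial>lborel) \<le> ennreal e"
    using L1_trans_cont_open[OF U(1) finU z] by (intro bexI[of _ "indicator U"]) auto
qed measurable

lemma L1_trans_cont_integrable:
  fixes w :: "'a::euclidean_space \<Rightarrow> real"
  assumes "integrable lborel w" and z: "z \<longlonglongrightarrow> 0"
  shows "L1_trans_cont z w"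
  using assms(1)
proof (induction rule: integrable_induct)
  case (base A c)
  have [measurable]: "A \<in> sets borel" using base by simp
  have "(\<lambda>i. ennreal \<bar>c\<bar> * (\<integral>\<^sup>+x. ennreal \<bar>indicator A (x - z i) - indicator A x\<bar> \<partial>lborel)) \<longlonglongrightarrow> ennreal \<bar>c\<bar> * 0"
    using L1_trans_cont_indicator[of A z] base z unfolding L1_trans_cont_def
    by (intro ennreal_tendsto_cmult) auto
  moreover have "ennreal \<bar>c\<bar> * (\<integral>\<^sup>+x. ennreal \<bar>indicator A (x - z i) - indicator A x\<bar> \<partial>lborel)
     = (\<integral>\<^sup>+x. ennreal \<bar>indicator A (x - z i) *\<^sub>R c - indicator A x *\<^sub>R c\<bar> \<partial>lborel)" for i
  proof -
    have pw: "ennreal \<bar>a *\<^sub>R c - b *\<^sub>R c\<bar> = ennreal \<bar>c\<bar> * ennreal \<bar>a - b\<bar>" for a b :: real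
      unfolding ennreal_mult[OF abs_ge_zero abs_ge_zero, symmetric] abs_mult[symmetric]
      by (simp add: algebra_simps)
    show ?thesis unfolding pw by (rule nn_integral_cmult[symmetric]) measurable
  qed
  ultimately show ?case unfolding L1_trans_cont_def by simp
next
  case (add f h)
  have [measurable]: "f \<in> borel_measurable borel" "h \<in> borel_measurable borel"
    using add borel_measurable_integrable by fastforce+
  show ?case unfolding L1_trans_cont_def
  proof (rule tendsto_sandwich[OF _ _ tendsto_const])
    show "(\<lambda>i. (\<integral>\<^sup>+x. ennreal \<bar>f (x - z i) - f x\<bar> \<partial>lborel) + (\<integral>\<^sup>+x. ennreal \<bar>h (x - z i) - h x\<bar> \<partial>lborel)) \<longlonglongrightarrow> 0"
      using tendsto_add[OF add.IH[unfolded L1_trans_cont_def]] by simp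
    show "\<forall>\<^sub>F i in sequentially. (\<integral>\<^sup>+x. ennreal \<bar>f (x - z i) + h (x - z i) - (f x + h x)\<bar> \<partial>lborel)
      \<le> (\<integral>\<^sup>+x. ennreal \<bar>f (x - z i) - f x\<bar> \<partial>lborel) + (\<integral>\<^sup>+x. ennreal \<bar>h (x - z i) - h x\<bar> \<partial>lborel)"
    proof (intro always_eventually allI)
      fix i
      have "(\<integral>\<^sup>+x. ennreal \<bar>f (x - z i) + h (x - z i) - (f x + h x)\<bar> \<partial>lborel)
        \<le> (\<integral>\<^sup>+x. ennreal \<bar>f (x - z i) - f x\<bar> + ennreal \<bar>h (x - z i) - h x\<bar> \<partial>lborel)"
        by (intro nn_integral_mono) (simp flip: ennreal_plus)
      thus "(\<integral>\<^sup>+x. ennreal \<bar>f (x - z i) + h (x - z i) - (f x + h x)\<bar> \<partial>lborel)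
      \<le> (\<integral>\<^sup>+x. ennreal \<bar>f (x - z i) - f x\<bar> \<partial>lborel) + (\<integral>\<^sup>+x. ennreal \<bar>h (x - z i) - h x\<bar> \<partial>lborel)"
        by (subst (asm) nn_integral_add) auto
    qed
  qed auto
next
  case (lim f sq)
  have intf: "integrable lborel f" and intsq: "integrable lborel (sq i)" for i by fact+
  have [measurable]: "f \<in> borel_measurable borel" "sq i \<in> borel_measurable borel" for i
    using borel_measurable_integrable[OF intf] borel_measurable_integrable[OF intsq, of i] by simp_all
  have conv: "(\<lambda>i. \<integral>\<^sup>+x. ennreal (norm (f x - sq i x)) \<partial>lborel) \<longlonglongrightarrow> 0"
  proof (rule nn_integral_dominated_convergence_norm[where w = "\<lambda>x. 2 * norm (f x)"])
    have "integrable lborel (\<lambda>x. 2 * norm (f x))" using intf by simp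
    thus "(\<integral>\<^sup>+x. ennreal (2 * norm (f x)) \<partial>lborel) < \<infinity>" unfolding integrable_iff_bounded by simp
  qed (use lim in auto)
  show ?case
  proof (rule L1_trans_cont_approx)
    fix e :: real assume "0 < e"
    from eventually_happens[OF ennreal_tendsto_0D[OF conv this]]
    obtain i where "(\<integral>\<^sup>+x. ennreal \<bar>f x - sq i x\<bar> \<partial>lborel) \<le> ennreal e" by auto
    thus "\<exists>h\<in>borel_measurable borel. L1_trans_cont z h \<and> (\<integral>\<^sup>+x. ennreal \<bar>f x - h x\<bar> \<partial>lborel) \<le> ennreal e"
      using lim by (intro bexI[of _ "sq i"]) auto
  qed measurable
qed

text \<open>The Gagliardo-type modular over the whole space, as an iterated Borel integral. In
  contrast to \<open>modular_W\<close> on a product of two domains it is invariant under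
  translations.\<close>

definition MW :: "real \<Rightarrow> (real \<Rightarrow> real) \<Rightarrow> ('a::euclidean_space \<Rightarrow> real) \<Rightarrow> ennreal" where
  "MW s G w = (\<integral>\<^sup>+x. \<integral>\<^sup>+y. ennreal (G \<bar>Ds s w x y\<bar> / norm (x - y) ^ DIM('a)) \<partial>lborel \<partial>lborel)"

section \<open>Translation continuity and mollification for the modulars of G\<close>

context growth
begin

lemma G_abs_add3: "G \<bar>a + b + c\<bar> \<le> 4^N * (G \<bar>a\<bar> + G \<bar>b\<bar> + G \<bar>c\<bar>)"
proof -
  have "G \<bar>a + b + c\<bar> \<le> 2^N * (G \<bar>a + b\<bar> + G \<bar>c\<bar>)" by (rule G_abs_add)
  also have "\<dots> \<le> 2^N * (2^N * (G \<bar>a\<bar> + G \<bar>b\<bar>) + 2^N * G \<bar>c\<bar>)"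
    using mult_right_mono[of 1 "2^N" "G \<bar>c\<bar>"]
    by (intro mult_left_mono add_mono G_abs_add) (auto simp: G_nonneg)
  also have "\<dots> = (2*2)^N * (G \<bar>a\<bar> + G \<bar>b\<bar> + G \<bar>c\<bar>)" unfolding power_mult_distrib by (simp add: algebra_simps)
  finally show ?thesis by simp
qed

text \<open>Cutting w off both in the argument and in the value leaves a bounded integrable
  function, on whose increments \<open>G\<close> is at most linear; continuity of translations in L1
  then applies, and the remainder has small modular.\<close>

lemma LG_trans_cont:
  fixes w :: "'a::euclidean_space \<Rightarrow> real"
  assumes [measurable]: "w \<in> borel_measurable borel"
    and fin: "(\<integral>\<^sup>+x. ennreal (G \<bar>w x\<bar>) \<partial>lborel) < \<infinity>" and z: "z \<longlonglongrightarrow> 0"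
  shows "(\<lambda>i. \<integral>\<^sup>+x. ennreal (G \<bar>w (x - z i) - w x\<bar>) \<partial>lborel) \<longlonglongrightarrow> 0"
proof (rule ennreal_tendsto_0I)
  fix e :: real assume e: "0 < e"
  define T where "T M x = (if norm x \<le> real M \<and> \<bar>w x\<bar> \<le> real M then w x else 0)" for M :: nat and x
  have [measurable]: "T M \<in> borel_measurable borel" for M unfolding T_def by measurable
  \<comment> \<open>The factor 4^N comes from \<open>G_abs_add3\<close>, and each of the three parts
    receives one third of the error.\<close>
  define e' where "e' = e / (3 * 4^N)"
  have e': "0 < e'" using e by (simp add: e'_def)
  have "(\<lambda>M. \<integral>\<^sup>+x. ennreal (G \<bar>w x - T M x\<bar>) \<partial>lborel) \<longlonglongrightarrow> (\<integral>\<^sup>+(x::'a). 0 \<partial>lborel)"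
  proof (rule nn_integral_dominated_convergence[where w = "\<lambda>x. ennreal (G \<bar>w x\<bar>)"])
    show "AE x in lborel. (\<lambda>M. ennreal (G \<bar>w x - T M x\<bar>)) \<longlonglongrightarrow> 0"
    proof (intro AE_I2)
      fix x
      have "\<forall>\<^sub>F M in sequentially. M \<ge> nat \<lceil>norm x\<rceil> + nat \<lceil>\<bar>w x\<bar>\<rceil>" by (rule eventually_ge_at_top)
      hence "\<forall>\<^sub>F M in sequentially. 0 = ennreal (G \<bar>w x - T M x\<bar>)"
      proof (rule eventually_mono)
        fix M assume "nat \<lceil>norm x\<rceil> + nat \<lceil>\<bar>w x\<bar>\<rceil> \<le> M"
        hence "norm x \<le> real M" "\<bar>w x\<bar> \<le> real M"
          using real_nat_ceiling_ge[of "norm x"] real_nat_ceiling_ge[of "\<bar>w x\<bar>"] by linarith+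
        thus "0 = ennreal (G \<bar>w x - T M x\<bar>)" by (simp add: T_def)
      qed
      thus "(\<lambda>M. ennreal (G \<bar>w x - T M x\<bar>)) \<longlonglongrightarrow> 0"
        by (rule Lim_transform_eventually[OF tendsto_const])
    qed
  qed (use fin in \<open>auto simp: T_def G_nonneg\<close>)
  hence "(\<lambda>M. \<integral>\<^sup>+x. ennreal (G \<bar>w x - T M x\<bar>) \<partial>lborel) \<longlonglongrightarrow> 0" by simp
  from eventually_happens[OF ennreal_tendsto_0D[OF this e']]
  obtain M where M: "(\<integral>\<^sup>+x. ennreal (G \<bar>w x - T M x\<bar>) \<partial>lborel) \<le> ennreal e'" by auto
  have int: "integrable lborel (T M)"
  proof (rule Bochner_Integration.integrable_bound)
    show "integrable lborel (\<lambda>x::'a. real M * indicator (cball 0 (real M)) x)"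
      by (intro integrable_mult_right integrable_real_indicator)
         (auto simp: emeasure_bounded_finite[unfolded infinity_ennreal_def])
  qed (auto simp: T_def indicator_def)
  \<comment> \<open>Increments of the truncation are at most 2 M, and on that range G t \<le> t g t
    makes \<open>c\<close> a linear bound for \<open>G\<close>.\<close>
  define c where "c = max 1 (g (2 * real M))"
  have c: "0 < c" by (simp add: c_def)
  have "\<forall>\<^sub>F i in sequentially. (\<integral>\<^sup>+x. ennreal \<bar>T M (x - z i) - T M x\<bar> \<partial>lborel) \<le> ennreal (e'/c)"
    using L1_trans_cont_integrable[OF int z] c e' unfolding L1_trans_cont_def by (intro ennreal_tendsto_0D) auto
  thus "\<forall>\<^sub>F i in sequentially. (\<integral>\<^sup>+x. ennreal (G \<bar>w (x - z i) - w x\<bar>) \<partial>lborel) \<le> ennreal e"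
  proof eventually_elim
    case (elim i)
    define A where "A x = ennreal \<bar>T M (x - z i) - T M x\<bar>" for x
    define B where "B x = ennreal (G \<bar>w x - T M x\<bar>)" for x
    have [measurable]: "A \<in> borel_measurable borel" "B \<in> borel_measurable borel"
      unfolding A_def B_def by measurable
    have pw: "ennreal (G \<bar>w (x - z i) - w x\<bar>) \<le> ennreal (4^N) * (ennreal c * A x + (B (x - z i) + B x))" for x
    proof -
      let ?a = "T M (x - z i) - T M x"
      have bd: "\<bar>?a\<bar> \<le> 2 * real M" unfolding T_def by auto
      have "G \<bar>?a\<bar> \<le> \<bar>?a\<bar> * g \<bar>?a\<bar>" by (rule G_le_tg) simp
      also have "\<dots> \<le> \<bar>?a\<bar> * c" using bd g_mono[of "\<bar>?a\<bar>" "2 * real M"]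
        by (intro mult_left_mono) (auto simp: c_def)
      finally have Ga: "G \<bar>?a\<bar> \<le> c * \<bar>?a\<bar>" by (simp add: mult.commute)
      have "w (x - z i) - w x = ?a + (w (x - z i) - T M (x - z i)) + (- (w x - T M x))" by simp
      hence "G \<bar>w (x - z i) - w x\<bar> \<le> 4^N * (G \<bar>?a\<bar> + G \<bar>w (x - z i) - T M (x - z i)\<bar> + G \<bar>- (w x - T M x)\<bar>)"
        using G_abs_add3 by metis
      also have "\<dots> \<le> 4^N * (c * \<bar>?a\<bar> + (G \<bar>w (x - z i) - T M (x - z i)\<bar> + G \<bar>w x - T M x\<bar>))"
        using Ga by (intro mult_left_mono) (auto simp: abs_minus_commute)
      finally have "ennreal (G \<bar>w (x - z i) - w x\<bar>) \<le> ennreal (4^N * (c * \<bar>?a\<bar> + (G \<bar>w (x - z i) - T M (x - z i)\<bar> + G \<bar>w x - T M x\<bar>)))"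
        by (rule ennreal_leI)
      also have "\<dots> = ennreal (4^N) * (ennreal c * A x + (B (x - z i) + B x))"
        using c by (simp add: A_def B_def ennreal_mult ennreal_plus G_nonneg)
      finally show ?thesis .
    qed
    have "(\<integral>\<^sup>+x. ennreal (G \<bar>w (x - z i) - w x\<bar>) \<partial>lborel)
      \<le> (\<integral>\<^sup>+x. ennreal (4^N) * (ennreal c * A x + (B (x - z i) + B x)) \<partial>lborel)"
      by (rule nn_integral_mono) (rule pw)
    also have "\<dots> = ennreal (4^N) * (ennreal c * (\<integral>\<^sup>+x. A x \<partial>lborel) + ((\<integral>\<^sup>+x. B (x - z i) \<partial>lborel) + (\<integral>\<^sup>+x. B x \<partial>lborel)))"
      by (simp add: nn_integral_cmult nn_integral_add)
    also have "(\<integral>\<^sup>+x. B (x - z i) \<partial>lborel) = (\<integral>\<^sup>+x. B x \<partial>lborel)"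
      by (rule nn_integral_lborel_shift_minus) measurable
    also have "ennreal (4^N) * (ennreal c * (\<integral>\<^sup>+x. A x \<partial>lborel) + ((\<integral>\<^sup>+x. B x \<partial>lborel) + (\<integral>\<^sup>+x. B x \<partial>lborel)))
      \<le> ennreal (4^N) * (ennreal c * ennreal (e'/c) + (ennreal e' + ennreal e'))"
      using elim M unfolding A_def B_def by (intro mult_left_mono add_mono) auto
    also have "\<dots> = ennreal (4^N * (c * (e'/c) + (e' + e')))"
      using c e' by (simp add: ennreal_mult'[symmetric] ennreal_plus[symmetric] del: ennreal_plus times_divide_eq_right)
    also have "4^N * (c * (e'/c) + (e' + e')) = e" using c by (simp add: e'_def field_simps)
    finally show ?case .
  qed
qed

text \<open>With the increment h as outer variable, |h| is a constant in the inner integral, which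
  becomes an ordinary modular of the increment of w by h; this prepares dominated convergence in
  h.\<close>

lemma MW_shift:
  fixes w :: "'a::euclidean_space \<Rightarrow> real"
  assumes [measurable]: "w \<in> borel_measurable borel"
  shows "MW s G w = (\<integral>\<^sup>+h. \<integral>\<^sup>+x. ennreal (G \<bar>(w x - w (x + h)) / norm h powr s\<bar> / norm h ^ DIM('a)) \<partial>lborel \<partial>lborel)"
proof -
  have "MW s G w = (\<integral>\<^sup>+x. \<integral>\<^sup>+h. ennreal (G \<bar>(w x - w (x + h)) / norm h powr s\<bar> / norm h ^ DIM('a)) \<partial>lborel \<partial>lborel)"
    unfolding MW_def
  proof (rule nn_integral_cong)
    fix x :: 'a
    have "(\<integral>\<^sup>+y. ennreal (G \<bar>Ds s w x y\<bar> / norm (x - y) ^ DIM('a)) \<partial>lborel)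
       = (\<integral>\<^sup>+h. ennreal (G \<bar>Ds s w x (h + x)\<bar> / norm (x - (h + x)) ^ DIM('a)) \<partial>lborel)"
      by (rule nn_integral_lborel_shift[symmetric]) (unfold Ds_def, measurable)
    thus "(\<integral>\<^sup>+y. ennreal (G \<bar>Ds s w x y\<bar> / norm (x - y) ^ DIM('a)) \<partial>lborel)
       = (\<integral>\<^sup>+h. ennreal (G \<bar>(w x - w (x + h)) / norm h powr s\<bar> / norm h ^ DIM('a)) \<partial>lborel)"
      by (simp add: Ds_def add.commute)
  qed
  also have "\<dots> = (\<integral>\<^sup>+h. \<integral>\<^sup>+x. ennreal (G \<bar>(w x - w (x + h)) / norm h powr s\<bar> / norm h ^ DIM('a)) \<partial>lborel \<partial>lborel)"
    by (rule lborel_pair.Fubini') measurable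
  finally show ?thesis .
qed

text \<open>For a fixed increment h the inner integral is at most a constant depending on h times
  the modular of the translation difference, which tends to 0. The integration over h is dominated
  by the corresponding integral for w itself, finite by hypothesis, so the blow-up of that constant
  as h tends to 0 is harmless.\<close>

lemma MW_trans_cont:
  fixes w :: "'a::euclidean_space \<Rightarrow> real"
  assumes [measurable]: "w \<in> borel_measurable borel"
    and fin: "(\<integral>\<^sup>+x. ennreal (G \<bar>w x\<bar>) \<partial>lborel) < \<infinity>" and finW: "MW s G w < \<infinity>"
    and z: "z \<longlonglongrightarrow> 0"
  shows "(\<lambda>i. MW s G (\<lambda>x. w (x - z i) - w x)) \<longlonglongrightarrow> 0"
proof -
  define v where "v i x = w (x - z i) - w x" for i x
  have [measurable]: "v i \<in> borel_measurable borel" for i unfolding v_def by measurable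
  define \<Psi> where "\<Psi> h = (\<integral>\<^sup>+x. ennreal (G \<bar>(w x - w (x + h)) / norm h powr s\<bar> / norm h ^ DIM('a)) \<partial>lborel)" for h
  define \<Phi> where "\<Phi> i h = (\<integral>\<^sup>+x. ennreal (G \<bar>(v i x - v i (x + h)) / norm h powr s\<bar> / norm h ^ DIM('a)) \<partial>lborel)" for i h
  have [measurable]: "\<Psi> \<in> borel_measurable borel" "\<Phi> i \<in> borel_measurable borel" for i
    unfolding \<Psi>_def \<Phi>_def by measurable
  have "(\<lambda>i. \<integral>\<^sup>+h. \<Phi> i h \<partial>lborel) \<longlonglongrightarrow> (\<integral>\<^sup>+(h::'a). 0 \<partial>lborel)"
  proof (rule nn_integral_dominated_convergence[where w = "\<lambda>h. ennreal (2^N) * (\<Psi> h + \<Psi> h)"])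
    have "MW s G w = (\<integral>\<^sup>+h. \<Psi> h \<partial>lborel)" unfolding \<Psi>_def by (rule MW_shift) measurable
    hence "(\<integral>\<^sup>+h. ennreal (2^N) * (\<Psi> h + \<Psi> h) \<partial>lborel) = ennreal (2^N) * (MW s G w + MW s G w)"
      by (simp add: nn_integral_cmult nn_integral_add)
    thus "(\<integral>\<^sup>+h. ennreal (2^N) * (\<Psi> h + \<Psi> h) \<partial>lborel) < \<infinity>"
      using finW by (simp add: ennreal_mult_less_top)
    show "AE h in lborel. \<Phi> i h \<le> ennreal (2^N) * (\<Psi> h + \<Psi> h)" for i
    proof (rule AE_I2)
      fix h :: 'a
      define F where "F x = ennreal (G \<bar>(w x - w (x + h)) / norm h powr s\<bar> / norm h ^ DIM('a))" for x
      have [measurable]: "F \<in> borel_measurable borel" unfolding F_def by measurable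
      have "\<Phi> i h \<le> (\<integral>\<^sup>+x. ennreal (2^N) * (F (x - z i) + F x) \<partial>lborel)" unfolding \<Phi>_def
      proof (rule nn_integral_mono)
        fix x
        let ?a = "(w (x - z i) - w (x - z i + h)) / norm h powr s"
        let ?b = "(w x - w (x + h)) / norm h powr s"
        have "(v i x - v i (x + h)) / norm h powr s = ?a + (- ?b)"
          by (simp add: v_def diff_divide_distrib add_divide_distrib algebra_simps)
        hence "G \<bar>(v i x - v i (x + h)) / norm h powr s\<bar> \<le> 2^N * (G \<bar>?a\<bar> + G \<bar>?b\<bar>)"
          using G_abs_add[of ?a "- ?b"] by simp
        hence "G \<bar>(v i x - v i (x + h)) / norm h powr s\<bar> / norm h ^ DIM('a)
           \<le> 2^N * (G \<bar>?a\<bar> + G \<bar>?b\<bar>) / norm h ^ DIM('a)" by (rule divide_right_mono) simp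
        also have "\<dots> = 2^N * (G \<bar>?a\<bar> / norm h ^ DIM('a) + G \<bar>?b\<bar> / norm h ^ DIM('a))"
          by (simp only: add_divide_distrib[symmetric] times_divide_eq_right)
        finally show "ennreal (G \<bar>(v i x - v i (x + h)) / norm h powr s\<bar> / norm h ^ DIM('a))
           \<le> ennreal (2^N) * (F (x - z i) + F x)"
          unfolding F_def by (subst ennreal_plus[symmetric], simp add: G_nonneg, simp add: G_nonneg)
            (subst ennreal_mult'[symmetric], auto intro: ennreal_leI)
      qed
      also have "\<dots> = ennreal (2^N) * ((\<integral>\<^sup>+x. F (x - z i) \<partial>lborel) + (\<integral>\<^sup>+x. F x \<partial>lborel))"
        by (simp add: nn_integral_cmult nn_integral_add)
      also have "(\<integral>\<^sup>+x. F (x - z i) \<partial>lborel) = (\<integral>\<^sup>+x. F x \<partial>lborel)"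
        by (rule nn_integral_lborel_shift_minus) measurable
      finally show "\<Phi> i h \<le> ennreal (2^N) * (\<Psi> h + \<Psi> h)" by (simp add: F_def \<Psi>_def)
    qed
    show "AE h in lborel. (\<lambda>i. \<Phi> i h) \<longlonglongrightarrow> 0"
    proof (rule AE_I2)
      fix h :: 'a
      define D where "D = max 1 (1 / norm h powr s)"
      define c where "c = D ^ N * 2 ^ N / norm h ^ DIM('a)"
      have D: "1 \<le> D" by (simp add: D_def)
      have c: "0 \<le> c" using D by (simp add: c_def)
      define A where "A i = (\<integral>\<^sup>+x. ennreal (G \<bar>v i x\<bar>) \<partial>lborel)" for i
      have A: "A \<longlonglongrightarrow> 0" unfolding A_def v_def by (rule LG_trans_cont[OF assms(1) fin z])
      show "(\<lambda>i. \<Phi> i h) \<longlonglongrightarrow> 0"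
      proof (rule tendsto_sandwich[OF _ _ tendsto_const])
        have "(\<lambda>i. ennreal c * (A i + A i)) \<longlonglongrightarrow> ennreal c * (0 + 0)"
          by (intro ennreal_tendsto_cmult tendsto_add A) auto
        thus "(\<lambda>i. ennreal c * (A i + A i)) \<longlonglongrightarrow> 0" by simp
        have "\<Phi> i h \<le> ennreal c * (A i + A i)" for i
        proof -
          have "\<Phi> i h \<le> (\<integral>\<^sup>+x. ennreal c * (ennreal (G \<bar>v i x\<bar>) + ennreal (G \<bar>v i (x + h)\<bar>)) \<partial>lborel)"
            unfolding \<Phi>_def
          proof (rule nn_integral_mono)
            fix x
            have "G \<bar>(v i x - v i (x + h)) / norm h powr s\<bar> \<le> G (D * \<bar>v i x - v i (x + h)\<bar>)"
            proof (rule G_mono)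
              have "\<bar>(v i x - v i (x + h)) / norm h powr s\<bar> = (1 / norm h powr s) * \<bar>v i x - v i (x + h)\<bar>"
                by (simp add: abs_divide)
              also have "\<dots> \<le> D * \<bar>v i x - v i (x + h)\<bar>" by (intro mult_right_mono) (auto simp: D_def)
              finally show "\<bar>(v i x - v i (x + h)) / norm h powr s\<bar> \<le> D * \<bar>v i x - v i (x + h)\<bar>" .
            qed simp
            also have "\<dots> \<le> D^N * G \<bar>v i x - v i (x + h)\<bar>" using D by (intro G_scale_upper) auto
            also have "\<dots> \<le> D^N * (2^N * (G \<bar>v i x\<bar> + G \<bar>v i (x + h)\<bar>))"
              using D G_abs_add[of "v i x" "- v i (x + h)"] by (intro mult_left_mono) auto
            finally have "G \<bar>(v i x - v i (x + h)) / norm h powr s\<bar> / norm h ^ DIM('a)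
              \<le> D^N * (2^N * (G \<bar>v i x\<bar> + G \<bar>v i (x + h)\<bar>)) / norm h ^ DIM('a)"
              by (rule divide_right_mono) simp
            also have "\<dots> = c * (G \<bar>v i x\<bar> + G \<bar>v i (x + h)\<bar>)" by (simp add: c_def)
            finally show "ennreal (G \<bar>(v i x - v i (x + h)) / norm h powr s\<bar> / norm h ^ DIM('a))
              \<le> ennreal c * (ennreal (G \<bar>v i x\<bar>) + ennreal (G \<bar>v i (x + h)\<bar>))"
              using c by (simp add: ennreal_mult'[symmetric] ennreal_plus[symmetric] G_nonneg ennreal_leI del: ennreal_plus)
          qed
          also have "\<dots> = ennreal c * (A i + (\<integral>\<^sup>+x. ennreal (G \<bar>v i (x + h)\<bar>) \<partial>lborel))"
            by (simp add: nn_integral_cmult nn_integral_add A_def)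
          also have "(\<integral>\<^sup>+x. ennreal (G \<bar>v i (x + h)\<bar>) \<partial>lborel) = A i" unfolding A_def
            by (rule nn_integral_lborel_shift[of "\<lambda>x. ennreal (G \<bar>v i x\<bar>)"]) measurable
          finally show ?thesis .
        qed
        thus "\<forall>\<^sub>F i in sequentially. \<Phi> i h \<le> ennreal c * (A i + A i)" by (intro always_eventually allI)
      qed auto
    qed
  qed measurable
  moreover have "MW s G (\<lambda>x. w (x - z i) - w x) = (\<integral>\<^sup>+h. \<Phi> i h \<partial>lborel)" for i
    unfolding \<Phi>_def v_def[symmetric, abs_def] by (subst MW_shift) (auto simp: v_def[abs_def])
  ultimately show ?thesis by simp
qed

text \<open>Tangent line of \<open>G\<close> at the modulus of the mean. Its slope is nonnegative,
  so passing from f to |f| in the mean goes in the right direction.\<close>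

lemma G_jensen:
  assumes [measurable]: "\<rho> \<in> borel_measurable M" "f \<in> borel_measurable M"
    and nn: "\<And>z. 0 \<le> \<rho> z" and int: "integrable M \<rho>" "(\<integral>z. \<rho> z \<partial>M) = 1"
    and intf: "integrable M (\<lambda>z. \<rho> z * f z)"
  shows "ennreal (G \<bar>\<integral>z. \<rho> z * f z \<partial>M\<bar>) \<le> (\<integral>\<^sup>+z. ennreal (\<rho> z * G \<bar>f z\<bar>) \<partial>M)"
proof (cases "(\<integral>\<^sup>+z. ennreal (\<rho> z * G \<bar>f z\<bar>) \<partial>M) = \<infinity>")
  case False
  have intG: "integrable M (\<lambda>z. \<rho> z * G \<bar>f z\<bar>)"
    using False nn by (intro integrableI_nonneg) (auto simp: G_nonneg less_top)
  have inta: "integrable M (\<lambda>z. \<rho> z * \<bar>f z\<bar>)"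
    using integrable_abs[OF intf] nn by (simp add: abs_mult)
  define t where "t = \<bar>\<integral>z. \<rho> z * f z \<partial>M\<bar>"
  have "t \<le> (\<integral>z. \<bar>\<rho> z * f z\<bar> \<partial>M)" unfolding t_def by (rule integral_abs_bound)
  hence t: "t \<le> (\<integral>z. \<rho> z * \<bar>f z\<bar> \<partial>M)" using nn by (simp add: abs_mult)
  have "G t \<le> G t + g t * ((\<integral>z. \<rho> z * \<bar>f z\<bar> \<partial>M) - t)"
    using t g_nonneg[of t] by (simp add: t_def)
  also have "\<dots> = (\<integral>z. G t * \<rho> z + g t * (\<rho> z * \<bar>f z\<bar> - t * \<rho> z) \<partial>M)"
    using int inta by simp
  also have "\<dots> \<le> (\<integral>z. \<rho> z * G \<bar>f z\<bar> \<partial>M)"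
  proof (rule integral_mono)
    fix z
    have "\<rho> z * (G t + g t * (\<bar>f z\<bar> - t)) \<le> \<rho> z * G \<bar>f z\<bar>"
      using nn by (intro mult_left_mono G_tangent) (auto simp: t_def)
    thus "G t * \<rho> z + g t * (\<rho> z * \<bar>f z\<bar> - t * \<rho> z) \<le> \<rho> z * G \<bar>f z\<bar>" by (simp add: algebra_simps)
  qed (use int inta intG in auto)
  finally have "ennreal (G t) \<le> ennreal (\<integral>z. \<rho> z * G \<bar>f z\<bar> \<partial>M)" by (rule ennreal_leI)
  also have "\<dots> = (\<integral>\<^sup>+z. ennreal (\<rho> z * G \<bar>f z\<bar>) \<partial>M)"
    using intG nn by (intro nn_integral_eq_integral[symmetric]) (auto simp: G_nonneg)
  finally show ?thesis by (simp add: t_def)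
qed auto

text \<open>Reflection invariance of Lebesgue measure moves the shift onto w, and since the kernel
  has mass one, w x can be taken inside the integral.\<close>

lemma conv_minus_eq:
  fixes w :: "'a::euclidean_space \<Rightarrow> real"
  assumes \<rho>: "smooth_bdd \<rho>" "integrable lborel \<rho>" "(\<integral>x. \<rho> x \<partial>lborel) = 1" and w: "integrable lborel w"
  shows "conv \<rho> w x - w x = (\<integral>z. \<rho> z * (w (x - z) - w x) \<partial>lborel)"
    and "integrable lborel (\<lambda>z. \<rho> z * (w (x - z) - w x))"
proof -
  have [measurable]: "\<rho> \<in> borel_measurable borel" using \<rho>(1) by (rule smooth_bdd_measurable)
  have [measurable]: "w \<in> borel_measurable borel" using w borel_measurable_integrable by fastforce
  have "integrable (distr lborel borel (\<lambda>z. x - z)) (\<lambda>y. \<rho> (x - y) * w y)"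
    unfolding distr_lborel_reflect by (rule conv_integrable[OF \<rho>(1) w])
  hence i: "integrable lborel (\<lambda>z. \<rho> z * w (x - z))"
    by (subst (asm) integrable_distr_eq) auto
  have "conv \<rho> w x = (\<integral>y. \<rho> (x - y) * w y \<partial>(distr lborel borel (\<lambda>z. x - z)))"
    unfolding distr_lborel_reflect conv_def ..
  also have "\<dots> = (\<integral>z. \<rho> z * w (x - z) \<partial>lborel)" by (subst integral_distr) auto
  finally have c: "conv \<rho> w x = (\<integral>z. \<rho> z * w (x - z) \<partial>lborel)" .
  have j: "integrable lborel (\<lambda>z. \<rho> z * w x)" using \<rho>(2) by simp
  show "integrable lborel (\<lambda>z. \<rho> z * (w (x - z) - w x))"
    using Bochner_Integration.integrable_diff[OF i j] by (simp add: algebra_simps)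
  have "(\<integral>z. \<rho> z * (w (x - z) - w x) \<partial>lborel) = (\<integral>z. \<rho> z * w (x - z) - \<rho> z * w x \<partial>lborel)"
    by (simp add: algebra_simps)
  also have "\<dots> = conv \<rho> w x - w x"
    using Bochner_Integration.integral_diff[OF i j] \<rho>(2,3) by (simp add: c)
  finally show "conv \<rho> w x - w x = (\<integral>z. \<rho> z * (w (x - z) - w x) \<partial>lborel)" ..
qed

text \<open>The mollification error is the average of w (x - z) - w x with weight \<rho>. Jensen and
  Fubini bound its modular by the average of the modulars of the translation differences, of which
  only shifts with |z| \<le> e matter.\<close>

lemma modular_conv:
  fixes w :: "'a::euclidean_space \<Rightarrow> real"
  assumes \<rho>: "smooth_bdd \<rho>" "integrable lborel \<rho>" "(\<integral>x. \<rho> x \<partial>lborel) = 1" and w: "integrable lborel w"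
    and nn: "\<And>x. 0 \<le> \<rho> x" and supp: "\<And>x. norm x > e \<Longrightarrow> \<rho> x = 0"
  shows "(\<And>z. norm z \<le> e \<Longrightarrow> (\<integral>\<^sup>+x. ennreal (G \<bar>w (x - z) - w x\<bar>) \<partial>lborel) \<le> \<eta>) \<Longrightarrow>
      (\<integral>\<^sup>+x. ennreal (G \<bar>conv \<rho> w x - w x\<bar>) \<partial>lborel) \<le> \<eta>"
    and "(\<And>z. norm z \<le> e \<Longrightarrow> MW s G (\<lambda>x. w (x - z) - w x) \<le> \<eta>) \<Longrightarrow>
      MW s G (\<lambda>x. conv \<rho> w x - w x) \<le> \<eta>"
proof -
  have [measurable]: "\<rho> \<in> borel_measurable borel" using \<rho>(1) by (rule smooth_bdd_measurable)
  have [measurable]: "w \<in> borel_measurable borel" using w borel_measurable_integrable by fastforce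
  note c = conv_minus_eq[OF \<rho> w]
  have one: "(\<integral>\<^sup>+z. ennreal (\<rho> z) \<partial>lborel) = 1"
    using \<rho>(2,3) nn by (subst nn_integral_eq_integral) auto
  have avg: "(\<integral>\<^sup>+z. ennreal (\<rho> z) * F z \<partial>lborel) \<le> \<eta>"
    if "\<And>z. norm z \<le> e \<Longrightarrow> F z \<le> \<eta>" for F :: "'a \<Rightarrow> ennreal"
  proof -
    have "(\<integral>\<^sup>+z. ennreal (\<rho> z) * F z \<partial>lborel) \<le> (\<integral>\<^sup>+z. ennreal (\<rho> z) * \<eta> \<partial>lborel)"
    proof (rule nn_integral_mono)
      fix z show "ennreal (\<rho> z) * F z \<le> ennreal (\<rho> z) * \<eta>"
        using that[of z] supp[of z] by (cases "norm z \<le> e") (auto intro: mult_left_mono)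
    qed
    also have "\<dots> = (\<integral>\<^sup>+z. ennreal (\<rho> z) \<partial>lborel) * \<eta>" by (rule nn_integral_multc) measurable
    finally show ?thesis by (simp add: one)
  qed
  show "(\<integral>\<^sup>+x. ennreal (G \<bar>conv \<rho> w x - w x\<bar>) \<partial>lborel) \<le> \<eta>"
    if A: "\<And>z. norm z \<le> e \<Longrightarrow> (\<integral>\<^sup>+x. ennreal (G \<bar>w (x - z) - w x\<bar>) \<partial>lborel) \<le> \<eta>"
  proof -
    have "(\<integral>\<^sup>+x. ennreal (G \<bar>conv \<rho> w x - w x\<bar>) \<partial>lborel)
      \<le> (\<integral>\<^sup>+x. \<integral>\<^sup>+z. ennreal (\<rho> z) * ennreal (G \<bar>w (x - z) - w x\<bar>) \<partial>lborel \<partial>lborel)"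
    proof (rule nn_integral_mono)
      fix x
      show "ennreal (G \<bar>conv \<rho> w x - w x\<bar>) \<le> (\<integral>\<^sup>+z. ennreal (\<rho> z) * ennreal (G \<bar>w (x - z) - w x\<bar>) \<partial>lborel)"
        using G_jensen[of \<rho> lborel "\<lambda>z. w (x - z) - w x"] nn \<rho> c(2)[of x]
        by (simp add: c(1) ennreal_mult' )
    qed
    also have "\<dots> = (\<integral>\<^sup>+z. \<integral>\<^sup>+x. ennreal (\<rho> z) * ennreal (G \<bar>w (x - z) - w x\<bar>) \<partial>lborel \<partial>lborel)"
      by (rule lborel_pair.Fubini') measurable
    also have "\<dots> = (\<integral>\<^sup>+z. ennreal (\<rho> z) * (\<integral>\<^sup>+x. ennreal (G \<bar>w (x - z) - w x\<bar>) \<partial>lborel) \<partial>lborel)"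
      by (intro nn_integral_cong nn_integral_cmult) measurable
    also have "\<dots> \<le> \<eta>" by (rule avg) (rule A)
    finally show ?thesis .
  qed
  show "MW s G (\<lambda>x. conv \<rho> w x - w x) \<le> \<eta>"
    if A: "\<And>z. norm z \<le> e \<Longrightarrow> MW s G (\<lambda>x. w (x - z) - w x) \<le> \<eta>"
  proof -
    have "MW s G (\<lambda>x. conv \<rho> w x - w x)
      \<le> (\<integral>\<^sup>+x. \<integral>\<^sup>+y. \<integral>\<^sup>+z. ennreal (\<rho> z) * ennreal (G \<bar>Ds s (\<lambda>x. w (x - z) - w x) x y\<bar> / norm (x - y) ^ DIM('a)) \<partial>lborel \<partial>lborel \<partial>lborel)"
      unfolding MW_def
    proof (intro nn_integral_mono)
      fix x y :: 'a
      define f where "f z = Ds s (\<lambda>x. w (x - z) - w x) x y" for z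
      have [measurable]: "f \<in> borel_measurable borel" unfolding f_def Ds_def by measurable
      have f: "\<rho> z * f z = (\<rho> z * (w (x - z) - w x) - \<rho> z * (w (y - z) - w y)) / norm (x - y) powr s" for z
        by (simp add: f_def Ds_def right_diff_distrib)
      have "Ds s (\<lambda>x. conv \<rho> w x - w x) x y = (\<integral>z. \<rho> z * f z \<partial>lborel)"
        unfolding f unfolding Ds_def c(1) using c(2)[of x] c(2)[of y] by simp
      moreover have "integrable lborel (\<lambda>z. \<rho> z * f z)"
        unfolding f by (intro integrable_divide Bochner_Integration.integrable_diff c(2))
      ultimately have "ennreal (G \<bar>Ds s (\<lambda>x. conv \<rho> w x - w x) x y\<bar>) \<le> (\<integral>\<^sup>+z. ennreal (\<rho> z * G \<bar>f z\<bar>) \<partial>lborel)"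
        using G_jensen[of \<rho> lborel f] nn \<rho> by simp
      hence "ennreal (1 / norm (x - y) ^ DIM('a)) * ennreal (G \<bar>Ds s (\<lambda>x. conv \<rho> w x - w x) x y\<bar>)
        \<le> ennreal (1 / norm (x - y) ^ DIM('a)) * (\<integral>\<^sup>+z. ennreal (\<rho> z * G \<bar>f z\<bar>) \<partial>lborel)"
        by (intro mult_left_mono) auto
      also have "\<dots> = (\<integral>\<^sup>+z. ennreal (1 / norm (x - y) ^ DIM('a)) * ennreal (\<rho> z * G \<bar>f z\<bar>) \<partial>lborel)"
        by (rule nn_integral_cmult[symmetric]) measurable
      also have "\<dots> = (\<integral>\<^sup>+z. ennreal (\<rho> z) * ennreal (G \<bar>f z\<bar> / norm (x - y) ^ DIM('a)) \<partial>lborel)"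
        by (intro nn_integral_cong) (simp add: ennreal_mult'[symmetric] nn G_nonneg mult_ac)
      finally show "ennreal (G \<bar>Ds s (\<lambda>x. conv \<rho> w x - w x) x y\<bar> / norm (x - y) ^ DIM('a))
        \<le> (\<integral>\<^sup>+z. ennreal (\<rho> z) * ennreal (G \<bar>Ds s (\<lambda>x. w (x - z) - w x) x y\<bar> / norm (x - y) ^ DIM('a)) \<partial>lborel)"
        by (simp add: ennreal_mult'[symmetric] G_nonneg f_def)
    qed
    also have "\<dots> = (\<integral>\<^sup>+x. \<integral>\<^sup>+z. \<integral>\<^sup>+y. ennreal (\<rho> z) * ennreal (G \<bar>Ds s (\<lambda>x. w (x - z) - w x) x y\<bar> / norm (x - y) ^ DIM('a)) \<partial>lborel \<partial>lborel \<partial>lborel)"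
      unfolding Ds_def by (intro nn_integral_cong lborel_pair.Fubini') measurable
    also have "\<dots> = (\<integral>\<^sup>+z. \<integral>\<^sup>+x. \<integral>\<^sup>+y. ennreal (\<rho> z) * ennreal (G \<bar>Ds s (\<lambda>x. w (x - z) - w x) x y\<bar> / norm (x - y) ^ DIM('a)) \<partial>lborel \<partial>lborel \<partial>lborel)"
      unfolding Ds_def by (rule lborel_pair.Fubini') measurable
    also have "\<dots> = (\<integral>\<^sup>+z. ennreal (\<rho> z) * MW s G (\<lambda>x. w (x - z) - w x) \<partial>lborel)"
      unfolding MW_def Ds_def
      by (intro nn_integral_cong, subst nn_integral_cmult[symmetric], measurable)
         (intro nn_integral_cong nn_integral_cmult, measurable)
    also have "\<dots> \<le> \<eta>" by (rule avg) (rule A)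
    finally show ?thesis .
  qed
qed

end

text \<open>Dominated convergence gives continuity at 0 along sequences, while mollification needs a
  bound on a whole ball of shifts.\<close>

lemma seq_continuous_0_imp_eps:
  fixes F :: "'a::real_normed_vector \<Rightarrow> ennreal"
  assumes "\<And>z. z \<longlonglongrightarrow> 0 \<Longrightarrow> (\<lambda>i. F (z i)) \<longlonglongrightarrow> 0" and e: "0 < e"
  shows "\<exists>d>0. \<forall>z. norm z \<le> d \<longrightarrow> F z \<le> ennreal e"
proof (rule ccontr)
  assume "\<not> ?thesis"
  hence "\<forall>i::nat. \<exists>z. norm z \<le> 1 / real (Suc i) \<and> \<not> F z \<le> ennreal e" by (metis zero_less_divide_1_iff of_nat_0_less_iff zero_less_Suc)
  then obtain z where z: "\<And>i. norm (z i) \<le> 1 / real (Suc i)" "\<And>i. \<not> F (z i) \<le> ennreal e" by metis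
  have "(\<lambda>i. norm (z i)) \<longlonglongrightarrow> 0"
    by (rule tendsto_sandwich[OF _ _ tendsto_const lim_1_over_n[THEN LIMSEQ_Suc]]) (use z(1) in auto)
  hence "z \<longlonglongrightarrow> 0" by (rule tendsto_norm_zero_cancel)
  from eventually_happens[OF ennreal_tendsto_0D[OF assms(1)[OF this] e]] z(2) show False by auto
qed

lemma conv_support:
  assumes supp: "\<And>x. norm x > e \<Longrightarrow> \<rho> x = 0" and w: "\<And>x. x \<notin> K \<Longrightarrow> w x = 0" and x: "x \<notin> (\<Union>y\<in>K. cball y e)"
  shows "conv \<rho> w x = 0"
proof -
  have "\<rho> (x - y) * w y = 0" for y
    using supp[of "x - y"] w[of y] x by (cases "y \<in> K") (auto simp: dist_norm norm_minus_commute not_le)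
  hence "(\<lambda>y. \<rho> (x - y) * w y) = (\<lambda>_. 0)" by (intro ext)
  thus ?thesis by (simp only: conv_def) simp
qed

context growth
begin

lemma smooth_approx:
  fixes w :: "'a::euclidean_space \<Rightarrow> real"
  assumes [measurable]: "w \<in> borel_measurable borel"
    and K: "compact K" "K \<subseteq> \<Omega>" "open \<Omega>" "\<And>x. x \<notin> K \<Longrightarrow> w x = 0"
    and fin: "(\<integral>\<^sup>+x. ennreal (G \<bar>w x\<bar>) \<partial>lborel) < \<infinity>" and finW: "MW s G w < \<infinity>"
  shows "\<exists>\<phi>. (\<forall>k::nat. test_fun \<Omega> (\<phi> k)) \<and> (\<lambda>k. \<integral>\<^sup>+x. ennreal (G \<bar>\<phi> k x - w x\<bar>) \<partial>lborel) \<longlonglongrightarrow> 0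
     \<and> (\<lambda>k. MW s G (\<lambda>x. \<phi> k x - w x)) \<longlonglongrightarrow> 0"
proof -
  \<comment> \<open>On K, values below 1 are bounded by the indicator and the others by
    \<open>G\<close>, since t \<le> G t for t \<ge> 1.\<close>
  have intw: "integrable lborel w"
  proof (rule Bochner_Integration.integrable_bound)
    have "integrable lborel (\<lambda>x. G \<bar>w x\<bar>)"
      using fin by (intro integrableI_nonneg) (auto simp: G_nonneg)
    moreover have "integrable lborel (indicator K :: 'a \<Rightarrow> real)"
      using K(1) by (intro integrable_real_indicator)
        (auto simp: emeasure_bounded_finite[unfolded infinity_ennreal_def] compact_imp_bounded borel_compact)
    ultimately show "integrable lborel (\<lambda>x. indicator K x + G \<bar>w x\<bar>)" by simp
    show "AE x in lborel. norm (w x) \<le> norm (indicator K x + G \<bar>w x\<bar>)"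
    proof (rule AE_I2)
      fix x
      have "\<bar>w x\<bar> \<le> indicator K x + G \<bar>w x\<bar>"
        using K(4)[of x] G_ge_self[of "\<bar>w x\<bar>"] G_nonneg[of "\<bar>w x\<bar>"]
        by (cases "x \<in> K"; cases "1 \<le> \<bar>w x\<bar>") auto
      thus "norm (w x) \<le> norm (indicator K x + G \<bar>w x\<bar>)" by simp
    qed
  qed measurable
  obtain e0 where e0: "0 < e0" "(\<Union>x\<in>K. cball x e0) \<subseteq> \<Omega>"
    using compact_subset_open_imp_cball_epsilon_subset[OF K(1) K(3) K(2)] by metis
  have "\<exists>\<phi>. test_fun \<Omega> \<phi> \<and> (\<integral>\<^sup>+x. ennreal (G \<bar>\<phi> x - w x\<bar>) \<partial>lborel) \<le> ennreal (1 / Suc k)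
     \<and> MW s G (\<lambda>x. \<phi> x - w x) \<le> ennreal (1 / Suc k)" for k
  proof -
    have k: "0 < 1 / real (Suc k)" by simp
    obtain d1 where d1: "0 < d1" "\<And>z. norm z \<le> d1 \<Longrightarrow> (\<integral>\<^sup>+x. ennreal (G \<bar>w (x - z) - w x\<bar>) \<partial>lborel) \<le> ennreal (1 / Suc k)"
    proof -
      have "\<exists>d>0. \<forall>z. norm z \<le> d \<longrightarrow> (\<integral>\<^sup>+x. ennreal (G \<bar>w (x - z) - w x\<bar>) \<partial>lborel) \<le> ennreal (1 / Suc k)"
        by (rule seq_continuous_0_imp_eps[OF _ k]) (rule LG_trans_cont[OF assms(1) fin])
      thus ?thesis using that by blast
    qed
    obtain d2 where d2: "0 < d2" "\<And>z. norm z \<le> d2 \<Longrightarrow> MW s G (\<lambda>x. w (x - z) - w x) \<le> ennreal (1 / Suc k)"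
    proof -
      have "\<exists>d>0. \<forall>z. norm z \<le> d \<longrightarrow> MW s G (\<lambda>x. w (x - z) - w x) \<le> ennreal (1 / Suc k)"
        by (rule seq_continuous_0_imp_eps[OF _ k]) (rule MW_trans_cont[OF assms(1) fin finW])
      thus ?thesis using that by blast
    qed
    define e where "e = min e0 (min d1 d2)"
    have e: "0 < e" "e \<le> e0" "e \<le> d1" "e \<le> d2" using e0 d1 d2 by (auto simp: e_def)
    obtain \<rho> :: "'a \<Rightarrow> real" where \<rho>: "smooth_bdd \<rho>" "\<And>x. 0 \<le> \<rho> x" "\<And>x. norm x > e \<Longrightarrow> \<rho> x = 0"
      "integrable lborel \<rho>" "(\<integral>x. \<rho> x \<partial>lborel) = 1" using mollifier_exists[OF e(1)] by metis
    \<comment> \<open>This Minkowski sum is compact, and by the choice of \<open>e0\<close> it lies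
      in \<Omega>; it contains the support of the mollification.\<close>
    define C where "C = {x + y |x y. x \<in> K \<and> y \<in> cball 0 e}"
    have C: "compact C" unfolding C_def by (rule compact_sums[OF K(1) compact_cball])
    have CU: "C = (\<Union>x\<in>K. cball x e)" unfolding C_def
    proof safe
      fix x y :: 'a assume "x \<in> K" "y \<in> cball 0 e"
      thus "x + y \<in> (\<Union>x\<in>K. cball x e)" by (intro UN_I[of x]) (auto simp: dist_norm)
    next
      fix x y :: 'a assume "x \<in> K" "y \<in> cball x e"
      thus "\<exists>x' y'. y = x' + y' \<and> x' \<in> K \<and> y' \<in> cball 0 e"
        by (intro exI[of _ x] exI[of _ "y - x"]) (auto simp: dist_norm norm_minus_commute)
    qed
    have "(\<Union>x\<in>K. cball x e) \<subseteq> (\<Union>x\<in>K. cball x e0)" using e(2) by (intro UN_mono subset_cball) auto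
    hence C\<Omega>: "C \<subseteq> \<Omega>" using e0(2) CU by blast
    have "{x. conv \<rho> w x \<noteq> 0} \<subseteq> C" using conv_support[of e \<rho> K w] \<rho>(3) K(4) unfolding CU by blast
    hence "closure {x. conv \<rho> w x \<noteq> 0} \<subseteq> C" using C by (intro closure_minimal compact_imp_closed)
    moreover from this have "compact (closure {x. conv \<rho> w x \<noteq> 0})"
      using compact_imp_bounded[OF C] bounded_subset by (auto simp: compact_eq_bounded_closed)
    ultimately have "test_fun \<Omega> (conv \<rho> w)"
      unfolding test_fun_def using conv_smooth[OF \<rho>(1) intw] C\<Omega> by blast
    moreover have "(\<integral>\<^sup>+x. ennreal (G \<bar>conv \<rho> w x - w x\<bar>) \<partial>lborel) \<le> ennreal (1 / Suc k)"
      by (rule modular_conv(1)[OF \<rho>(1,4,5) intw \<rho>(2,3)]) (use d1(2) e in auto)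
    moreover have "MW s G (\<lambda>x. conv \<rho> w x - w x) \<le> ennreal (1 / Suc k)"
      by (rule modular_conv(2)[OF \<rho>(1,4,5) intw \<rho>(2,3)]) (use d2(2) e in auto)
    ultimately show ?thesis by blast
  qed
  then obtain \<phi> where \<phi>: "\<And>k. test_fun \<Omega> (\<phi> k)"
    "\<And>k. (\<integral>\<^sup>+x. ennreal (G \<bar>\<phi> k x - w x\<bar>) \<partial>lborel) \<le> ennreal (1 / Suc k)"
    "\<And>k. MW s G (\<lambda>x. \<phi> k x - w x) \<le> ennreal (1 / Suc k)" by metis
  have lim: "(\<lambda>k. ennreal (1 / Suc k)) \<longlonglongrightarrow> 0"
    using tendsto_ennrealI[OF lim_1_over_n[THEN LIMSEQ_Suc]] by simp
  have "(\<lambda>k. \<integral>\<^sup>+x. ennreal (G \<bar>\<phi> k x - w x\<bar>) \<partial>lborel) \<longlonglongrightarrow> 0"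
    by (rule tendsto_sandwich[OF _ _ tendsto_const lim]) (use \<phi>(2) in auto)
  moreover have "(\<lambda>k. MW s G (\<lambda>x. \<phi> k x - w x)) \<longlonglongrightarrow> 0"
    by (rule tendsto_sandwich[OF _ _ tendsto_const lim]) (use \<phi>(3) in auto)
  ultimately show ?thesis using \<phi>(1) by blast
qed

end

section \<open>Spaces over Lebesgue measure\<close>

lemma sigma_finite_lebesgue: "sigma_finite_measure (lebesgue :: 'a::euclidean_space measure)"
proof -
  obtain A :: "'a set set" where A: "countable A" "A \<subseteq> sets lborel" "\<Union>A = space lborel"
    "\<forall>a\<in>A. emeasure lborel a \<noteq> \<infinity>"
    using lborel.sigma_finite_countable by blast
  show ?thesis
  proof
    show "\<exists>A :: 'a set set. countable A \<and> A \<subseteq> sets lebesgue \<and> \<Union>A = space lebesgue \<and> (\<forall>a\<in>A. emeasure lebesgue a \<noteq> \<infinity>)"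
      using A by (intro exI[of _ A]) (auto simp: subset_iff)
  qed
qed

interpretation lebesgue: sigma_finite_measure "lebesgue :: 'a::euclidean_space measure"
  by (rule sigma_finite_lebesgue)

interpretation lebesgue_pair: pair_sigma_finite "lebesgue :: 'a::euclidean_space measure" "lebesgue :: 'b::euclidean_space measure" ..

lemma id_measurable_lebesgue [measurable]: "(\<lambda>x. x) \<in> lebesgue \<rightarrow>\<^sub>M borel"
  by (rule measurable_completion) simp

lemma measurable_lebesgueI: "f \<in> borel_measurable borel \<Longrightarrow> f \<in> borel_measurable lebesgue"
  by (rule measurable_completion) simp

lemma fst_measurable_lebesgue [measurable]:
  "fst \<in> lebesgue \<Otimes>\<^sub>M M \<rightarrow>\<^sub>M (borel :: 'a::euclidean_space measure)"
  by (rule measurable_compose[OF measurable_fst id_measurable_lebesgue])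

lemma snd_measurable_lebesgue [measurable]:
  "snd \<in> M \<Otimes>\<^sub>M lebesgue \<rightarrow>\<^sub>M (borel :: 'a::euclidean_space measure)"
  by (rule measurable_compose[OF measurable_snd id_measurable_lebesgue])

lemma measurable_lebesgue_pairI:
  fixes f :: "'a::euclidean_space \<times> 'b::euclidean_space \<Rightarrow> 'c::topological_space"
  assumes "f \<in> borel_measurable (borel \<Otimes>\<^sub>M borel)"
  shows "f \<in> borel_measurable (lebesgue \<Otimes>\<^sub>M lebesgue)"
proof -
  have "(\<lambda>z. (fst z, snd z)) \<in> lebesgue \<Otimes>\<^sub>M lebesgue \<rightarrow>\<^sub>M (borel :: 'a measure) \<Otimes>\<^sub>M (borel :: 'b measure)" by measurable
  from measurable_compose[OF this assms] show ?thesis by simp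
qed

text \<open>For a Borel integrand each inner integral over the completed measure equals the one over
  \<open>lborel\<close>, so energies defined on the product of completions become iterated Borel
  integrals.\<close>

lemma nn_integral_lebesgue_pair:
  fixes f :: "'a::euclidean_space \<times> 'b::euclidean_space \<Rightarrow> ennreal"
  assumes "f \<in> borel_measurable (borel \<Otimes>\<^sub>M borel)"
  shows "(\<integral>\<^sup>+z. f z \<partial>(lebesgue \<Otimes>\<^sub>M lebesgue)) = (\<integral>\<^sup>+x. \<integral>\<^sup>+y. f (x, y) \<partial>lborel \<partial>lborel)"
proof -
  have "(\<integral>\<^sup>+x. \<integral>\<^sup>+y. f (x, y) \<partial>lebesgue \<partial>lebesgue) = (\<integral>\<^sup>+z. f z \<partial>(lebesgue \<Otimes>\<^sub>M lebesgue))"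
    by (rule lebesgue.nn_integral_fst) (rule measurable_lebesgue_pairI[OF assms])
  thus ?thesis by (simp add: nn_integral_completion)
qed

lemma AE_lebesgue_pair:
  fixes P :: "'a::euclidean_space \<Rightarrow> bool"
  assumes "AE x in lebesgue. P x"
  shows "AE z in (lebesgue :: 'a measure) \<Otimes>\<^sub>M (lebesgue :: 'a measure). P (fst z) \<and> P (snd z)"
proof -
  obtain N where N: "N \<in> null_sets lebesgue" "{x \<in> space lebesgue. \<not> P x} \<subseteq> N"
    using assms unfolding eventually_ae_filter by blast
  have "N \<times> UNIV \<in> null_sets ((lebesgue :: 'a measure) \<Otimes>\<^sub>M (lebesgue :: 'a measure))"
    using lebesgue.times_in_null_sets1[OF N(1), of UNIV] by simp
  moreover have "UNIV \<times> N \<in> null_sets ((lebesgue :: 'a measure) \<Otimes>\<^sub>M (lebesgue :: 'a measure))"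
    using lebesgue.times_in_null_sets2[OF _ N(1), of UNIV lebesgue] by simp
  ultimately have "N \<times> UNIV \<union> UNIV \<times> N \<in> null_sets ((lebesgue :: 'a measure) \<Otimes>\<^sub>M (lebesgue :: 'a measure))"
    by (rule null_sets.Un)
  thus ?thesis by (rule AE_I') (use N(2) in \<open>auto simp: space_pair_measure\<close>)
qed

lemma Ds_measurable_lebesgue [measurable]:
  assumes [measurable]: "f \<in> borel_measurable lebesgue"
  shows "(\<lambda>z. Ds s f (fst z) (snd z)) \<in> borel_measurable (lebesgue \<Otimes>\<^sub>M lebesgue)"
  unfolding Ds_def by measurable

lemma modular_W_borel:
  fixes f :: "'a::euclidean_space \<Rightarrow> real"
  assumes [measurable]: "f \<in> borel_measurable borel" "(\<lambda>z. G \<bar>Ds s f (fst z) (snd z)\<bar>) \<in> borel_measurable (borel \<Otimes>\<^sub>M borel)"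
    "\<Omega> \<in> sets borel" "\<Omega>' \<in> sets borel"
  shows "modular_W s G \<Omega> \<Omega>' f = (\<integral>\<^sup>+x. \<integral>\<^sup>+y. indicator \<Omega> x * indicator \<Omega>' y *
     ennreal (G \<bar>Ds s f x y\<bar> / norm (x - y) ^ DIM('a)) \<partial>lborel \<partial>lborel)"
  unfolding modular_W_def
  by (subst nn_integral_lebesgue_pair) (simp_all add: indicator_times)

section \<open>Sums of test functions\<close>

lemma iter_dd_add:
  assumes "smooth_fun f" "smooth_fun h"
  shows "iter_dd vs (\<lambda>x. f x + h x) = (\<lambda>x. iter_dd vs f x + iter_dd vs h x)"
proof (induction vs)
  case (Cons v vs)
  show ?case
  proof
    fix x
    have d: "iter_dd vs f differentiable (at x)" "iter_dd vs h differentiable (at x)"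
      using assms by (auto simp: smooth_fun_def)
    have "((\<lambda>x. iter_dd vs f x + iter_dd vs h x) has_derivative
       (\<lambda>v. frechet_derivative (iter_dd vs f) (at x) v + frechet_derivative (iter_dd vs h) (at x) v)) (at x)"
      using d unfolding frechet_derivative_works by (rule has_derivative_add)
    from frechet_derivative_at[OF this]
    show "iter_dd (v # vs) (\<lambda>x. f x + h x) x = iter_dd (v # vs) f x + iter_dd (v # vs) h x"
      by (simp add: Cons.IH) metis
  qed
qed simp

lemma smooth_fun_add: "smooth_fun f \<Longrightarrow> smooth_fun h \<Longrightarrow> smooth_fun (\<lambda>x. f x + h x)"
  using iter_dd_add[of f h] unfolding smooth_fun_def by (simp add: differentiable_add)

lemma test_fun_add: assumes "test_fun \<Omega> f" "test_fun \<Omega> h" shows "test_fun \<Omega> (\<lambda>x. f x + h x)"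
proof -
  let ?S = "\<lambda>f. closure {x. f x \<noteq> (0::real)}"
  have sub: "?S (\<lambda>x. f x + h x) \<subseteq> ?S f \<union> ?S h"
    unfolding closure_Un[symmetric] by (rule closure_mono) auto
  have "compact (?S f \<union> ?S h)" using assms by (auto simp: test_fun_def)
  hence "compact (?S (\<lambda>x. f x + h x))" using sub
    unfolding compact_eq_bounded_closed using bounded_subset by blast
  thus ?thesis using assms sub smooth_fun_add unfolding test_fun_def by blast
qed

lemma test_fun_smooth_bdd: assumes "test_fun \<Omega> f" shows "smooth_bdd f"
proof -
  have "bounded (closure {x. f x \<noteq> 0})" using assms by (auto simp: test_fun_def compact_imp_bounded)
  then obtain R where R: "\<forall>x\<in>closure {x. f x \<noteq> 0}. norm x \<le> R" unfolding bounded_iff by blast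
  have "f x = 0" if "norm x > R" for x
    using R that closure_subset[of "{x. f x \<noteq> 0}"] by (auto simp: subset_iff not_le[symmetric])
  thus ?thesis using assms unfolding smooth_bdd_def test_fun_def by blast
qed

section \<open>Modulars, their scaling, and Luxemburg norms\<close>

context growth
begin

lemma modular_L_add:
  assumes [measurable]: "f \<in> borel_measurable lebesgue" "h \<in> borel_measurable lebesgue" "\<Omega> \<in> sets borel"
  shows "modular_L G \<Omega> (\<lambda>x. f x + h x) \<le> ennreal (2^N) * (modular_L G \<Omega> f + modular_L G \<Omega> h)"
proof -
  have [measurable]: "\<Omega> \<in> sets lebesgue" using assms(3) by simp
  have "modular_L G \<Omega> (\<lambda>x. f x + h x) \<le> (\<integral>\<^sup>+x. ennreal (2^N) *
     (indicator \<Omega> x * ennreal (G \<bar>f x\<bar>) + indicator \<Omega> x * ennreal (G \<bar>h x\<bar>)) \<partial>lebesgue)"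
    unfolding modular_L_def
  proof (rule nn_integral_mono)
    fix x
    have "ennreal (G \<bar>f x + h x\<bar>) \<le> ennreal (2^N) * (ennreal (G \<bar>f x\<bar>) + ennreal (G \<bar>h x\<bar>))"
      using G_abs_add[of "f x" "h x"]
      by (simp add: ennreal_mult'[symmetric] ennreal_plus[symmetric] G_nonneg ennreal_leI del: ennreal_plus)
    thus "indicator \<Omega> x * ennreal (G \<bar>f x + h x\<bar>) \<le> ennreal (2^N) *
     (indicator \<Omega> x * ennreal (G \<bar>f x\<bar>) + indicator \<Omega> x * ennreal (G \<bar>h x\<bar>))"
      by (auto simp: indicator_def)
  qed
  also have "\<dots> = ennreal (2^N) * (modular_L G \<Omega> f + modular_L G \<Omega> h)"
    unfolding modular_L_def by (simp add: nn_integral_cmult nn_integral_add)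
  finally show ?thesis .
qed

lemma modular_W_add:
  fixes f h :: "'a::euclidean_space \<Rightarrow> real"
  assumes [measurable]: "f \<in> borel_measurable lebesgue" "h \<in> borel_measurable lebesgue" "\<Omega> \<in> sets borel" "\<Omega>' \<in> sets borel"
  shows "modular_W s G \<Omega> \<Omega>' (\<lambda>x. f x + h x) \<le> ennreal (2^N) * (modular_W s G \<Omega> \<Omega>' f + modular_W s G \<Omega> \<Omega>' h)"
proof -
  have [measurable]: "\<Omega> \<times> \<Omega>' \<in> sets (lebesgue \<Otimes>\<^sub>M lebesgue)" using assms(3,4) by (intro pair_measureI) auto
  let ?n = "\<lambda>z::'a\<times>'a. norm (fst z - snd z) ^ DIM('a)"
  have "modular_W s G \<Omega> \<Omega>' (\<lambda>x. f x + h x) \<le> (\<integral>\<^sup>+z. ennreal (2^N) *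
     (indicator (\<Omega> \<times> \<Omega>') z * ennreal (G \<bar>Ds s f (fst z) (snd z)\<bar> / ?n z)
      + indicator (\<Omega> \<times> \<Omega>') z * ennreal (G \<bar>Ds s h (fst z) (snd z)\<bar> / ?n z)) \<partial>(lebesgue \<Otimes>\<^sub>M lebesgue))"
    unfolding modular_W_def
  proof (rule nn_integral_mono)
    fix z :: "'a \<times> 'a"
    let ?a = "Ds s f (fst z) (snd z)" and ?b = "Ds s h (fst z) (snd z)"
    have eq: "Ds s (\<lambda>x. f x + h x) (fst z) (snd z) = ?a + ?b"
      by (simp add: Ds_def diff_divide_distrib add_divide_distrib)
    have "G \<bar>?a + ?b\<bar> / ?n z \<le> 2^N * (G \<bar>?a\<bar> + G \<bar>?b\<bar>) / ?n z"
      by (rule divide_right_mono[OF G_abs_add]) simp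
    also have "\<dots> = 2^N * (G \<bar>?a\<bar> / ?n z + G \<bar>?b\<bar> / ?n z)"
      by (simp only: add_divide_distrib[symmetric] times_divide_eq_right)
    finally have "ennreal (G \<bar>?a + ?b\<bar> / ?n z) \<le> ennreal (2^N) * (ennreal (G \<bar>?a\<bar> / ?n z) + ennreal (G \<bar>?b\<bar> / ?n z))"
      by (simp add: ennreal_mult'[symmetric] ennreal_plus[symmetric] G_nonneg ennreal_leI del: ennreal_plus)
    thus "indicator (\<Omega> \<times> \<Omega>') z * ennreal (G \<bar>Ds s (\<lambda>x. f x + h x) (fst z) (snd z)\<bar> / ?n z) \<le> ennreal (2^N) *
     (indicator (\<Omega> \<times> \<Omega>') z * ennreal (G \<bar>?a\<bar> / ?n z) + indicator (\<Omega> \<times> \<Omega>') z * ennreal (G \<bar>?b\<bar> / ?n z))"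
      unfolding eq by (auto simp: indicator_def)
  qed
  also have "\<dots> = ennreal (2^N) * (modular_W s G \<Omega> \<Omega>' f + modular_W s G \<Omega> \<Omega>' h)"
    unfolding modular_W_def by (simp add: nn_integral_cmult nn_integral_add)
  finally show ?thesis .
qed

lemma modular_L_uminus: "modular_L G \<Omega> (\<lambda>x. - f x) = modular_L G \<Omega> f"
  by (simp add: modular_L_def)

lemma modular_W_uminus: "modular_W s G \<Omega> \<Omega>' (\<lambda>x. - f x) = modular_W s G \<Omega> \<Omega>' f"
  by (simp add: modular_W_def Ds_def abs_minus_commute)

text \<open>Stated for an abstract scaling family M so that it serves the modular of values and the
  modular of difference quotients alike. The upper power bound turns a small modular into a small
  norm, the linear lower bound turns a small norm into a small modular.\<close>

lemma luxemburg_Inf: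
  fixes M :: "real \<Rightarrow> ennreal"
  assumes up: "\<And>c. 0 < c \<Longrightarrow> c \<le> 1 \<Longrightarrow> M c \<le> ennreal ((1/c)^N) * M 1"
    and lo: "\<And>c. 0 < c \<Longrightarrow> c \<le> 1 \<Longrightarrow> M 1 \<le> ennreal c * M c"
    and big: "\<And>c. 1 \<le> c \<Longrightarrow> M c \<le> ennreal (1/c) * M 1"
    and fin: "M 1 < \<infinity>"
  defines "L \<equiv> Inf {c. c > 0 \<and> M c \<le> 1}"
  shows "0 \<le> L"
    and "0 < e \<Longrightarrow> e \<le> 1 \<Longrightarrow> M 1 \<le> ennreal (e^N) \<Longrightarrow> L \<le> e"
    and "0 < e \<Longrightarrow> e \<le> 1 \<Longrightarrow> L < e \<Longrightarrow> M 1 \<le> ennreal e"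
proof -
  let ?S = "{c. c > 0 \<and> M c \<le> 1}"
  have bb: "bdd_below ?S" by (rule bdd_belowI[of _ 0]) auto
  obtain m where m: "M 1 = ennreal m" "0 \<le> m" using fin by (cases "M 1") auto
  \<comment> \<open>An explicit admissible scale: the infimum must be taken over a nonempty set for
    its bounds to be meaningful.\<close>
  have "M (max 1 m) \<le> ennreal (1 / max 1 m) * M 1" by (rule big) simp
  also have "\<dots> = ennreal (1 / max 1 m * m)" unfolding m(1) by (rule ennreal_mult[symmetric]) (use m in auto)
  also have "\<dots> \<le> 1" using m by (auto simp: max_def divide_le_eq_1)
  finally have ne: "max 1 m \<in> ?S" by auto
  show "0 \<le> L" unfolding L_def using ne by (intro cInf_greatest) auto
  show "L \<le> e" if e: "0 < e" "e \<le> 1" "M 1 \<le> ennreal (e^N)"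
  proof -
    have "M e \<le> ennreal ((1/e)^N) * M 1" by (rule up) (use e in auto)
    also have "\<dots> \<le> ennreal ((1/e)^N) * ennreal (e^N)" using e by (intro mult_left_mono) auto
    also have "\<dots> = 1" using e by (simp add: ennreal_mult'[symmetric] power_divide)
    finally show ?thesis unfolding L_def using e bb by (intro cInf_lower) auto
  qed
  show "M 1 \<le> ennreal e" if e: "0 < e" "e \<le> 1" "L < e"
  proof -
    obtain c where c: "0 < c" "M c \<le> 1" "c < e"
      using e(3) cInf_less_iff[OF _ bb, of e] ne unfolding L_def by auto
    have "M 1 \<le> ennreal c * M c" by (rule lo) (use c e in auto)
    also have "\<dots> \<le> ennreal c * 1" using c by (intro mult_left_mono) auto
    also have "\<dots> \<le> ennreal e" using c by (simp add: ennreal_leI)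
    finally show ?thesis .
  qed
qed

lemma G_div_bounds:
  assumes t: "0 \<le> t"
  shows "0 < c \<Longrightarrow> c \<le> 1 \<Longrightarrow> G (t / c) \<le> (1/c)^N * G t"
    and "0 < c \<Longrightarrow> c \<le> 1 \<Longrightarrow> G t \<le> c * G (t / c)"
    and "1 \<le> c \<Longrightarrow> G (t / c) \<le> (1/c) * G t"
proof -
  show "G (t / c) \<le> (1/c)^N * G t" if "0 < c" "c \<le> 1"
    using G_scale_upper[of "1/c" t] t that by simp
  show "G (t / c) \<le> (1/c) * G t" if "1 \<le> c"
  proof -
    have "G ((1/c) * t) \<le> (1/c) powr p * G t" using t that by (intro G_scale_small) auto
    also have "\<dots> \<le> (1/c) powr 1 * G t" using t that p_gt_1
      by (intro mult_right_mono powr_mono') (auto simp: G_nonneg)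
    finally show ?thesis using that by simp
  qed
  show "G t \<le> c * G (t / c)" if "0 < c" "c \<le> 1"
  proof -
    have "G (c * (t/c)) \<le> c powr p * G (t/c)" using t that by (intro G_scale_small) auto
    also have "\<dots> \<le> c powr 1 * G (t/c)" using t that p_gt_1
      by (intro mult_right_mono powr_mono') (auto simp: G_nonneg)
    finally show ?thesis using that by simp
  qed
qed

lemma modular_L_scaling:
  assumes [measurable]: "f \<in> borel_measurable lebesgue" "\<Omega> \<in> sets borel"
  defines "M \<equiv> \<lambda>c. modular_L G \<Omega> (\<lambda>x. f x / c)"
  shows "0 < c \<Longrightarrow> c \<le> 1 \<Longrightarrow> M c \<le> ennreal ((1/c)^N) * M 1"
    and "0 < c \<Longrightarrow> c \<le> 1 \<Longrightarrow> M 1 \<le> ennreal c * M c"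
    and "1 \<le> c \<Longrightarrow> M c \<le> ennreal (1/c) * M 1"
proof -
  have [measurable]: "\<Omega> \<in> sets lebesgue" using assms(2) by simp
  have key: "modular_L G \<Omega> (\<lambda>x. f x / c) \<le> ennreal K * modular_L G \<Omega> (\<lambda>x. f x / d)"
    if K: "0 \<le> K" "\<And>x. G (\<bar>f x / c\<bar>) \<le> K * G \<bar>f x / d\<bar>" for c d K
    unfolding modular_L_def
    by (subst nn_integral_cmult[symmetric], measurable, rule nn_integral_mono)
       (use K in \<open>auto simp: indicator_def ennreal_mult'[symmetric] G_nonneg intro!: ennreal_leI\<close>)
  show "M c \<le> ennreal ((1/c)^N) * M 1" if "0 < c" "c \<le> 1"
    unfolding M_def by (rule key) (use that G_div_bounds(1)[of "\<bar>f _\<bar>" c] in auto)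
  show "M 1 \<le> ennreal c * M c" if "0 < c" "c \<le> 1"
    unfolding M_def by (rule key) (use that G_div_bounds(2)[of "\<bar>f _\<bar>" c] in auto)
  show "M c \<le> ennreal (1/c) * M 1" if "1 \<le> c"
    unfolding M_def by (rule key) (use that G_div_bounds(3)[of "\<bar>f _\<bar>" c] in auto)
qed

lemma modular_W_scaling:
  fixes f :: "'a::euclidean_space \<Rightarrow> real" and s :: real
  assumes [measurable]: "f \<in> borel_measurable lebesgue" "\<Omega> \<in> sets borel" "\<Omega>' \<in> sets borel"
  defines "M \<equiv> \<lambda>c. modular_W s G \<Omega> \<Omega>' (\<lambda>x. f x / c)"
  shows "0 < c \<Longrightarrow> c \<le> 1 \<Longrightarrow> M c \<le> ennreal ((1/c)^N) * M 1"
    and "0 < c \<Longrightarrow> c \<le> 1 \<Longrightarrow> M 1 \<le> ennreal c * M c"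
    and "1 \<le> c \<Longrightarrow> M c \<le> ennreal (1/c) * M 1"
proof -
  have [measurable]: "\<Omega> \<times> \<Omega>' \<in> sets (lebesgue \<Otimes>\<^sub>M lebesgue)" using assms(2,3) by (intro pair_measureI) auto
  have D: "\<bar>Ds s (\<lambda>x. f x / c) x y\<bar> = \<bar>Ds s f x y\<bar> / c" if "0 < c" for c :: real and x y
    using that by (simp add: Ds_def diff_divide_distrib[symmetric] abs_divide)
  have key: "modular_W s G \<Omega> \<Omega>' (\<lambda>x. f x / c) \<le> ennreal K * modular_W s G \<Omega> \<Omega>' (\<lambda>x. f x / d)"
    if K: "0 \<le> K" "0 < c" "0 < d" "\<And>t. 0 \<le> t \<Longrightarrow> G (t / c) \<le> K * G (t / d)" for c d K
  proof -
    have [measurable]: "(\<lambda>x. f x / d) \<in> borel_measurable lebesgue" by measurable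
    have "G (\<bar>Ds s f x y\<bar> / c) / norm (x - y) ^ DIM('a) \<le> K * (G (\<bar>Ds s f x y\<bar> / d) / norm (x - y) ^ DIM('a))" for x y
      using divide_right_mono[OF K(4)[of "\<bar>Ds s f x y\<bar>"], of "norm (x - y) ^ DIM('a)"] by simp
    thus ?thesis
      unfolding modular_W_def
      by (subst nn_integral_cmult[symmetric], measurable, intro nn_integral_mono)
         (use K in \<open>auto simp: D indicator_def ennreal_mult'[symmetric] intro!: ennreal_leI\<close>)
  qed
  show "M c \<le> ennreal ((1/c)^N) * M 1" if "0 < c" "c \<le> 1"
    unfolding M_def by (rule key) (use that G_div_bounds(1)[of _ c] in auto)
  show "M 1 \<le> ennreal c * M c" if "0 < c" "c \<le> 1"
    unfolding M_def by (rule key) (use that G_div_bounds(2)[of _ c] in auto)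
  show "M c \<le> ennreal (1/c) * M 1" if "1 \<le> c"
    unfolding M_def by (rule key) (use that G_div_bounds(3)[of _ c] in auto)
qed

text \<open>Zero boundary values are defined by norm convergence, whereas every approximation
  estimate here is for modulars. The power bounds on \<open>G\<close> make the two convergences
  agree.\<close>

lemma norm_W_tendsto_0_iff:
  fixes f :: "nat \<Rightarrow> 'a::euclidean_space \<Rightarrow> real"
  assumes f: "\<And>k. in_W s G \<Omega> \<Omega>' (f k)" and \<Omega>: "\<Omega> \<in> sets borel" "\<Omega>' \<in> sets borel"
  shows "(\<lambda>k. norm_W s G \<Omega> \<Omega>' (f k)) \<longlonglongrightarrow> 0 \<longleftrightarrow>
     (\<lambda>k. modular_L G \<Omega> (f k)) \<longlonglongrightarrow> 0 \<and> (\<lambda>k. modular_W s G \<Omega> \<Omega>' (f k)) \<longlonglongrightarrow> 0"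
proof -
  have m: "f k \<in> borel_measurable lebesgue" for k using f by (simp add: in_W_def)
  have fin: "modular_L G \<Omega> (\<lambda>x. f k x / 1) < \<infinity>" "modular_W s G \<Omega> \<Omega>' (\<lambda>x. f k x / 1) < \<infinity>" for k
    using f[of k] by (auto simp: in_W_def)
  have L: "0 \<le> lux_L G \<Omega> (f k)"
    "0 < e \<Longrightarrow> e \<le> 1 \<Longrightarrow> modular_L G \<Omega> (f k) \<le> ennreal (e^N) \<Longrightarrow> lux_L G \<Omega> (f k) \<le> e"
    "0 < e \<Longrightarrow> e \<le> 1 \<Longrightarrow> lux_L G \<Omega> (f k) < e \<Longrightarrow> modular_L G \<Omega> (f k) \<le> ennreal e" for k e
    using luxemburg_Inf(1)[OF modular_L_scaling[OF m[of k] \<Omega>(1)] fin(1)[of k], folded lux_L_def]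
      luxemburg_Inf(2,3)[OF modular_L_scaling[OF m[of k] \<Omega>(1)] fin(1)[of k], of e, folded lux_L_def] by simp_all
  have W: "0 \<le> lux_W s G \<Omega> \<Omega>' (f k)"
    "0 < e \<Longrightarrow> e \<le> 1 \<Longrightarrow> modular_W s G \<Omega> \<Omega>' (f k) \<le> ennreal (e^N) \<Longrightarrow> lux_W s G \<Omega> \<Omega>' (f k) \<le> e"
    "0 < e \<Longrightarrow> e \<le> 1 \<Longrightarrow> lux_W s G \<Omega> \<Omega>' (f k) < e \<Longrightarrow> modular_W s G \<Omega> \<Omega>' (f k) \<le> ennreal e" for k e
    using luxemburg_Inf(1)[OF modular_W_scaling[OF m[of k] \<Omega>] fin(2)[of k], folded lux_W_def]
      luxemburg_Inf(2,3)[OF modular_W_scaling[OF m[of k] \<Omega>] fin(2)[of k], of e, folded lux_W_def] by simp_all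
  show ?thesis
  proof safe
    assume a: "(\<lambda>k. norm_W s G \<Omega> \<Omega>' (f k)) \<longlonglongrightarrow> 0"
    have ev: "\<forall>\<^sub>F k in sequentially. modular_L G \<Omega> (f k) \<le> ennreal e \<and> modular_W s G \<Omega> \<Omega>' (f k) \<le> ennreal e"
      if e: "0 < e" for e
    proof -
      have "\<forall>\<^sub>F k in sequentially. norm_W s G \<Omega> \<Omega>' (f k) < min 1 e"
        using a e by (intro order_tendstoD(2)) auto
      thus ?thesis
      proof eventually_elim
        case (elim k)
        have "modular_L G \<Omega> (f k) \<le> ennreal (min 1 e)"
          using elim e L(1)[of k] W(1)[of k] by (intro L(3)) (auto simp: norm_W_def)
        moreover have "modular_W s G \<Omega> \<Omega>' (f k) \<le> ennreal (min 1 e)"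
          using elim e L(1)[of k] W(1)[of k] by (intro W(3)) (auto simp: norm_W_def)
        moreover have "ennreal (min 1 e) \<le> ennreal e" by (intro ennreal_leI) simp
        ultimately show ?case by (blast intro: order_trans)
      qed
    qed
    show "(\<lambda>k. modular_L G \<Omega> (f k)) \<longlonglongrightarrow> 0"
      by (rule ennreal_tendsto_0I, drule ev, erule eventually_mono) simp
    show "(\<lambda>k. modular_W s G \<Omega> \<Omega>' (f k)) \<longlonglongrightarrow> 0"
      by (rule ennreal_tendsto_0I, drule ev, erule eventually_mono) simp
  next
    assume a: "(\<lambda>k. modular_L G \<Omega> (f k)) \<longlonglongrightarrow> 0" "(\<lambda>k. modular_W s G \<Omega> \<Omega>' (f k)) \<longlonglongrightarrow> 0"
    have "\<forall>\<^sub>F k in sequentially. norm_W s G \<Omega> \<Omega>' (f k) < e" if e: "0 < e" for e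
    proof -
      define d where "d = min 1 (e/4)"
      have d: "0 < d" "d \<le> 1" "d \<le> e/4" using e by (auto simp: d_def)
      have "\<forall>\<^sub>F k in sequentially. modular_L G \<Omega> (f k) \<le> ennreal (d^N)" using d a(1) by (intro ennreal_tendsto_0D) auto
      moreover have "\<forall>\<^sub>F k in sequentially. modular_W s G \<Omega> \<Omega>' (f k) \<le> ennreal (d^N)" using d a(2) by (intro ennreal_tendsto_0D) auto
      ultimately show ?thesis
      proof eventually_elim
        case (elim k)
        have "lux_L G \<Omega> (f k) \<le> d" using elim d by (intro L(2)) auto
        moreover have "lux_W s G \<Omega> \<Omega>' (f k) \<le> d" using elim d by (intro W(2)) auto
        ultimately show ?case using d e by (simp add: norm_W_def)
      qed
    qed
    moreover have "0 \<le> norm_W s G \<Omega> \<Omega>' (f k)" for k using L(1) W(1) by (simp add: norm_W_def)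
    ultimately have "\<forall>\<^sub>F k in sequentially. dist (norm_W s G \<Omega> \<Omega>' (f k)) 0 < e" if "0 < e" for e
      using that by (simp add: dist_real_def)
    thus "(\<lambda>k. norm_W s G \<Omega> \<Omega>' (f k)) \<longlonglongrightarrow> 0" by (rule tendstoI)
  qed
qed

end

declare id_measurable_lebesgue [measurable del] fst_measurable_lebesgue [measurable del]
  snd_measurable_lebesgue [measurable del] Ds_measurable_lebesgue [measurable del]

section \<open>Admissible perturbations\<close>

text \<open>Up to a factor, \<open>near_far s h\<close> bounds the difference quotient of order \<open>s\<close>, at distance \<open>h\<close>, of a bounded Lipschitz function.\<close>

definition near_far :: "real \<Rightarrow> 'a::euclidean_space \<Rightarrow> real" where
  "near_far s h = (if norm h < 1 then norm h powr (1 - s) else norm h powr (- s))"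

lemma near_far_bounds:
  assumes "0 < s" "s < 1" shows "0 \<le> near_far s h" "near_far s h \<le> 1"
proof -
  show "0 \<le> near_far s h" by (simp add: near_far_def)
  show "near_far s h \<le> 1"
  proof (cases "norm h < 1")
    case True
    have "norm h powr (1-s) \<le> 1 powr (1-s)" using True assms by (intro powr_mono2) auto
    thus ?thesis using True by (simp add: near_far_def)
  next
    case False
    have "norm h powr (-s) \<le> 1 powr (-s)" using False assms by (intro powr_mono2') auto
    thus ?thesis using False by (simp add: near_far_def)
  qed
qed

lemma near_far_measurable [measurable]: "near_far s \<in> borel_measurable borel"
  unfolding near_far_def by measurable

text \<open>After division by |h|^n the exponents are (1-s) p - n near the origin and -s p - n far
  away, each integrable in its own region; this uses 0 < s < 1 on both sides.\<close>

lemma near_far_integral: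
  assumes s: "0 < s" "s < 1" and p: "0 < p"
  shows "(\<integral>\<^sup>+h. ennreal (near_far s h powr p / norm h ^ DIM('a)) \<partial>(lborel :: 'a::euclidean_space measure)) < \<infinity>"
proof -
  let ?n = "DIM('a)"
  let ?A = "\<lambda>h::'a. indicator (ball 0 1) h * ennreal (norm h powr ((1-s)*p - real ?n))"
  let ?B = "\<lambda>h::'a. indicator (- ball 0 1) h * ennreal (norm h powr (- (s*p) - real ?n))"
  have [measurable]: "ball (0::'a) 1 \<in> sets borel" by simp
  have "(\<integral>\<^sup>+h. ennreal (near_far s h powr p / norm h ^ ?n) \<partial>(lborel :: 'a measure)) \<le> (\<integral>\<^sup>+h. ?A h + ?B h \<partial>lborel)"
  proof (rule nn_integral_mono)
    fix h :: 'a
    show "ennreal (near_far s h powr p / norm h ^ ?n) \<le> ?A h + ?B h"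
    proof (cases "h = 0")
      case False
      hence "norm h ^ ?n = norm h powr real ?n" by (simp add: powr_realpow)
      thus ?thesis using False
        by (cases "norm h < 1")
           (auto simp: near_far_def powr_powr powr_diff[of _ "(1-s)*p"] powr_diff[of _ "- (s*p)"] indicator_def)
    qed (simp add: near_far_def)
  qed
  also have "\<dots> = (\<integral>\<^sup>+h. ?A h \<partial>lborel) + (\<integral>\<^sup>+h. ?B h \<partial>lborel)"
    by (rule nn_integral_add) measurable
  also have "\<dots> < \<infinity>"
    using nn_integral_ball_radial[of "(1-s)*p" 1, where 'a = 'a] nn_integral_exterior_radial[of "s*p" 1, where 'a = 'a] s p
    by (auto intro: le_less_trans)
  finally show ?thesis .
qed

section \<open>Cutting off functions of finite modular\<close>

context growth
begin

text \<open>Discrete product rule: the difference quotient of the product splits into a(x) times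
  that of \<zeta>, controlled by \<open>near_far\<close> with a finite total integral, and
  \<zeta>(y) times that of a, which lives on y in K. Thus finiteness of the modular on a product of
  domains becomes finiteness on the whole space.\<close>

lemma MW_cutoff:
  fixes a \<zeta> :: "'a::euclidean_space \<Rightarrow> real"
  assumes s: "0 < s" "s < 1"
    and [measurable]: "a \<in> borel_measurable borel" "\<zeta> \<in> borel_measurable borel"
      "\<Omega> \<in> sets borel" "\<Omega>' \<in> sets borel" "K \<in> sets borel"
    and sub: "K \<subseteq> \<Omega>" "\<Omega> \<subseteq> \<Omega>'"
    and \<zeta>0: "\<And>x. x \<notin> K \<Longrightarrow> \<zeta> x = 0" and \<zeta>B: "\<And>x. \<bar>\<zeta> x\<bar> \<le> B" and \<zeta>L: "\<And>x y. \<bar>\<zeta> x - \<zeta> y\<bar> \<le> L * norm (x - y)"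
    and finA: "(\<integral>\<^sup>+x. indicator \<Omega> x * ennreal (G \<bar>a x\<bar>) \<partial>lborel) < \<infinity>"
    and finD: "(\<integral>\<^sup>+x. \<integral>\<^sup>+y. indicator \<Omega> x * indicator \<Omega>' y * ennreal (G \<bar>Ds s a x y\<bar> / norm (x - y) ^ DIM('a)) \<partial>lborel \<partial>lborel) < \<infinity>"
  shows "MW s G (\<lambda>x. \<zeta> x * a x) < \<infinity>" and "(\<integral>\<^sup>+x. ennreal (G \<bar>\<zeta> x * a x\<bar>) \<partial>lborel) < \<infinity>"
proof -
  \<comment> \<open>One constant covering the Lipschitz bound at short range and twice the sup bound
    at long range; it is at least 1 so that \<open>G_scale_upper\<close> applies.\<close>
  define Q where "Q = max 1 (max L (2 * B))"
  have Q: "1 \<le> Q" "L \<le> Q" "2 * B \<le> Q" by (auto simp: Q_def)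
  have B: "B \<le> Q" "0 \<le> B" using \<zeta>B[of undefined] Q by auto
  define F where "F x y = ennreal (G \<bar>Ds s (\<lambda>x. \<zeta> x * a x) x y\<bar> / norm (x - y) ^ DIM('a))" for x y
  define M where "M h = ennreal (near_far s h powr p / norm h ^ DIM('a))" for h :: 'a
  define H where "H x y = ennreal (G \<bar>Ds s a x y\<bar> / norm (x - y) ^ DIM('a))" for x y
  define C where "C = 2^N * Q^N"
  have C: "0 \<le> C" using Q by (simp add: C_def)
  have [measurable]: "(\<lambda>(x,y). F x y) \<in> borel_measurable (borel \<Otimes>\<^sub>M borel)" "(\<lambda>(x,y). H x y) \<in> borel_measurable (borel \<Otimes>\<^sub>M borel)"
    "M \<in> borel_measurable borel"
    unfolding F_def H_def M_def Ds_def by measurable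
  have pw: "F x y \<le> ennreal C * (ennreal (G \<bar>a x\<bar>) * M (x - y)) + ennreal C * (indicator \<Omega>' y * H x y)" for x y
  proof (cases "x = y")
    case False
    define d where "d = norm (x - y) powr s"
    have d: "0 < d" using False by (simp add: d_def)
    have nf: "\<bar>\<zeta> x - \<zeta> y\<bar> / d \<le> Q * near_far s (x - y)"
    proof (cases "norm (x - y) < 1")
      case True
      have "\<bar>\<zeta> x - \<zeta> y\<bar> / d \<le> L * norm (x - y) / d" using d by (intro divide_right_mono \<zeta>L) auto
      also have "\<dots> = L * norm (x - y) powr (1 - s)" using False by (simp add: d_def powr_diff)
      also have "\<dots> \<le> Q * norm (x - y) powr (1 - s)" using Q by (intro mult_right_mono) auto
      finally show ?thesis using True by (simp add: near_far_def)
    next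
      case far: False
      have "\<bar>\<zeta> x - \<zeta> y\<bar> / d \<le> 2 * B / d" using d \<zeta>B[of x] \<zeta>B[of y] by (intro divide_right_mono) auto
      also have "\<dots> = 2 * B * norm (x - y) powr (- s)" by (simp add: d_def powr_minus divide_inverse)
      also have "\<dots> \<le> Q * norm (x - y) powr (- s)" using Q by (intro mult_right_mono) auto
      finally show ?thesis using far by (simp add: near_far_def)
    qed
    let ?A = "(\<zeta> x - \<zeta> y) * a x / d" and ?B = "\<zeta> y * Ds s a x y"
    have eq: "Ds s (\<lambda>x. \<zeta> x * a x) x y = ?A + ?B"
      unfolding Ds_def d_def[symmetric] using d by (simp add: field_simps)
    have "G \<bar>?A\<bar> \<le> G (near_far s (x - y) * (Q * \<bar>a x\<bar>))"
    proof (rule G_mono)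
      have "\<bar>?A\<bar> = \<bar>\<zeta> x - \<zeta> y\<bar> / d * \<bar>a x\<bar>" using d by (simp add: abs_mult)
      also have "\<dots> \<le> Q * near_far s (x - y) * \<bar>a x\<bar>" by (intro mult_right_mono nf) auto
      finally show "\<bar>?A\<bar> \<le> near_far s (x - y) * (Q * \<bar>a x\<bar>)" by (simp add: mult_ac)
    qed simp
    also have "\<dots> \<le> near_far s (x - y) powr p * G (Q * \<bar>a x\<bar>)"
      using near_far_bounds[OF s] Q by (intro G_scale_small) auto
    also have "\<dots> \<le> near_far s (x - y) powr p * (Q^N * G \<bar>a x\<bar>)"
      using Q by (intro mult_left_mono G_scale_upper) auto
    finally have A: "G \<bar>?A\<bar> \<le> Q^N * (G \<bar>a x\<bar> * near_far s (x - y) powr p)" by (simp add: mult_ac)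
    have Bb: "G \<bar>?B\<bar> \<le> Q^N * (indicator \<Omega>' y * G \<bar>Ds s a x y\<bar>)"
    proof (cases "y \<in> \<Omega>'")
      case True
      have "\<bar>\<zeta> y\<bar> \<le> Q" using \<zeta>B[of y] B by simp
      hence "G \<bar>?B\<bar> \<le> G (Q * \<bar>Ds s a x y\<bar>)" by (intro G_mono) (auto simp: abs_mult intro: mult_right_mono)
      also have "\<dots> \<le> Q^N * G \<bar>Ds s a x y\<bar>" using Q by (intro G_scale_upper) auto
      finally show ?thesis using True by simp
    next
      case False
      hence "\<zeta> y = 0" using \<zeta>0 sub by blast
      thus ?thesis using False by simp
    qed
    have "G \<bar>?A + ?B\<bar> \<le> 2^N * (G \<bar>?A\<bar> + G \<bar>?B\<bar>)" by (rule G_abs_add)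
    also have "\<dots> \<le> 2^N * (Q^N * (G \<bar>a x\<bar> * near_far s (x - y) powr p) + Q^N * (indicator \<Omega>' y * G \<bar>Ds s a x y\<bar>))"
      by (intro mult_left_mono add_mono A Bb) auto
    also have "\<dots> = C * (G \<bar>a x\<bar> * near_far s (x - y) powr p) + C * (indicator \<Omega>' y * G \<bar>Ds s a x y\<bar>)"
      by (simp add: C_def algebra_simps)
    finally have "G \<bar>?A + ?B\<bar> / norm (x - y) ^ DIM('a) \<le>
      C * (G \<bar>a x\<bar> * (near_far s (x - y) powr p / norm (x - y) ^ DIM('a)))
      + C * (indicator \<Omega>' y * (G \<bar>Ds s a x y\<bar> / norm (x - y) ^ DIM('a)))"
      using divide_right_mono[of _ _ "norm (x - y) ^ DIM('a)"] by (fastforce simp: add_divide_distrib)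
    hence "F x y \<le> ennreal (C * (G \<bar>a x\<bar> * (near_far s (x - y) powr p / norm (x - y) ^ DIM('a)))
      + C * (indicator \<Omega>' y * (G \<bar>Ds s a x y\<bar> / norm (x - y) ^ DIM('a))))"
      unfolding F_def eq by (rule ennreal_leI)
    also have "\<dots> = ennreal C * (ennreal (G \<bar>a x\<bar>) * M (x - y)) + ennreal C * (indicator \<Omega>' y * H x y)"
      using C by (subst ennreal_plus) (auto simp: M_def H_def ennreal_mult G_nonneg indicator_def simp del: times_divide_eq_right)
    finally show ?thesis .
  qed (simp add: F_def Ds_def)
  have sym: "F x y = F y x" for x y
    by (simp add: F_def Ds_def norm_minus_commute abs_divide abs_minus_commute)
  have [measurable]: "(\<lambda>(x,y). indicator K x * F x y) \<in> borel_measurable (borel \<Otimes>\<^sub>M borel)" by measurable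
  \<comment> \<open>The integrand vanishes unless one of the points lies in K, and it is symmetric.
    Hence the case x in K is enough, and there a(x) is controlled.\<close>
  define J where "J = (\<integral>\<^sup>+x. \<integral>\<^sup>+y. indicator K x * F x y \<partial>lborel \<partial>lborel)"
  have "MW s G (\<lambda>x. \<zeta> x * a x) \<le> (\<integral>\<^sup>+x. \<integral>\<^sup>+y. indicator K x * F x y + indicator K y * F x y \<partial>lborel \<partial>lborel)"
    unfolding MW_def F_def[symmetric]
  proof (intro nn_integral_mono)
    fix x y
    show "F x y \<le> indicator K x * F x y + indicator K y * F x y"
    proof (cases "x \<in> K \<or> y \<in> K")
      case False
      thus ?thesis using \<zeta>0 by (simp add: F_def Ds_def)
    qed (auto simp: indicator_def)
  qed
  also have "\<dots> = J + (\<integral>\<^sup>+x. \<integral>\<^sup>+y. indicator K y * F x y \<partial>lborel \<partial>lborel)"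
    unfolding J_def by (subst nn_integral_add[symmetric], measurable) (intro nn_integral_cong nn_integral_add, measurable)
  also have "(\<integral>\<^sup>+x. \<integral>\<^sup>+y. indicator K y * F x y \<partial>lborel \<partial>lborel) = (\<integral>\<^sup>+y. \<integral>\<^sup>+x. indicator K y * F x y \<partial>lborel \<partial>lborel)"
    by (rule lborel_pair.Fubini') measurable
  also have "\<dots> = J" unfolding J_def by (subst sym) simp
  finally have MWJ: "MW s G (\<lambda>x. \<zeta> x * a x) \<le> J + J" .
  have "J \<le> (\<integral>\<^sup>+x. \<integral>\<^sup>+y. ennreal C * (indicator \<Omega> x * ennreal (G \<bar>a x\<bar>) * M (x - y)) +
      ennreal C * (indicator \<Omega> x * indicator \<Omega>' y * H x y) \<partial>lborel \<partial>lborel)"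
    unfolding J_def
  proof (intro nn_integral_mono)
    fix x y
    show "indicator K x * F x y \<le> ennreal C * (indicator \<Omega> x * ennreal (G \<bar>a x\<bar>) * M (x - y)) +
      ennreal C * (indicator \<Omega> x * indicator \<Omega>' y * H x y)"
      using pw[of x y] sub by (cases "x \<in> K") auto
  qed
  also have "\<dots> = (\<integral>\<^sup>+x. \<integral>\<^sup>+y. ennreal C * (indicator \<Omega> x * ennreal (G \<bar>a x\<bar>) * M (x - y)) \<partial>lborel \<partial>lborel) +
      (\<integral>\<^sup>+x. \<integral>\<^sup>+y. ennreal C * (indicator \<Omega> x * indicator \<Omega>' y * H x y) \<partial>lborel \<partial>lborel)"
    by (subst nn_integral_add[symmetric], measurable) (intro nn_integral_cong nn_integral_add, measurable)
  also have "(\<integral>\<^sup>+x. \<integral>\<^sup>+y. ennreal C * (indicator \<Omega> x * indicator \<Omega>' y * H x y) \<partial>lborel \<partial>lborel)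
     = ennreal C * (\<integral>\<^sup>+x. \<integral>\<^sup>+y. indicator \<Omega> x * indicator \<Omega>' y * H x y \<partial>lborel \<partial>lborel)"
    by (subst nn_integral_cmult[symmetric], measurable) (intro nn_integral_cong nn_integral_cmult, measurable)
  also have "(\<integral>\<^sup>+x. \<integral>\<^sup>+y. ennreal C * (indicator \<Omega> x * ennreal (G \<bar>a x\<bar>) * M (x - y)) \<partial>lborel \<partial>lborel)
     = (\<integral>\<^sup>+x. ennreal C * (indicator \<Omega> x * ennreal (G \<bar>a x\<bar>) * (\<integral>\<^sup>+h. M h \<partial>lborel)) \<partial>lborel)"
  proof (rule nn_integral_cong)
    fix x
    have "(\<integral>\<^sup>+y. M (x - y) \<partial>lborel) = (\<integral>\<^sup>+h. M h \<partial>(distr lborel borel (\<lambda>y. x - y)))"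
      by (rule nn_integral_distr[symmetric]) measurable
    hence "(\<integral>\<^sup>+y. M (x - y) \<partial>lborel) = (\<integral>\<^sup>+h. M h \<partial>lborel)" by (simp only: distr_lborel_reflect)
    thus "(\<integral>\<^sup>+y. ennreal C * (indicator \<Omega> x * ennreal (G \<bar>a x\<bar>) * M (x - y)) \<partial>lborel)
      = ennreal C * (indicator \<Omega> x * ennreal (G \<bar>a x\<bar>) * (\<integral>\<^sup>+h. M h \<partial>lborel))"
      by (simp add: nn_integral_cmult)
  qed
  also have "\<dots> = ennreal C * ((\<integral>\<^sup>+x. indicator \<Omega> x * ennreal (G \<bar>a x\<bar>) \<partial>lborel) * (\<integral>\<^sup>+h. M h \<partial>lborel))"
    by (simp add: nn_integral_cmult nn_integral_multc)
  finally have "J \<le> ennreal C * ((\<integral>\<^sup>+x. indicator \<Omega> x * ennreal (G \<bar>a x\<bar>) \<partial>lborel) * (\<integral>\<^sup>+h. M h \<partial>lborel)) +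
     ennreal C * (\<integral>\<^sup>+x. \<integral>\<^sup>+y. indicator \<Omega> x * indicator \<Omega>' y * H x y \<partial>lborel \<partial>lborel)" .
  moreover have "(\<integral>\<^sup>+h. M h \<partial>lborel) < \<infinity>" unfolding M_def using near_far_integral[OF s, where 'a = 'a] p_gt_1 by simp
  ultimately have "J < \<infinity>" using finA finD unfolding H_def by (auto simp: ennreal_mult_less_top intro: le_less_trans)
  thus "MW s G (\<lambda>x. \<zeta> x * a x) < \<infinity>" using MWJ by (auto intro: le_less_trans)
  have "(\<integral>\<^sup>+x. ennreal (G \<bar>\<zeta> x * a x\<bar>) \<partial>lborel) \<le> (\<integral>\<^sup>+x. ennreal (Q^N) * (indicator \<Omega> x * ennreal (G \<bar>a x\<bar>)) \<partial>lborel)"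
  proof (rule nn_integral_mono)
    fix x
    show "ennreal (G \<bar>\<zeta> x * a x\<bar>) \<le> ennreal (Q^N) * (indicator \<Omega> x * ennreal (G \<bar>a x\<bar>))"
    proof (cases "x \<in> K")
      case True
      have "\<bar>\<zeta> x\<bar> \<le> Q" using \<zeta>B[of x] B by simp
      hence "G \<bar>\<zeta> x * a x\<bar> \<le> G (Q * \<bar>a x\<bar>)" by (intro G_mono) (auto simp: abs_mult intro: mult_right_mono)
      also have "\<dots> \<le> Q^N * G \<bar>a x\<bar>" using Q by (intro G_scale_upper) auto
      finally show ?thesis using True sub Q by (auto simp: ennreal_mult'[symmetric] intro!: ennreal_leI)
    qed (simp add: \<zeta>0)
  qed
  also have "\<dots> = ennreal (Q^N) * (\<integral>\<^sup>+x. indicator \<Omega> x * ennreal (G \<bar>a x\<bar>) \<partial>lborel)"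
    by (rule nn_integral_cmult) measurable
  also have "\<dots> < \<infinity>" using finA by (simp add: ennreal_mult_less_top)
  finally show "(\<integral>\<^sup>+x. ennreal (G \<bar>\<zeta> x * a x\<bar>) \<partial>lborel) < \<infinity>" .
qed

lemma modular_le_total:
  fixes w :: "'a::euclidean_space \<Rightarrow> real"
  assumes [measurable]: "w \<in> borel_measurable borel" "\<Omega> \<in> sets borel" "\<Omega>' \<in> sets borel"
  shows "modular_L G \<Omega> w \<le> (\<integral>\<^sup>+x. ennreal (G \<bar>w x\<bar>) \<partial>lborel)" "modular_W s G \<Omega> \<Omega>' w \<le> MW s G w"
proof -
  show "modular_L G \<Omega> w \<le> (\<integral>\<^sup>+x. ennreal (G \<bar>w x\<bar>) \<partial>lborel)"
    unfolding modular_L_def nn_integral_completion by (rule nn_integral_mono) (auto simp: indicator_def)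
  have "modular_W s G \<Omega> \<Omega>' w = (\<integral>\<^sup>+x. \<integral>\<^sup>+y. indicator \<Omega> x * indicator \<Omega>' y *
     ennreal (G \<bar>Ds s w x y\<bar> / norm (x - y) ^ DIM('a)) \<partial>lborel \<partial>lborel)"
    by (rule modular_W_borel) (unfold Ds_def, measurable)
  also have "\<dots> \<le> MW s G w"
    unfolding MW_def by (intro nn_integral_mono) (auto simp: indicator_def)
  finally show "modular_W s G \<Omega> \<Omega>' w \<le> MW s G w" .
qed

lemma total_imp_in_W:
  fixes w :: "'a::euclidean_space \<Rightarrow> real"
  assumes "w \<in> borel_measurable borel" "\<Omega> \<in> sets borel" "\<Omega>' \<in> sets borel"
    "(\<integral>\<^sup>+x. ennreal (G \<bar>w x\<bar>) \<partial>lborel) < \<infinity>" "MW s G w < \<infinity>"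
  shows "in_W s G \<Omega> \<Omega>' w"
  unfolding in_W_def using measurable_lebesgueI[OF assms(1)] modular_le_total[OF assms(1-3)] assms(4,5)
  by (auto intro: le_less_trans)

lemma test_fun_total:
  fixes \<phi> :: "'a::euclidean_space \<Rightarrow> real"
  assumes s: "0 < s" "s < 1" and \<phi>: "test_fun \<Omega> \<phi>" and \<Omega>: "open \<Omega>" "bounded \<Omega>"
  shows "\<phi> \<in> borel_measurable borel" "(\<integral>\<^sup>+x. ennreal (G \<bar>\<phi> x\<bar>) \<partial>lborel) < \<infinity>" "MW s G \<phi> < \<infinity>"
proof -
  have sb: "smooth_bdd \<phi>" using \<phi> by (rule test_fun_smooth_bdd)
  show m[measurable]: "\<phi> \<in> borel_measurable borel" using sb by (rule smooth_bdd_measurable)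
  obtain B where B: "\<And>x. \<bar>\<phi> x\<bar> \<le> B" using smooth_bdd_bounded[OF sb] by blast
  obtain L where L: "\<And>x y. \<bar>\<phi> x - \<phi> y\<bar> \<le> L * norm (x - y)" using smooth_bdd_lipschitz[OF sb] by blast
  let ?K = "closure {x. \<phi> x \<noteq> 0}"
  have K: "?K \<subseteq> \<Omega>" using \<phi> by (simp add: test_fun_def)
  have z: "\<phi> x = 0" if "x \<notin> ?K" for x using that closure_subset[of "{x. \<phi> x \<noteq> 0}"] by blast
  \<comment> \<open>A test function plays the role of the cutoff itself; the function it multiplies
    is the constant 1, whose difference quotients vanish.\<close>
  have fin: "(\<integral>\<^sup>+x. indicator \<Omega> x * ennreal (G \<bar>1\<bar>) \<partial>(lborel :: 'a measure)) < \<infinity>"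
    using \<Omega> by (simp add: emeasure_bounded_finite[unfolded infinity_ennreal_def])
  note C = MW_cutoff[OF s _ m _ _ _ K subset_refl z B L fin]
  show "(\<integral>\<^sup>+x. ennreal (G \<bar>\<phi> x\<bar>) \<partial>lborel) < \<infinity>" using C(2) \<Omega> by (simp add: Ds_def)
  show "MW s G \<phi> < \<infinity>" using C(1) \<Omega> by (simp add: Ds_def)
qed

lemma in_W_add:
  assumes "in_W s G \<Omega> \<Omega>' f" "in_W s G \<Omega> \<Omega>' h" and [measurable]: "\<Omega> \<in> sets borel" "\<Omega>' \<in> sets borel"
  shows "in_W s G \<Omega> \<Omega>' (\<lambda>x. f x + h x)"
proof -
  have m: "f \<in> borel_measurable lebesgue" "h \<in> borel_measurable lebesgue" using assms by (auto simp: in_W_def)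
  have "modular_L G \<Omega> (\<lambda>x. f x + h x) < \<infinity>"
    using modular_L_add[OF m assms(3)] assms(1,2) unfolding in_W_def
    by (auto intro!: le_less_trans[OF modular_L_add[OF m assms(3)]] simp: ennreal_mult_less_top)
  moreover have "modular_W s G \<Omega> \<Omega>' (\<lambda>x. f x + h x) < \<infinity>"
    using assms(1,2) unfolding in_W_def
    by (auto intro!: le_less_trans[OF modular_W_add[OF m assms(3,4)]] simp: ennreal_mult_less_top)
  ultimately show ?thesis unfolding in_W_def using m by simp
qed

lemma in_W_uminus: "in_W s G \<Omega> \<Omega>' f \<Longrightarrow> in_W s G \<Omega> \<Omega>' (\<lambda>x. - f x)"
  unfolding in_W_def by (simp add: modular_L_uminus modular_W_uminus)

text \<open>Approximants of f are added to mollifications of w, so a compactly supported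
  perturbation of finite modular preserves the boundary values.\<close>

lemma in_W0_add:
  fixes f w :: "'a::euclidean_space \<Rightarrow> real"
  assumes s: "0 < s" "s < 1" and \<Omega>: "open \<Omega>" "bounded \<Omega>" and [measurable]: "\<Omega>' \<in> sets borel"
    and f: "in_W0 s G \<Omega> \<Omega>' f"
    and w: "w \<in> borel_measurable borel" "compact K" "K \<subseteq> \<Omega>" "\<And>x. x \<notin> K \<Longrightarrow> w x = 0"
      "(\<integral>\<^sup>+x. ennreal (G \<bar>w x\<bar>) \<partial>lborel) < \<infinity>" "MW s G w < \<infinity>"
  shows "in_W0 s G \<Omega> \<Omega>' (\<lambda>x. f x + w x)"
proof -
  have \<Omega>m[measurable]: "\<Omega> \<in> sets borel" using \<Omega> by simp
  have \<Omega>'m: "\<Omega>' \<in> sets borel" by measurable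
  have Wf: "in_W s G \<Omega> \<Omega>' f" using f by (simp add: in_W0_def)
  have Ww: "in_W s G \<Omega> \<Omega>' w" by (rule total_imp_in_W[OF w(1) \<Omega>m \<Omega>'m w(5,6)])
  obtain \<phi> where \<phi>: "\<And>k. test_fun \<Omega> (\<phi> k)" "(\<lambda>k. norm_W s G \<Omega> \<Omega>' (\<lambda>x. f x - \<phi> k x)) \<longlonglongrightarrow> 0"
    using f unfolding in_W0_def by blast
  obtain \<xi> where \<xi>0: "(\<forall>k::nat. test_fun \<Omega> (\<xi> k)) \<and> (\<lambda>k. \<integral>\<^sup>+x. ennreal (G \<bar>\<xi> k x - w x\<bar>) \<partial>lborel) \<longlonglongrightarrow> 0
     \<and> (\<lambda>k. MW s G (\<lambda>x. \<xi> k x - w x)) \<longlonglongrightarrow> 0"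
    using smooth_approx[OF w(1-3) \<Omega>(1) w(4-6)] by (rule exE)
  have \<xi>: "\<And>k. test_fun \<Omega> (\<xi> k)" "(\<lambda>k. \<integral>\<^sup>+x. ennreal (G \<bar>\<xi> k x - w x\<bar>) \<partial>lborel) \<longlonglongrightarrow> 0"
     "(\<lambda>k. MW s G (\<lambda>x. \<xi> k x - w x)) \<longlonglongrightarrow> 0"
    using \<xi>0 by simp_all
  have W\<phi>: "in_W s G \<Omega> \<Omega>' \<psi>" if "test_fun \<Omega> \<psi>" for \<psi>
    using test_fun_total[OF s that \<Omega>] by (intro total_imp_in_W \<Omega>m \<Omega>'m)
  have W1: "in_W s G \<Omega> \<Omega>' (\<lambda>x. f x - \<phi> k x)" for k
    using in_W_add[OF Wf in_W_uminus[OF W\<phi>[OF \<phi>(1)[of k]]] \<Omega>m \<Omega>'m] by simp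
  have W2: "in_W s G \<Omega> \<Omega>' (\<lambda>x. \<xi> k x - w x)" for k
    using in_W_add[OF W\<phi>[OF \<xi>(1)[of k]] in_W_uminus[OF Ww] \<Omega>m \<Omega>'m] by simp
  define e where "e k x = (f x - \<phi> k x) + - (\<xi> k x - w x)" for k x
  have We: "in_W s G \<Omega> \<Omega>' (e k)" for k
    unfolding e_def by (rule in_W_add[OF W1 in_W_uminus[OF W2] \<Omega>m \<Omega>'m])
  have m1: "(\<lambda>x. f x - \<phi> k x) \<in> borel_measurable lebesgue" "(\<lambda>x. - (\<xi> k x - w x)) \<in> borel_measurable lebesgue" for k
    using W1[of k] in_W_uminus[OF W2[of k]] by (auto simp: in_W_def)
  have m2: "(\<lambda>x. \<xi> k x - w x) \<in> borel_measurable borel" for k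
    using test_fun_total(1)[OF s \<xi>(1) \<Omega>, of k] w(1) by simp
  have lim1: "(\<lambda>k. modular_L G \<Omega> (\<lambda>x. f x - \<phi> k x)) \<longlonglongrightarrow> 0" "(\<lambda>k. modular_W s G \<Omega> \<Omega>' (\<lambda>x. f x - \<phi> k x)) \<longlonglongrightarrow> 0"
    using \<phi>(2) norm_W_tendsto_0_iff[OF W1 \<Omega>m \<Omega>'m] by auto
  have lim2: "(\<lambda>k. modular_L G \<Omega> (\<lambda>x. - (\<xi> k x - w x))) \<longlonglongrightarrow> 0"
  proof (rule tendsto_sandwich[OF _ _ tendsto_const \<xi>(2)])
    show "\<forall>\<^sub>F k in sequentially. modular_L G \<Omega> (\<lambda>x. - (\<xi> k x - w x)) \<le> (\<integral>\<^sup>+x. ennreal (G \<bar>\<xi> k x - w x\<bar>) \<partial>lborel)"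
      unfolding modular_L_uminus by (intro always_eventually allI modular_le_total(1)[OF m2 \<Omega>m \<Omega>'m])
  qed simp
  have lim3: "(\<lambda>k. modular_W s G \<Omega> \<Omega>' (\<lambda>x. - (\<xi> k x - w x))) \<longlonglongrightarrow> 0"
  proof (rule tendsto_sandwich[OF _ _ tendsto_const \<xi>(3)])
    show "\<forall>\<^sub>F k in sequentially. modular_W s G \<Omega> \<Omega>' (\<lambda>x. - (\<xi> k x - w x)) \<le> MW s G (\<lambda>x. \<xi> k x - w x)"
      unfolding modular_W_uminus by (intro always_eventually allI modular_le_total(2)[OF m2 \<Omega>m \<Omega>'m])
  qed simp
  have "(\<lambda>k. modular_L G \<Omega> (e k)) \<longlonglongrightarrow> 0"
  proof (rule tendsto_sandwich[OF _ _ tendsto_const])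
    show "\<forall>\<^sub>F k in sequentially. modular_L G \<Omega> (e k) \<le> ennreal (2^N) * (modular_L G \<Omega> (\<lambda>x. f x - \<phi> k x) + modular_L G \<Omega> (\<lambda>x. - (\<xi> k x - w x)))"
      unfolding e_def by (intro always_eventually allI modular_L_add m1 \<Omega>m)
    have "(\<lambda>k. ennreal (2^N) * (modular_L G \<Omega> (\<lambda>x. f x - \<phi> k x) + modular_L G \<Omega> (\<lambda>x. - (\<xi> k x - w x)))) \<longlonglongrightarrow> ennreal (2^N) * (0 + 0)"
      by (intro ennreal_tendsto_cmult tendsto_add lim1 lim2) auto
    thus "(\<lambda>k. ennreal (2^N) * (modular_L G \<Omega> (\<lambda>x. f x - \<phi> k x) + modular_L G \<Omega> (\<lambda>x. - (\<xi> k x - w x)))) \<longlonglongrightarrow> 0" by simp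
  qed auto
  moreover have "(\<lambda>k. modular_W s G \<Omega> \<Omega>' (e k)) \<longlonglongrightarrow> 0"
  proof (rule tendsto_sandwich[OF _ _ tendsto_const])
    show "\<forall>\<^sub>F k in sequentially. modular_W s G \<Omega> \<Omega>' (e k) \<le> ennreal (2^N) * (modular_W s G \<Omega> \<Omega>' (\<lambda>x. f x - \<phi> k x) + modular_W s G \<Omega> \<Omega>' (\<lambda>x. - (\<xi> k x - w x)))"
      unfolding e_def by (intro always_eventually allI modular_W_add m1 \<Omega>m \<Omega>'m)
    have "(\<lambda>k. ennreal (2^N) * (modular_W s G \<Omega> \<Omega>' (\<lambda>x. f x - \<phi> k x) + modular_W s G \<Omega> \<Omega>' (\<lambda>x. - (\<xi> k x - w x)))) \<longlonglongrightarrow> ennreal (2^N) * (0 + 0)"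
      by (intro ennreal_tendsto_cmult tendsto_add lim1 lim3) auto
    thus "(\<lambda>k. ennreal (2^N) * (modular_W s G \<Omega> \<Omega>' (\<lambda>x. f x - \<phi> k x) + modular_W s G \<Omega> \<Omega>' (\<lambda>x. - (\<xi> k x - w x)))) \<longlonglongrightarrow> 0" by simp
  qed auto
  ultimately have "(\<lambda>k. norm_W s G \<Omega> \<Omega>' (e k)) \<longlonglongrightarrow> 0"
    using norm_W_tendsto_0_iff[of s \<Omega> \<Omega>' e, OF We \<Omega>m \<Omega>'m] by blast
  moreover have "e k = (\<lambda>x. f x + w x - (\<phi> k x + \<xi> k x))" for k by (simp add: e_def fun_eq_iff)
  ultimately have "(\<lambda>k. norm_W s G \<Omega> \<Omega>' (\<lambda>x. f x + w x - (\<phi> k x + \<xi> k x))) \<longlonglongrightarrow> 0" by simp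
  moreover have "test_fun \<Omega> (\<lambda>x. \<phi> k x + \<xi> k x)" for k by (intro test_fun_add \<phi> \<xi>)
  moreover have "AE x in lebesgue. x \<notin> \<Omega> \<longrightarrow> f x + w x = 0"
  proof -
    have "AE x in lebesgue. x \<notin> \<Omega> \<longrightarrow> f x = 0" using f by (simp add: in_W0_def)
    thus ?thesis by (rule eventually_mono) (use w(3,4) in auto)
  qed
  ultimately show ?thesis unfolding in_W0_def using in_W_add[OF Wf Ww \<Omega>m \<Omega>'m]
    by (intro conjI exI[of _ "\<lambda>k x. \<phi> k x + \<xi> k x"]) auto
qed

text \<open>The variational inequality is read with the competitor u + w. Membership in the space
  and in the boundary class is settled here, so later applications only have to verify the obstacle
  condition.\<close>

lemma obstacle_perturbation:
  fixes u w :: "'a::euclidean_space \<Rightarrow> real"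
  assumes s: "0 < s" "s < 1" and \<Omega>: "open \<Omega>" "bounded \<Omega>" and \<Omega>': "\<Omega>' \<in> sets borel"
    and sol: "obstacle_solution s G g k \<Omega> \<Omega>' \<psi> \<theta> u"
    and w: "w \<in> borel_measurable borel" "compact K" "K \<subseteq> \<Omega>" "\<And>x. x \<notin> K \<Longrightarrow> w x = 0"
      "(\<integral>\<^sup>+x. ennreal (G \<bar>w x\<bar>) \<partial>lborel) < \<infinity>" "MW s G w < \<infinity>"
    and ob: "AE x in lebesgue. x \<in> \<Omega> \<longrightarrow> \<psi> x \<le> ereal (u x + w x)"
  shows "integrable (lebesgue \<Otimes>\<^sub>M lebesgue) (energy_integrand s g k u w)" "0 \<le> energy s g k u w"
proof -
  have \<Omega>m: "\<Omega> \<in> sets borel" using \<Omega> by simp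
  have u: "in_W s G \<Omega> \<Omega>' u" "in_W0 s G \<Omega> \<Omega>' (\<lambda>x. u x - \<theta> x)"
    using sol by (auto simp: obstacle_solution_def obstacle_set_def)
  have "in_W s G \<Omega> \<Omega>' (\<lambda>x. u x + w x)"
    by (rule in_W_add[OF u(1) total_imp_in_W[OF w(1) \<Omega>m \<Omega>' w(5,6)] \<Omega>m \<Omega>'])
  moreover have "in_W0 s G \<Omega> \<Omega>' (\<lambda>x. (u x - \<theta> x) + w x)"
    by (rule in_W0_add[OF s \<Omega> \<Omega>' u(2) w])
  hence "in_W0 s G \<Omega> \<Omega>' (\<lambda>x. (u x + w x) - \<theta> x)" by (simp add: algebra_simps)
  ultimately have "(\<lambda>x. u x + w x) \<in> obstacle_set s G \<Omega> \<Omega>' \<psi> \<theta>"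
    using ob by (simp add: obstacle_set_def)
  with sol[unfolded obstacle_solution_def, THEN conjunct2]
  have "integrable (lebesgue \<Otimes>\<^sub>M lebesgue) (energy_integrand s g k u (\<lambda>x. (u x + w x) - u x)) \<and>
        energy s g k u (\<lambda>x. (u x + w x) - u x) \<ge> 0"
    by (rule bspec)
  thus "integrable (lebesgue \<Otimes>\<^sub>M lebesgue) (energy_integrand s g k u w)" "0 \<le> energy s g k u w" by simp_all
qed

end

section \<open>The Caccioppoli inequality\<close>

text \<open>Used with I a multiple of the energy density, which has a sign only after integration.
  If the integral of B is finite, P is integrable because it lies between 0 and I + B, and the sign
  of the integral of I becomes usable; otherwise nothing is claimed.\<close>

lemma nn_integral_le_of_integral_nonpos:
  fixes P I B :: "'b \<Rightarrow> real"
  assumes [measurable]: "P \<in> borel_measurable M" "B \<in> borel_measurable M"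
    and I: "integrable M I" "(\<integral>z. I z \<partial>M) \<le> 0"
    and nn: "\<And>z. 0 \<le> P z" "\<And>z. 0 \<le> B z"
    and le: "AE z in M. P z \<le> I z + B z"
  shows "(\<integral>\<^sup>+z. ennreal (P z) \<partial>M) \<le> (\<integral>\<^sup>+z. ennreal (B z) \<partial>M)"
proof (cases "(\<integral>\<^sup>+z. ennreal (B z) \<partial>M) = \<infinity>")
  case False
  have iB: "integrable M B" using False nn by (intro integrableI_nonneg) (auto simp: less_top)
  have iIB: "integrable M (\<lambda>z. I z + B z)" using I iB by simp
  have iP: "integrable M P"
    by (rule Bochner_Integration.integrable_bound[OF iIB]) (use le nn in auto)
  have "(\<integral>z. P z \<partial>M) \<le> (\<integral>z. I z + B z \<partial>M)"
    by (rule integral_mono_AE[OF iP iIB le])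
  also have "\<dots> \<le> (\<integral>z. B z \<partial>M)" using I iB by simp
  finally show ?thesis
    using iP iB nn by (simp add: nn_integral_eq_integral ennreal_leI)
qed simp

definition cutoff :: "'a::euclidean_space \<Rightarrow> real \<Rightarrow> real \<Rightarrow> 'a \<Rightarrow> real" where
  "cutoff x0 r \<rho> x = max 0 (min 1 ((\<rho> - norm (x - x0)) / (\<rho> - r)))"

lemma cutoff_props:
  assumes "r < \<rho>"
  shows "0 \<le> cutoff x0 r \<rho> x" "cutoff x0 r \<rho> x \<le> 1"
    "norm (x - x0) \<le> r \<Longrightarrow> cutoff x0 r \<rho> x = 1" "\<rho> \<le> norm (x - x0) \<Longrightarrow> cutoff x0 r \<rho> x = 0"
    "\<bar>cutoff x0 r \<rho> x - cutoff x0 r \<rho> y\<bar> \<le> 1 / (\<rho> - r) * norm (x - y)"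
proof -
  show "0 \<le> cutoff x0 r \<rho> x" "cutoff x0 r \<rho> x \<le> 1" by (auto simp: cutoff_def)
  show "norm (x - x0) \<le> r \<Longrightarrow> cutoff x0 r \<rho> x = 1" using assms by (simp add: cutoff_def)
  show "\<rho> \<le> norm (x - x0) \<Longrightarrow> cutoff x0 r \<rho> x = 0" using assms by (simp add: cutoff_def divide_nonpos_pos)
  have "\<bar>cutoff x0 r \<rho> x - cutoff x0 r \<rho> y\<bar> \<le> \<bar>(\<rho> - norm (x - x0)) / (\<rho> - r) - (\<rho> - norm (y - x0)) / (\<rho> - r)\<bar>"
    unfolding cutoff_def by (simp add: max_def min_def abs_if)
  also have "\<dots> = \<bar>norm (x - x0) - norm (y - x0)\<bar> / (\<rho> - r)"
    using assms unfolding diff_divide_distrib[symmetric] by (simp add: abs_minus_commute)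
  also have "\<dots> \<le> norm (x - y) / (\<rho> - r)"
    using assms norm_triangle_ineq3[of "x - x0" "y - x0"] by (intro divide_right_mono) auto
  finally show "\<bar>cutoff x0 r \<rho> x - cutoff x0 r \<rho> y\<bar> \<le> 1 / (\<rho> - r) * norm (x - y)" by simp
qed

lemma cutoff_measurable [measurable]: "cutoff x0 r \<rho> \<in> borel_measurable borel"
  unfolding cutoff_def by measurable

context growth
begin

text \<open>The energy density before weighting by the kernel: t and t' stand for the values of U -
  l at the two points, a and b for the cutoff there, d for |x-y|^s. Isolating it reduces the sign
  analysis to real numbers.\<close>

definition cacc_term :: "real \<Rightarrow> real \<Rightarrow> real \<Rightarrow> real \<Rightarrow> real \<Rightarrow> real" where
  "cacc_term t t' a b d = g (\<bar>t - t'\<bar> / d) * sgn (t - t') * ((a^N * max 0 t - b^N * max 0 t') / d)"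

lemma cacc_term_sym: "cacc_term t t' a b d = cacc_term t' t b a d"
proof -
  have "sgn (t - t') = - sgn (t' - t)" by (metis minus_diff_eq sgn_minus)
  moreover have "(a^N * max 0 t - b^N * max 0 t') / d = - ((b^N * max 0 t' - a^N * max 0 t) / d)"
    by (simp add: minus_divide_left)
  ultimately show ?thesis by (simp add: cacc_term_def abs_minus_commute)
qed

lemma cacc_term_cross:
  "0 < t \<Longrightarrow> t' \<le> 0 \<Longrightarrow> cacc_term t t' a b d = a^N * t * g (\<bar>t - t'\<bar> / d) / d"
  by (simp add: cacc_term_def)

lemma cacc_term_nonpos: "t \<le> 0 \<Longrightarrow> t' \<le> 0 \<Longrightarrow> cacc_term t t' a b d = 0"
  by (simp add: cacc_term_def max_def)

lemma cacc_term_zero: "cacc_term t t' 0 0 d = 0"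
  by (simp add: cacc_term_def zero_power)

text \<open>With both values above the level the term is negative only if b^N t' > a^N t, which
  forces a < b. With \<tau> = a/b, Bernoulli's inequality bounds t - t' and the weighted difference
  by multiples of t (1 - \<tau>), that is, by the cutoff difference divided by b. The resulting loss
  b^(-N) is compensated by the weight b^N; this is the reason for the N-th power of the
  cutoff.\<close>

lemma cacc_term_lower_aux:
  assumes t: "0 < t'" "t' \<le> t" and ab: "0 \<le> a" "a \<le> 1" "0 \<le> b" "b \<le> 1" and d: "0 < d"
  shows "- (real N * real N ^ N * G (t * \<bar>a - b\<bar> / d)) \<le> cacc_term t t' a b d"
proof (cases "b^N * t' \<le> a^N * t")
  case True
  have "0 \<le> cacc_term t t' a b d" unfolding cacc_term_def
    using t True d by (intro mult_nonneg_nonneg divide_nonneg_pos g_nonneg) (auto simp: sgn_if)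
  moreover have "0 \<le> real N * real N ^ N * G (t * \<bar>a - b\<bar> / d)"
    using t d by (intro mult_nonneg_nonneg G_nonneg) auto
  ultimately show ?thesis by linarith
next
  case False
  have b: "0 < b" using False t ab by (cases "b = 0") (auto simp: zero_power mult_nonneg_nonneg)
  have "a < b"
  proof (rule ccontr)
    assume "\<not> a < b"
    hence "b^N * t' \<le> a^N * t" using t ab by (intro mult_mono power_mono) auto
    thus False using False by simp
  qed
  define \<tau> where "\<tau> = a / b"
  have \<tau>: "0 \<le> \<tau>" "\<tau> < 1" "a = \<tau> * b" using b ab \<open>a < b\<close> by (auto simp: \<tau>_def)
  define z where "z = t * \<bar>a - b\<bar> / d"
  \<comment> \<open>Common bound for both quotients: (t - t')/d \<le> m and (b^N t' - a^N t)/d \<le>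
    b^N m.\<close>
  define m where "m = real N * z / b"
  have z: "z = t * (1 - \<tau>) * b / d" using \<tau> b by (simp add: z_def abs_if algebra_simps)
  have z0: "0 \<le> z" using t d by (simp add: z_def)
  have m0: "0 \<le> m" using z0 b by (simp add: m_def)
  have mm: "m * d = real N * t * (1 - \<tau>)" using z b d by (simp add: m_def)
  have bern: "1 - \<tau>^N \<le> real N * (1 - \<tau>)"
    using Bernoulli_inequality[of "\<tau> - 1" N] \<tau> by (simp add: algebra_simps)
  have tt: "t * (1 - \<tau>^N) \<le> m * d" unfolding mm
    using mult_left_mono[OF bern, of t] t by (simp add: mult_ac)
  have 1: "t - t' \<le> m * d"
  proof -
    have "b^N * (\<tau>^N * t) < b^N * t'" using False \<tau> by (simp add: power_mult_distrib mult_ac)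
    hence "\<tau>^N * t < t'" using b by simp
    thus ?thesis using tt by (simp add: algebra_simps)
  qed
  have 2: "b^N * t' - a^N * t \<le> b^N * (m * d)"
  proof -
    have "b^N * t' - a^N * t = b^N * (t' - \<tau>^N * t)" using \<tau> by (simp add: power_mult_distrib algebra_simps)
    also have "\<dots> \<le> b^N * (m * d)" using tt t b by (intro mult_left_mono) (auto simp: algebra_simps)
    finally show ?thesis .
  qed
  have "g (\<bar>t - t'\<bar> / d) * sgn (t - t') * ((b^N * t' - a^N * t) / d) \<le> g m * 1 * (b^N * m)"
  proof (intro mult_mono)
    show "g (\<bar>t - t'\<bar> / d) \<le> g m" using 1 t d by (intro g_mono) (auto simp: divide_le_eq)
    show "(b^N * t' - a^N * t) / d \<le> b^N * m" using 2 d by (simp add: divide_le_eq mult_ac)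
  qed (use t d m0 False b in \<open>auto simp: sgn_if g_nonneg intro!: mult_nonneg_nonneg g_nonneg\<close>)
  also have "\<dots> = b^N * (m * g m)" by simp
  also have "\<dots> \<le> b^N * (real N * G m)" using b m0 by (intro mult_left_mono tg_le) auto
  also have "\<dots> \<le> b^N * (real N * ((1/b)^N * (real N ^ N * G z)))"
  proof -
    \<comment> \<open>Scaling 1/b out of \<open>G\<close> costs b^(-N), exactly the weight that is
      available.\<close>
    have "G m = G ((1/b) * (real N * z))" by (simp add: m_def)
    also have "\<dots> \<le> (1/b)^N * G (real N * z)" using b ab z0 by (intro G_scale_upper) auto
    also have "\<dots> \<le> (1/b)^N * (real N ^ N * G z)"
      using b z0 N_gt_1 by (intro mult_left_mono G_scale_upper) auto
    finally show ?thesis using b by (intro mult_left_mono) auto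
  qed
  also have "\<dots> = real N * real N ^ N * G z" using b by (simp add: power_divide)
  finally have "- cacc_term t t' a b d \<le> real N * real N ^ N * G z"
    using t by (simp add: cacc_term_def minus_divide_left[symmetric] diff_divide_distrib algebra_simps)
  thus ?thesis by (simp add: z_def)
qed

lemma cacc_term_lower:
  assumes t: "0 < t'" "0 < t" and ab: "0 \<le> a" "a \<le> 1" "0 \<le> b" "b \<le> 1" and d: "0 < d"
  shows "- (real N * real N ^ N * (G (t * \<bar>a - b\<bar> / d) + G (t' * \<bar>a - b\<bar> / d))) \<le> cacc_term t t' a b d"
proof -
  have nn: "0 \<le> real N * real N ^ N * G (t * \<bar>a - b\<bar> / d)" "0 \<le> real N * real N ^ N * G (t' * \<bar>a - b\<bar> / d)"
    using t d by (auto intro!: mult_nonneg_nonneg G_nonneg)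
  show ?thesis
  proof (cases "t' \<le> t")
    case True
    show ?thesis using cacc_term_lower_aux[OF t(1) True ab d] nn by (simp add: algebra_simps)
  next
    case False
    hence "t \<le> t'" by simp
    from cacc_term_lower_aux[OF t(2) this ab(3,4,1,2) d]
    show ?thesis using nn by (simp add: cacc_term_sym[of t t'] abs_minus_commute algebra_simps)
  qed
qed

text \<open>The second point lies outside the support of the cutoff. The term is negative only if t'
  > t > 0, and then t' - t \<le> t' bounds it by a tail integrand.\<close>

lemma cacc_term_lower_far:
  assumes t: "0 < t" and a: "0 \<le> a" "a \<le> 1" and d: "0 < d"
  shows "- (t * g (max 0 t' / d) / d) \<le> cacc_term t t' a 0 d"
proof (cases "t' \<le> t")
  case True
  have "0 \<le> cacc_term t t' a 0 d" unfolding cacc_term_def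
    using t True d a by (intro mult_nonneg_nonneg divide_nonneg_pos g_nonneg) (auto simp: sgn_if zero_power)
  moreover have "0 \<le> t * g (max 0 t' / d) / d" using t d by (intro divide_nonneg_pos mult_nonneg_nonneg g_nonneg) auto
  ultimately show ?thesis by linarith
next
  case False
  have "g ((t' - t) / d) * (a^N * t / d) \<le> g (max 0 t' / d) * (1 * t / d)"
    using False t d a
    by (intro mult_mono g_mono divide_right_mono power_le_one mult_nonneg_nonneg g_nonneg divide_nonneg_pos) auto
  thus ?thesis using False t by (simp add: cacc_term_def zero_power mult_ac)
qed

definition excess :: "real \<Rightarrow> 'a::euclidean_space \<Rightarrow> real \<Rightarrow> real \<Rightarrow> ('a \<Rightarrow> real) \<Rightarrow> ennreal" where
  "excess s x0 R l U = (\<integral>\<^sup>+x. indicator (ball x0 R) x * ennreal (G \<bar>max 0 (U x - l) / R powr s\<bar>) \<partial>lborel)"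

definition mass :: "'a::euclidean_space \<Rightarrow> real \<Rightarrow> real \<Rightarrow> ('a \<Rightarrow> real) \<Rightarrow> ennreal" where
  "mass x0 R l U = (\<integral>\<^sup>+x. indicator (ball x0 R) x * ennreal (max 0 (U x - l)) \<partial>lborel)"

text \<open>Nonlocal tail of the positive part without normalising powers of R. Its natural unit is
  g (H / R^s) / R^s, the form in which the tail hypotheses below are stated.\<close>

definition tail :: "real \<Rightarrow> 'a::euclidean_space \<Rightarrow> real \<Rightarrow> real \<Rightarrow> ('a \<Rightarrow> real) \<Rightarrow> ennreal" where
  "tail s x0 R l U = (\<integral>\<^sup>+y. indicator (- ball x0 R) y *
     ennreal (g \<bar>max 0 (U y - l) / norm (y - x0) powr s\<bar> / (norm (y - x0) powr s * norm (y - x0) ^ DIM('a))) \<partial>lborel)"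

text \<open>The only part of the energy that is kept on the left-hand side: interactions across the level \<open>l\<close>.\<close>

definition cross :: "real \<Rightarrow> 'a::euclidean_space \<Rightarrow> real \<Rightarrow> real \<Rightarrow> real \<Rightarrow> ('a \<Rightarrow> real) \<Rightarrow> 'a \<Rightarrow> 'a \<Rightarrow> real" where
  "cross s x0 r R l U x y =
     indicator (ball x0 r) x * indicator (ball x0 R) y *
     (if l < U x \<and> U y \<le> l then (U x - l) * g \<bar>(U x - U y) / norm (x - y) powr s\<bar> / (norm (x - y) powr s * norm (x - y) ^ DIM('a)) else 0)"

text \<open>Four cases by the position of the two values relative to the level. Across it the term
  is nonnegative and, in one orientation, contains the good part; below it the term vanishes; above
  it the term may be negative and is charged to cutoff differences or to the tail.\<close>

lemma caccioppoli_pointwise: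
  fixes s l :: real and U :: "'a::euclidean_space \<Rightarrow> real" and x y x0 :: 'a
  assumes r: "0 < r" "r < R" and L: "1 \<le> \<Lambda>" and k: "1 / \<Lambda> \<le> \<kappa>" "\<kappa> \<le> \<Lambda>"
  defines "\<rho> \<equiv> (r + R) / 2"
  defines "\<eta> \<equiv> cutoff x0 r \<rho>" and "d \<equiv> norm (x - y) powr s" and "m \<equiv> norm (x - y) ^ DIM('a)"
    and "a \<equiv> max 0 (U x - l)" and "b \<equiv> max 0 (U y - l)"
  shows "cross s x0 r R l U x y / \<Lambda> \<le>
     g \<bar>(U x - U y) / d\<bar> * sgn ((U x - U y) / d) * ((\<eta> x ^ N * a - \<eta> y ^ N * b) / d) * \<kappa> / m
     + \<Lambda> * (indicator (ball x0 R) x * indicator (ball x0 R) y * (real N * real N ^ N)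
               * (G \<bar>a * (\<eta> x - \<eta> y) / d\<bar> / m + G \<bar>b * (\<eta> x - \<eta> y) / d\<bar> / m)
        + indicator (ball x0 \<rho>) x * indicator (- ball x0 R) y * (a * g \<bar>b / d\<bar> / (d * m))
        + indicator (ball x0 \<rho>) y * indicator (- ball x0 R) x * (b * g \<bar>a / d\<bar> / (d * m)))"
    (is "?good / \<Lambda> \<le> ?I + \<Lambda> * ?bad")
proof (cases "x = y")
  case False
  have L0: "0 < \<Lambda>" using L by simp
  have kpos: "0 < \<kappa>" using k L0 by (meson less_le_trans zero_less_divide_1_iff)
  have d: "0 < d" and m: "0 < m" using False by (auto simp: d_def m_def)
  have rr: "r < \<rho>" "\<rho> < R" using r by (auto simp: \<rho>_def)
  note cp = cutoff_props[OF rr(1), where ?x0.0 = x0, folded \<eta>_def]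
  define t t' where "t = U x - l" and "t' = U y - l"
  define E where "E = cacc_term t t' (\<eta> x) (\<eta> y) d"
  have ab: "0 \<le> a" "0 \<le> b" by (auto simp: a_def b_def)
  have sg: "sgn ((U x - U y) / d) = sgn (U x - U y)" using d by (simp add: sgn_divide)
  have ad: "\<bar>(U x - U y) / d\<bar> = \<bar>U x - U y\<bar> / d" using d by simp
  have IE: "?I = E * (\<kappa> / m)"
    unfolding E_def cacc_term_def sg ad by (simp add: t_def t'_def a_def b_def)
  have bad_parts: "0 \<le> indicator (ball x0 R) x * indicator (ball x0 R) y * (real N * real N ^ N)
               * (G \<bar>a * (\<eta> x - \<eta> y) / d\<bar> / m + G \<bar>b * (\<eta> x - \<eta> y) / d\<bar> / m)"
     "0 \<le> indicator (ball x0 \<rho>) x * indicator (- ball x0 R) y * (a * g \<bar>b / d\<bar> / (d * m))"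
     "0 \<le> indicator (ball x0 \<rho>) y * indicator (- ball x0 R) x * (b * g \<bar>a / d\<bar> / (d * m))"
    using ab d m by (auto intro!: mult_nonneg_nonneg add_nonneg_nonneg divide_nonneg_pos G_nonneg g_nonneg)
  hence bad0: "0 \<le> ?bad" by linarith
  \<comment> \<open>A nonnegative term is bounded below with the lower bound 1/\<Lambda> of the
    kernel, a possibly negative one (\<open>step_neg\<close>) with the upper bound
    \<Lambda>.\<close>
  have step_pos: ?thesis if "?good \<le> E / m" "0 \<le> E"
  proof -
    have "?good / \<Lambda> \<le> (E / m) / \<Lambda>" using that L0 by (intro divide_right_mono) auto
    also have "\<dots> = E / m * (1 / \<Lambda>)" by simp
    also have "\<dots> \<le> E / m * \<kappa>" using that m k by (intro mult_left_mono) auto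
    also have "\<dots> = ?I" unfolding IE by simp
    also have "\<dots> \<le> ?I + \<Lambda> * ?bad" using L0 bad0 by simp
    finally show ?thesis .
  qed
  have step_neg: ?thesis if "?good = 0" "- (m * ?bad) \<le> E"
  proof -
    have aux: "0 \<le> E * (\<kappa> / m) + \<Lambda> * B" if B: "- (m * B) \<le> E" "0 \<le> B" for B
    proof -
      have "- B \<le> E / m" using B(1) m by (simp add: le_divide_eq mult.commute)
      hence "- (\<kappa> * B) \<le> \<kappa> * (E / m)" using kpos mult_left_mono[of "- B" "E / m" \<kappa>] by simp
      moreover have "\<kappa> * B \<le> \<Lambda> * B" using k B(2) by (intro mult_right_mono) auto
      ultimately show ?thesis by (simp add: mult.commute)
    qed
    show ?thesis unfolding that(1) IE using aux[OF that(2) bad0] by simp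
  qed
  have G_eq: "G \<bar>a * (\<eta> x - \<eta> y) / d\<bar> = G (a * \<bar>\<eta> x - \<eta> y\<bar> / d)" "G \<bar>b * (\<eta> x - \<eta> y) / d\<bar> = G (b * \<bar>\<eta> x - \<eta> y\<bar> / d)"
    using ab d by (simp_all add: abs_mult)
  consider (cross) "0 < t" "t' \<le> 0" | (cross') "t \<le> 0" "0 < t'" | (neg) "t \<le> 0" "t' \<le> 0" | (pos) "0 < t" "0 < t'"
    by linarith
  thus ?thesis
  proof cases
    case cross
    have Eq: "E = \<eta> x ^ N * t * g (\<bar>t - t'\<bar> / d) / d" unfolding E_def by (rule cacc_term_cross[OF cross])
    have E0: "0 \<le> E" unfolding Eq using cross d cp(1) by (intro divide_nonneg_pos mult_nonneg_nonneg g_nonneg) auto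
    have "?good \<le> E / m"
    proof (cases "x \<in> ball x0 r")
      case True
      hence "\<eta> x = 1" using cp(3) by (auto simp: dist_norm norm_minus_commute)
      hence "E / m = (U x - l) * g \<bar>(U x - U y) / d\<bar> / (d * m)" unfolding Eq ad by (simp add: t_def t'_def)
      moreover have "0 \<le> E / m" using E0 m by simp
      ultimately show ?thesis unfolding cross_def d_def[symmetric] m_def[symmetric] by (auto simp: indicator_def)
    next
      case False
      thus ?thesis using E0 m by (simp add: cross_def)
    qed
    thus ?thesis using E0 by (rule step_pos)
  next
    case cross'
    have "E = \<eta> y ^ N * t' * g (\<bar>t' - t\<bar> / d) / d"
      unfolding E_def cacc_term_sym[of t t'] by (rule cacc_term_cross[OF cross'(2,1)])
    hence E0: "0 \<le> E" using cross' d cp(1) by (auto intro!: divide_nonneg_pos mult_nonneg_nonneg g_nonneg)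
    moreover have "?good = 0" using cross' by (simp add: cross_def t_def)
    ultimately show ?thesis using m by (intro step_pos) auto
  next
    case neg
    have "E = 0" unfolding E_def by (rule cacc_term_nonpos[OF neg])
    moreover have "?good = 0" using neg by (simp add: cross_def t_def)
    ultimately show ?thesis by (intro step_pos) auto
  next
    case pos
    have good0: "?good = 0" using pos by (simp add: cross_def t'_def)
    have abt: "a = t" "b = t'" using pos by (auto simp: a_def b_def t_def t'_def)
    have out: "\<eta> z = 0" if "z \<notin> ball x0 \<rho>" for z
      using that cp(4)[of z] by (auto simp: dist_norm norm_minus_commute)
    have sub: "ball x0 \<rho> \<subseteq> ball x0 R" using rr by (intro subset_ball) auto
    \<comment> \<open>The cutoff lives in the ball of radius \<rho> halfway between r and R. Hence
      in a far interaction the two points are at distance at least R - \<rho>, and pairs with both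
      points outside the ball of radius \<rho> contribute nothing.\<close>
    consider "x \<in> ball x0 R" "y \<in> ball x0 R" | "x \<in> ball x0 \<rho>" "y \<notin> ball x0 R" | "y \<in> ball x0 \<rho>" "x \<notin> ball x0 R"
       | "x \<notin> ball x0 \<rho>" "y \<notin> ball x0 \<rho>" using sub by blast
    hence "- (m * ?bad) \<le> E"
    proof cases
      case 1
      have "?bad \<ge> (real N * real N ^ N) * (G \<bar>a * (\<eta> x - \<eta> y) / d\<bar> / m + G \<bar>b * (\<eta> x - \<eta> y) / d\<bar> / m)"
        using 1 bad_parts by simp
      hence "m * ?bad \<ge> m * ((real N * real N ^ N) * (G \<bar>a * (\<eta> x - \<eta> y) / d\<bar> / m + G \<bar>b * (\<eta> x - \<eta> y) / d\<bar> / m))"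
        using m by (intro mult_left_mono) auto
      also have "m * ((real N * real N ^ N) * (G \<bar>a * (\<eta> x - \<eta> y) / d\<bar> / m + G \<bar>b * (\<eta> x - \<eta> y) / d\<bar> / m))
        = real N * real N ^ N * (G (t * \<bar>\<eta> x - \<eta> y\<bar> / d) + G (t' * \<bar>\<eta> x - \<eta> y\<bar> / d))"
        unfolding G_eq using m by (simp add: abt field_simps)
      finally show ?thesis
        using cacc_term_lower[OF pos(2,1) cp(1)[of x] cp(2)[of x] cp(1)[of y] cp(2)[of y] d] by (simp add: E_def)
    next
      case 2
      hence "\<eta> y = 0" using out sub by blast
      moreover have "?bad \<ge> a * g \<bar>b / d\<bar> / (d * m)" using 2 bad_parts by (auto simp: indicator_def)
      hence "m * ?bad \<ge> m * (a * g \<bar>b / d\<bar> / (d * m))" using m by (intro mult_left_mono) auto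
      moreover have "m * (a * g \<bar>b / d\<bar> / (d * m)) = t * g (max 0 t' / d) / d"
        using m d pos by (simp add: abt)
      ultimately show ?thesis
        using cacc_term_lower_far[OF pos(1) cp(1)[of x] cp(2)[of x] d, of t'] by (simp add: E_def)
    next
      case 3
      hence "\<eta> x = 0" using out sub by blast
      moreover have "?bad \<ge> b * g \<bar>a / d\<bar> / (d * m)" using 3 bad_parts by (auto simp: indicator_def)
      hence "m * ?bad \<ge> m * (b * g \<bar>a / d\<bar> / (d * m))" using m by (intro mult_left_mono) auto
      moreover have "m * (b * g \<bar>a / d\<bar> / (d * m)) = t' * g (max 0 t / d) / d"
        using m d pos by (simp add: abt)
      ultimately show ?thesis
        using cacc_term_lower_far[OF pos(2) cp(1)[of y] cp(2)[of y] d, of t] by (simp add: E_def cacc_term_sym[of t t'])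
    next
      case 4
      hence "E = 0" unfolding E_def using out cacc_term_zero by simp
      thus ?thesis using m bad0 by simp
    qed
    with good0 show ?thesis by (rule step_neg)
  qed
next
  case True
  have "?good = 0" using True by (simp add: cross_def)
  moreover have "?bad = 0" using True by (simp add: m_def d_def zero_power)
  ultimately show ?thesis using True by (simp add: m_def)
qed

text \<open>The constant of \<open>nn_integral_ball_radial\<close> for the exponent (1-s) p accounts
  for the near interactions, 2 N for the far ones; both factors 2 come from symmetrisation.\<close>

definition cacc_const :: "real \<Rightarrow> nat \<Rightarrow> real" where
  "cacc_const s n = 2 * (real N * real N ^ N) * (unit_ball_vol (real n) * 2 ^ n / (1 - 2 powr (-((1 - s) * p)))) + 2 * real N"

text \<open>The Lipschitz bound on the cutoff gains |x-y|^(1-s), so the argument of \<open>G\<close>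
  is a factor at most 1 times a multiple of a / R^s. Scaling with the power p then produces
  |x-y|^((1-s) p - n), integrable on a ball of radius 2 R.\<close>

lemma cacc_near_bound:
  fixes x x0 :: "'a::euclidean_space" and \<eta> :: "'a \<Rightarrow> real"
  assumes s: "0 < s" "s < 1" and r: "0 < r" "r < R" and a: "0 \<le> a" and xR: "x \<in> ball x0 R"
    and \<eta>: "\<And>y. \<bar>\<eta> x - \<eta> y\<bar> \<le> 2 / (R - r) * norm (x - y)" and [measurable]: "\<eta> \<in> borel_measurable borel"
  shows "(\<integral>\<^sup>+y. indicator (ball x0 R) y * ennreal (G \<bar>a * (\<eta> x - \<eta> y) / norm (x - y) powr s\<bar> / norm (x - y) ^ DIM('a)) \<partial>lborel)
    \<le> ennreal ((4 * R / (R - r)) ^ N * (unit_ball_vol (real DIM('a)) * 2 ^ DIM('a) / (1 - 2 powr (-((1 - s) * p)))) * G (a / R powr s))"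
proof -
  let ?n = "DIM('a)"
  define \<beta> where "\<beta> = (1 - s) * p"
  have \<beta>: "0 < \<beta>" using s p_gt_1 by (simp add: \<beta>_def)
  define \<mu> where "\<mu> = 4 * R / (R - r)"
  have \<mu>: "1 \<le> \<mu>" using r by (simp add: \<mu>_def le_divide_eq)
  define t where "t = a / R powr s"
  have t: "0 \<le> t" using a by (simp add: t_def)
  define c where "c = (2 * R) powr (- \<beta>) * (\<mu>^N * G t)"
  have c: "0 \<le> c" using \<mu> t by (auto simp: c_def intro!: mult_nonneg_nonneg G_nonneg)
  define F where "F h = indicator (ball 0 (2 * R)) h * ennreal (norm h powr (\<beta> - real ?n))" for h :: 'a
  have [measurable]: "F \<in> borel_measurable borel"
    unfolding F_def by (intro borel_measurable_times_ennreal borel_measurable_indicator) auto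
  have "(\<integral>\<^sup>+y. indicator (ball x0 R) y * ennreal (G \<bar>a * (\<eta> x - \<eta> y) / norm (x - y) powr s\<bar> / norm (x - y) ^ ?n) \<partial>lborel)
    \<le> (\<integral>\<^sup>+y. ennreal c * F (x - y) \<partial>lborel)"
  proof (rule nn_integral_mono)
    fix y
    show "indicator (ball x0 R) y * ennreal (G \<bar>a * (\<eta> x - \<eta> y) / norm (x - y) powr s\<bar> / norm (x - y) ^ ?n) \<le> ennreal c * F (x - y)"
    proof (cases "y \<in> ball x0 R \<and> x \<noteq> y")
      case True
      define h where "h = norm (x - y)"
      have h: "0 < h" using True by (simp add: h_def)
      have "norm (x - y) \<le> norm (x - x0) + norm (x0 - y)" using norm_triangle_ineq[of "x - x0" "x0 - y"] by simp
      hence h2: "h < 2 * R" using True xR by (simp add: h_def dist_norm norm_minus_commute)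
      \<comment> \<open>At most 1, as \<open>G_scale_small\<close> requires, because two points of
        the ball are less than 2 R apart.\<close>
      define lam where "lam = (h / (2 * R)) powr (1 - s)"
      have lam: "0 \<le> lam" "lam \<le> 1" using h h2 s r by (auto simp: lam_def intro!: powr_le1)
      have "\<bar>a * (\<eta> x - \<eta> y) / h powr s\<bar> \<le> lam * (\<mu> * t)"
      proof -
        have "\<bar>a * (\<eta> x - \<eta> y) / h powr s\<bar> = a * \<bar>\<eta> x - \<eta> y\<bar> / h powr s" using a by (simp add: abs_mult)
        also have "\<dots> \<le> a * (2 / (R - r) * h) / h powr s"
          using a \<eta>[of y] by (intro divide_right_mono mult_left_mono) (auto simp: h_def)
        also have "\<dots> = a * (2 / (R - r)) * h powr (1 - s)" using h by (simp add: powr_diff)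
        also have "\<dots> = (h / (2 * R)) powr (1 - s) * ((2 powr (1 - s) * 2 * R / (R - r)) * (a / R powr s))"
        proof -
          have "h powr (1 - s) = (h / (2 * R)) powr (1 - s) * (2 powr (1 - s) * R powr (1 - s))"
            using h r by (simp add: powr_divide powr_mult)
          also have "R powr (1 - s) = R / R powr s" using r by (simp add: powr_diff)
          finally show ?thesis by simp
        qed
        also have "\<dots> \<le> (h / (2 * R)) powr (1 - s) * (\<mu> * (a / R powr s))"
        proof (intro mult_left_mono mult_right_mono)
          have "2 powr (1 - s) \<le> 2 powr 1" using s by (intro powr_mono) auto
          hence "2 powr (1 - s) * (2 * R / (R - r)) \<le> 2 * (2 * R / (R - r))" using r by (intro mult_right_mono) auto
          thus "2 powr (1 - s) * 2 * R / (R - r) \<le> \<mu>" by (simp add: \<mu>_def mult_ac)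
        qed (use a in auto)
        finally show ?thesis by (simp add: lam_def t_def)
      qed
      hence "G \<bar>a * (\<eta> x - \<eta> y) / h powr s\<bar> \<le> G (lam * (\<mu> * t))" by (intro G_mono) auto
      also have "\<dots> \<le> lam powr p * G (\<mu> * t)" using lam \<mu> t by (intro G_scale_small) auto
      also have "\<dots> \<le> lam powr p * (\<mu>^N * G t)" using \<mu> t by (intro mult_left_mono G_scale_upper) auto
      also have "lam powr p = h powr \<beta> * (2 * R) powr (- \<beta>)"
      proof -
        have "lam powr p = (h / (2 * R)) powr \<beta>" unfolding lam_def \<beta>_def by (rule powr_powr)
        also have "\<dots> = h powr \<beta> / (2 * R) powr \<beta>" by (rule powr_divide)
        finally show ?thesis by (simp only: powr_minus divide_inverse)
      qed
      finally have "G \<bar>a * (\<eta> x - \<eta> y) / h powr s\<bar> / h ^ ?n \<le> h powr \<beta> * (2 * R) powr (- \<beta>) * (\<mu>^N * G t) / h ^ ?n"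
        using h by (intro divide_right_mono) auto
      also have "\<dots> = c * h powr (\<beta> - real ?n)" using h by (simp add: c_def powr_diff powr_realpow)
      finally show ?thesis using True h2 c
        by (simp add: F_def h_def[symmetric] ennreal_mult'[symmetric] ennreal_leI)
    next
      case False
      thus ?thesis by (auto simp: indicator_def)
    qed
  qed
  also have "\<dots> = ennreal c * (\<integral>\<^sup>+y. F (x - y) \<partial>lborel)" by (rule nn_integral_cmult) measurable
  also have "(\<integral>\<^sup>+y. F (x - y) \<partial>lborel) = (\<integral>\<^sup>+h. F h \<partial>(distr lborel borel (\<lambda>y. x - y)))"
    by (rule nn_integral_distr[symmetric]) measurable
  also have "\<dots> = (\<integral>\<^sup>+h. F h \<partial>lborel)" by (simp only: distr_lborel_reflect)
  also have "\<dots> \<le> ennreal (unit_ball_vol ?n * 2 ^ ?n / (1 - 2 powr (-\<beta>)) * (2 * R) powr \<beta>)"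
    unfolding F_def using \<beta> r by (intro nn_integral_ball_radial) auto
  also have "ennreal c * \<dots> = ennreal (c * (unit_ball_vol ?n * 2 ^ ?n / (1 - 2 powr (-\<beta>)) * (2 * R) powr \<beta>))"
    using c by (rule ennreal_mult'[symmetric])
  also have "c * (unit_ball_vol ?n * 2 ^ ?n / (1 - 2 powr (-\<beta>)) * (2 * R) powr \<beta>)
    = \<mu>^N * (unit_ball_vol ?n * 2 ^ ?n / (1 - 2 powr (-\<beta>))) * G t"
    using r by (simp add: c_def powr_minus field_simps)
  finally show ?thesis by (simp add: mult_left_mono \<mu>_def \<beta>_def t_def)
qed

text \<open>From x in the middle ball, the distance to y outside the large ball is comparable with
  |y - x0|, so the tail can be centred at x0. Of the exponent N + n + 1, the N comes from scaling
  \<open>g\<close>, the n from |x-y|^n and the 1 from |x-y|^s.\<close>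

lemma cacc_far_bound:
  fixes x x0 :: "'a::euclidean_space" and U :: "'a \<Rightarrow> real"
  assumes s: "0 < s" "s < 1" and r: "0 < r" "r < R" and a: "0 \<le> a" and x: "x \<in> ball x0 ((r + R) / 2)"
    and [measurable]: "U \<in> borel_measurable borel"
  shows "(\<integral>\<^sup>+y. indicator (- ball x0 R) y * ennreal (a * g \<bar>max 0 (U y - l) / norm (x - y) powr s\<bar> / (norm (x - y) powr s * norm (x - y) ^ DIM('a))) \<partial>lborel)
    \<le> ennreal (real N * (4 * R / (R - r)) ^ (N + DIM('a) + 1) * a) * tail s x0 R l U"
proof -
  let ?n = "DIM('a)"
  define \<Theta> where "\<Theta> = 4 * R / (R - r)"
  have \<Theta>: "1 \<le> \<Theta>" using r by (simp add: \<Theta>_def le_divide_eq)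
  define c where "c = real N * \<Theta> ^ (N + ?n + 1) * a"
  have c: "0 \<le> c" using \<Theta> a by (simp add: c_def)
  have [measurable]: "- ball x0 R \<in> sets borel" by simp
  have "(\<integral>\<^sup>+y. indicator (- ball x0 R) y * ennreal (a * g \<bar>max 0 (U y - l) / norm (x - y) powr s\<bar> / (norm (x - y) powr s * norm (x - y) ^ ?n)) \<partial>lborel)
    \<le> (\<integral>\<^sup>+y. ennreal c * (indicator (- ball x0 R) y *
     ennreal (g \<bar>max 0 (U y - l) / norm (y - x0) powr s\<bar> / (norm (y - x0) powr s * norm (y - x0) ^ ?n))) \<partial>lborel)"
  proof (rule nn_integral_mono)
    fix y
    show "indicator (- ball x0 R) y * ennreal (a * g \<bar>max 0 (U y - l) / norm (x - y) powr s\<bar> / (norm (x - y) powr s * norm (x - y) ^ ?n))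
     \<le> ennreal c * (indicator (- ball x0 R) y *
     ennreal (g \<bar>max 0 (U y - l) / norm (y - x0) powr s\<bar> / (norm (y - x0) powr s * norm (y - x0) ^ ?n)))"
    proof (cases "y \<in> ball x0 R")
      case False
      define D where "D = norm (y - x0)"
      define h where "h = norm (x - y)"
      define b where "b = max 0 (U y - l)"
      have D: "R \<le> D" "0 < D" using False r by (auto simp: D_def dist_norm norm_minus_commute)
      have "D \<le> norm (x - x0) + h" unfolding D_def h_def using norm_triangle_ineq4[of "x - x0" "x - y"] by simp
      moreover have "norm (x - x0) \<le> (r + R) / 2" using x by (simp add: dist_norm norm_minus_commute)
      ultimately have h1: "D - (r + R) / 2 \<le> h" by linarith
      have "(r + R) / 2 * R \<le> (r + R) / 2 * D" using D r by (intro mult_left_mono) auto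
      hence "D * (R - r) \<le> 2 * R * (D - (r + R) / 2)" by (simp add: algebra_simps)
      also have "\<dots> \<le> 2 * R * h" using h1 r by (intro mult_left_mono) auto
      also have "\<dots> \<le> 4 * R * h" using r by (simp add: h_def)
      finally have Dh: "D \<le> \<Theta> * h" using r by (simp add: \<Theta>_def field_simps)
      have "h \<noteq> 0" using Dh D by auto
      hence h: "0 < h" by (simp add: h_def)
      have Ds: "D powr s \<le> \<Theta> * h powr s"
      proof -
        have "D powr s \<le> (\<Theta> * h) powr s" using Dh D s by (intro powr_mono2) auto
        also have "\<dots> = \<Theta> powr s * h powr s" using \<Theta> h by (simp add: powr_mult)
        also have "\<dots> \<le> \<Theta> powr 1 * h powr s" using \<Theta> s by (intro mult_right_mono powr_mono) auto
        finally show ?thesis using \<Theta> by simp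
      qed
      have Dn: "D ^ ?n \<le> \<Theta> ^ ?n * h ^ ?n" unfolding power_mult_distrib[symmetric] using Dh D by (intro power_mono) auto
      have b0: "0 \<le> b" by (simp add: b_def)
      have "g (b / h powr s) \<le> g (\<Theta> * (b / D powr s))"
      proof (rule g_mono)
        have "b * D powr s \<le> b * (\<Theta> * h powr s)" using Ds b0 by (intro mult_left_mono) auto
        thus "b / h powr s \<le> \<Theta> * (b / D powr s)" using h D by (simp add: field_simps)
      qed (use b0 in auto)
      also have "\<dots> \<le> real N * \<Theta> ^ N * g (b / D powr s)" using \<Theta> b0 by (intro g_scale_upper) auto
      finally have gb: "g (b / h powr s) \<le> real N * \<Theta> ^ N * g (b / D powr s)" .
      have den: "1 / (h powr s * h ^ ?n) \<le> \<Theta> ^ (?n + 1) / (D powr s * D ^ ?n)"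
      proof -
        have "D powr s * D ^ ?n \<le> (\<Theta> * h powr s) * (\<Theta> ^ ?n * h ^ ?n)" using Ds Dn \<Theta> D by (intro mult_mono) auto
        thus ?thesis using h D by (simp add: field_simps)
      qed
      have "a * g (b / h powr s) / (h powr s * h ^ ?n) = a * (g (b / h powr s) * (1 / (h powr s * h ^ ?n)))" by simp
      also have "\<dots> \<le> a * ((real N * \<Theta> ^ N * g (b / D powr s)) * (\<Theta> ^ (?n + 1) / (D powr s * D ^ ?n)))"
        using a gb den \<Theta> b0 D h by (intro mult_left_mono mult_mono) (auto intro!: mult_nonneg_nonneg g_nonneg)
      also have "\<dots> = c * (g (b / D powr s) / (D powr s * D ^ ?n))" by (simp add: c_def power_add)
      finally have "a * g (b / h powr s) / (h powr s * h ^ ?n) \<le> c * (g (b / D powr s) / (D powr s * D ^ ?n))" .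
      hence "ennreal (a * g (b / h powr s) / (h powr s * h ^ ?n)) \<le> ennreal c * ennreal (g (b / D powr s) / (D powr s * D ^ ?n))"
        using c by (simp only: ennreal_mult'[symmetric] ennreal_leI)
      thus ?thesis using False b0 unfolding b_def[symmetric] D_def[symmetric] h_def[symmetric] by simp
    qed simp
  qed
  also have "\<dots> = ennreal c * tail s x0 R l U" unfolding tail_def by (rule nn_integral_cmult) measurable
  finally show ?thesis by (simp add: c_def \<Theta>_def)
qed

text \<open>The pointwise inequality is multiplied by \<Lambda> and integrated; the energy has
  nonpositive integral and drops out. The bad terms come in symmetric pairs, so each is twice a
  one-sided integral.\<close>

lemma caccioppoli:
  fixes s l \<Lambda> r R :: real and U :: "'a::euclidean_space \<Rightarrow> real" and x0 :: 'a
  assumes s: "0 < s" "s < 1" and r: "0 < r" "r < R" and L: "1 \<le> \<Lambda>"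
    and U[measurable]: "U \<in> borel_measurable borel"
    and k_bounds: "AE z in lebesgue \<Otimes>\<^sub>M lebesgue. 1 / \<Lambda> \<le> k (fst z) (snd z) \<and> k (fst z) (snd z) \<le> \<Lambda>"
  defines "w \<equiv> \<lambda>x. cutoff x0 r ((r + R) / 2) x ^ N * max 0 (U x - l)"
  assumes int: "integrable (lebesgue \<Otimes>\<^sub>M lebesgue) (energy_integrand s g k U w)" and en: "energy s g k U w \<le> 0"
  shows "(\<integral>\<^sup>+x. \<integral>\<^sup>+y. ennreal (cross s x0 r R l U x y) \<partial>lborel \<partial>lborel)
    \<le> ennreal (\<Lambda>\<^sup>2 * cacc_const s DIM('a) * (4 * R / (R - r)) ^ (N + DIM('a) + 1)) *
       (excess s x0 R l U + mass x0 R l U * tail s x0 R l U)"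
proof -
  let ?n = "DIM('a)" and ?K = "real N * real N ^ N"
  define \<rho> where "\<rho> = (r + R) / 2"
  define \<eta> where "\<eta> = cutoff x0 r \<rho>"
  define a where "a x = max 0 (U x - l)" for x
  define c1 where "c1 x y = indicator (ball x0 R) x * indicator (ball x0 R) y * (G \<bar>a x * (\<eta> x - \<eta> y) / norm (x - y) powr s\<bar> / norm (x - y) ^ ?n)" for x y
  define c2 where "c2 x y = indicator (ball x0 \<rho>) x * indicator (- ball x0 R) y * (a x * g \<bar>a y / norm (x - y) powr s\<bar> / (norm (x - y) powr s * norm (x - y) ^ ?n))" for x y
  define \<mu> where "\<mu> = 4 * R / (R - r)"
  define Cr where "Cr = unit_ball_vol (real ?n) * 2 ^ ?n / (1 - 2 powr (-((1 - s) * p)))"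
  have \<mu>: "1 \<le> \<mu>" using r by (simp add: \<mu>_def le_divide_eq)
  have "2 powr (-((1 - s) * p)) < 1" using s p_gt_1 by (simp add: powr_less_one)
  hence Cr: "0 \<le> Cr" by (auto simp: Cr_def intro!: divide_nonneg_nonneg mult_nonneg_nonneg)
  have [measurable]: "ball x0 R \<in> sets borel" "- ball x0 R \<in> sets borel" "ball x0 \<rho> \<in> sets borel" "ball x0 r \<in> sets borel" by auto
  have [measurable]: "\<eta> \<in> borel_measurable borel" "a \<in> borel_measurable borel" unfolding \<eta>_def a_def by measurable
  have c1m[measurable]: "(\<lambda>(x,y). c1 x y) \<in> borel_measurable (borel \<Otimes>\<^sub>M borel)" unfolding c1_def by measurable
  have c2m[measurable]: "(\<lambda>(x,y). c2 x y) \<in> borel_measurable (borel \<Otimes>\<^sub>M borel)" unfolding c2_def by measurable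
  have crm[measurable]: "(\<lambda>(x,y). cross s x0 r R l U x y) \<in> borel_measurable (borel \<Otimes>\<^sub>M borel)" unfolding cross_def by measurable
  have rr: "r < \<rho>" "\<rho> < R" using r by (auto simp: \<rho>_def)
  note cp = cutoff_props[OF rr(1), where ?x0.0 = x0, folded \<eta>_def]
  have a0: "0 \<le> a x" for x by (simp add: a_def)
  have c1_nn: "0 \<le> c1 x y" and c2_nn: "0 \<le> c2 x y" for x y
    using a0 by (auto simp: c1_def c2_def intro!: mult_nonneg_nonneg divide_nonneg_nonneg G_nonneg g_nonneg)
  have cross_nn: "0 \<le> cross s x0 r R l U x y" for x y
    by (auto simp: cross_def intro!: mult_nonneg_nonneg divide_nonneg_nonneg g_nonneg)
  define bad where "bad x y = ?K * (c1 x y + c1 y x) + (c2 x y + c2 y x)" for x y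
  have bad_nn: "0 \<le> bad x y" for x y using c1_nn c2_nn by (simp add: bad_def)
  have bm[measurable]: "(\<lambda>(x,y). bad x y) \<in> borel_measurable (borel \<Otimes>\<^sub>M borel)" unfolding bad_def by measurable
  define I where "I z = energy_integrand s g k U w z" for z
  have "(\<integral>\<^sup>+z. ennreal (cross s x0 r R l U (fst z) (snd z)) \<partial>(lebesgue \<Otimes>\<^sub>M lebesgue))
     \<le> (\<integral>\<^sup>+z. ennreal (\<Lambda>\<^sup>2 * bad (fst z) (snd z)) \<partial>(lebesgue \<Otimes>\<^sub>M lebesgue))"
  proof (rule nn_integral_le_of_integral_nonpos[where I = "\<lambda>z. \<Lambda> * I z"])
    show "(\<lambda>z. cross s x0 r R l U (fst z) (snd z)) \<in> borel_measurable (lebesgue \<Otimes>\<^sub>M lebesgue)"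
      using measurable_lebesgue_pairI[OF crm] by (simp add: case_prod_beta')
    show "(\<lambda>z. \<Lambda>\<^sup>2 * bad (fst z) (snd z)) \<in> borel_measurable (lebesgue \<Otimes>\<^sub>M lebesgue)"
      using measurable_lebesgue_pairI[OF bm] by (simp add: case_prod_beta')
    show "integrable (lebesgue \<Otimes>\<^sub>M lebesgue) (\<lambda>z. \<Lambda> * I z)" unfolding I_def using int by simp
    show "(\<integral>z. \<Lambda> * I z \<partial>(lebesgue \<Otimes>\<^sub>M lebesgue)) \<le> 0"
      using en L unfolding I_def energy_def by (simp add: mult_le_0_iff)
    show "0 \<le> cross s x0 r R l U (fst z) (snd z)" "0 \<le> \<Lambda>\<^sup>2 * bad (fst z) (snd z)" for z
      using cross_nn bad_nn by auto
    show "AE z in lebesgue \<Otimes>\<^sub>M lebesgue. cross s x0 r R l U (fst z) (snd z) \<le> \<Lambda> * I z + \<Lambda>\<^sup>2 * bad (fst z) (snd z)"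
      using k_bounds
    proof eventually_elim
      case (elim z)
      define x y where "x = fst z" and "y = snd z"
      have "cross s x0 r R l U x y / \<Lambda> \<le> I z + \<Lambda> * bad x y"
      proof -
        have Iz: "I z = g \<bar>(U x - U y) / norm (x - y) powr s\<bar> * sgn ((U x - U y) / norm (x - y) powr s) *
          ((\<eta> x ^ N * max 0 (U x - l) - \<eta> y ^ N * max 0 (U y - l)) / norm (x - y) powr s) * k x y / norm (x - y) ^ ?n"
          by (simp add: I_def energy_integrand_def Ds_def w_def \<eta>_def \<rho>_def x_def y_def)
        have "a y * (\<eta> x - \<eta> y) / norm (x - y) powr s = - (a y * (\<eta> y - \<eta> x) / norm (y - x) powr s)"
          by (simp add: norm_minus_commute minus_divide_left algebra_simps)
        hence c1s: "c1 y x = indicator (ball x0 R) x * indicator (ball x0 R) y * (G \<bar>a y * (\<eta> x - \<eta> y) / norm (x - y) powr s\<bar> / norm (x - y) ^ ?n)"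
          by (simp add: c1_def norm_minus_commute mult_ac)
        have c2s: "c2 y x = indicator (ball x0 \<rho>) y * indicator (- ball x0 R) x * (a y * g \<bar>a x / norm (x - y) powr s\<bar> / (norm (x - y) powr s * norm (x - y) ^ ?n))"
          by (simp add: c2_def norm_minus_commute)
        have B: "bad x y = indicator (ball x0 R) x * indicator (ball x0 R) y * ?K
               * (G \<bar>a x * (\<eta> x - \<eta> y) / norm (x - y) powr s\<bar> / norm (x - y) ^ ?n + G \<bar>a y * (\<eta> x - \<eta> y) / norm (x - y) powr s\<bar> / norm (x - y) ^ ?n)
              + c2 x y + c2 y x"
          unfolding bad_def c1s unfolding c1_def by (simp only: algebra_simps)
        show ?thesis
          unfolding Iz B c2s unfolding c2_def a_def \<eta>_def \<rho>_def
          by (rule caccioppoli_pointwise[OF r L]) (use elim in \<open>auto simp: x_def y_def\<close>)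
      qed
      hence "\<Lambda> * (cross s x0 r R l U x y / \<Lambda>) \<le> \<Lambda> * (I z + \<Lambda> * bad x y)" using L by (intro mult_left_mono) auto
      thus ?case using L by (simp add: x_def y_def power2_eq_square algebra_simps)
    qed
  qed
  also have "(\<integral>\<^sup>+z. ennreal (\<Lambda>\<^sup>2 * bad (fst z) (snd z)) \<partial>(lebesgue \<Otimes>\<^sub>M lebesgue))
     = (\<integral>\<^sup>+x. \<integral>\<^sup>+y. ennreal (\<Lambda>\<^sup>2 * bad x y) \<partial>lborel \<partial>lborel)"
    by (subst nn_integral_lebesgue_pair) simp_all
  also have "(\<integral>\<^sup>+z. ennreal (cross s x0 r R l U (fst z) (snd z)) \<partial>(lebesgue \<Otimes>\<^sub>M lebesgue))
     = (\<integral>\<^sup>+x. \<integral>\<^sup>+y. ennreal (cross s x0 r R l U x y) \<partial>lborel \<partial>lborel)"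
    by (subst nn_integral_lebesgue_pair) simp_all
  finally have main: "(\<integral>\<^sup>+x. \<integral>\<^sup>+y. ennreal (cross s x0 r R l U x y) \<partial>lborel \<partial>lborel)
     \<le> (\<integral>\<^sup>+x. \<integral>\<^sup>+y. ennreal (\<Lambda>\<^sup>2 * bad x y) \<partial>lborel \<partial>lborel)" .
  define J1 where "J1 = (\<integral>\<^sup>+x. \<integral>\<^sup>+y. ennreal (c1 x y) \<partial>lborel \<partial>lborel)"
  define J2 where "J2 = (\<integral>\<^sup>+x. \<integral>\<^sup>+y. ennreal (c2 x y) \<partial>lborel \<partial>lborel)"
  have J1': "(\<integral>\<^sup>+x. \<integral>\<^sup>+y. ennreal (c1 y x) \<partial>lborel \<partial>lborel) = J1" unfolding J1_def
    by (rule lborel_pair.Fubini') measurable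
  have J2': "(\<integral>\<^sup>+x. \<integral>\<^sup>+y. ennreal (c2 y x) \<partial>lborel \<partial>lborel) = J2" unfolding J2_def
    by (rule lborel_pair.Fubini') measurable
  have "ennreal (\<Lambda>\<^sup>2 * bad x y) = ennreal (\<Lambda>\<^sup>2) * (ennreal ?K * (ennreal (c1 x y) + ennreal (c1 y x)) + (ennreal (c2 x y) + ennreal (c2 y x)))" for x y
    unfolding bad_def using c1_nn c2_nn
    by (simp add: ennreal_mult'[symmetric] ennreal_plus[symmetric] del: ennreal_plus)
  hence "(\<integral>\<^sup>+x. \<integral>\<^sup>+y. ennreal (\<Lambda>\<^sup>2 * bad x y) \<partial>lborel \<partial>lborel) = ennreal (\<Lambda>\<^sup>2) * (ennreal ?K * (J1 + J1) + (J2 + J2))"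
    by (simp add: nn_integral_cmult nn_integral_add J1_def[symmetric] J2_def[symmetric] J1' J2')
  also have "J1 \<le> ennreal (\<mu>^N * Cr) * excess s x0 R l U"
  proof -
    have "J1 \<le> (\<integral>\<^sup>+x. ennreal (\<mu>^N * Cr) * (indicator (ball x0 R) x * ennreal (G \<bar>a x / R powr s\<bar>)) \<partial>lborel)"
      unfolding J1_def
    proof (rule nn_integral_mono)
      fix x
      show "(\<integral>\<^sup>+y. ennreal (c1 x y) \<partial>lborel) \<le> ennreal (\<mu>^N * Cr) * (indicator (ball x0 R) x * ennreal (G \<bar>a x / R powr s\<bar>))"
      proof (cases "x \<in> ball x0 R")
        case True
        have "(\<integral>\<^sup>+y. ennreal (c1 x y) \<partial>lborel) = (\<integral>\<^sup>+y. indicator (ball x0 R) y *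
          ennreal (G \<bar>a x * (\<eta> x - \<eta> y) / norm (x - y) powr s\<bar> / norm (x - y) ^ ?n) \<partial>lborel)"
          using True by (intro nn_integral_cong) (simp add: c1_def indicator_def)
        also have "\<dots> \<le> ennreal (\<mu>^N * Cr * G (a x / R powr s))"
          unfolding \<mu>_def Cr_def
        proof (rule cacc_near_bound[OF s r a0 True])
          show "\<bar>\<eta> x - \<eta> y\<bar> \<le> 2 / (R - r) * norm (x - y)" for y
            using cp(5)[of x y] by (simp add: \<rho>_def field_simps)
        qed measurable
        finally show ?thesis using True a0 \<mu> Cr by (simp add: ennreal_mult'[symmetric])
      qed (simp add: c1_def)
    qed
    also have "\<dots> = ennreal (\<mu>^N * Cr) * excess s x0 R l U"
      unfolding excess_def a_def by (rule nn_integral_cmult) measurable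
    finally show ?thesis .
  qed
  also have "J2 \<le> ennreal (real N * \<mu> ^ (N + ?n + 1)) * (mass x0 R l U * tail s x0 R l U)"
  proof -
    have "J2 \<le> (\<integral>\<^sup>+x. ennreal (real N * \<mu> ^ (N + ?n + 1)) * (indicator (ball x0 R) x * ennreal (a x) * tail s x0 R l U) \<partial>lborel)"
      unfolding J2_def
    proof (rule nn_integral_mono)
      fix x
      show "(\<integral>\<^sup>+y. ennreal (c2 x y) \<partial>lborel) \<le> ennreal (real N * \<mu> ^ (N + ?n + 1)) * (indicator (ball x0 R) x * ennreal (a x) * tail s x0 R l U)"
      proof (cases "x \<in> ball x0 \<rho>")
        case True
        hence xR: "x \<in> ball x0 R" using rr by auto
        have "(\<integral>\<^sup>+y. ennreal (c2 x y) \<partial>lborel) = (\<integral>\<^sup>+y. indicator (- ball x0 R) y *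
          ennreal (a x * g \<bar>max 0 (U y - l) / norm (x - y) powr s\<bar> / (norm (x - y) powr s * norm (x - y) ^ ?n)) \<partial>lborel)"
          using True by (intro nn_integral_cong) (simp add: c2_def indicator_def a_def)
        also have "\<dots> \<le> ennreal (real N * \<mu> ^ (N + ?n + 1) * a x) * tail s x0 R l U"
          unfolding \<mu>_def by (rule cacc_far_bound[OF s r a0]) (use True in \<open>simp_all add: \<rho>_def\<close>)
        finally show ?thesis using xR a0 \<mu> by (simp add: ennreal_mult mult.assoc)
      qed (simp add: c2_def)
    qed
    also have "\<dots> = ennreal (real N * \<mu> ^ (N + ?n + 1)) * (mass x0 R l U * tail s x0 R l U)"
      unfolding mass_def a_def by (simp add: nn_integral_cmult nn_integral_multc)
    finally show ?thesis .
  qed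
  finally have fin: "(\<integral>\<^sup>+x. \<integral>\<^sup>+y. ennreal (\<Lambda>\<^sup>2 * bad x y) \<partial>lborel \<partial>lborel) \<le> ennreal (\<Lambda>\<^sup>2) *
    (ennreal ?K * (ennreal (\<mu>^N * Cr) * excess s x0 R l U + ennreal (\<mu>^N * Cr) * excess s x0 R l U) +
     (ennreal (real N * \<mu> ^ (N + ?n + 1)) * (mass x0 R l U * tail s x0 R l U) + ennreal (real N * \<mu> ^ (N + ?n + 1)) * (mass x0 R l U * tail s x0 R l U)))"
    (is "_ \<le> ?rhs") by (simp add: add_mono mult_left_mono)
  \<comment> \<open>A single power of \<mu> dominates both coefficients, so one exponent suffices in
    \<open>dg_class\<close>.\<close>
  define M where "M = \<mu> ^ (N + ?n + 1)"
  have "N \<le> N + ?n + 1" by simp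
  from power_increasing[OF this \<mu>] one_le_power[OF \<mu>, of "N + ?n + 1"]
  have M: "\<mu>^N \<le> M" "1 \<le> M" unfolding M_def .
  have "?rhs = ennreal (\<Lambda>\<^sup>2) * (ennreal (2 * ?K * (\<mu>^N * Cr)) * excess s x0 R l U + ennreal (2 * (real N * M)) * (mass x0 R l U * tail s x0 R l U))"
  proof -
    have "ennreal (2 * t) = 2 * ennreal t" if "0 \<le> t" for t using that by (simp add: ennreal_mult)
    hence eqs: "ennreal (2 * ?K * (\<mu>^N * Cr)) = 2 * (ennreal ?K * ennreal (\<mu>^N * Cr))" "ennreal (2 * (real N * M)) = 2 * ennreal (real N * M)"
      using \<mu> Cr M by (auto simp: ennreal_mult'[symmetric] mult.assoc)
    have gen: "K * (A * E + A * E) + (B * X + B * X) = 2 * (K * A) * E + 2 * B * X" for K A E B X :: ennreal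
      unfolding mult_2 by (simp only: distrib_left distrib_right mult.assoc)
    show ?thesis unfolding M_def[symmetric] eqs gen ..
  qed
  also have "\<dots> \<le> ennreal (\<Lambda>\<^sup>2) * (ennreal (cacc_const s ?n * M) * excess s x0 R l U + ennreal (cacc_const s ?n * M) * (mass x0 R l U * tail s x0 R l U))"
  proof (intro mult_left_mono add_mono mult_right_mono ennreal_leI)
    have "2 * ?K * (\<mu>^N * Cr) = (2 * ?K * Cr) * \<mu>^N" by simp
    also have "\<dots> \<le> (2 * ?K * Cr) * M" using M Cr by (intro mult_left_mono) auto
    also have "\<dots> \<le> cacc_const s ?n * M" unfolding cacc_const_def Cr_def[symmetric] using M by (intro mult_right_mono) auto
    finally show "2 * ?K * (\<mu>^N * Cr) \<le> cacc_const s ?n * M" .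
    show "2 * (real N * M) \<le> cacc_const s ?n * M"
      unfolding cacc_const_def Cr_def[symmetric] using M Cr by (simp add: algebra_simps)
  qed auto
  also have "\<dots> = ennreal (\<Lambda>\<^sup>2 * (cacc_const s ?n * M)) * (excess s x0 R l U + mass x0 R l U * tail s x0 R l U)"
    by (simp add: ennreal_mult' distrib_left mult.assoc)
  finally show ?thesis using main fin by (simp add: M_def \<mu>_def mult.assoc)
qed

section \<open>De Giorgi iteration\<close>

text \<open>Encodes what the iteration uses of the equation: a level-set inequality on concentric
  balls. The threshold \<open>k0\<close> reflects the obstacle, which restricts the levels available
  for u but not those for -u.\<close>

definition dg_class :: "real \<Rightarrow> real \<Rightarrow> 'a::euclidean_space \<Rightarrow> real \<Rightarrow> real \<Rightarrow> ('a \<Rightarrow> real) \<Rightarrow> bool" where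
  "dg_class s C x0 R0 k0 U \<longleftrightarrow> U \<in> borel_measurable borel \<and>
     (\<forall>l\<ge>k0. \<forall>r R. 0 < r \<and> r < R \<and> R \<le> R0 \<longrightarrow>
       (\<integral>\<^sup>+x. \<integral>\<^sup>+y. ennreal (cross s x0 r R l U x y) \<partial>lborel \<partial>lborel)
       \<le> ennreal (C * (R / (R - r)) ^ (N + DIM('a) + 1)) * (excess s x0 R l U + mass x0 R l U * tail s x0 R l U))"

text \<open>The excess with the scale \<open>Q\<close> of the values decoupled from the radius, as needed along shrinking balls.\<close>

definition wexc :: "real \<Rightarrow> 'a::euclidean_space \<Rightarrow> real \<Rightarrow> real \<Rightarrow> ('a \<Rightarrow> real) \<Rightarrow> ennreal" where
  "wexc Q x0 r l U = (\<integral>\<^sup>+x. indicator (ball x0 r) x * ennreal (G \<bar>max 0 (U x - l) / Q\<bar>) \<partial>lborel)"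

lemma excess_eq_wexc: "excess s x0 R l U = wexc (R powr s) x0 R l U"
  by (simp add: excess_def wexc_def)

lemma dg_class_mono: "dg_class s C x0 R0 k0 U \<Longrightarrow> k0 \<le> k1 \<Longrightarrow> R1 \<le> R0 \<Longrightarrow> dg_class s C x0 R1 k1 U"
  unfolding dg_class_def by (meson order_trans)

lemma wexc_mono:
  assumes "r \<le> r'" "l' \<le> l" "0 < Q" shows "wexc Q x0 r l U \<le> wexc Q x0 r' l' U"
  unfolding wexc_def
proof (rule nn_integral_mono)
  fix x
  have "\<bar>max 0 (U x - l) / Q\<bar> \<le> \<bar>max 0 (U x - l') / Q\<bar>" using assms by (auto simp: divide_right_mono)
  hence "ennreal (G \<bar>max 0 (U x - l) / Q\<bar>) \<le> ennreal (G \<bar>max 0 (U x - l') / Q\<bar>)" by (intro ennreal_leI G_mono) auto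
  thus "indicator (ball x0 r) x * ennreal (G \<bar>max 0 (U x - l) / Q\<bar>)
      \<le> indicator (ball x0 r') x * ennreal (G \<bar>max 0 (U x - l') / Q\<bar>)"
    using assms by (auto simp: indicator_def)
qed

lemma tail_mono:
  fixes x0 :: "'a::euclidean_space"
  assumes "r \<le> r'" "l' \<le> l" shows "tail s x0 r' l U \<le> tail s x0 r l' U"
  unfolding tail_def
proof (rule nn_integral_mono)
  fix y :: 'a
  have "\<bar>max 0 (U y - l) / norm (y - x0) powr s\<bar> \<le> \<bar>max 0 (U y - l') / norm (y - x0) powr s\<bar>"
    using assms by (auto simp: divide_right_mono)
  hence "g \<bar>max 0 (U y - l) / norm (y - x0) powr s\<bar> / (norm (y - x0) powr s * norm (y - x0) ^ DIM('a))
    \<le> g \<bar>max 0 (U y - l') / norm (y - x0) powr s\<bar> / (norm (y - x0) powr s * norm (y - x0) ^ DIM('a))"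
    by (intro divide_right_mono g_mono) auto
  thus "indicator (- ball x0 r') y * ennreal (g \<bar>max 0 (U y - l) / norm (y - x0) powr s\<bar> / (norm (y - x0) powr s * norm (y - x0) ^ DIM('a)))
    \<le> indicator (- ball x0 r) y * ennreal (g \<bar>max 0 (U y - l') / norm (y - x0) powr s\<bar> / (norm (y - x0) powr s * norm (y - x0) ^ DIM('a)))"
    using assms by (auto simp: indicator_def intro!: ennreal_leI)
qed

text \<open>Replaces the Sobolev inequality: each point of \<open>{U > l}\<close> sees the sub-level set in at least half of a ball of radius \<open>\<rho>\<close>.\<close>

lemma cross_lower:
  fixes U :: "'a::euclidean_space \<Rightarrow> real" and x0 :: 'a
  assumes s: "0 < s" "s < 1" and [measurable]: "U \<in> borel_measurable borel"
    and \<rho>: "0 < \<rho>" "\<rho> \<le> R" "r' + \<rho> \<le> r"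
    and A: "emeasure lborel (ball x0 r \<inter> {x. l < U x}) \<le> ennreal (unit_ball_vol (real DIM('a)) / 2 * \<rho> ^ DIM('a))"
  shows "ennreal (unit_ball_vol (real DIM('a)) / 2 * (R / \<rho>) powr (s * p)) * wexc (R powr s) x0 r' l U
    \<le> (\<integral>\<^sup>+x. \<integral>\<^sup>+y. ennreal (cross s x0 r' r l U x y) \<partial>lborel \<partial>lborel)"
proof -
  let ?n = "DIM('a)"
  define \<omega> where "\<omega> = unit_ball_vol (real ?n)"
  have \<omega>: "0 < \<omega>" by (simp add: \<omega>_def)
  have [measurable]: "ball x0 r \<in> sets borel" "ball x0 r' \<in> sets borel" by auto
  define E where "E = ball x0 r \<inter> {x. l < U x}"
  have Em[measurable]: "E \<in> sets borel" unfolding E_def by measurable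
  have R: "0 < R" using \<rho> by simp
  have "ennreal (\<omega> / 2 * (R / \<rho>) powr (s * p)) * wexc (R powr s) x0 r' l U
    = (\<integral>\<^sup>+x. ennreal (\<omega> / 2 * (R / \<rho>) powr (s * p)) * (indicator (ball x0 r') x * ennreal (G \<bar>max 0 (U x - l) / R powr s\<bar>)) \<partial>lborel)"
    unfolding wexc_def by (rule nn_integral_cmult[symmetric]) measurable
  also have "\<dots> \<le> (\<integral>\<^sup>+x. \<integral>\<^sup>+y. ennreal (cross s x0 r' r l U x y) \<partial>lborel \<partial>lborel)"
  proof (rule nn_integral_mono)
    fix x
    show "ennreal (\<omega> / 2 * (R / \<rho>) powr (s * p)) * (indicator (ball x0 r') x * ennreal (G \<bar>max 0 (U x - l) / R powr s\<bar>))
       \<le> (\<integral>\<^sup>+y. ennreal (cross s x0 r' r l U x y) \<partial>lborel)"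
    proof (cases "x \<in> ball x0 r' \<and> l < U x")
      case True
      define a where "a = U x - l"
      have a: "0 < a" using True by (simp add: a_def)
      define c where "c = a * g (a / \<rho> powr s) / (\<rho> powr s * \<rho> ^ ?n)"
      have c: "0 \<le> c" using a \<rho> by (auto simp: c_def intro!: divide_nonneg_nonneg mult_nonneg_nonneg g_nonneg)
      have [measurable]: "ball x \<rho> \<in> sets borel" by auto
      have sub: "ball x \<rho> \<subseteq> ball x0 r"
      proof
        fix y assume "y \<in> ball x \<rho>"
        hence "dist x0 x + dist x y < r" using True \<rho> by simp
        thus "y \<in> ball x0 r" using dist_triangle[of x0 y x] by simp
      qed
      have "ennreal (\<omega> * \<rho> ^ ?n) = emeasure lborel (ball x \<rho>)" using \<rho> by (simp add: emeasure_ball \<omega>_def)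
      also have "\<dots> \<le> emeasure lborel ((ball x \<rho> - E) \<union> E)" by (rule emeasure_mono) auto
      also have "\<dots> \<le> emeasure lborel (ball x \<rho> - E) + emeasure lborel E" by (rule emeasure_subadditive) auto
      also have "\<dots> \<le> emeasure lborel (ball x \<rho> - E) + ennreal (\<omega> / 2 * \<rho> ^ ?n)"
        using A by (intro add_mono) (auto simp: E_def \<omega>_def)
      finally have 1: "ennreal (\<omega> * \<rho> ^ ?n) \<le> emeasure lborel (ball x \<rho> - E) + ennreal (\<omega> / 2 * \<rho> ^ ?n)" .
      have half: "ennreal (\<omega> / 2 * \<rho> ^ ?n) \<le> emeasure lborel (ball x \<rho> - E)"
      proof (cases "emeasure lborel (ball x \<rho> - E)")
        case (real e)
        hence "ennreal (\<omega> * \<rho> ^ ?n) \<le> ennreal (e + \<omega> / 2 * \<rho> ^ ?n)" using 1 \<omega> \<rho> by (simp add: ennreal_plus)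
        hence "\<omega> * \<rho> ^ ?n \<le> e + \<omega> / 2 * \<rho> ^ ?n" using real \<omega> \<rho> by (subst (asm) ennreal_le_iff) auto
        thus ?thesis using real by (auto intro!: ennreal_leI)
      qed simp
      define t where "t = a / R powr s"
      have t: "0 \<le> t" using a by (simp add: t_def)
      \<comment> \<open>The gain: replacing the scale R^s by the smaller \<rho>^s multiplies the
        argument of \<open>G\<close> by (R/\<rho>)^s, hence its value by at least (R/\<rho>)^(s
        p).\<close>
      have cG: "(R / \<rho>) powr (s * p) * G t \<le> c * \<rho> ^ ?n"
      proof -
        have "(R / \<rho>) powr (s * p) * G t = ((R / \<rho>) powr s) powr p * G t" by (simp add: powr_powr)
        also have "\<dots> \<le> G ((R / \<rho>) powr s * t)" using \<rho> s t by (intro G_scale_lower ge_one_powr_ge_zero) auto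
        also have "(R / \<rho>) powr s * t = a / \<rho> powr s" using R \<rho> by (simp add: t_def powr_divide)
        also have "G (a / \<rho> powr s) \<le> a / \<rho> powr s * g (a / \<rho> powr s)" using a by (intro G_le_tg) auto
        also have "\<dots> = c * \<rho> ^ ?n" using \<rho> by (simp add: c_def)
        finally show ?thesis .
      qed
      have "ennreal (\<omega> / 2 * (R / \<rho>) powr (s * p)) * (indicator (ball x0 r') x * ennreal (G \<bar>max 0 (U x - l) / R powr s\<bar>))
        = ennreal (\<omega> / 2 * ((R / \<rho>) powr (s * p) * G t))"
        using True a \<omega> by (simp add: t_def a_def ennreal_mult'[symmetric] G_nonneg mult.assoc)
      also have "\<dots> \<le> ennreal (\<omega> / 2 * (c * \<rho> ^ ?n))" using cG \<omega> by (intro ennreal_leI mult_left_mono) auto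
      also have "\<dots> = ennreal c * ennreal (\<omega> / 2 * \<rho> ^ ?n)" using c by (simp add: ennreal_mult'[symmetric] mult_ac)
      also have "\<dots> \<le> ennreal c * emeasure lborel (ball x \<rho> - E)" by (intro mult_left_mono half) auto
      also have "\<dots> = (\<integral>\<^sup>+y. ennreal c * indicator (ball x \<rho> - E) y \<partial>lborel)" by (rule nn_integral_cmult_indicator[symmetric]) auto
      also have "\<dots> \<le> (\<integral>\<^sup>+y. ennreal (cross s x0 r' r l U x y) \<partial>lborel)"
      proof (rule nn_integral_mono)
        fix y
        show "ennreal c * indicator (ball x \<rho> - E) y \<le> ennreal (cross s x0 r' r l U x y)"
        proof (cases "y \<in> ball x \<rho> - E")
          case yin: True
          hence y: "U y \<le> l" "y \<in> ball x0 r" using sub by (auto simp: E_def)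
          hence "x \<noteq> y" using True by auto
          define d where "d = norm (x - y)"
          have d: "0 < d" "d \<le> \<rho>" using yin \<open>x \<noteq> y\<close> by (auto simp: d_def dist_norm)
          have ds: "d powr s \<le> \<rho> powr s" "0 < d powr s" using d s by (auto intro: powr_mono2)
          have "a / \<rho> powr s \<le> (U x - U y) / d powr s"
            using y a ds \<rho> by (intro frac_le) (auto simp: a_def)
          moreover have "0 \<le> U x - U y" using y True by simp
          ultimately have gg: "g (a / \<rho> powr s) \<le> g \<bar>(U x - U y) / d powr s\<bar>" using a by (intro g_mono) auto
          have "c \<le> a * g \<bar>(U x - U y) / d powr s\<bar> / (d powr s * d ^ ?n)" unfolding c_def
            using a d gg ds by (intro frac_le mult_mono mult_left_mono power_mono mult_nonneg_nonneg g_nonneg) auto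
          also have "\<dots> = cross s x0 r' r l U x y" using True y by (simp add: cross_def d_def a_def)
          finally show ?thesis using yin by (simp add: ennreal_leI)
        qed simp
      qed
      finally show ?thesis .
    next
      case False
      thus ?thesis by (auto simp: indicator_def)
    qed
  qed
  finally show ?thesis by (simp add: \<omega>_def)
qed

text \<open>Chebyshev's inequality: above l + h the integrand of the excess is at least G (h /
  Q).\<close>

lemma superlevel_measure:
  fixes U :: "'a::euclidean_space \<Rightarrow> real" and x0 :: 'a
  assumes [measurable]: "U \<in> borel_measurable borel" and Q: "0 < Q" and h: "0 < h" and V: "0 < V" "V \<le> G (h / Q)"
    and Y: "wexc Q x0 r l U \<le> ennreal (V * y)" and y: "0 \<le> y"
  shows "emeasure lborel (ball x0 r \<inter> {x. l + h < U x}) \<le> ennreal y"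
proof -
  have [measurable]: "ball x0 r \<in> sets borel" by auto
  have "ennreal V * emeasure lborel (ball x0 r \<inter> {x. l + h < U x})
     = (\<integral>\<^sup>+x. ennreal V * indicator (ball x0 r \<inter> {x. l + h < U x}) x \<partial>lborel)"
    by (rule nn_integral_cmult_indicator[symmetric]) measurable
  also have "\<dots> \<le> wexc Q x0 r l U" unfolding wexc_def
  proof (rule nn_integral_mono)
    fix x
    show "ennreal V * indicator (ball x0 r \<inter> {x. l + h < U x}) x \<le> indicator (ball x0 r) x * ennreal (G \<bar>max 0 (U x - l) / Q\<bar>)"
    proof (cases "x \<in> ball x0 r \<and> l + h < U x")
      case True
      have "V \<le> G \<bar>max 0 (U x - l) / Q\<bar>" using True Q h
        by (intro order_trans[OF V(2)] G_mono) (auto intro!: divide_right_mono)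
      thus ?thesis using True by (simp add: ennreal_leI)
    qed (auto simp: indicator_def)
  qed
  also have "\<dots> \<le> ennreal V * ennreal y" using Y V by (simp add: ennreal_mult')
  finally have "ennreal V * emeasure lborel (ball x0 r \<inter> {x. l + h < U x}) \<le> ennreal V * ennreal y" .
  thus ?thesis using V by (subst (asm) ennreal_mult_le_mult_iff) auto
qed

text \<open>One step from stage j to j + 1. The product of mass and tail reduces to the excess at
  the lower level: where U exceeds the upper level it exceeds the lower one by at least H / 2^(j+1),
  so g (H / R^s) is at most a power of 2 times \<open>g\<close> at the actual height, and t g(t)
  \<le> N G(t) finishes.\<close>

lemma de_giorgi_upper:
  fixes U :: "'a::euclidean_space \<Rightarrow> real" and x0 :: 'a and l H :: real and j :: nat
  assumes s: "0 < s" "s < 1" and dg: "dg_class s C x0 R k0 U" and C: "0 \<le> C" "0 \<le> C1" and R: "0 < R"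
    and l: "k0 \<le> l" and H: "0 < H" and tl: "tail s x0 (R/2) l U \<le> ennreal (C1 * g (H / R powr s) / R powr s)"
  defines "r \<equiv> \<lambda>j::nat. R / 2 * (1 + 1 / 2^j)" and "L \<equiv> \<lambda>j::nat. l + H * (1 - 1 / 2^j)"
  shows "(\<integral>\<^sup>+x. \<integral>\<^sup>+y. ennreal (cross s x0 (r (Suc j)) (r j) (L (Suc j)) U x y) \<partial>lborel \<partial>lborel)
     \<le> ennreal (C * (2^N + C1 * real N ^ 2) * 2 ^ (2 * (2 * N + DIM('a) + 1)) * (2 ^ (2 * N + DIM('a) + 1)) ^ j) * wexc (R powr s) x0 (r j) (L j) U"
proof -
  let ?D = "N + DIM('a) + 1" and ?Q = "R powr s"
  have [measurable]: "U \<in> borel_measurable borel" using dg by (simp add: dg_class_def)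
  have [measurable]: "ball x0 (r j) \<in> sets borel" by auto
  have Q: "0 < ?Q" using R by simp
  have rj: "r j - r (Suc j) = R / 2^(j+2)" by (simp add: r_def field_simps)
  have r_bd: "R / 2 \<le> r j" "r j \<le> R" "0 < r (Suc j)" "r (Suc j) < r j"
  proof -
    show "R / 2 \<le> r j" "r j \<le> R" "0 < r (Suc j)" using R by (auto simp: r_def add_pos_pos divide_le_eq)
    have "0 < R / 2^(j+2)" using R by simp
    thus "r (Suc j) < r j" using rj by simp
  qed
  have Lj: "L (Suc j) - L j = H / 2^(j+1)" by (simp add: L_def field_simps)
  have "0 \<le> H * (1 - 1 / 2 ^ Suc j)" using H one_le_power[of "2::real" "Suc j"] by (intro mult_nonneg_nonneg) auto
  moreover have "0 < H / 2^(j+1)" using H by simp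
  ultimately have L_bd: "l \<le> L (Suc j)" "L j \<le> L (Suc j)" using Lj by (simp_all add: L_def)
  define Y where "Y = wexc ?Q x0 (r j) (L j) U"
  have "(\<integral>\<^sup>+x. \<integral>\<^sup>+y. ennreal (cross s x0 (r (Suc j)) (r j) (L (Suc j)) U x y) \<partial>lborel \<partial>lborel)
     \<le> ennreal (C * (r j / (r j - r (Suc j))) ^ ?D) * (excess s x0 (r j) (L (Suc j)) U + mass x0 (r j) (L (Suc j)) U * tail s x0 (r j) (L (Suc j)) U)"
    using dg l L_bd r_bd unfolding dg_class_def by auto
  also have "\<dots> \<le> ennreal (C * (2^(j+2)) ^ ?D) * (ennreal (2^N) * Y + ennreal (C1 * real N ^ 2 * 2^((j+1)*N)) * Y)"
  proof (rule mult_mono[OF _ add_mono])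
    show "ennreal (C * (r j / (r j - r (Suc j))) ^ ?D) \<le> ennreal (C * (2^(j+2)) ^ ?D)"
    proof (intro ennreal_leI mult_left_mono power_mono)
      show "r j / (r j - r (Suc j)) \<le> 2^(j+2)" unfolding rj using R r_bd by (simp add: field_simps)
    qed (use C r_bd in auto)
    show "excess s x0 (r j) (L (Suc j)) U \<le> ennreal (2^N) * Y"
    proof -
      have "excess s x0 (r j) (L (Suc j)) U \<le> (\<integral>\<^sup>+x. ennreal (2^N) * (indicator (ball x0 (r j)) x * ennreal (G \<bar>max 0 (U x - L j) / ?Q\<bar>)) \<partial>lborel)"
        unfolding excess_def
      proof (rule nn_integral_mono)
        fix x
        \<comment> \<open>Radii stay above R/2, so r_j^s can be traded for the fixed scale R^s at
          the price of a factor 2.\<close>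
        have q: "?Q \<le> 2 * r j powr s"
        proof -
          have "?Q \<le> (2 * r j) powr s" using r_bd R s by (intro powr_mono2) auto
          also have "\<dots> = 2 powr s * r j powr s" using r_bd by (simp add: powr_mult)
          also have "\<dots> \<le> 2 powr 1 * r j powr s" using s by (intro mult_right_mono powr_mono) auto
          finally show ?thesis by simp
        qed
        have rp: "0 < r j powr s" using r_bd by simp
        have "max 0 (U x - L (Suc j)) / r j powr s \<le> 2 * (max 0 (U x - L j) / ?Q)"
        proof -
          have "max 0 (U x - L (Suc j)) * ?Q \<le> max 0 (U x - L j) * (2 * r j powr s)"
            using q L_bd Q by (intro mult_mono) auto
          thus ?thesis using rp Q by (simp add: field_simps)
        qed
        hence "G \<bar>max 0 (U x - L (Suc j)) / r j powr s\<bar> \<le> G (2 * \<bar>max 0 (U x - L j) / ?Q\<bar>)"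
          by (intro G_mono) auto
        also have "\<dots> \<le> 2^N * G \<bar>max 0 (U x - L j) / ?Q\<bar>" by (intro G_scale_upper) auto
        finally have "ennreal (G \<bar>max 0 (U x - L (Suc j)) / r j powr s\<bar>) \<le> ennreal (2^N) * ennreal (G \<bar>max 0 (U x - L j) / ?Q\<bar>)"
          by (simp only: ennreal_mult'[symmetric] ennreal_leI zero_le_power zero_le_numeral)
        thus "indicator (ball x0 (r j)) x * ennreal (G \<bar>max 0 (U x - L (Suc j)) / r j powr s\<bar>)
          \<le> ennreal (2^N) * (indicator (ball x0 (r j)) x * ennreal (G \<bar>max 0 (U x - L j) / ?Q\<bar>))"
          by (auto simp: indicator_def)
      qed
      also have "\<dots> = ennreal (2^N) * Y" unfolding Y_def wexc_def by (rule nn_integral_cmult) measurable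
      finally show ?thesis .
    qed
    define T where "T = g (H / ?Q) / ?Q"
    have T: "0 \<le> T" using H Q by (auto simp: T_def intro!: divide_nonneg_nonneg g_nonneg)
    show "mass x0 (r j) (L (Suc j)) U * tail s x0 (r j) (L (Suc j)) U \<le> ennreal (C1 * real N ^ 2 * 2^((j+1)*N)) * Y"
    proof -
      have "tail s x0 (r j) (L (Suc j)) U \<le> tail s x0 (R/2) l U" using r_bd L_bd by (intro tail_mono)
      also have "\<dots> \<le> ennreal (C1 * T)" using tl by (simp add: T_def)
      finally have "mass x0 (r j) (L (Suc j)) U * tail s x0 (r j) (L (Suc j)) U \<le> mass x0 (r j) (L (Suc j)) U * ennreal (C1 * T)"
        by (rule mult_left_mono) simp
      also have "\<dots> = (\<integral>\<^sup>+x. indicator (ball x0 (r j)) x * ennreal (max 0 (U x - L (Suc j))) * ennreal (C1 * T) \<partial>lborel)"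
        unfolding mass_def by (rule nn_integral_multc[symmetric]) measurable
      also have "\<dots> \<le> (\<integral>\<^sup>+x. ennreal (C1 * real N ^ 2 * 2^((j+1)*N)) * (indicator (ball x0 (r j)) x * ennreal (G \<bar>max 0 (U x - L j) / ?Q\<bar>)) \<partial>lborel)"
      proof (rule nn_integral_mono)
        fix x
        have "max 0 (U x - L (Suc j)) * (C1 * T) \<le> C1 * real N ^ 2 * 2^((j+1)*N) * G \<bar>max 0 (U x - L j) / ?Q\<bar>"
        proof (cases "L (Suc j) < U x")
          case True
          define a where "a = U x - L j"
          have "H / 2^(j+1) \<le> a" using True Lj by (simp add: a_def)
          hence Ha: "H \<le> 2^(j+1) * a" by (simp add: field_simps)
          have a: "0 < a" using Lj True H by (simp add: a_def) (smt (verit) L_bd(2))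
          have "g (H / ?Q) \<le> g (2^(j+1) * (a / ?Q))"
            using Ha H Q by (intro g_mono) (auto simp: divide_right_mono)
          also have "\<dots> \<le> real N * (2^(j+1))^N * g (a / ?Q)" using a Q one_le_power[of "2::real" "j+1"] by (intro g_scale_upper) auto
          finally have gH: "g (H / ?Q) \<le> real N * 2^((j+1)*N) * g (a / ?Q)" unfolding power_mult .
          have "max 0 (U x - L (Suc j)) * (C1 * T) \<le> a * (C1 * T)"
            using C T a L_bd by (intro mult_right_mono) (auto simp: a_def)
          also have "\<dots> = C1 * (a / ?Q * g (H / ?Q))" by (simp add: T_def)
          also have "\<dots> \<le> C1 * (a / ?Q * (real N * 2^((j+1)*N) * g (a / ?Q)))"
            using C a Q gH by (intro mult_left_mono) auto
          also have "\<dots> = C1 * real N * 2^((j+1)*N) * (a / ?Q * g (a / ?Q))" by simp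
          also have "\<dots> \<le> C1 * real N * 2^((j+1)*N) * (real N * G (a / ?Q))"
            using C a Q by (intro mult_left_mono tg_le) auto
          also have "\<dots> = C1 * real N ^ 2 * 2^((j+1)*N) * G \<bar>max 0 (U x - L j) / ?Q\<bar>"
            using a by (simp add: a_def power2_eq_square)
          finally show ?thesis .
        next
          case False
          thus ?thesis using C by (auto intro!: mult_nonneg_nonneg G_nonneg)
        qed
        hence "ennreal (max 0 (U x - L (Suc j))) * ennreal (C1 * T) \<le> ennreal (C1 * real N ^ 2 * 2^((j+1)*N)) * ennreal (G \<bar>max 0 (U x - L j) / ?Q\<bar>)"
          using C T by (simp add: ennreal_mult'[symmetric] ennreal_leI)
        thus "indicator (ball x0 (r j)) x * ennreal (max 0 (U x - L (Suc j))) * ennreal (C1 * T)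
          \<le> ennreal (C1 * real N ^ 2 * 2^((j+1)*N)) * (indicator (ball x0 (r j)) x * ennreal (G \<bar>max 0 (U x - L j) / ?Q\<bar>))"
          by (auto simp: indicator_def)
      qed
      also have "\<dots> = ennreal (C1 * real N ^ 2 * 2^((j+1)*N)) * Y" unfolding Y_def wexc_def by (rule nn_integral_cmult) measurable
      finally show ?thesis .
    qed
  qed auto
  also have "\<dots> = ennreal (C * (2^(j+2)) ^ ?D * (2^N + C1 * real N ^ 2 * 2^((j+1)*N))) * Y"
    using C by (simp add: ennreal_mult' ennreal_plus distrib_right mult.assoc)
  also have "\<dots> \<le> ennreal (C * (2^N + C1 * real N ^ 2) * 2 ^ (2 * (2 * N + DIM('a) + 1)) * (2 ^ (2 * N + DIM('a) + 1)) ^ j) * Y"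
  proof (intro mult_right_mono ennreal_leI)
    have "2^N + C1 * real N ^ 2 * 2^((j+1)*N) \<le> (2^N + C1 * real N ^ 2) * 2^((j+2)*N)"
    proof -
      have "2^N * 1 \<le> 2^N * (2::real)^((j+2)*N)" by (intro mult_left_mono one_le_power) auto
      moreover have "C1 * real N ^ 2 * 2^((j+1)*N) \<le> C1 * real N ^ 2 * 2^((j+2)*N)"
        using C by (intro mult_left_mono power_increasing) auto
      ultimately show ?thesis unfolding distrib_right mult_1_right by (rule add_mono)
    qed
    hence "C * (2^(j+2)) ^ ?D * (2^N + C1 * real N ^ 2 * 2^((j+1)*N)) \<le> C * (2^(j+2)) ^ ?D * ((2^N + C1 * real N ^ 2) * 2^((j+2)*N))"
      using C by (intro mult_left_mono) auto
    also have "\<dots> = C * (2^N + C1 * real N ^ 2) * 2 ^ ((j+2) * ?D + (j+2) * N)"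
      by (simp only: power_add power_mult) (simp only: mult_ac)
    also have "(j+2) * ?D + (j+2) * N = 2 * (2 * N + DIM('a) + 1) + (2 * N + DIM('a) + 1) * j" by (simp add: algebra_simps)
    finally show "C * (2^(j+2)) ^ ?D * (2^N + C1 * real N ^ 2 * 2^((j+1)*N)) \<le>
      C * (2^N + C1 * real N ^ 2) * 2 ^ (2 * (2 * N + DIM('a) + 1)) * (2 ^ (2 * N + DIM('a) + 1)) ^ j"
      by (simp only: power_add power_mult mult.assoc)
  qed simp
  finally show ?thesis unfolding Y_def .
qed

lemma ennreal_le_divI:
  assumes "0 < c" "0 \<le> d" "ennreal c * Y \<le> ennreal d" shows "Y \<le> ennreal (d / c)"
proof -
  have "ennreal c * Y \<le> ennreal c * ennreal (d / c)" using assms by (simp add: ennreal_mult'[symmetric])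
  thus ?thesis using assms by (subst (asm) ennreal_mult_le_mult_iff) auto
qed

text \<open>The decay of the excess is prescribed as \<epsilon> lam^j and proved by induction. The
  induction hypothesis makes the super-level set, by Chebyshev, small enough for
  \<open>cross_lower\<close> with radius R \<kappa> \<mu>^j; the gain from this radius compensates
  the factor A B^j from \<open>de_giorgi_upper\<close>. The number \<epsilon> is independent of
  centre, radius, height and function.\<close>

lemma de_giorgi:
  assumes s: "0 < s" "s < 1" and C: "0 \<le> C" "0 \<le> C1"
  shows "\<exists>\<epsilon>>0. \<forall>(x0::'a::euclidean_space) R k0 U l H. 0 < R \<longrightarrow> 0 < H \<longrightarrow> k0 \<le> l \<longrightarrow> dg_class s C x0 R k0 U
     \<longrightarrow> tail s x0 (R/2) l U \<le> ennreal (C1 * g (H / R powr s) / R powr s)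
     \<longrightarrow> excess s x0 R l U \<le> ennreal (\<epsilon> * R ^ DIM('a) * G (H / R powr s))
     \<longrightarrow> (AE x in lborel. x \<in> ball x0 (R/2) \<longrightarrow> U x \<le> l + H)"
proof -
  let ?n = "DIM('a)"
  define \<omega> where "\<omega> = unit_ball_vol (real ?n)"
  have \<omega>: "0 < \<omega>" by (simp add: \<omega>_def)
  define A where "A = C * (2^N + C1 * real N ^ 2) * 2 ^ (2 * (2 * N + ?n + 1)) + 1"
  have A: "0 < A" "C * (2^N + C1 * real N ^ 2) * 2 ^ (2 * (2 * N + ?n + 1)) \<le> A"
    using C by (auto simp: A_def intro!: add_nonneg_pos mult_nonneg_nonneg add_nonneg_nonneg)
  define B where "B = (2::real) ^ (2 * N + ?n + 1)"
  have B: "1 \<le> B" unfolding B_def by (rule one_le_power) simp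
  define \<sigma> where "\<sigma> = s * p"
  have \<sigma>: "0 < \<sigma>" using s p_gt_1 by (simp add: \<sigma>_def)
  \<comment> \<open>The entry 1/2 keeps the small radii within the shrinking gaps between
    consecutive balls; the other makes B \<mu>^\<sigma> \<le> 1, cancelling the growth of the
    constants at every step.\<close>
  define \<mu> where "\<mu> = min (1/2) (B powr (- (1/\<sigma>)))"
  have \<mu>: "0 < \<mu>" "\<mu> \<le> 1/2" using B by (auto simp: \<mu>_def)
  have B\<mu>: "B * \<mu> powr \<sigma> \<le> 1"
  proof -
    have "\<mu> powr \<sigma> \<le> (B powr (- (1/\<sigma>))) powr \<sigma>" using \<mu> \<sigma> by (intro powr_mono2) (auto simp: \<mu>_def)
    also have "\<dots> = B powr (- (1/\<sigma>) * \<sigma>)" by (rule powr_powr)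
    also have "- (1/\<sigma>) * \<sigma> = -1" using \<sigma> by simp
    also have "B powr (-1) = 1 / B" using B by (simp add: powr_minus inverse_eq_divide)
    finally show ?thesis using B by (simp add: field_simps)
  qed
  \<comment> \<open>The rate at which the excess has to decay: \<mu>^n for the volume of the small
    ball, divided by 2^N because the level increments halve in Chebyshev's inequality.\<close>
  define lam where "lam = \<mu> ^ ?n / 2^N"
  have lam: "0 < lam" using \<mu> by (simp add: lam_def)
  have "\<mu> ^ ?n \<le> 1" using \<mu> by (intro power_le_one) auto
  hence lam1: "lam < 1" using N_pos by (simp add: lam_def divide_less_eq) (smt (verit) N_pos one_less_power)
  \<comment> \<open>Makes the remaining constant 2 A \<kappa>^\<sigma> / \<omega> at most
    \<open>lam\<close>; the entry 1/4 fits the first gap, which is R/4.\<close>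
  define \<kappa> where "\<kappa> = min (1/4) ((lam * \<omega> / (2 * A)) powr (1/\<sigma>))"
  have \<kappa>: "0 < \<kappa>" "\<kappa> \<le> 1/4" using lam \<omega> A by (auto simp: \<kappa>_def)
  have A\<kappa>: "2 * A / \<omega> * \<kappa> powr \<sigma> \<le> lam"
  proof -
    have "\<kappa> powr \<sigma> \<le> ((lam * \<omega> / (2 * A)) powr (1/\<sigma>)) powr \<sigma>" using \<kappa> \<sigma> by (intro powr_mono2) (auto simp: \<kappa>_def)
    also have "\<dots> = lam * \<omega> / (2 * A)" using \<sigma> lam \<omega> A by (simp add: powr_powr)
    finally show ?thesis using \<omega> A by (simp add: field_simps)
  qed
  \<comment> \<open>Makes the bound at stage j coincide with what Chebyshev's inequality needs for
    half the volume of the small ball.\<close>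
  define \<epsilon> where "\<epsilon> = \<omega> / 2 * \<kappa> ^ ?n / 2^N"
  have \<epsilon>: "0 < \<epsilon>" using \<omega> \<kappa> by (simp add: \<epsilon>_def)
  show ?thesis
  proof (intro exI[of _ \<epsilon>] conjI \<epsilon> allI impI)
    fix x0 :: 'a and R k0 U l H
    assume R: "0 < R" and H: "0 < H" and l: "k0 \<le> l" and dg: "dg_class s C x0 R k0 U"
      and tl: "tail s x0 (R/2) l U \<le> ennreal (C1 * g (H / R powr s) / R powr s)"
      and ex: "excess s x0 R l U \<le> ennreal (\<epsilon> * R ^ ?n * G (H / R powr s))"
    have [measurable]: "U \<in> borel_measurable borel" using dg by (simp add: dg_class_def)
    define r where "r j = R / 2 * (1 + 1 / 2^j)" for j :: nat
    define L where "L j = l + H * (1 - 1 / 2^j)" for j :: nat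
    define Q where "Q = R powr s"
    have Q: "0 < Q" using R by (simp add: Q_def)
    define V where "V = G (H / Q)"
    have V: "0 < V" unfolding V_def using H Q by (intro G_pos) auto
    have claim: "wexc Q x0 (r j) (L j) U \<le> ennreal (\<epsilon> * lam ^ j * (R ^ ?n * V))" for j
    proof (induction j)
      case 0
      show ?case using ex by (simp add: r_def L_def excess_eq_wexc Q_def V_def mult.assoc)
    next
      case (Suc j)
      define \<rho> where "\<rho> = R * \<kappa> * \<mu>^j"
      have \<rho>: "0 < \<rho>" using R \<kappa> \<mu> by (simp add: \<rho>_def)
      have \<mu>j: "\<mu>^j \<le> (1/2)^j" using \<mu> by (intro power_mono) auto
      have "\<kappa> * \<mu>^j \<le> 1/4 * (1/2)^j" using \<kappa> \<mu> \<mu>j by (intro mult_mono) auto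
      hence "R * (\<kappa> * \<mu>^j) \<le> R * (1/4 * (1/2)^j)" using R by (intro mult_left_mono) auto
      hence \<rho>2: "\<rho> \<le> R / 2^(j+2)" by (simp add: \<rho>_def power_divide mult_ac)
      have "R / 2^(j+2) \<le> R / 1" using R one_le_power[of "2::real" "j+2"] by (intro divide_left_mono) auto
      hence \<rho>R: "\<rho> \<le> R" using \<rho>2 by simp
      have rs: "r (Suc j) + \<rho> \<le> r j" using \<rho>2 by (simp add: r_def field_simps)
      have Ls: "L (Suc j) = L j + H / 2^(j+1)" by (simp add: L_def field_simps)
      have meas: "emeasure lborel (ball x0 (r j) \<inter> {x. L (Suc j) < U x}) \<le> ennreal (\<omega> / 2 * \<rho> ^ ?n)"
        unfolding Ls
      proof (rule superlevel_measure[where Q = Q and V = "V / 2^((j+1)*N)"])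
        show "V / 2^((j+1)*N) \<le> G (H / 2^(j+1) / Q)"
        proof -
          have "(1 / 2^(j+1)) ^ N * G (H / Q) \<le> G (1 / 2^(j+1) * (H / Q))"
            using H Q one_le_power[of "2::real" "j+1"] by (intro G_scale_small_lower) auto
          also have "(1 / 2^(j+1)) ^ N * G (H / Q) = V / 2^((j+1)*N)"
            unfolding V_def by (simp only: power_divide power_one power_mult) simp
          finally show ?thesis by (simp add: mult_ac)
        qed
        have "V / 2^((j+1)*N) * (\<omega> / 2 * \<rho> ^ ?n) = \<epsilon> * lam ^ j * (R ^ ?n * V)"
          by (simp add: \<rho>_def \<epsilon>_def lam_def power_mult_distrib power_divide power_mult[symmetric] power_add mult_ac)
        thus "wexc Q x0 (r j) (L j) U \<le> ennreal (V / 2^((j+1)*N) * (\<omega> / 2 * \<rho> ^ ?n))" using Suc.IH by simp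
      qed (use V H Q \<omega> \<rho> in auto)
      have "ennreal (\<omega> / 2 * (R / \<rho>) powr \<sigma>) * wexc Q x0 (r (Suc j)) (L (Suc j)) U
        \<le> (\<integral>\<^sup>+x. \<integral>\<^sup>+y. ennreal (cross s x0 (r (Suc j)) (r j) (L (Suc j)) U x y) \<partial>lborel \<partial>lborel)"
        unfolding Q_def \<sigma>_def \<omega>_def by (rule cross_lower[OF s _ \<rho> \<rho>R rs]) (use meas in \<open>simp_all add: \<omega>_def\<close>)
      also have "\<dots> \<le> ennreal (C * (2^N + C1 * real N ^ 2) * 2 ^ (2 * (2 * N + DIM('a) + 1)) * (2 ^ (2 * N + DIM('a) + 1)) ^ j) * wexc (R powr s) x0 (r j) (L j) U"
        unfolding r_def L_def by (rule de_giorgi_upper[OF s dg C R l H tl])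
      also have "\<dots> \<le> ennreal (A * B ^ j) * wexc Q x0 (r j) (L j) U"
        unfolding Q_def using A B by (intro mult_right_mono ennreal_leI) (auto simp: B_def intro!: mult_right_mono)
      also have "\<dots> \<le> ennreal (A * B ^ j) * ennreal (\<epsilon> * lam ^ j * (R ^ ?n * V))"
        by (intro mult_left_mono Suc.IH) auto
      also have "\<dots> = ennreal (A * B ^ j * (\<epsilon> * lam ^ j * (R ^ ?n * V)))"
        using A B by (intro ennreal_mult'[symmetric]) auto
      finally have "wexc Q x0 (r (Suc j)) (L (Suc j)) U \<le> ennreal (A * B ^ j * (\<epsilon> * lam ^ j * (R ^ ?n * V)) / (\<omega> / 2 * (R / \<rho>) powr \<sigma>))"
        using \<omega> R \<rho> A B \<epsilon> lam V by (intro ennreal_le_divI) auto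
      also have "\<dots> \<le> ennreal (\<epsilon> * lam ^ Suc j * (R ^ ?n * V))"
      proof (rule ennreal_leI)
        have R\<rho>: "(R / \<rho>) powr \<sigma> = 1 / (\<kappa> powr \<sigma> * (\<mu> powr \<sigma>) ^ j)"
        proof -
          have "R / \<rho> = 1 / (\<kappa> * \<mu>^j)" using R by (simp add: \<rho>_def)
          hence "(R / \<rho>) powr \<sigma> = 1 / (\<kappa> * \<mu>^j) powr \<sigma>" using \<kappa> \<mu> by (simp add: powr_divide)
          also have "(\<kappa> * \<mu>^j) powr \<sigma> = \<kappa> powr \<sigma> * (\<mu>^j) powr \<sigma>" using \<kappa> \<mu> by (simp add: powr_mult)
          also have "(\<mu>^j) powr \<sigma> = (\<mu> powr \<sigma>)^j" using \<mu> by (simp add: powr_realpow[symmetric] powr_powr mult.commute)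
          finally show ?thesis .
        qed
        have "A * B ^ j * (\<epsilon> * lam ^ j * (R ^ ?n * V)) / (\<omega> / 2 * (R / \<rho>) powr \<sigma>)
          = (2 * A / \<omega> * \<kappa> powr \<sigma>) * (B * \<mu> powr \<sigma>) ^ j * (\<epsilon> * lam ^ j * (R ^ ?n * V))"
          unfolding R\<rho> using \<omega> \<kappa> \<mu> by (simp add: power_mult_distrib field_simps)
        also have "\<dots> \<le> lam * 1 * (\<epsilon> * lam ^ j * (R ^ ?n * V))"
          using A\<kappa> B\<mu> lam \<epsilon> R V B A \<omega> by (intro mult_right_mono mult_mono power_le_one) auto
        finally show "A * B ^ j * (\<epsilon> * lam ^ j * (R ^ ?n * V)) / (\<omega> / 2 * (R / \<rho>) powr \<sigma>) \<le> \<epsilon> * lam ^ Suc j * (R ^ ?n * V)"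
          by (simp add: mult_ac)
      qed
      finally show ?case .
    qed
    \<comment> \<open>The excess on the half ball at level l + H lies below that of every stage,
      hence below a null sequence.\<close>
    have bound: "wexc Q x0 (R/2) (l + H) U \<le> ennreal (\<epsilon> * lam ^ j * (R ^ ?n * V))" for j
    proof (rule order_trans[OF wexc_mono claim])
      show "R/2 \<le> r j" using R by (simp add: r_def)
      show "L j \<le> l + H" using H by (simp add: L_def)
    qed (rule Q)
    have "(\<lambda>j. \<epsilon> * lam ^ j * (R ^ ?n * V)) \<longlonglongrightarrow> \<epsilon> * 0 * (R ^ ?n * V)"
      using lam lam1 by (intro tendsto_intros LIMSEQ_power_zero) auto
    hence "(\<lambda>j. ennreal (\<epsilon> * lam ^ j * (R ^ ?n * V))) \<longlonglongrightarrow> 0" using tendsto_ennrealI by fastforce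
    hence "wexc Q x0 (R/2) (l + H) U \<le> 0" by (rule LIMSEQ_le_const) (use bound in auto)
    hence z: "wexc Q x0 (R/2) (l + H) U = 0" by simp
    have [measurable]: "ball x0 (R/2) \<in> sets borel" by auto
    have m: "(\<lambda>x. indicator (ball x0 (R/2)) x * ennreal (G \<bar>max 0 (U x - (l + H)) / Q\<bar>)) \<in> borel_measurable lborel"
      by measurable
    have "AE x in lborel. indicator (ball x0 (R/2)) x * ennreal (G \<bar>max 0 (U x - (l + H)) / Q\<bar>) = 0"
      using z unfolding wexc_def nn_integral_0_iff_AE[OF m] .
    thus "AE x in lborel. x \<in> ball x0 (R/2) \<longrightarrow> U x \<le> l + H"
    proof eventually_elim
      case (elim x)
      show ?case
      proof (intro impI, rule ccontr)
        assume x: "x \<in> ball x0 (R/2)" and "\<not> U x \<le> l + H"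
        hence "0 < G \<bar>max 0 (U x - (l + H)) / Q\<bar>" using Q by (intro G_pos) auto
        thus False using elim x by simp
      qed
    qed
  qed
qed

end

section \<open>Decrease of the upper bound\<close>

text \<open>The constant of \<open>nn_integral_exterior_radial\<close> for the exponent b =
  s.\<close>

definition ext_const :: "real \<Rightarrow> nat \<Rightarrow> real" where
  "ext_const s n = unit_ball_vol (real n) * 2 ^ n / (1 - 2 powr (-s))"

lemma ext_const_nonneg: "0 < s \<Longrightarrow> 0 \<le> ext_const s n"
proof -
  assume "0 < s"
  hence "2 powr (-s) < 1" by (simp add: powr_less_one)
  thus ?thesis by (auto simp: ext_const_def intro!: divide_nonneg_nonneg mult_nonneg_nonneg)
qed

lemma nn_integral_exterior_kernel:
  fixes x0 :: "'a::euclidean_space"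
  assumes s: "0 < s" and r: "0 < r"
  shows "(\<integral>\<^sup>+y. indicator (- ball x0 r) y * ennreal (1 / (norm (y - x0) powr s * norm (y - x0) ^ DIM('a))) \<partial>lborel)
     \<le> ennreal (ext_const s DIM('a) * r powr (-s))"
proof -
  let ?F = "\<lambda>h::'a. indicator (- ball 0 r) h * ennreal (norm h powr (- s - real DIM('a)))"
  have [measurable]: "- ball (0::'a) r \<in> sets borel" by simp
  have "(\<integral>\<^sup>+y. indicator (- ball x0 r) y * ennreal (1 / (norm (y - x0) powr s * norm (y - x0) ^ DIM('a))) \<partial>lborel)
     = (\<integral>\<^sup>+y. ?F (y - x0) \<partial>lborel)"
  proof (rule nn_integral_cong)
    fix y :: 'a
    show "indicator (- ball x0 r) y * ennreal (1 / (norm (y - x0) powr s * norm (y - x0) ^ DIM('a))) = ?F (y - x0)"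
    proof (cases "y \<in> ball x0 r")
      case False
      define h where "h = norm (y - x0)"
      have h: "r \<le> h" "0 < h" using False r by (auto simp: h_def dist_norm norm_minus_commute)
      have "h powr (- s - real DIM('a)) = h powr (-s) / h powr real DIM('a)" by (rule powr_diff)
      also have "\<dots> = 1 / (h powr s * h ^ DIM('a))" using h by (simp add: powr_minus powr_realpow divide_inverse)
      finally show ?thesis using False h(1) by (simp add: h_def indicator_def)
    next
      case True
      thus ?thesis by (simp add: dist_norm norm_minus_commute)
    qed
  qed
  also have "\<dots> = (\<integral>\<^sup>+h. ?F h \<partial>lborel)" by (rule nn_integral_lborel_shift_minus) measurable
  also have "\<dots> \<le> ennreal (ext_const s DIM('a) * r powr (-s))"
    unfolding ext_const_def by (rule nn_integral_exterior_radial[OF s r])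
  finally show ?thesis .
qed

context growth
begin

lemma dg_classD:
  fixes x0 :: "'a::euclidean_space"
  assumes "dg_class s C x0 R0 k0 U" "k0 \<le> l" "0 < r" "r < R" "R \<le> R0"
  shows "(\<integral>\<^sup>+x. \<integral>\<^sup>+y. ennreal (cross s x0 r R l U x y) \<partial>lborel \<partial>lborel)
       \<le> ennreal (C * (R / (R - r)) ^ (N + DIM('a) + 1)) * (excess s x0 R l U + mass x0 R l U * tail s x0 R l U)"
  using assms unfolding dg_class_def by blast

text \<open>Every point above M - \<delta> w sees the whole low set of the half ball, at distance at
  most R and with a jump of at least w/4. The bound is linear in the height, with a coefficient
  involving w instead of \<delta> w; this disparity drives the decrease.\<close>

lemma growth_cross_lower:
  fixes U :: "'a::euclidean_space \<Rightarrow> real" and x0 :: 'a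
  assumes s: "0 < s" "s < 1" and [measurable]: "U \<in> borel_measurable borel"
    and R: "0 < R" and w: "0 < w" and \<delta>: "0 < \<delta>" "\<delta> \<le> 1/4"
    and half: "ennreal (unit_ball_vol (real DIM('a)) / 2 * (R/2) ^ DIM('a)) \<le> emeasure lborel (ball x0 (R/2) \<inter> {x. U x \<le> M - w/2})"
  shows "ennreal (g (w / 4 / R powr s) / R powr s * (unit_ball_vol (real DIM('a)) / 2 / 2 ^ DIM('a))) * mass x0 (R/2) (M - \<delta> * w) U
    \<le> (\<integral>\<^sup>+x. \<integral>\<^sup>+y. ennreal (cross s x0 (R/2) R (M - \<delta> * w) U x y) \<partial>lborel \<partial>lborel)"
proof -
  let ?n = "DIM('a)"
  define \<omega> where "\<omega> = unit_ball_vol (real ?n)"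
  have \<omega>: "0 < \<omega>" by (simp add: \<omega>_def)
  define Q where "Q = R powr s"
  have Q: "0 < Q" using R by (simp add: Q_def)
  define l where "l = M - \<delta> * w"
  have \<delta>w: "\<delta> * w \<le> w / 4" using \<delta> w mult_right_mono[of \<delta> "1/4" w] by simp
  define F where "F = ball x0 (R/2) \<inter> {x. U x \<le> M - w/2}"
  have [measurable]: "ball x0 (R/2) \<in> sets borel" "ball x0 R \<in> sets borel" by auto
  have [measurable]: "F \<in> sets borel" unfolding F_def by measurable
  define c where "c = g (w / 4 / Q) / (Q * R ^ ?n)"
  have c: "0 \<le> c" using w Q R by (auto simp: c_def intro!: divide_nonneg_nonneg g_nonneg)
  have c_eq: "g (w / 4 / Q) / Q * (\<omega> / 2 / 2 ^ ?n) = c * (\<omega> / 2 * (R/2) ^ ?n)"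
    using R by (simp add: c_def power_divide)
  have "ennreal (g (w / 4 / Q) / Q * (\<omega> / 2 / 2 ^ ?n)) * mass x0 (R/2) l U
     = (\<integral>\<^sup>+x. ennreal (c * (\<omega> / 2 * (R/2) ^ ?n)) * (indicator (ball x0 (R/2)) x * ennreal (max 0 (U x - l))) \<partial>lborel)"
    unfolding mass_def c_eq by (rule nn_integral_cmult[symmetric]) measurable
  also have "\<dots> \<le> (\<integral>\<^sup>+x. \<integral>\<^sup>+y. ennreal (cross s x0 (R/2) R l U x y) \<partial>lborel \<partial>lborel)"
  proof (rule nn_integral_mono)
    fix x
    show "ennreal (c * (\<omega> / 2 * (R/2) ^ ?n)) * (indicator (ball x0 (R/2)) x * ennreal (max 0 (U x - l)))
      \<le> (\<integral>\<^sup>+y. ennreal (cross s x0 (R/2) R l U x y) \<partial>lborel)"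
    proof (cases "x \<in> ball x0 (R/2) \<and> l < U x")
      case True
      define a where "a = U x - l"
      have a: "0 < a" using True by (simp add: a_def)
      have "ennreal (c * (\<omega> / 2 * (R/2) ^ ?n)) * (indicator (ball x0 (R/2)) x * ennreal (max 0 (U x - l)))
        = ennreal (a * c) * ennreal (\<omega> / 2 * (R/2) ^ ?n)"
        using True a c \<omega> R by (simp add: a_def ennreal_mult'[symmetric] mult_ac)
      also have "\<dots> \<le> ennreal (a * c) * emeasure lborel F"
        using half by (intro mult_left_mono) (auto simp: F_def \<omega>_def)
      also have "\<dots> = (\<integral>\<^sup>+y. ennreal (a * c) * indicator F y \<partial>lborel)" by (rule nn_integral_cmult_indicator[symmetric]) auto
      also have "\<dots> \<le> (\<integral>\<^sup>+y. ennreal (cross s x0 (R/2) R l U x y) \<partial>lborel)"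
      proof (rule nn_integral_mono)
        fix y
        show "ennreal (a * c) * indicator F y \<le> ennreal (cross s x0 (R/2) R l U x y)"
        proof (cases "y \<in> F")
          case yF: True
          hence y: "y \<in> ball x0 (R/2)" "U y \<le> M - w/2" by (auto simp: F_def)
          have yl: "U y \<le> l" unfolding l_def using y(2) \<delta>w w by linarith
          have diff: "w / 4 \<le> U x - U y" using y(2) True \<delta>w by (simp add: l_def)
          define d where "d = norm (x - y)"
          have "x \<noteq> y" using yl True by auto
          hence d0: "0 < d" by (simp add: d_def)
          have "dist x y \<le> dist x0 x + dist x0 y" by (metis dist_commute dist_triangle)
          hence dR: "d \<le> R" using True y(1) by (simp add: d_def dist_norm[symmetric])
          have ds: "d powr s \<le> Q" "0 < d powr s" using d0 dR s by (auto simp: Q_def intro: powr_mono2)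
          have "w / 4 / Q \<le> (U x - U y) / d powr s" using diff ds w by (intro frac_le) auto
          moreover have "0 \<le> U x - U y" using diff w by linarith
          ultimately have gg: "g (w / 4 / Q) \<le> g \<bar>(U x - U y) / d powr s\<bar>" using w Q by (intro g_mono) auto
          have "a * c = a * g (w / 4 / Q) / (Q * R ^ ?n)" by (simp add: c_def)
          also have "\<dots> \<le> a * g \<bar>(U x - U y) / d powr s\<bar> / (d powr s * d ^ ?n)"
            using a d0 dR gg ds w Q by (intro frac_le mult_mono mult_left_mono power_mono mult_nonneg_nonneg g_nonneg) auto
          also have "\<dots> = cross s x0 (R/2) R l U x y" using True y yl R by (simp add: cross_def d_def a_def)
          finally show ?thesis using yF by (simp add: ennreal_leI)
        qed simp
      qed
      finally show ?thesis .
    next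
      case False
      thus ?thesis by (auto simp: indicator_def)
    qed
  qed
  finally show ?thesis by (simp add: l_def Q_def \<omega>_def)
qed

lemma ball_volume_lborel:
  "0 \<le> r \<Longrightarrow> emeasure lborel (ball (x0::'a::euclidean_space) r) = ennreal (unit_ball_vol (real DIM('a)) * r ^ DIM('a))"
  by (rule emeasure_ball)

text \<open>The low set enters on the left with g (w / 4 / R^s), whereas the right-hand side is of
  order \<delta> w g (\<delta> w / R^s), because U exceeds the level by at most \<delta> w. The
  ratio supplies (4 \<delta>)^(p-1) and plays the part of De Giorgi's isoperimetric
  inequality.\<close>

lemma growth_mass_bound:
  fixes U :: "'a::euclidean_space \<Rightarrow> real" and x0 :: 'a
  assumes s: "0 < s" "s < 1" and C: "0 \<le> C" "0 \<le> C1" and dg: "dg_class s C x0 R k0 U"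
    and R: "0 < R" and w: "0 < w" and \<delta>: "0 < \<delta>" "\<delta> \<le> 1/4" and k0: "k0 \<le> M - w/2"
    and bd: "AE x in lborel. x \<in> ball x0 R \<longrightarrow> U x \<le> M"
    and half: "ennreal (unit_ball_vol (real DIM('a)) / 2 * (R/2) ^ DIM('a)) \<le> emeasure lborel (ball x0 (R/2) \<inter> {x. U x \<le> M - w/2})"
    and tl: "tail s x0 R (M - \<delta> * w) U \<le> ennreal (C1 * g (\<delta> * w / R powr s) / R powr s)"
  shows "mass x0 (R/2) (M - \<delta> * w) U \<le> ennreal (C * 2 ^ (N + DIM('a) + 1) * (1 + C1) * real N * 2 ^ (DIM('a) + 1) * (\<delta> * w) * (4 * \<delta>) powr (p - 1) * R ^ DIM('a))"
proof -
  let ?n = "DIM('a)" and ?D = "N + DIM('a) + 1"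
  have [measurable]: "U \<in> borel_measurable borel" using dg by (simp add: dg_class_def)
  define \<omega> where "\<omega> = unit_ball_vol (real ?n)"
  have \<omega>: "0 < \<omega>" by (simp add: \<omega>_def)
  define Q where "Q = R powr s"
  have Q: "0 < Q" using R by (simp add: Q_def)
  define l where "l = M - \<delta> * w"
  define h where "h = \<delta> * w"
  have h: "0 < h" using \<delta> w by (simp add: h_def)
  have \<delta>w: "\<delta> * w \<le> w / 4" using \<delta> w mult_right_mono[of \<delta> "1/4" w] by simp
  have kl: "k0 \<le> l" unfolding l_def using k0 \<delta>w w by linarith
  have [measurable]: "ball x0 (R/2) \<in> sets borel" "ball x0 R \<in> sets borel" by auto
  define t where "t = h / Q"
  have t: "0 < t" using h Q by (simp add: t_def)
  have ae: "AE x in lborel. indicator (ball x0 R) x * ennreal (max 0 (U x - l)) \<le> ennreal h * indicator (ball x0 R) x"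
    using bd by eventually_elim (use h in \<open>auto simp: indicator_def l_def h_def intro!: ennreal_leI\<close>)
  have mass_R: "mass x0 R l U \<le> ennreal (h * (\<omega> * R ^ ?n))"
  proof -
    have "mass x0 R l U \<le> (\<integral>\<^sup>+x. ennreal h * indicator (ball x0 R) x \<partial>lborel)"
      unfolding mass_def by (rule nn_integral_mono_AE[OF ae])
    also have "\<dots> = ennreal (h * (\<omega> * R ^ ?n))"
      using R h \<omega> by (subst nn_integral_cmult_indicator) (auto simp: ball_volume_lborel \<omega>_def ennreal_mult'[symmetric])
    finally show ?thesis .
  qed
  have exc_R: "excess s x0 R l U \<le> ennreal (G t * (\<omega> * R ^ ?n))"
  proof -
    have "excess s x0 R l U \<le> (\<integral>\<^sup>+x. ennreal (G t) * indicator (ball x0 R) x \<partial>lborel)"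
      unfolding excess_def
    proof (rule nn_integral_mono_AE)
      show "AE x in lborel. indicator (ball x0 R) x * ennreal (G \<bar>max 0 (U x - l) / R powr s\<bar>) \<le> ennreal (G t) * indicator (ball x0 R) x"
        using bd
      proof eventually_elim
        case (elim x)
        show ?case
        proof (cases "x \<in> ball x0 R")
          case True
          hence "max 0 (U x - l) \<le> h" using elim h by (auto simp: l_def h_def)
          hence "max 0 (U x - l) / Q \<le> t" using Q by (simp add: t_def divide_right_mono)
          hence "G \<bar>max 0 (U x - l) / Q\<bar> \<le> G t" using Q by (intro G_mono) auto
          thus ?thesis using True by (simp add: Q_def ennreal_leI)
        qed simp
      qed
    qed
    also have "\<dots> = ennreal (G t * (\<omega> * R ^ ?n))"
      using R t \<omega> by (subst nn_integral_cmult_indicator) (auto simp: ball_volume_lborel \<omega>_def ennreal_mult'[symmetric] G_nonneg)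
    finally show ?thesis .
  qed
  define W where "W = \<omega> * R ^ ?n"
  have W: "0 \<le> W" using \<omega> R by (simp add: W_def)
  define V where "V = g (w / 4 / Q)"
  have V: "0 < V" unfolding V_def using w Q by (intro g_pos) auto
  have tl': "tail s x0 R l U \<le> ennreal (C1 * g t / Q)" using tl by (simp add: l_def h_def t_def Q_def)
  \<comment> \<open>The argument is 4 \<delta> times w / 4 / Q, and 4 \<delta> \<le> 1 is the reason
    for requiring \<delta> \<le> 1/4.\<close>
  have gt: "g t \<le> real N * (4 * \<delta>) powr (p-1) * V"
  proof -
    have "g t = g ((4 * \<delta>) * (w / 4 / Q))" by (simp add: t_def h_def)
    also have "\<dots> \<le> real N * (4 * \<delta>) powr (p-1) * V" unfolding V_def using \<delta> w Q by (intro g_scale_small) auto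
    finally show ?thesis .
  qed
  have "ennreal (V / Q * (\<omega> / 2 / 2 ^ ?n)) * mass x0 (R/2) l U
     \<le> (\<integral>\<^sup>+x. \<integral>\<^sup>+y. ennreal (cross s x0 (R/2) R l U x y) \<partial>lborel \<partial>lborel)"
    unfolding V_def Q_def \<omega>_def l_def by (rule growth_cross_lower[OF s _ R w \<delta> half]) measurable
  also have "\<dots> \<le> ennreal (C * (R / (R - R/2)) ^ ?D) * (excess s x0 R l U + mass x0 R l U * tail s x0 R l U)"
    by (rule dg_classD[OF dg kl]) (use R in auto)
  also have "\<dots> \<le> ennreal (C * (R / (R - R/2)) ^ ?D) * (ennreal (G t * W) + ennreal (h * W) * ennreal (C1 * g t / Q))"
    using exc_R mass_R tl' unfolding W_def[symmetric]
    by (intro mult_left_mono add_mono mult_mono) auto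
  also have "\<dots> = ennreal (C * 2 ^ ?D * (G t * W + h * W * (C1 * g t / Q)))"
  proof -
    have "R / (R - R/2) = 2" using R by simp
    moreover have "0 \<le> G t * W" "0 \<le> h * W" "0 \<le> C1 * g t / Q"
      using t W h C Q by (auto intro!: mult_nonneg_nonneg divide_nonneg_nonneg G_nonneg g_nonneg)
    ultimately show ?thesis using C
      by (simp add: ennreal_mult'[symmetric] ennreal_plus[symmetric] del: ennreal_plus times_divide_eq_right)
  qed
  also have "\<dots> \<le> ennreal (C * 2 ^ ?D * (W * (1 + C1) * t * (real N * (4 * \<delta>) powr (p-1) * V)))"
  proof (intro ennreal_leI mult_left_mono)
    have "G t * W + h * W * (C1 * g t / Q) \<le> (t * g t) * W + C1 * (t * g t) * W"
    proof (rule add_mono)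
      show "G t * W \<le> (t * g t) * W" using G_le_tg[of t] t W by (intro mult_right_mono) auto
      show "h * W * (C1 * g t / Q) \<le> C1 * (t * g t) * W" by (simp add: t_def mult_ac)
    qed
    also have "\<dots> = W * (1 + C1) * t * g t" by (simp add: algebra_simps)
    also have "\<dots> \<le> W * (1 + C1) * t * (real N * (4 * \<delta>) powr (p-1) * V)"
      using W C t by (intro mult_left_mono gt) auto
    finally show "G t * W + h * W * (C1 * g t / Q) \<le> W * (1 + C1) * t * (real N * (4 * \<delta>) powr (p-1) * V)" .
  qed (use C in auto)
  finally have "mass x0 (R/2) l U \<le> ennreal (C * 2 ^ ?D * (W * (1 + C1) * t * (real N * (4 * \<delta>) powr (p-1) * V)) / (V / Q * (\<omega> / 2 / 2 ^ ?n)))"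
    using V Q \<omega> C W t by (intro ennreal_le_divI) auto
  also have "C * 2 ^ ?D * (W * (1 + C1) * t * (real N * (4 * \<delta>) powr (p-1) * V)) / (V / Q * (\<omega> / 2 / 2 ^ ?n))
     = C * 2 ^ ?D * (1 + C1) * real N * 2 ^ (?n + 1) * h * (4 * \<delta>) powr (p - 1) * R ^ ?n"
    using V Q \<omega> by (simp add: W_def t_def field_simps)
  finally show ?thesis unfolding l_def h_def .
qed

text \<open>Between radii R/4 and R the function exceeds the new level M - h/2 by at most h/2, so
  that region costs an explicit kernel integral; beyond R, raising the level only lowers the tail.
  The result is expressed at scale R/2 and height h/4, the data of the De Giorgi step in
  \<open>growth_lemma\<close>.\<close>

lemma tail_annulus:
  fixes U :: "'a::euclidean_space \<Rightarrow> real" and x0 :: 'a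
  assumes s: "0 < s" "s < 1" and [measurable]: "U \<in> borel_measurable borel" and R: "0 < R" and h: "0 < h" and C1: "0 \<le> C1"
    and bd: "AE x in lborel. x \<in> ball x0 R \<longrightarrow> U x \<le> M"
    and tl: "tail s x0 R (M - h) U \<le> ennreal (C1 * g (h / R powr s) / R powr s)"
  shows "tail s x0 (R/2/2) (M - h/2) U \<le> ennreal ((C1 + 2 * ext_const s DIM('a)) * (real N * 4^N) * g (h / 4 / (R/2) powr s) / (R/2) powr s)"
proof -
  let ?n = "DIM('a)"
  define Q where "Q = (R/2) powr s"
  have Q: "0 < Q" using R by (simp add: Q_def)
  define q where "q = (R/4) powr s"
  have q: "0 < q" using R by (simp add: q_def)
  have two: "2 powr s \<le> 2" using s powr_mono[of s 1 2] by simp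
  have qQ: "Q \<le> 2 * q"
  proof -
    have "Q = 2 powr s * q" unfolding Q_def q_def using R by (subst powr_mult[symmetric]) auto
    thus ?thesis using two q by simp
  qed
  have QR: "Q \<le> R powr s" unfolding Q_def using R s by (intro powr_mono2) auto
  define K where "K = real N * 4^N * g (h / 4 / Q)"
  have K: "0 \<le> K" using h Q by (auto simp: K_def intro!: mult_nonneg_nonneg g_nonneg)
  have gK: "g t \<le> K" if "0 \<le> t" "t \<le> h / Q" for t
  proof -
    have "g t \<le> g (4 * (h / 4 / Q))" using that by (intro g_mono) auto
    also have "\<dots> \<le> K" unfolding K_def using h Q by (intro g_scale_upper) auto
    finally show ?thesis .
  qed
  have [measurable]: "- ball x0 R \<in> sets borel" "- ball x0 (R/4) \<in> sets borel" by auto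
  define T where "T l y = g \<bar>max 0 (U y - l) / norm (y - x0) powr s\<bar> / (norm (y - x0) powr s * norm (y - x0) ^ ?n)" for l y
  have [measurable]: "T l \<in> borel_measurable borel" for l unfolding T_def by measurable
  let ?k = "\<lambda>y. 1 / (norm (y - x0) powr s * norm (y - x0) ^ ?n)"
  have "tail s x0 (R/4) (M - h/2) U \<le> (\<integral>\<^sup>+y. indicator (- ball x0 R) y * ennreal (T (M - h) y)
      + ennreal K * (indicator (- ball x0 (R/4)) y * ennreal (?k y)) \<partial>lborel)"
    unfolding tail_def T_def[symmetric]
  proof (rule nn_integral_mono_AE)
    show "AE y in lborel. indicator (- ball x0 (R/4)) y * ennreal (T (M - h/2) y) \<le> indicator (- ball x0 R) y * ennreal (T (M - h) y)
      + ennreal K * (indicator (- ball x0 (R/4)) y * ennreal (?k y))"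
      using bd
    proof eventually_elim
      case (elim y)
      show ?case
      proof (cases "y \<in> ball x0 R")
        case True
        show ?thesis
        proof (cases "y \<in> ball x0 (R/4)")
          case False
          hence "R/4 \<le> norm (y - x0)" by (simp add: dist_norm norm_minus_commute)
          hence nq: "q \<le> norm (y - x0) powr s" unfolding q_def using R s by (intro powr_mono2) auto
          have "U y \<le> M" using elim True by simp
          hence "max 0 (U y - (M - h/2)) \<le> h/2" using h by (intro max.boundedI) linarith+
          hence "max 0 (U y - (M - h/2)) / norm (y - x0) powr s \<le> h/2 / q"
            using nq q h by (intro frac_le) auto
          also have "\<dots> \<le> h / Q" using qQ q Q h by (simp add: field_simps)
          finally have "g \<bar>max 0 (U y - (M - h/2)) / norm (y - x0) powr s\<bar> \<le> K" by (intro gK) auto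
          hence "T (M - h/2) y \<le> K * ?k y" unfolding T_def
            using divide_right_mono[of _ K "norm (y - x0) powr s * norm (y - x0) ^ ?n"] by simp
          hence "ennreal (T (M - h/2) y) \<le> ennreal K * ennreal (?k y)"
            using K by (simp only: ennreal_mult'[symmetric] ennreal_leI)
          thus ?thesis using False True by simp
        qed simp
      next
        case False
        have "T (M - h/2) y \<le> T (M - h) y" unfolding T_def
          using h by (intro divide_right_mono g_mono) (auto intro!: divide_right_mono)
        hence "indicator (- ball x0 (R/4)) y * ennreal (T (M - h/2) y) \<le> indicator (- ball x0 R) y * ennreal (T (M - h) y)"
          using False by (auto simp: indicator_def intro!: ennreal_leI)
        thus ?thesis by (rule order_trans) simp
      qed
    qed
  qed
  also have "\<dots> = tail s x0 R (M - h) U + ennreal K * (\<integral>\<^sup>+y. indicator (- ball x0 (R/4)) y * ennreal (?k y) \<partial>lborel)"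
    unfolding tail_def T_def[symmetric] by (subst nn_integral_add, measurable) (subst nn_integral_cmult, measurable)
  also have "\<dots> \<le> ennreal (C1 * K / Q) + ennreal K * ennreal (ext_const s ?n * (2 / Q))"
  proof (intro add_mono mult_left_mono)
    have "g (h / R powr s) / R powr s \<le> K / Q"
      using QR Q h K by (intro frac_le gK) (auto intro!: divide_left_mono)
    hence "C1 * (g (h / R powr s) / R powr s) \<le> C1 * (K / Q)" using C1 by (intro mult_left_mono)
    thus "tail s x0 R (M - h) U \<le> ennreal (C1 * K / Q)" using tl by (auto intro: order_trans ennreal_leI)
    have "(R/4) powr (-s) \<le> 2 / Q" using qQ q Q R by (simp add: powr_minus q_def[symmetric] field_simps)
    hence "ext_const s ?n * (R/4) powr (-s) \<le> ext_const s ?n * (2 / Q)"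
      using ext_const_nonneg[OF s(1)] by (intro mult_left_mono) auto
    thus "(\<integral>\<^sup>+y. indicator (- ball x0 (R/4)) y * ennreal (?k y) \<partial>lborel) \<le> ennreal (ext_const s ?n * (2 / Q))"
      using nn_integral_exterior_kernel[OF s(1), of "R/4" x0] R by (auto intro: order_trans ennreal_leI)
  qed simp
  also have "\<dots> = ennreal (C1 * K / Q + K * (ext_const s ?n * (2 / Q)))"
    using C1 K Q ext_const_nonneg[OF s(1), of ?n]
    by (simp add: ennreal_mult'[symmetric] ennreal_plus[symmetric] del: ennreal_plus times_divide_eq_right)
  also have "C1 * K / Q + K * (ext_const s ?n * (2 / Q)) = (C1 + 2 * ext_const s ?n) * (real N * 4^N) * g (h / 4 / Q) / Q"
    unfolding K_def using Q by (simp add: field_simps)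
  finally show ?thesis by (simp add: Q_def)
qed

text \<open>Small mass above M - h, with h = \<delta> w, gives by Chebyshev a small super-level set
  at M - h/2. There U is at most h/2 above the level, so the excess on the half ball is small and
  \<open>de_giorgi\<close> applies with height h/4, leaving the upper bound M - h/2 + h/4.\<close>

lemma growth_lemma:
  assumes s: "0 < s" "s < 1" and C: "0 \<le> C" "0 \<le> C1"
  shows "\<exists>\<delta>>0. \<delta> \<le> 1/4 \<and> (\<forall>(x0::'a::euclidean_space) R k0 U M w. 0 < R \<longrightarrow> 0 < w \<longrightarrow> k0 \<le> M - w/2 \<longrightarrow> dg_class s C x0 R k0 U
     \<longrightarrow> (AE x in lborel. x \<in> ball x0 R \<longrightarrow> U x \<le> M)
     \<longrightarrow> ennreal (unit_ball_vol (real DIM('a)) / 2 * (R/2) ^ DIM('a)) \<le> emeasure lborel (ball x0 (R/2) \<inter> {x. U x \<le> M - w/2})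
     \<longrightarrow> tail s x0 R (M - \<delta> * w) U \<le> ennreal (C1 * g (\<delta> * w / R powr s) / R powr s)
     \<longrightarrow> (AE x in lborel. x \<in> ball x0 (R/4) \<longrightarrow> U x \<le> M - \<delta> / 4 * w))"
proof -
  let ?n = "DIM('a)"
  \<comment> \<open>The tail constant after \<open>tail_annulus\<close>. It does not depend on
    \<delta>, so \<epsilon> can be fixed before \<delta> is chosen.\<close>
  define C1' where "C1' = (C1 + 2 * ext_const s ?n) * (real N * 4^N)"
  have C1': "0 \<le> C1'" using C ext_const_nonneg[OF s(1), of ?n] by (simp add: C1'_def)
  obtain \<epsilon> where \<epsilon>: "0 < \<epsilon>" and DG: "\<And>(x0::'a) R k0 U l H. 0 < R \<Longrightarrow> 0 < H \<Longrightarrow> k0 \<le> l \<Longrightarrow> dg_class s C x0 R k0 U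
     \<Longrightarrow> tail s x0 (R/2) l U \<le> ennreal (C1' * g (H / R powr s) / R powr s)
     \<Longrightarrow> excess s x0 R l U \<le> ennreal (\<epsilon> * R ^ ?n * G (H / R powr s))
     \<Longrightarrow> (AE x in lborel. x \<in> ball x0 (R/2) \<longrightarrow> U x \<le> l + H)"
    using de_giorgi[OF s C(1) C1', where 'a = 'a] by blast
  define K where "K = C * 2 ^ (N + ?n + 1) * (1 + C1) * real N * 2 ^ (?n + 1)"
  have K: "0 \<le> K" using C by (simp add: K_def)
  \<comment> \<open>Solves 2^(N+1+n) K (4 \<delta>)^(p-1) \<le> \<epsilon> for \<delta>; the added 1
    guards against K = 0.\<close>
  define e where "e = \<epsilon> / (2 ^ (N + 1 + ?n) * (K + 1))"
  have e: "0 < e" using \<epsilon> K by (simp add: e_def)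
  define \<delta> where "\<delta> = min (1/4) (e powr (1 / (p - 1)) / 4)"
  have \<delta>: "0 < \<delta>" "\<delta> \<le> 1/4" using e by (auto simp: \<delta>_def)
  have \<delta>p: "2 ^ (N + 1 + ?n) * (K * (4 * \<delta>) powr (p - 1)) \<le> \<epsilon>"
  proof -
    have "(4 * \<delta>) powr (p-1) \<le> (e powr (1 / (p-1))) powr (p-1)"
      using \<delta> p_gt_1 by (intro powr_mono2) (auto simp: \<delta>_def)
    also have "\<dots> = e" using e p_gt_1 by (simp add: powr_powr)
    finally have "K * (4 * \<delta>) powr (p - 1) \<le> (K + 1) * e" using K by (intro mult_mono) auto
    hence "2 ^ (N + 1 + ?n) * (K * (4 * \<delta>) powr (p - 1)) \<le> 2 ^ (N + 1 + ?n) * ((K + 1) * e)" by (intro mult_left_mono) auto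
    also have "\<dots> = \<epsilon>" using K by (simp add: e_def)
    finally show ?thesis .
  qed
  show ?thesis
  proof (intro exI[of _ \<delta>] conjI \<delta> allI impI)
    fix x0 :: 'a and R k0 U M w
    assume R: "0 < R" and w: "0 < w" and k0: "k0 \<le> M - w/2" and dg: "dg_class s C x0 R k0 U"
      and bd: "AE x in lborel. x \<in> ball x0 R \<longrightarrow> U x \<le> M"
      and half: "ennreal (unit_ball_vol (real ?n) / 2 * (R/2) ^ ?n) \<le> emeasure lborel (ball x0 (R/2) \<inter> {x. U x \<le> M - w/2})"
      and tl: "tail s x0 R (M - \<delta> * w) U \<le> ennreal (C1 * g (\<delta> * w / R powr s) / R powr s)"
    have Um[measurable]: "U \<in> borel_measurable borel" using dg by (simp add: dg_class_def)
    define h where "h = \<delta> * w"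
    have h: "0 < h" using \<delta> w by (simp add: h_def)
    define Q where "Q = (R/2) powr s"
    have Q: "0 < Q" using R by (simp add: Q_def)
    define l where "l = M - h / 2"
    define E where "E = ball x0 (R/2) \<inter> {x. l < U x}"
    have [measurable]: "ball x0 (R/2) \<in> sets borel" by auto
    have Em[measurable]: "E \<in> sets borel" unfolding E_def by measurable
    have m: "mass x0 (R/2) (M - h) U \<le> ennreal (K * h * (4 * \<delta>) powr (p - 1) * R ^ ?n)"
      using growth_mass_bound[OF s C dg R w \<delta> k0 bd half tl] by (simp add: K_def h_def)
    have "ennreal (h/2) * emeasure lborel E = (\<integral>\<^sup>+x. ennreal (h/2) * indicator E x \<partial>lborel)"
      by (rule nn_integral_cmult_indicator[symmetric]) auto
    also have "\<dots> \<le> mass x0 (R/2) (M - h) U" unfolding mass_def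
    proof (rule nn_integral_mono)
      fix x
      show "ennreal (h/2) * indicator E x \<le> indicator (ball x0 (R/2)) x * ennreal (max 0 (U x - (M - h)))"
      proof (cases "x \<in> E")
        case True
        hence "M - h/2 < U x" "x \<in> ball x0 (R/2)" by (auto simp: E_def l_def)
        moreover from this have "h/2 \<le> U x - (M - h)" by linarith
        ultimately show ?thesis using True by (simp add: le_max_iff_disj ennreal_leI)
      qed simp
    qed
    also note m
    finally have "emeasure lborel E \<le> ennreal (K * h * (4 * \<delta>) powr (p - 1) * R ^ ?n / (h/2))"
      using h K R by (intro ennreal_le_divI) auto
    also have "K * h * (4 * \<delta>) powr (p - 1) * R ^ ?n / (h/2) = 2 * K * (4 * \<delta>) powr (p - 1) * R ^ ?n" using h by simp
    finally have meas: "emeasure lborel E \<le> ennreal (2 * K * (4 * \<delta>) powr (p - 1) * R ^ ?n)" .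
    \<comment> \<open>Twice this height covers the gap h/2 between the level and the bound M, so
      \<open>G\<close> loses only a factor 2^N in the excess.\<close>
    define H where "H = h / 4"
    have H: "0 < H" using h by (simp add: H_def)
    have exc: "excess s x0 (R/2) l U \<le> ennreal (\<epsilon> * (R/2) ^ ?n * G (H / Q))"
    proof -
      have "excess s x0 (R/2) l U \<le> (\<integral>\<^sup>+x. ennreal (2^N * G (H / Q)) * indicator E x \<partial>lborel)"
        unfolding excess_def
      proof (rule nn_integral_mono_AE)
        show "AE x in lborel. indicator (ball x0 (R/2)) x * ennreal (G \<bar>max 0 (U x - l) / (R/2) powr s\<bar>) \<le> ennreal (2^N * G (H / Q)) * indicator E x"
          using bd
        proof eventually_elim
          case (elim x)
          show ?case
          proof (cases "x \<in> E")
            case True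
            hence "U x \<le> M" using elim R by (auto simp: E_def)
            hence "max 0 (U x - l) \<le> 2 * H" unfolding l_def H_def using h by (intro max.boundedI) linarith+
            hence "G \<bar>max 0 (U x - l) / Q\<bar> \<le> G (2 * (H / Q))" using Q by (intro G_mono) (auto simp: divide_right_mono)
            also have "\<dots> \<le> 2^N * G (H / Q)" using H Q by (intro G_scale_upper) auto
            finally show ?thesis using True by (simp add: Q_def[symmetric] E_def ennreal_leI)
          next
            case False
            thus ?thesis by (auto simp: E_def indicator_def max_def)
          qed
        qed
      qed
      also have "\<dots> = ennreal (2^N * G (H / Q)) * emeasure lborel E" by (rule nn_integral_cmult_indicator) auto
      also have "\<dots> \<le> ennreal (2^N * G (H / Q)) * ennreal (2 * K * (4 * \<delta>) powr (p - 1) * R ^ ?n)"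
        by (intro mult_left_mono meas) auto
      also have "\<dots> = ennreal (2^N * G (H / Q) * (2 * K * (4 * \<delta>) powr (p - 1) * R ^ ?n))"
        using H Q by (intro ennreal_mult'[symmetric] mult_nonneg_nonneg G_nonneg) auto
      also have "\<dots> \<le> ennreal (\<epsilon> * (R/2) ^ ?n * G (H / Q))"
      proof (rule ennreal_leI)
        have "2^N * G (H / Q) * (2 * K * (4 * \<delta>) powr (p - 1) * R ^ ?n)
          = (2 ^ (N + 1 + ?n) * (K * (4 * \<delta>) powr (p - 1))) * ((R/2) ^ ?n * G (H / Q))"
          by (simp add: power_divide power_add)
        also have "\<dots> \<le> \<epsilon> * ((R/2) ^ ?n * G (H / Q))"
          using \<delta>p R H Q by (intro mult_right_mono mult_nonneg_nonneg G_nonneg) auto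
        finally show "2^N * G (H / Q) * (2 * K * (4 * \<delta>) powr (p - 1) * R ^ ?n) \<le> \<epsilon> * (R/2) ^ ?n * G (H / Q)" by (simp add: mult.assoc)
      qed
      finally show ?thesis .
    qed
    have tl2: "tail s x0 (R/2/2) l U \<le> ennreal (C1' * g (H / Q) / Q)"
      using tail_annulus[OF s Um R h C(2) bd tl[folded h_def]] by (simp add: C1'_def H_def Q_def l_def)
    have "\<delta> * w \<le> w / 4" using \<delta> w mult_right_mono[of \<delta> "1/4" w] by simp
    hence kl: "k0 \<le> l" unfolding l_def h_def using k0 w by linarith
    have dg2: "dg_class s C x0 (R/2) k0 U" by (rule dg_class_mono[OF dg]) (use R in auto)
    have "AE x in lborel. x \<in> ball x0 (R/2/2) \<longrightarrow> U x \<le> l + H"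
      by (rule DG[OF _ H kl dg2]) (use R tl2 exc in \<open>simp_all add: Q_def\<close>)
    moreover have "l + H = M - \<delta> / 4 * w" by (simp add: l_def H_def h_def)
    ultimately show "AE x in lborel. x \<in> ball x0 (R/4) \<longrightarrow> U x \<le> M - \<delta> / 4 * w" by simp
  qed
qed

end

section \<open>Decay of the oscillation\<close>

text \<open>Compares two geometric growths from their first step alone. In \<open>tail_stage\<close>
  X = 1/\<tau> is the growth of the oscillation bound, and Y = 4^s that of the radius to the power
  s, per step outwards.\<close>

lemma geometric_compare:
  fixes X Y \<delta> :: real
  assumes "1 \<le> X" "X - 1 \<le> \<delta> * (Y - 1)" "0 \<le> \<delta>" "\<delta> \<le> 1" "1 \<le> Y"
  shows "X ^ k - 1 \<le> \<delta> * (Y ^ k - 1)"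
proof (induction k)
  case (Suc k)
  have "\<delta> * (Y - 1) \<le> 1 * (Y - 1)" using assms by (intro mult_right_mono) auto
  hence "\<delta> * (Y - 1) \<le> Y - 1" by simp
  hence XY: "X \<le> Y" using assms(2) by linarith
  have "0 \<le> \<delta> * (Y ^ k - 1)" using assms one_le_power[of Y k] by (intro mult_nonneg_nonneg) auto
  hence "X * (X ^ k - 1) \<le> Y * (\<delta> * (Y ^ k - 1))"
    using Suc.IH XY assms one_le_power[of X k] by (intro mult_mono) auto
  thus ?case using assms(2) by (simp add: algebra_simps)
qed simp

context growth
begin

text \<open>First summand: the kernel integral with N 2^N from splitting \<open>g\<close> and N 4^N
  from g (4 t). Second summand: the exterior of the first ball.\<close>

definition tail_const :: "real \<Rightarrow> nat \<Rightarrow> real" where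
  "tail_const s n = real N * 2^N * (real N * 4^N) * ext_const s n + real N * 2^N"

lemma tail_const_nonneg: "0 < s \<Longrightarrow> 0 \<le> tail_const s n"
  using ext_const_nonneg[of s n] by (simp add: tail_const_def)

text \<open>On each ring between consecutive radii the excess over the level is at most \<delta> w_j
  4^(s (j-i)), a multiple t of the outer radius to the power s, so the quotient inside the tail is
  at most 4 t on all rings. Hence the constant is independent of \<delta> and \<tau>; the smallness
  of 1/\<tau> - 1 in \<open>cmp\<close> pays for this.\<close>

lemma tail_stage:
  fixes u U :: "'a::euclidean_space \<Rightarrow> real" and x0 :: 'a
  assumes s: "0 < s" "s < 1" and R0: "0 < R0" and w0: "0 < w0" and \<tau>: "0 < \<tau>" "\<tau> \<le> 1" and \<delta>: "0 < \<delta>" "\<delta> \<le> 1"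
    and cmp: "1/\<tau> - 1 \<le> \<delta> * (4 powr s - 1)"
    and [measurable]: "U \<in> borel_measurable borel" "u \<in> borel_measurable borel"
    and Uu: "\<And>y. U y \<le> \<bar>u y\<bar>" and M: "- M \<le> w0 - w0 * \<tau>^j"
    and nest: "\<And>i. i \<le> j \<Longrightarrow> AE x in lborel. x \<in> ball x0 (R0/4^i) \<longrightarrow> U x \<le> M + (w0 * \<tau>^i - w0 * \<tau>^j)"
    and tu: "(\<integral>\<^sup>+y. indicator (- ball x0 R0) y * ennreal (g \<bar>u y / norm (y - x0) powr s\<bar> / (norm (y - x0) powr s * norm (y - x0) ^ DIM('a))) \<partial>lborel) \<le> ennreal T0"
    and T0: "T0 \<le> g (\<delta> * w0 / R0 powr s) / R0 powr s"
  shows "tail s x0 (R0/4^j) (M - \<delta> * (w0 * \<tau>^j)) U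
     \<le> ennreal (tail_const s DIM('a) * g (\<delta> * (w0 * \<tau>^j) / (R0/4^j) powr s) / (R0/4^j) powr s)"
proof -
  let ?n = "DIM('a)"
  define R where "R i = R0/4^i" for i :: nat
  define w where "w i = w0 * \<tau>^i" for i :: nat
  have R: "0 < R i" for i using R0 by (simp add: R_def)
  have w: "0 < w i" for i using w0 \<tau> by (simp add: w_def)
  define Q where "Q = R j powr s"
  have Q: "0 < Q" using R[of j] by (simp add: Q_def)
  define t where "t = \<delta> * w j / Q"
  have t: "0 < t" using \<delta> w Q by (simp add: t_def)
  have four: "4 powr s \<le> 4" "1 \<le> 4 powr s" using s powr_mono[of s 1 4] powr_mono[of 0 s 4] by auto
  have four_pos: "0 < 4 powr s" by simp
  \<comment> \<open>\<open>w i\<close> is \<open>w j\<close> times (1/\<tau>)^(j-i), so this is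
    \<open>geometric_compare\<close> scaled by \<open>w j\<close>.\<close>
  have key: "w i - w j + \<delta> * w j \<le> \<delta> * w j * (4 powr s) ^ (j - i)" if "i \<le> j" for i
  proof -
    have "(1/\<tau>) ^ (j - i) - 1 \<le> \<delta> * ((4 powr s) ^ (j - i) - 1)"
      by (rule geometric_compare) (use \<tau> \<delta> cmp four in auto)
    hence "w j * ((1/\<tau>) ^ (j - i) - 1) \<le> w j * (\<delta> * ((4 powr s) ^ (j - i) - 1))"
      using w[of j] by (intro mult_left_mono) auto
    moreover have "w j * (1/\<tau>) ^ (j - i) = w i"
    proof -
      have "\<tau>^j = \<tau>^i * \<tau>^(j-i)" using that by (simp add: power_add[symmetric])
      thus ?thesis using \<tau> by (simp add: w_def power_divide)
    qed
    ultimately show ?thesis by (simp add: algebra_simps)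
  qed
  have ratio: "Q * (4 powr s) ^ (j - i) = R i powr s" if "i \<le> j" for i
  proof -
    have "R i = R j * 4^(j-i)"
    proof -
      have "(4::real)^j = 4^i * 4^(j-i)" using that by (simp add: power_add[symmetric])
      thus ?thesis by (simp add: R_def)
    qed
    moreover have "(4^(j-i)) powr s = (4 powr s) ^ (j-i)"
      by (simp add: powr_realpow[symmetric] powr_powr mult.commute)
    ultimately show ?thesis using R by (simp add: Q_def powr_mult)
  qed
  define l where "l = M - \<delta> * w j"
  define ker where "ker y = 1 / (norm (y - x0) powr s * norm (y - x0) ^ ?n)" for y
  define v where "v y = (if y \<in> ball x0 R0 then 0 else \<bar>u y\<bar> / norm (y - x0) powr s)" for y
  have ker0: "0 \<le> ker y" for y by (simp add: ker_def)
  define c where "c = real N * 2^N * (real N * 4^N) * g t"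
  have c: "0 \<le> c" using t by (auto simp: c_def intro!: mult_nonneg_nonneg g_nonneg)
  have sets[measurable]: "- ball x0 (R j) \<in> sets borel" "- ball x0 R0 \<in> sets borel" by auto
  have [measurable]: "ker \<in> borel_measurable borel" unfolding ker_def by measurable
  have "AE y in lborel. \<forall>i\<in>{..j}. y \<in> ball x0 (R0/4^i) \<longrightarrow> U y \<le> M + (w0 * \<tau>^i - w0 * \<tau>^j)"
    by (rule AE_finite_allI) (use nest in auto)
  hence bound: "AE y in lborel. y \<notin> ball x0 (R j) \<longrightarrow> max 0 (U y - l) / norm (y - x0) powr s \<le> 4 * t + v y"
  proof eventually_elim
    case (elim y)
    show ?case
    proof
      assume y: "y \<notin> ball x0 (R j)"
      define D where "D = norm (y - x0)"
      have D: "R j \<le> D" "0 < D" using y R[of j] by (auto simp: D_def dist_norm norm_minus_commute)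
      have Ds: "0 < D powr s" using D by simp
      show "max 0 (U y - l) / norm (y - x0) powr s \<le> 4 * t + v y"
      proof (cases "y \<in> ball x0 R0")
        case True
        \<comment> \<open>The first ball missing y locates the ring that contains it; index 0 is
          impossible as y lies in the initial ball.\<close>
        define P where "P i \<longleftrightarrow> y \<notin> ball x0 (R i)" for i
        have Pj: "P j" using y by (simp add: P_def)
        define k where "k = (LEAST i. P i)"
        have Pk: "P k" unfolding k_def using Pj by (rule LeastI)
        have kj: "k \<le> j" unfolding k_def using Pj by (rule Least_le)
        have "k \<noteq> 0" using Pk True by (intro notI) (simp add: P_def R_def)
        then obtain i where i: "k = Suc i" by (cases k) auto
        have "\<not> P i" using not_less_Least[of i P] i by (simp add: k_def)
        hence yi: "y \<in> ball x0 (R i)" by (simp add: P_def)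
        have ij: "i \<le> j" using kj i by simp
        have "R (Suc i) \<le> D" using Pk by (simp add: P_def i D_def dist_norm norm_minus_commute)
        hence "R i \<le> 4 * D" by (simp add: R_def)
        hence "R i powr s \<le> (4 * D) powr s" using R[of i] s by (intro powr_mono2) auto
        also have "\<dots> = 4 powr s * D powr s" using D by (simp add: powr_mult)
        also have "\<dots> \<le> 4 * D powr s" using four by (intro mult_right_mono) auto
        finally have Ri: "R i powr s \<le> 4 * D powr s" .
        have "U y \<le> M + (w i - w j)" using elim ij yi by (auto simp: w_def R_def)
        hence "U y - l \<le> w i - w j + \<delta> * w j" by (simp add: l_def)
        also have "\<dots> \<le> \<delta> * w j * (4 powr s) ^ (j - i)" by (rule key[OF ij])
        also have "\<dots> = t * (Q * (4 powr s) ^ (j - i))" using Q by (simp add: t_def)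
        also have "\<dots> = t * R i powr s" by (simp only: ratio[OF ij])
        also have "\<dots> \<le> t * (4 * D powr s)" using t Ri by (intro mult_left_mono) auto
        finally have "max 0 (U y - l) \<le> 4 * t * D powr s" using t Ds by (intro max.boundedI) (auto simp: mult_ac)
        thus ?thesis using True Ds by (simp add: v_def D_def[symmetric] divide_le_eq)
      next
        case False
        hence DR: "R0 \<le> D" by (simp add: D_def dist_norm norm_minus_commute)
        have "U y - l \<le> \<bar>u y\<bar> + (w 0 - w j + \<delta> * w j)" using Uu[of y] M by (simp add: l_def w_def)
        also have "\<dots> \<le> \<bar>u y\<bar> + \<delta> * w j * (4 powr s) ^ (j - 0)" by (intro add_left_mono key) simp
        also have "\<delta> * w j * (4 powr s) ^ (j - 0) = t * (Q * (4 powr s) ^ (j - 0))" using Q by (simp add: t_def)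
        also have "\<dots> = t * R 0 powr s" by (subst ratio) auto
        also have "\<bar>u y\<bar> + \<dots> \<le> \<bar>u y\<bar> + 4 * t * D powr s"
        proof -
          have "R 0 powr s \<le> D powr s" using DR R0 s by (intro powr_mono2) (auto simp: R_def)
          hence "t * R 0 powr s \<le> t * D powr s" using t by (intro mult_left_mono) auto
          also have "\<dots> \<le> 4 * t * D powr s" using t by (intro mult_right_mono) auto
          finally show ?thesis by simp
        qed
        finally have "max 0 (U y - l) \<le> \<bar>u y\<bar> + 4 * t * D powr s" using t Ds by (intro max.boundedI) auto
        hence "max 0 (U y - l) / D powr s \<le> (\<bar>u y\<bar> + 4 * t * D powr s) / D powr s" using Ds by (intro divide_right_mono) auto
        also have "\<dots> = 4 * t + \<bar>u y\<bar> / D powr s" using Ds by (simp add: add_divide_distrib)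
        finally show ?thesis using False by (simp add: v_def D_def[symmetric])
      qed
    qed
  qed
  have "tail s x0 (R j) l U \<le> (\<integral>\<^sup>+y. ennreal c * (indicator (- ball x0 (R j)) y * ennreal (ker y))
     + ennreal (real N * 2^N) * (indicator (- ball x0 R0) y * ennreal (g \<bar>u y / norm (y - x0) powr s\<bar> / (norm (y - x0) powr s * norm (y - x0) ^ ?n))) \<partial>lborel)"
    unfolding tail_def
  proof (rule nn_integral_mono_AE)
    show "AE y in lborel. indicator (- ball x0 (R j)) y * ennreal (g \<bar>max 0 (U y - l) / norm (y - x0) powr s\<bar> / (norm (y - x0) powr s * norm (y - x0) ^ ?n))
      \<le> ennreal c * (indicator (- ball x0 (R j)) y * ennreal (ker y))
     + ennreal (real N * 2^N) * (indicator (- ball x0 R0) y * ennreal (g \<bar>u y / norm (y - x0) powr s\<bar> / (norm (y - x0) powr s * norm (y - x0) ^ ?n)))"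
      using bound
    proof eventually_elim
      case (elim y)
      show ?case
      proof (cases "y \<in> ball x0 (R j)")
        case False
        have v0: "0 \<le> v y" by (simp add: v_def)
        have "g \<bar>max 0 (U y - l) / norm (y - x0) powr s\<bar> \<le> g (4 * t + v y)"
          using elim False by (intro g_mono) auto
        also have "\<dots> \<le> real N * 2^N * (g (4 * t) + g (v y))" using t v0 by (intro g_add) auto
        also have "\<dots> \<le> real N * 2^N * (real N * 4^N * g t + g (v y))"
          using t by (intro mult_left_mono add_right_mono g_scale_upper) auto
        also have "\<dots> = c + real N * 2^N * g (v y)" by (simp add: c_def algebra_simps)
        finally have "g \<bar>max 0 (U y - l) / norm (y - x0) powr s\<bar> * ker y \<le> (c + real N * 2^N * g (v y)) * ker y"
          using ker0 by (intro mult_right_mono) auto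
        hence "ennreal (g \<bar>max 0 (U y - l) / norm (y - x0) powr s\<bar> * ker y) \<le> ennreal c * ennreal (ker y) + ennreal (real N * 2^N) * ennreal (g (v y) * ker y)"
        proof -
          assume le: "g \<bar>max 0 (U y - l) / norm (y - x0) powr s\<bar> * ker y \<le> (c + real N * 2^N * g (v y)) * ker y"
          have "0 \<le> real N * 2^N * (g (v y) * ker y)" using v0 ker0 by (intro mult_nonneg_nonneg g_nonneg) auto
          moreover have "(c + real N * 2^N * g (v y)) * ker y = c * ker y + real N * 2^N * (g (v y) * ker y)"
            by (simp add: algebra_simps)
          ultimately have "ennreal ((c + real N * 2^N * g (v y)) * ker y) = ennreal c * ennreal (ker y) + ennreal (real N * 2^N) * ennreal (g (v y) * ker y)"
            using c ker0 by (simp only: ennreal_plus ennreal_mult'[symmetric] mult_nonneg_nonneg zero_le_power of_nat_0_le_iff zero_le_numeral)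
          thus ?thesis using ennreal_leI[OF le] by simp
        qed
        also have "ennreal (real N * 2^N) * ennreal (g (v y) * ker y) = ennreal (real N * 2^N) * (indicator (- ball x0 R0) y * ennreal (g \<bar>u y / norm (y - x0) powr s\<bar> / (norm (y - x0) powr s * norm (y - x0) ^ ?n)))"
          by (simp add: v_def ker_def)
        finally show ?thesis using False by (simp add: ker_def)
      qed simp
    qed
  qed
  also have "\<dots> = ennreal c * (\<integral>\<^sup>+y. indicator (- ball x0 (R j)) y * ennreal (ker y) \<partial>lborel)
    + ennreal (real N * 2^N) * (\<integral>\<^sup>+y. indicator (- ball x0 R0) y * ennreal (g \<bar>u y / norm (y - x0) powr s\<bar> / (norm (y - x0) powr s * norm (y - x0) ^ ?n)) \<partial>lborel)"
    by (subst nn_integral_add, measurable) (subst (1 2) nn_integral_cmult, measurable)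
  also have "\<dots> \<le> ennreal c * ennreal (ext_const s ?n * (1 / Q)) + ennreal (real N * 2^N) * ennreal (g t / Q)"
  proof (rule add_mono[OF mult_left_mono mult_left_mono])
    have "R j powr (-s) = 1 / Q" by (simp add: Q_def powr_minus inverse_eq_divide)
    thus "(\<integral>\<^sup>+y. indicator (- ball x0 (R j)) y * ennreal (ker y) \<partial>lborel) \<le> ennreal (ext_const s ?n * (1 / Q))"
      using nn_integral_exterior_kernel[OF s(1) R[of j], of x0] by (simp add: ker_def)
    \<comment> \<open>The exterior tail was absorbed at the initial scale. Since \<tau> 4^s \<ge> 1,
      the height quotient t never falls below its initial value while the radius shrinks, so it
      remains absorbed at stage j.\<close>
    have "T0 \<le> g t / Q"
    proof -
      have QR: "Q * (4 powr s)^j = R0 powr s" using ratio[of 0] by (simp add: R_def)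
      have "w 0 \<le> w j * (4 powr s)^j"
      proof -
        have "1/\<tau> \<le> 4 powr s"
        proof -
          have "\<delta> * (4 powr s - 1) \<le> 1 * (4 powr s - 1)" using \<delta> four by (intro mult_right_mono) auto
          with cmp have "1/\<tau> - 1 \<le> 1 * (4 powr s - 1)" by (rule order_trans)
          thus ?thesis by simp
        qed
        hence "1 \<le> \<tau> * 4 powr s" using \<tau> by (simp add: field_simps)
        hence "1 \<le> (\<tau> * 4 powr s)^j" by (rule one_le_power)
        thus ?thesis using w0 by (simp add: w_def power_mult_distrib mult.assoc)
      qed
      hence "\<delta> * w0 \<le> t * R0 powr s"
        using \<delta> Q mult_left_mono[of "w 0" "w j * (4 powr s)^j" \<delta>] unfolding QR[symmetric] by (simp add: t_def w_def mult_ac)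
      hence t0: "\<delta> * w0 / R0 powr s \<le> t" using R0 by (simp add: divide_le_eq)
      have "Q \<le> R0 powr s" unfolding Q_def using R[of j] s R0 by (intro powr_mono2) (auto simp: R_def divide_le_eq)
      hence "g (\<delta> * w0 / R0 powr s) / R0 powr s \<le> g t / Q"
        using t0 Q \<delta> w0 t by (intro frac_le g_mono g_nonneg) auto
      thus ?thesis using T0 by simp
    qed
    thus "(\<integral>\<^sup>+y. indicator (- ball x0 R0) y * ennreal (g \<bar>u y / norm (y - x0) powr s\<bar> / (norm (y - x0) powr s * norm (y - x0) ^ ?n)) \<partial>lborel) \<le> ennreal (g t / Q)"
      using tu by (auto intro: order_trans ennreal_leI)
  qed auto
  also have "\<dots> = ennreal (c * (ext_const s ?n * (1 / Q)) + real N * 2^N * (g t / Q))"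
    using c Q t ext_const_nonneg[OF s(1), of ?n]
    by (subst ennreal_plus) (auto simp: ennreal_mult' g_nonneg simp del: times_divide_eq_right)
  also have "c * (ext_const s ?n * (1 / Q)) + real N * 2^N * (g t / Q) = tail_const s ?n * g t / Q"
    by (simp add: tail_const_def c_def add_divide_distrib algebra_simps)
  finally show ?thesis by (simp add: l_def t_def w_def R_def Q_def)
qed

text \<open>The half-measure hypothesis of the growth lemma holds for \<open>u\<close> or for \<open>-u\<close> relative to the middle level. Large initial oscillation absorbs the tail outside the first ball.\<close>

lemma holder_iteration:
  assumes s: "0 < s" "s < 1" and C: "0 \<le> C" and A: "0 \<le> A" and \<beta>: "0 < \<beta>" and R0: "0 < R0" and A0: "0 \<le> A0"
  shows "\<exists>\<alpha> K. 0 < \<alpha> \<and> \<alpha> \<le> 1 \<and> 0 \<le> K \<and> (\<forall>(x0::'a::euclidean_space) u. u \<in> borel_measurable borel \<longrightarrow>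
     (\<forall>R l. 0 < R \<longrightarrow> R \<le> R0 \<longrightarrow> dg_class s C x0 R l (\<lambda>x. - u x)) \<longrightarrow>
     (\<forall>R l. 0 < R \<longrightarrow> R \<le> R0 \<longrightarrow> dg_class s C x0 R l u \<or> (AE x in lborel. x \<in> ball x0 R \<longrightarrow> l - A * R powr \<beta> \<le> u x)) \<longrightarrow>
     (AE x in lborel. x \<in> ball x0 R0 \<longrightarrow> \<bar>u x\<bar> \<le> A0) \<longrightarrow>
     (\<integral>\<^sup>+y. indicator (- ball x0 R0) y * ennreal (g \<bar>u y / norm (y - x0) powr s\<bar> / (norm (y - x0) powr s * norm (y - x0) ^ DIM('a))) \<partial>lborel) \<le> ennreal T0 \<longrightarrow>
     (\<forall>r. 0 < r \<longrightarrow> r \<le> R0 \<longrightarrow> (\<exists>m. AE x in lborel. x \<in> ball x0 r \<longrightarrow> \<bar>u x - m\<bar> \<le> K * r powr \<alpha>)))"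
proof -
  let ?n = "DIM('a)"
  define \<omega> where "\<omega> = unit_ball_vol (real ?n)"
  have \<omega>: "0 < \<omega>" by (simp add: \<omega>_def)
  \<comment> \<open>The tail constant is available before \<delta>, which breaks the apparent circle
    between the growth lemma and the tail estimate.\<close>
  define C1 where "C1 = tail_const s ?n"
  have C1: "0 \<le> C1" unfolding C1_def by (rule tail_const_nonneg[OF s(1)])
  obtain \<delta> where \<delta>: "0 < \<delta>" "\<delta> \<le> 1/4" and
    GL: "\<And>(x0::'a) R k0 U M w. 0 < R \<Longrightarrow> 0 < w \<Longrightarrow> k0 \<le> M - w/2 \<Longrightarrow> dg_class s C x0 R k0 U
     \<Longrightarrow> (AE x in lborel. x \<in> ball x0 R \<longrightarrow> U x \<le> M)
     \<Longrightarrow> ennreal (\<omega> / 2 * (R/2) ^ ?n) \<le> emeasure lborel (ball x0 (R/2) \<inter> {x. U x \<le> M - w/2})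
     \<Longrightarrow> tail s x0 R (M - \<delta> * w) U \<le> ennreal (C1 * g (\<delta> * w / R powr s) / R powr s)
     \<Longrightarrow> (AE x in lborel. x \<in> ball x0 (R/4) \<longrightarrow> U x \<le> M - \<delta> / 4 * w)"
    using growth_lemma[OF s C C1, where 'a = 'a, folded \<omega>_def] by blast
  have four: "1 < 4 powr s" using s powr_less_mono[of 0 s 4] by simp
  \<comment> \<open>Four lower bounds on the contraction factor: 1 - \<delta>/4 is the gain of the
    growth lemma, the second entry yields \<open>cmp\<close>, 4^(-\<beta>) keeps the obstacle term
    below a quarter of \<open>w j\<close> at all scales, and 1/4 makes \<alpha> \<le> 1.\<close>
  define \<tau> where "\<tau> = max (max (1 - \<delta>/4) (1 / (1 + \<delta> * (4 powr s - 1)))) (max (4 powr (-\<beta>)) (1/4))"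
  have \<tau>: "1 - \<delta>/4 \<le> \<tau>" "1 / (1 + \<delta> * (4 powr s - 1)) \<le> \<tau>" "4 powr (-\<beta>) \<le> \<tau>" "1/4 \<le> \<tau>"
    by (simp_all only: \<tau>_def le_max_iff_disj order_refl simp_thms)
  have \<tau>0: "0 < \<tau>" using \<tau> by linarith
  have d4: "0 < \<delta> * (4 powr s - 1)" using \<delta> four by simp
  have \<tau>1: "\<tau> < 1" using \<delta> d4 \<beta> by (auto simp: \<tau>_def powr_less_one divide_less_eq)
  have cmp: "1/\<tau> - 1 \<le> \<delta> * (4 powr s - 1)" using \<tau>(2) \<tau>0 d4 by (simp add: field_simps)
  obtain t0 where t0: "0 < t0" "\<And>t. t0 \<le> t \<Longrightarrow> T0 * R0 powr s \<le> g t" using g_unbounded by blast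
  \<comment> \<open>The summands ensure, in turn, positivity, that the first interval contains the
    values of u, that the obstacle term is small at the first scale, and that the exterior tail
    bound T0 is absorbed.\<close>
  define w0 where "w0 = 1 + 2 * A0 + 4 * A * R0 powr \<beta> + t0 * R0 powr s / \<delta>"
  have w0: "0 < w0" "2 * A0 \<le> w0" "4 * A * R0 powr \<beta> \<le> w0" "t0 * R0 powr s / \<delta> \<le> w0"
  proof -
    have "0 \<le> 4 * A * R0 powr \<beta>" "0 \<le> t0 * R0 powr s / \<delta>" using A t0 \<delta> by auto
    thus "0 < w0" "2 * A0 \<le> w0" "4 * A * R0 powr \<beta> \<le> w0" "t0 * R0 powr s / \<delta> \<le> w0" using A0 by (auto simp: w0_def)
  qed
  have T0: "T0 \<le> g (\<delta> * w0 / R0 powr s) / R0 powr s"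
  proof -
    have "t0 * R0 powr s \<le> \<delta> * w0" using w0(4) \<delta> by (simp add: divide_le_eq mult.commute)
    hence "t0 \<le> \<delta> * w0 / R0 powr s" using R0 by (simp add: le_divide_eq)
    thus ?thesis using t0(2) R0 by (simp add: le_divide_eq)
  qed
  \<comment> \<open>Oscillation \<tau>^j at radius R0 / 4^j corresponds to this power of the
    radius.\<close>
  define \<alpha> where "\<alpha> = - log 4 \<tau>"
  have \<tau>\<alpha>: "\<tau> = 4 powr (- \<alpha>)" using \<tau>0 by (simp add: \<alpha>_def)
  have \<alpha>: "0 < \<alpha>" "\<alpha> \<le> 1"
  proof -
    show "0 < \<alpha>" using \<tau>0 \<tau>1 by (simp add: \<alpha>_def)
    have "log 4 (1/4) \<le> log 4 \<tau>" using \<tau> \<tau>0 by (subst log_le_cancel_iff) auto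
    thus "\<alpha> \<le> 1" by (simp add: \<alpha>_def log_divide)
  qed
  define R where "R j = R0/4^j" for j :: nat
  define w where "w j = w0 * \<tau>^j" for j :: nat
  have R: "0 < R j" "R j \<le> R0" "R (Suc j) = R j / 4" for j
    using R0 one_le_power[of "4::real" j] by (auto simp: R_def divide_le_eq)
  have w: "0 < w j" "w (Suc j) = \<tau> * w j" for j using w0 \<tau>0 by (auto simp: w_def)
  define K where "K = w0 * (4 / R0) powr \<alpha>"
  show ?thesis
  proof (rule exI[of _ \<alpha>], rule exI[of _ K], intro conjI \<alpha> allI impI)
    show "0 \<le> K" using w0 by (simp add: K_def)
    fix x0 :: 'a and u :: "'a \<Rightarrow> real"
    assume um[measurable]: "u \<in> borel_measurable borel"
      and sup: "\<forall>R l. 0 < R \<longrightarrow> R \<le> R0 \<longrightarrow> dg_class s C x0 R l (\<lambda>x. - u x)"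
      and sub: "\<forall>R l. 0 < R \<longrightarrow> R \<le> R0 \<longrightarrow> dg_class s C x0 R l u \<or> (AE x in lborel. x \<in> ball x0 R \<longrightarrow> l - A * R powr \<beta> \<le> u x)"
      and bd: "AE x in lborel. x \<in> ball x0 R0 \<longrightarrow> \<bar>u x\<bar> \<le> A0"
      and tu: "(\<integral>\<^sup>+y. indicator (- ball x0 R0) y * ennreal (g \<bar>u y / norm (y - x0) powr s\<bar> / (norm (y - x0) powr s * norm (y - x0) ^ ?n)) \<partial>lborel) \<le> ennreal T0"
    \<comment> \<open>Nested intervals [f i, f i + w i] holding the values of u on the i-th ball for
      i \<le> j. Nesting is recorded at both ends because the tail estimate for u uses one of the
      inequalities and the one for -u the other.\<close>
    define inv where "inv j f \<longleftrightarrow> f 0 = - w0/2 \<and> (\<forall>i\<le>j. (AE x in lborel. x \<in> ball x0 (R i) \<longrightarrow> f i \<le> u x \<and> u x \<le> f i + w i)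
        \<and> f i \<le> f j \<and> f j + w j \<le> f i + w i)" for j and f :: "nat \<Rightarrow> real"
    have step: "\<exists>v. f j \<le> v \<and> v + w (Suc j) \<le> f j + w j \<and> (AE x in lborel. x \<in> ball x0 (R (Suc j)) \<longrightarrow> v \<le> u x \<and> u x \<le> v + w (Suc j))"
      if inv: "inv j f" for j f
    proof -
      define M where "M = f j + w j"
      have bdj: "AE x in lborel. x \<in> ball x0 (R j) \<longrightarrow> f j \<le> u x \<and> u x \<le> M" using inv by (auto simp: inv_def M_def)
      have f0: "f 0 = - w0/2" "f 0 \<le> f j" "f j + w j \<le> f 0 + w0" using inv by (auto simp: inv_def w_def)
      have wS: "w (Suc j) \<le> w j" "(1 - \<delta>/4) * w j \<le> w (Suc j)"
        using \<tau>(1) \<tau>1 w[of j] by (auto intro: mult_right_mono)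
      have subset: "ball x0 (R (Suc j)) \<subseteq> ball x0 (R j)" using R[of j] by (intro subset_ball) (auto simp: R(3))
      have lower_ok: ?thesis if "AE x in lborel. x \<in> ball x0 (R (Suc j)) \<longrightarrow> f j + \<delta>/4 * w j \<le> u x"
      proof (intro exI[of _ "M - w (Suc j)"] conjI)
        show "f j \<le> M - w (Suc j)" using wS by (simp add: M_def)
        show "M - w (Suc j) + w (Suc j) \<le> f j + w j" by (simp add: M_def)
        show "AE x in lborel. x \<in> ball x0 (R (Suc j)) \<longrightarrow> M - w (Suc j) \<le> u x \<and> u x \<le> M - w (Suc j) + w (Suc j)"
          using that bdj by eventually_elim (use wS(2) subset in \<open>auto simp: M_def algebra_simps\<close>)
      qed
      have upper_ok: ?thesis if "AE x in lborel. x \<in> ball x0 (R (Suc j)) \<longrightarrow> u x \<le> M - \<delta>/4 * w j"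
      proof (intro exI[of _ "f j"] conjI)
        show "f j + w (Suc j) \<le> f j + w j" using wS by simp
        show "AE x in lborel. x \<in> ball x0 (R (Suc j)) \<longrightarrow> f j \<le> u x \<and> u x \<le> f j + w (Suc j)"
          using that bdj by eventually_elim (use wS(2) subset in \<open>auto simp: M_def algebra_simps\<close>)
      qed simp
      define mid where "mid = M - w j / 2"
      have osc_small: "A * R j powr \<beta> \<le> w j / 4"
      proof -
        have "R j powr \<beta> = R0 powr \<beta> * (4 powr (-\<beta>))^j"
        proof -
          have "(4^j) powr \<beta> = (4 powr \<beta>)^j" by (simp add: powr_realpow[symmetric] powr_powr mult.commute)
          thus ?thesis using R0 by (simp add: R_def powr_divide powr_minus_divide power_one_over)
        qed
        hence "A * R j powr \<beta> = (A * R0 powr \<beta>) * (4 powr (-\<beta>))^j" by simp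
        also have "\<dots> \<le> (w0 / 4) * \<tau>^j" using w0 \<tau> A by (intro mult_mono power_mono) auto
        finally show ?thesis by (simp add: w_def)
      qed
      have sets[measurable]: "ball x0 (R j / 2) \<in> sets borel" by auto
      have vol: "emeasure lborel (ball x0 (R j / 2)) = ennreal (\<omega> * (R j / 2) ^ ?n)"
        using R[of j] by (simp add: ball_volume_lborel \<omega>_def)
      show ?thesis
      proof (cases "dg_class s C x0 (R j) mid u")
        \<comment> \<open>The level is not admissible for u, but then u is at least the middle level
          minus a quarter of the oscillation, so the lower end of the interval moves up without any
          energy estimate.\<close>
        case False
        hence "AE x in lborel. x \<in> ball x0 (R j) \<longrightarrow> mid - A * R j powr \<beta> \<le> u x" using sub R[of j] by blast
        hence "AE x in lborel. x \<in> ball x0 (R (Suc j)) \<longrightarrow> f j + \<delta>/4 * w j \<le> u x"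
        proof eventually_elim
          case (elim x)
          have "\<delta>/4 * w j \<le> w j / 4" using \<delta> w[of j] mult_right_mono[of \<delta> 1 "w j"] by simp
          thus ?case using elim osc_small subset by (auto simp: mid_def M_def)
        qed
        thus ?thesis by (rule lower_ok)
      next
        case True
        note dgu = this
        define S1 where "S1 = ball x0 (R j / 2) \<inter> {x. u x \<le> mid}"
        define S2 where "S2 = ball x0 (R j / 2) \<inter> {x. - u x \<le> - mid}"
        have [measurable]: "S1 \<in> sets borel" "S2 \<in> sets borel" unfolding S1_def S2_def by measurable
        show ?thesis
        proof (cases "ennreal (\<omega> / 2 * (R j / 2) ^ ?n) \<le> emeasure lborel S1")
          case True
          have "AE x in lborel. x \<in> ball x0 (R j / 4) \<longrightarrow> u x \<le> M - \<delta>/4 * w j"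
          proof (rule GL[of "R j" "w j" mid M x0 u])
            show "ennreal (\<omega> / 2 * (R j / 2) ^ ?n) \<le> emeasure lborel (ball x0 (R j / 2) \<inter> {x. u x \<le> M - w j / 2})"
              using True by (simp add: S1_def mid_def)
            show "AE x in lborel. x \<in> ball x0 (R j) \<longrightarrow> u x \<le> M" using bdj by (rule eventually_mono) auto
            show "tail s x0 (R j) (M - \<delta> * w j) u \<le> ennreal (C1 * g (\<delta> * w j / R j powr s) / R j powr s)"
              unfolding R_def w_def C1_def
            proof (rule tail_stage[OF s R0 w0(1) \<tau>0 _ \<delta>(1) _ cmp um um _ _ _ tu T0])
              show "- M \<le> w0 - w0 * \<tau>^j" using f0 w0 by (simp add: M_def w_def)
              fix i assume "i \<le> j"
              hence "AE x in lborel. x \<in> ball x0 (R i) \<longrightarrow> f i \<le> u x \<and> u x \<le> f i + w i" "f i \<le> f j" using inv by (auto simp: inv_def)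
              thus "AE x in lborel. x \<in> ball x0 (R0/4^i) \<longrightarrow> u x \<le> M + (w0 * \<tau>^i - w0 * \<tau>^j)"
                by (auto simp: M_def w_def R_def elim!: eventually_mono)
            qed (use \<tau>1 \<delta> in auto)
          qed (use R[of j] w[of j] dgu in \<open>auto simp: mid_def\<close>)
          thus ?thesis using upper_ok by (simp add: R(3))
        next
          case False
          \<comment> \<open>The two sets cover the half ball, so if u is low on less than half of
            it, -u is low on at least half.\<close>
          have "ennreal (\<omega> * (R j / 2) ^ ?n) \<le> emeasure lborel (S1 \<union> S2)"
            unfolding vol[symmetric] by (rule emeasure_mono) (auto simp: S1_def S2_def)
          also have "\<dots> \<le> emeasure lborel S1 + emeasure lborel S2" by (rule emeasure_subadditive) auto
          also have "\<dots> \<le> ennreal (\<omega> / 2 * (R j / 2) ^ ?n) + emeasure lborel S2" using False by (intro add_right_mono) auto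
          finally have half2: "ennreal (\<omega> * (R j / 2) ^ ?n) \<le> ennreal (\<omega> / 2 * (R j / 2) ^ ?n) + emeasure lborel S2" .
          have S2: "ennreal (\<omega> / 2 * (R j / 2) ^ ?n) \<le> emeasure lborel S2"
          proof (cases "emeasure lborel S2")
            case (real e)
            hence "ennreal (\<omega> * (R j / 2) ^ ?n) \<le> ennreal (\<omega> / 2 * (R j / 2) ^ ?n + e)" using half2 \<omega> R[of j] by (simp add: ennreal_plus)
            hence "\<omega> * (R j / 2) ^ ?n \<le> \<omega> / 2 * (R j / 2) ^ ?n + e" using real \<omega> R[of j] by (subst (asm) ennreal_le_iff) auto
            thus ?thesis using real by (auto intro!: ennreal_leI)
          qed simp
          have "AE x in lborel. x \<in> ball x0 (R j / 4) \<longrightarrow> - u x \<le> - f j - \<delta>/4 * w j"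
          proof (rule GL[of "R j" "w j" "- mid" "- f j" x0 "\<lambda>x. - u x"])
            show "ennreal (\<omega> / 2 * (R j / 2) ^ ?n) \<le> emeasure lborel (ball x0 (R j / 2) \<inter> {x. - u x \<le> - f j - w j / 2})"
            proof -
              have "- mid = - f j - w j / 2" by (simp add: mid_def M_def)
              thus ?thesis using S2 unfolding S2_def by (simp only:)
            qed
            show "AE x in lborel. x \<in> ball x0 (R j) \<longrightarrow> - u x \<le> - f j" using bdj by (rule eventually_mono) auto
            show "dg_class s C x0 (R j) (- mid) (\<lambda>x. - u x)" using sup R[of j] by blast
            show "tail s x0 (R j) (- f j - \<delta> * w j) (\<lambda>x. - u x) \<le> ennreal (C1 * g (\<delta> * w j / R j powr s) / R j powr s)"
              unfolding R_def w_def C1_def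
            proof (rule tail_stage[OF s R0 w0(1) \<tau>0 _ \<delta>(1) _ cmp _ um _ _ _ tu T0])
              show "- (- f j) \<le> w0 - w0 * \<tau>^j" using f0 w0 by (simp add: w_def)
              fix i assume "i \<le> j"
              hence "AE x in lborel. x \<in> ball x0 (R i) \<longrightarrow> f i \<le> u x \<and> u x \<le> f i + w i" "f j + w j \<le> f i + w i" using inv by (auto simp: inv_def)
              thus "AE x in lborel. x \<in> ball x0 (R0/4^i) \<longrightarrow> - u x \<le> - f j + (w0 * \<tau>^i - w0 * \<tau>^j)"
                by (auto simp: w_def R_def elim!: eventually_mono)
            qed (use \<tau>1 \<delta> in auto)
          qed (use R[of j] w[of j] in \<open>auto simp: mid_def M_def\<close>)
          hence "AE x in lborel. x \<in> ball x0 (R (Suc j)) \<longrightarrow> f j + \<delta>/4 * w j \<le> u x"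
            unfolding R(3) by (rule eventually_mono) auto
          thus ?thesis by (rule lower_ok)
        qed
      qed
    qed
    have ex: "\<exists>f. inv j f" for j
    proof (induction j)
      case 0
      have "inv 0 (\<lambda>_. - w0/2)" unfolding inv_def using bd w0(2)
        by (auto simp: R_def w_def abs_le_iff elim!: eventually_mono)
      thus ?case by blast
    next
      case (Suc j)
      then obtain f where f: "inv j f" by blast
      from step[OF f] obtain v where v: "f j \<le> v" "v + w (Suc j) \<le> f j + w j"
        "AE x in lborel. x \<in> ball x0 (R (Suc j)) \<longrightarrow> v \<le> u x \<and> u x \<le> v + w (Suc j)" by blast
      have "inv (Suc j) (f(Suc j := v))" unfolding inv_def
      proof (intro conjI allI impI)
        show "(f(Suc j := v)) 0 = - w0/2" using f by (simp add: inv_def)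
        fix i assume i: "i \<le> Suc j"
        show "AE x in lborel. x \<in> ball x0 (R i) \<longrightarrow> (f(Suc j := v)) i \<le> u x \<and> u x \<le> (f(Suc j := v)) i + w i"
          using f v i by (cases "i = Suc j") (auto simp: inv_def)
        have old: "f i \<le> f j" "f j + w j \<le> f i + w i" if "i \<le> j" using f that by (auto simp: inv_def)
        show "(f(Suc j := v)) i \<le> (f(Suc j := v)) (Suc j)"
          using old v(1) i by (cases "i = Suc j") auto
        show "(f(Suc j := v)) (Suc j) + w (Suc j) \<le> (f(Suc j := v)) i + w i"
          using old v(2) i by (cases "i = Suc j") auto
      qed
      thus ?case by blast
    qed
    fix r assume r: "0 < r" "r \<le> R0"
    \<comment> \<open>The scale just above r: its radius is less than 4 r, which accounts for the
      factor 4 in K.\<close>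
    obtain j where j: "R (Suc j) < r" "r \<le> R j"
    proof -
      have "(\<lambda>j. R0 * (1/4)^j) \<longlonglongrightarrow> R0 * 0" by (intro tendsto_intros LIMSEQ_power_zero) auto
      hence "\<forall>\<^sub>F j in sequentially. R0 * (1/4)^j < r" using r(1) by (intro order_tendstoD(2)[where y = 0]) auto
      then obtain k0 where "R0 * (1/4)^k0 < r" by (auto simp: eventually_sequentially)
      hence k0: "R k0 < r" by (simp add: R_def power_divide)
      define k where "k = (LEAST i. R i < r)"
      have k: "R k < r" unfolding k_def using k0 by (rule LeastI)
      have "k \<noteq> 0" using k r by (intro notI) (simp add: R_def)
      then obtain i where i: "k = Suc i" by (cases k) auto
      have "\<not> R i < r" using not_less_Least[of i "\<lambda>i. R i < r"] i by (simp add: k_def)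
      thus ?thesis using that[of i] k i by simp
    qed
    obtain f where f: "inv j f" using ex by blast
    have wj: "w j \<le> K * r powr \<alpha>"
    proof -
      have "\<tau>^j = (R j / R0) powr \<alpha>"
      proof -
        have "(4^j) powr \<alpha> = (4 powr \<alpha>)^j" by (simp add: powr_realpow[symmetric] powr_powr mult.commute)
        moreover have "R j / R0 = 1 / 4^j" using R0 by (simp add: R_def)
        ultimately show ?thesis by (simp add: \<tau>\<alpha> powr_divide powr_minus_divide power_one_over)
      qed
      also have "\<dots> \<le> (4 / R0 * r) powr \<alpha>"
        using j(1) R[of j] R0 \<alpha> r by (intro powr_mono2) (auto simp: R(3) divide_right_mono)
      also have "\<dots> = (4 / R0) powr \<alpha> * r powr \<alpha>" using R0 r by (subst powr_mult[symmetric]) auto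
      finally show ?thesis using w0 by (simp add: w_def K_def mult.assoc)
    qed
    show "\<exists>m. AE x in lborel. x \<in> ball x0 r \<longrightarrow> \<bar>u x - m\<bar> \<le> K * r powr \<alpha>"
    proof (intro exI[of _ "f j"])
      have "AE x in lborel. x \<in> ball x0 (R j) \<longrightarrow> f j \<le> u x \<and> u x \<le> f j + w j" using f by (auto simp: inv_def)
      thus "AE x in lborel. x \<in> ball x0 r \<longrightarrow> \<bar>u x - f j\<bar> \<le> K * r powr \<alpha>"
        by (rule eventually_mono) (use j wj in auto)
    qed
  qed
qed

end

section \<open>The continuous representative\<close>

text \<open>A limit insensitive to null sets; it supplies the values of the continuous
  representative.\<close>

definition ess_limit :: "('a::euclidean_space \<Rightarrow> real) \<Rightarrow> 'a \<Rightarrow> real \<Rightarrow> bool" where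
  "ess_limit u x c \<longleftrightarrow> (\<forall>e>0. \<exists>r>0. AE y in lborel. y \<in> ball x r \<longrightarrow> \<bar>u y - c\<bar> \<le> e)"

lemma AE_meets_open:
  fixes S :: "'a::euclidean_space set"
  assumes "AE y in lborel. P y" "open S" "S \<noteq> {}" shows "\<exists>y\<in>S. P y"
proof (rule ccontr)
  assume a: "\<not> ?thesis"
  obtain x where "x \<in> S" using assms by blast
  then obtain r where r: "0 < r" "ball x r \<subseteq> S" using assms(2) open_contains_ball by blast
  have "AE y in lborel. y \<notin> ball x r" using assms(1) by (rule eventually_mono) (use a r in blast)
  hence "emeasure lborel (ball x r) = 0"
    by (subst (asm) AE_iff_measurable[OF _ refl]) (auto simp: ball_def)
  thus False using r unit_ball_vol_pos[of "real DIM('a)"] by (simp add: emeasure_ball)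
qed

text \<open>Overlapping balls meet in a nonempty open set, which is not null, so both almost
  everywhere bounds hold at a common point.\<close>

lemma AE_ball_close:
  assumes "AE y in lborel. y \<in> ball x r \<longrightarrow> \<bar>u y - a\<bar> \<le> d" "AE y in lborel. y \<in> ball x' r' \<longrightarrow> \<bar>u y - b\<bar> \<le> e"
    and "z \<in> ball x r" "z \<in> ball x' (r'::real)"
  shows "\<bar>a - b\<bar> \<le> d + (e::real)"
proof -
  have "AE y in lborel. (y \<in> ball x r \<longrightarrow> \<bar>u y - a\<bar> \<le> d) \<and> (y \<in> ball x' r' \<longrightarrow> \<bar>u y - b\<bar> \<le> e)"
    using assms(1,2) by (rule eventually_conj)
  moreover have "open (ball x r \<inter> ball x' r')" by auto
  moreover have "ball x r \<inter> ball x' r' \<noteq> {}" using assms(3,4) by blast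
  ultimately obtain y where "\<bar>u y - a\<bar> \<le> d" "\<bar>u y - b\<bar> \<le> e" using AE_meets_open by blast
  thus ?thesis by linarith
qed

text \<open>The centres m of the oscillation bounds at different radii are compared at a common
  point, so they form a Cauchy sequence as the radii shrink.\<close>

lemma ess_limit_exists:
  fixes x :: "'a::euclidean_space"
  assumes C: "0 \<le> C" and \<alpha>: "0 < \<alpha>" and R0: "0 < R0"
    and osc: "\<And>r. 0 < r \<Longrightarrow> r \<le> R0 \<Longrightarrow> \<exists>m. AE y in lborel. y \<in> ball x r \<longrightarrow> \<bar>u y - m\<bar> \<le> C * r powr \<alpha>"
  shows "\<exists>c. ess_limit u x c"
proof -
  define r where "r j = R0 / real (Suc j)" for j
  have r: "0 < r j" "r j \<le> R0" for j using R0 by (auto simp: r_def divide_le_eq)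
  have rlim: "(\<lambda>j. C * r j powr \<alpha>) \<longlonglongrightarrow> 0"
  proof -
    have "r \<longlonglongrightarrow> 0" unfolding r_def using tendsto_mult[OF tendsto_const[of R0] LIMSEQ_inverse_real_of_nat] by (simp add: divide_inverse)
    hence "(\<lambda>j. C * r j powr \<alpha>) \<longlonglongrightarrow> C * 0 powr \<alpha>"
      using r(1) \<alpha> by (intro tendsto_intros tendsto_powr2) (auto intro!: always_eventually less_imp_le)
    thus ?thesis using \<alpha> by simp
  qed
  have "\<forall>j. \<exists>m. AE y in lborel. y \<in> ball x (r j) \<longrightarrow> \<bar>u y - m\<bar> \<le> C * r j powr \<alpha>" using osc r by blast
  then obtain m where m: "\<And>j. AE y in lborel. y \<in> ball x (r j) \<longrightarrow> \<bar>u y - m j\<bar> \<le> C * r j powr \<alpha>" by metis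
  have mm: "\<bar>m i - m j\<bar> \<le> C * r i powr \<alpha> + C * r j powr \<alpha>" for i j
    by (rule AE_ball_close[OF m[of i] m[of j], of x]) (use r in auto)
  have "Cauchy m"
  proof (rule metric_CauchyI)
    fix e :: real assume e: "0 < e"
    from order_tendstoD(2)[OF rlim, of "e/2"] e obtain J where J: "\<And>j. j \<ge> J \<Longrightarrow> C * r j powr \<alpha> < e/2"
      by (auto simp: eventually_sequentially)
    show "\<exists>M. \<forall>i\<ge>M. \<forall>j\<ge>M. dist (m i) (m j) < e"
    proof (intro exI[of _ J] allI impI)
      fix i j assume "J \<le> i" "J \<le> j"
      thus "dist (m i) (m j) < e" using mm[of i j] J[of i] J[of j] by (simp add: dist_real_def)
    qed
  qed
  then obtain c where c: "m \<longlonglongrightarrow> c" using Cauchy_convergent_iff convergent_def by blast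
  have "ess_limit u x c" unfolding ess_limit_def
  proof (intro allI impI)
    fix e :: real assume e: "0 < e"
    have "\<forall>\<^sub>F j in sequentially. dist (m j) c < e/2" using c e by (intro tendstoD) auto
    moreover have "\<forall>\<^sub>F j in sequentially. C * r j powr \<alpha> < e/2" by (rule order_tendstoD(2)[OF rlim]) (use e in simp)
    ultimately have "\<forall>\<^sub>F j in sequentially. dist (m j) c < e/2 \<and> C * r j powr \<alpha> < e/2" by (rule eventually_conj)
    then obtain j where j: "dist (m j) c < e/2" "C * r j powr \<alpha> < e/2" using eventually_happens by fastforce
    show "\<exists>r>0. AE y in lborel. y \<in> ball x r \<longrightarrow> \<bar>u y - c\<bar> \<le> e"
    proof (intro exI[of _ "r j"] conjI r)
      show "AE y in lborel. y \<in> ball x (r j) \<longrightarrow> \<bar>u y - c\<bar> \<le> e"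
        using m[of j]
      proof (rule eventually_mono, intro impI)
        fix y assume "y \<in> ball x (r j) \<longrightarrow> \<bar>u y - m j\<bar> \<le> C * r j powr \<alpha>" "y \<in> ball x (r j)"
        hence "\<bar>u y - m j\<bar> \<le> C * r j powr \<alpha>" by blast
        thus "\<bar>u y - c\<bar> \<le> e" using j unfolding dist_real_def by linarith
      qed
    qed
  qed
  thus ?thesis ..
qed

lemma ess_limit_close:
  assumes c: "ess_limit u x c" and r: "0 < r" and m: "AE y in lborel. y \<in> ball x r \<longrightarrow> \<bar>u y - m\<bar> \<le> d"
  shows "\<bar>c - m\<bar> \<le> d"
proof (rule field_le_epsilon)
  fix e :: real assume "0 < e"
  then obtain r' where r': "0 < r'" "AE y in lborel. y \<in> ball x r' \<longrightarrow> \<bar>u y - c\<bar> \<le> e" using c unfolding ess_limit_def by blast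
  have "\<bar>c - m\<bar> \<le> e + d" by (rule AE_ball_close[OF r'(2) m, of x]) (use r r' in auto)
  thus "\<bar>c - m\<bar> \<le> d + e" by simp
qed

text \<open>At each point of \<Omega> the oscillation bounds give an essential limit. Limits at two
  nearby points are compared through overlapping balls of radius just above their distance, which is
  the Hoelder estimate at short range; distant pairs are covered by boundedness on compact
  sets.\<close>

lemma holder_representative:
  fixes u :: "'a::euclidean_space \<Rightarrow> real"
  assumes \<Omega>: "open \<Omega>"
    and H: "\<And>K. compact K \<Longrightarrow> K \<subseteq> \<Omega> \<Longrightarrow> \<exists>\<alpha> C R0. 0 < \<alpha> \<and> \<alpha> \<le> 1 \<and> 0 \<le> C \<and> 0 < R0 \<and>
      (\<forall>x\<in>K. \<forall>r. 0 < r \<longrightarrow> r \<le> R0 \<longrightarrow> (\<exists>m. AE y in lborel. y \<in> ball x r \<longrightarrow> \<bar>u y - m\<bar> \<le> C * r powr \<alpha>))"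
  shows "\<exists>w. (AE x in lborel. u x = w x) \<and> locally_holder_on \<Omega> w"
proof -
  \<comment> \<open>Outside \<Omega> the representative is u itself, so equality almost everywhere
    has to be shown only inside.\<close>
  define w where "w x = (if x \<in> \<Omega> then SOME c. ess_limit u x c else u x)" for x
  have lim: "ess_limit u x (w x)" if "x \<in> \<Omega>" for x
  proof -
    have "compact {x}" "{x} \<subseteq> \<Omega>" using that by auto
    from H[OF this] obtain \<alpha> C R0 where "0 < \<alpha>" "0 \<le> C" "0 < R0"
      "\<forall>x'\<in>{x}. \<forall>r. 0 < r \<longrightarrow> r \<le> R0 \<longrightarrow> (\<exists>m. AE y in lborel. y \<in> ball x' r \<longrightarrow> \<bar>u y - m\<bar> \<le> C * r powr \<alpha>)"
      by blast
    hence "\<exists>c. ess_limit u x c" by (intro ess_limit_exists[of C \<alpha> R0]) auto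
    thus ?thesis using that by (simp add: w_def someI_ex)
  qed
  have near: "AE y in lborel. y \<in> ball x r \<longrightarrow> \<bar>u y - w x\<bar> \<le> 2 * d"
    if x: "x \<in> \<Omega>" and r: "0 < r" and m: "AE y in lborel. y \<in> ball x r \<longrightarrow> \<bar>u y - m\<bar> \<le> d" for x r m d
  proof -
    have "\<bar>w x - m\<bar> \<le> d" by (rule ess_limit_close[OF lim[OF x] r m])
    with m show ?thesis by (auto elim!: eventually_mono)
  qed
  have "locally_holder_on \<Omega> w" unfolding locally_holder_on_def
  proof (intro allI impI)
    fix K :: "'a set" assume K: "compact K \<and> K \<subseteq> \<Omega>"
    then obtain \<alpha> C R0 where 1: "0 < \<alpha>" "\<alpha> \<le> 1" "0 \<le> C" "0 < R0"
      and osc: "\<And>x r. x \<in> K \<Longrightarrow> 0 < r \<Longrightarrow> r \<le> R0 \<Longrightarrow> \<exists>m. AE y in lborel. y \<in> ball x r \<longrightarrow> \<bar>u y - m\<bar> \<le> C * r powr \<alpha>"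
      using H[of K] by blast
    have close: "\<bar>w x - w y\<bar> \<le> 4 * C * r powr \<alpha>" if "x \<in> K" "y \<in> K" "0 < r" "r \<le> R0" "dist x y < r" for x y r
    proof -
      obtain m where m: "AE z in lborel. z \<in> ball x r \<longrightarrow> \<bar>u z - m\<bar> \<le> C * r powr \<alpha>" using osc[OF \<open>x \<in> K\<close> \<open>0 < r\<close> \<open>r \<le> R0\<close>] by blast
      obtain m' where m': "AE z in lborel. z \<in> ball y r \<longrightarrow> \<bar>u z - m'\<bar> \<le> C * r powr \<alpha>" using osc[OF \<open>y \<in> K\<close> \<open>0 < r\<close> \<open>r \<le> R0\<close>] by blast
      have "\<bar>w x - w y\<bar> \<le> 2 * (C * r powr \<alpha>) + 2 * (C * r powr \<alpha>)"
        by (rule AE_ball_close[OF near[OF _ _ m] near[OF _ _ m'], of x]) (use that K in \<open>auto simp: dist_commute\<close>)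
      thus ?thesis by simp
    qed
    have "\<exists>W\<ge>0. \<forall>x\<in>K. \<bar>w x\<bar> \<le> W"
    proof -
      obtain F where F: "F \<subseteq> K" "finite F" "K \<subseteq> (\<Union>c\<in>F. ball c R0)"
        using compactE_image[of K K "\<lambda>c. ball c R0"] K 1 by force
      define W where "W = 4 * C * R0 powr \<alpha> + (\<Sum>c\<in>F. \<bar>w c\<bar>)"
      show ?thesis
      proof (intro exI[of _ W] conjI ballI)
        show "0 \<le> W" using 1 by (auto simp: W_def intro!: add_nonneg_nonneg sum_nonneg)
        fix x assume x: "x \<in> K"
        then obtain c where c: "c \<in> F" "x \<in> ball c R0" using F by blast
        have "\<bar>w x - w c\<bar> \<le> 4 * C * R0 powr \<alpha>" using c x F 1 by (intro close) (auto simp: dist_commute)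
        moreover have "\<bar>w c\<bar> \<le> (\<Sum>c\<in>F. \<bar>w c\<bar>)" using F c by (intro member_le_sum) auto
        ultimately show "\<bar>w x\<bar> \<le> W" by (simp add: W_def)
      qed
    qed
    then obtain W where W: "0 \<le> W" "\<And>x. x \<in> K \<Longrightarrow> \<bar>w x\<bar> \<le> W" by blast
    \<comment> \<open>First summand for pairs with 2 |x-y| \<le> R0, the doubling keeping the
      distance strictly below the radius used; second summand for the remaining pairs, where (2
      |x-y| / R0)^\<alpha> is at least 1.\<close>
    define D where "D = 4 * C * 2 powr \<alpha> + 2 * W * (2 / R0) powr \<alpha>"
    have "\<bar>w x - w y\<bar> \<le> D * norm (x - y) powr \<alpha>" if xy: "x \<in> K" "y \<in> K" for x y
    proof (cases "x = y")
      case False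
      hence n: "0 < norm (x - y)" by simp
      show ?thesis
      proof (cases "2 * norm (x - y) \<le> R0")
        case True
        have "\<bar>w x - w y\<bar> \<le> 4 * C * (2 * norm (x - y)) powr \<alpha>" using n True xy by (intro close) (auto simp: dist_norm)
        also have "\<dots> = 4 * C * 2 powr \<alpha> * norm (x - y) powr \<alpha>" by (simp add: powr_mult)
        also have "\<dots> \<le> D * norm (x - y) powr \<alpha>" using W by (intro mult_right_mono) (auto simp: D_def)
        finally show ?thesis .
      next
        case far: False
        have "1 \<le> (2 / R0 * norm (x - y)) powr \<alpha>" using far 1 by (intro ge_one_powr_ge_zero) (auto simp: field_simps)
        hence "1 \<le> (2 / R0) powr \<alpha> * norm (x - y) powr \<alpha>" using 1 n by (subst powr_mult[symmetric]) auto
        hence "2 * W * 1 \<le> 2 * W * ((2 / R0) powr \<alpha> * norm (x - y) powr \<alpha>)" using W by (intro mult_left_mono) auto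
        also have "\<dots> = (2 * W * (2 / R0) powr \<alpha>) * norm (x - y) powr \<alpha>" by simp
        also have "\<dots> \<le> D * norm (x - y) powr \<alpha>" using 1 by (intro mult_right_mono) (auto simp: D_def)
        finally show ?thesis using W(2)[OF xy(1)] W(2)[OF xy(2)] by linarith
      qed
    qed simp
    thus "\<exists>\<alpha> C. 0 < \<alpha> \<and> \<alpha> \<le> 1 \<and> (\<forall>x\<in>K. \<forall>y\<in>K. \<bar>w x - w y\<bar> \<le> C * norm (x - y) powr \<alpha>)" using 1 by blast
  qed
  moreover have "AE x in lborel. u x = w x"
  proof -
    have AEK: "AE x in lborel. x \<in> K \<longrightarrow> u x = w x" if K: "compact K" "K \<subseteq> \<Omega>" for K
    proof -
      obtain \<alpha> C R0 where 1: "0 < \<alpha>" "\<alpha> \<le> 1" "0 \<le> C" "0 < R0"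
        and osc: "\<And>x r. x \<in> K \<Longrightarrow> 0 < r \<Longrightarrow> r \<le> R0 \<Longrightarrow> \<exists>m. AE y in lborel. y \<in> ball x r \<longrightarrow> \<bar>u y - m\<bar> \<le> C * r powr \<alpha>"
        using H[OF K] by blast
      \<comment> \<open>Finite covers at the countably many radii R0 / (j+1) leave one null set, off
        which the difference is bounded by a sequence tending to 0.\<close>
      have "AE x in lborel. \<forall>j::nat. x \<in> K \<longrightarrow> \<bar>u x - w x\<bar> \<le> 4 * C * (R0 / Suc j) powr \<alpha>"
        unfolding AE_all_countable
      proof
        fix j :: nat
        define r where "r = R0 / Suc j"
        have r: "0 < r" "r \<le> R0" using 1 by (auto simp: r_def divide_le_eq)
        obtain F where F: "F \<subseteq> K" "finite F" "K \<subseteq> (\<Union>c\<in>F. ball c r)"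
          using compactE_image[of K K "\<lambda>c. ball c r"] K r by force
        have "\<forall>c\<in>F. \<exists>m. AE y in lborel. y \<in> ball c r \<longrightarrow> \<bar>u y - m\<bar> \<le> C * r powr \<alpha>" using osc F r by blast
        then obtain m where m: "\<And>c. c \<in> F \<Longrightarrow> AE y in lborel. y \<in> ball c r \<longrightarrow> \<bar>u y - m c\<bar> \<le> C * r powr \<alpha>" by metis
        have "AE x in lborel. \<forall>c\<in>F. x \<in> ball c r \<longrightarrow> \<bar>u x - m c\<bar> \<le> C * r powr \<alpha>"
          by (rule AE_finite_allI[OF F(2) m])
        thus "AE x in lborel. x \<in> K \<longrightarrow> \<bar>u x - w x\<bar> \<le> 4 * C * (R0 / Suc j) powr \<alpha>"
        proof (rule eventually_mono, intro impI)
          fix x assume x: "\<forall>c\<in>F. x \<in> ball c r \<longrightarrow> \<bar>u x - m c\<bar> \<le> C * r powr \<alpha>" "x \<in> K"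
          then obtain c where c: "c \<in> F" "x \<in> ball c r" using F by blast
          have x\<Omega>: "x \<in> \<Omega>" using x K by blast
          obtain m' where m': "AE y in lborel. y \<in> ball x r \<longrightarrow> \<bar>u y - m'\<bar> \<le> C * r powr \<alpha>" using osc[OF x(2) r] by blast
          have "\<bar>m c - w x\<bar> \<le> C * r powr \<alpha> + 2 * (C * r powr \<alpha>)"
            by (rule AE_ball_close[OF m[OF c(1)] near[OF x\<Omega> r(1) m'], of x]) (use c r in auto)
          moreover have "\<bar>u x - m c\<bar> \<le> C * r powr \<alpha>" using x c by blast
          ultimately show "\<bar>u x - w x\<bar> \<le> 4 * C * (R0 / Suc j) powr \<alpha>" unfolding r_def[symmetric] by linarith
        qed
      qed
      thus ?thesis
      proof (rule eventually_mono, intro impI)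
        fix x assume x: "\<forall>j::nat. x \<in> K \<longrightarrow> \<bar>u x - w x\<bar> \<le> 4 * C * (R0 / Suc j) powr \<alpha>" "x \<in> K"
        have "(\<lambda>j. R0 / real (Suc j)) \<longlonglongrightarrow> 0"
          using tendsto_mult[OF tendsto_const[of R0] LIMSEQ_inverse_real_of_nat] by (simp add: divide_inverse)
        hence "(\<lambda>j. 4 * C * (R0 / Suc j) powr \<alpha>) \<longlonglongrightarrow> 4 * C * 0 powr \<alpha>"
          using 1 by (intro tendsto_intros tendsto_powr2) (auto intro!: always_eventually)
        hence "\<bar>u x - w x\<bar> \<le> 4 * C * 0 powr \<alpha>" by (rule LIMSEQ_le_const) (use x in auto)
        thus "u x = w x" using 1 by simp
      qed
    qed
    obtain C where C: "\<And>n::nat. compact (C n)" "\<And>n. C n \<subseteq> \<Omega>" "\<Union>(range C) = \<Omega>"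
      using open_Union_compact_subsets[OF \<Omega>] by metis
    have "AE x in lborel. \<forall>n::nat. x \<in> C n \<longrightarrow> u x = w x" unfolding AE_all_countable using AEK C by blast
    thus ?thesis
    proof (rule eventually_mono)
      fix x assume "\<forall>n. x \<in> C n \<longrightarrow> u x = w x"
      thus "u x = w x" using C(3) by (cases "x \<in> \<Omega>") (auto simp: w_def)
    qed
  qed
  ultimately show ?thesis by blast
qed

section \<open>Solutions of the obstacle problem\<close>

lemma energy_integrand_uminus_left:
  "energy_integrand s g k (\<lambda>x. - u x) w z = - energy_integrand s g k u w z"
proof -
  have "Ds s (\<lambda>x. - u x) x y = - Ds s u x y" for x y by (simp add: Ds_def minus_divide_left)
  thus ?thesis by (simp add: energy_integrand_def sgn_minus)
qed

lemma energy_integrand_uminus_right: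
  "energy_integrand s g k u (\<lambda>x. - w x) z = - energy_integrand s g k u w z"
proof -
  have "Ds s (\<lambda>x. - w x) x y = - Ds s w x y" for x y by (simp add: Ds_def minus_divide_left)
  thus ?thesis by (simp add: energy_integrand_def)
qed

context growth
begin

text \<open>The inputs of \<open>MW_cutoff\<close> are supplied: the N-th power of the cutoff is
  Lipschitz and bounded by 1, and the positive part is 1-Lipschitz, so difference quotients do not
  increase. This makes the Caccioppoli test function an admissible perturbation.\<close>

lemma truncation_total:
  fixes U :: "'a::euclidean_space \<Rightarrow> real" and x0 :: 'a and s l r R :: real
  assumes s: "0 < s" "s < 1" and \<Omega>: "open \<Omega>" "bounded \<Omega>" and [measurable]: "\<Omega>' \<in> sets borel" and sub: "\<Omega> \<subseteq> \<Omega>'"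
    and U[measurable]: "U \<in> borel_measurable borel" and r: "0 < r" "r < R" "cball x0 R \<subseteq> \<Omega>"
    and finL: "(\<integral>\<^sup>+x. indicator \<Omega> x * ennreal (G \<bar>U x\<bar>) \<partial>lborel) < \<infinity>"
    and finW: "(\<integral>\<^sup>+x. \<integral>\<^sup>+y. indicator \<Omega> x * indicator \<Omega>' y * ennreal (G \<bar>Ds s U x y\<bar> / norm (x - y) ^ DIM('a)) \<partial>lborel \<partial>lborel) < \<infinity>"
  defines "w \<equiv> \<lambda>x. cutoff x0 r ((r + R) / 2) x ^ N * max 0 (U x - l)"
  shows "w \<in> borel_measurable borel" "(\<integral>\<^sup>+x. ennreal (G \<bar>w x\<bar>) \<partial>lborel) < \<infinity>" "MW s G w < \<infinity>"
    "\<And>x. x \<notin> cball x0 R \<Longrightarrow> w x = 0"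
proof -
  have \<Omega>m[measurable]: "\<Omega> \<in> sets borel" using \<Omega> by simp
  have rr: "r < (r + R) / 2" using r by simp
  note cp = cutoff_props[OF rr, where ?x0.0 = x0]
  let ?\<zeta> = "\<lambda>x. cutoff x0 r ((r + R) / 2) x ^ N" and ?a = "\<lambda>x. max 0 (U x - l)"
  show "w \<in> borel_measurable borel" unfolding w_def by measurable
  have z: "?\<zeta> x = 0" if "x \<notin> cball x0 R" for x
    using cp(4)[of x] that r by (simp add: dist_norm norm_minus_commute zero_power)
  thus "\<And>x. x \<notin> cball x0 R \<Longrightarrow> w x = 0" by (simp add: w_def)
  have B: "\<bar>?\<zeta> x\<bar> \<le> 1" for x using cp(1,2)[of x] by (simp add: power_le_one)
  have Lp: "\<bar>?\<zeta> x - ?\<zeta> y\<bar> \<le> (real N * (1 / ((r + R) / 2 - r))) * norm (x - y)" for x y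
  proof -
    have "\<bar>?\<zeta> x - ?\<zeta> y\<bar> \<le> real N * \<bar>cutoff x0 r ((r + R) / 2) x - cutoff x0 r ((r + R) / 2) y\<bar>"
      using norm_power_diff[of "cutoff x0 r ((r + R) / 2) x" "cutoff x0 r ((r + R) / 2) y" N] cp(1,2)[of x] cp(1,2)[of y] by simp
    also have "\<dots> \<le> real N * (1 / ((r + R) / 2 - r) * norm (x - y))" by (intro mult_left_mono cp(5)) auto
    finally show ?thesis by (simp only: mult.assoc)
  qed
  have fa: "(\<integral>\<^sup>+x. indicator \<Omega> x * ennreal (G \<bar>?a x\<bar>) \<partial>lborel) < \<infinity>"
  proof -
    have "(\<integral>\<^sup>+x. indicator \<Omega> x * ennreal (G \<bar>?a x\<bar>) \<partial>lborel)
      \<le> (\<integral>\<^sup>+x. ennreal (2^N) * (indicator \<Omega> x * ennreal (G \<bar>U x\<bar>)) + ennreal (2^N * G \<bar>l\<bar>) * indicator \<Omega> x \<partial>lborel)"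
    proof (rule nn_integral_mono)
      fix x
      have "G \<bar>?a x\<bar> \<le> G (\<bar>U x\<bar> + \<bar>l\<bar>)" by (intro G_mono) auto
      also have "\<dots> \<le> 2^N * (G \<bar>U x\<bar> + G \<bar>l\<bar>)" by (intro G_add) auto
      finally have "ennreal (G \<bar>?a x\<bar>) \<le> ennreal (2^N * G \<bar>U x\<bar> + 2^N * G \<bar>l\<bar>)" by (intro ennreal_leI) (simp add: algebra_simps)
      also have "\<dots> = ennreal (2^N) * ennreal (G \<bar>U x\<bar>) + ennreal (2^N * G \<bar>l\<bar>)"
        by (subst ennreal_plus) (auto simp: ennreal_mult' G_nonneg)
      finally show "indicator \<Omega> x * ennreal (G \<bar>?a x\<bar>) \<le> ennreal (2^N) * (indicator \<Omega> x * ennreal (G \<bar>U x\<bar>)) + ennreal (2^N * G \<bar>l\<bar>) * indicator \<Omega> x"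
        by (auto simp: indicator_def)
    qed
    also have "\<dots> = ennreal (2^N) * (\<integral>\<^sup>+x. indicator \<Omega> x * ennreal (G \<bar>U x\<bar>) \<partial>lborel) + ennreal (2^N * G \<bar>l\<bar>) * emeasure lborel \<Omega>"
      by (subst nn_integral_add, measurable) (simp add: nn_integral_cmult)
    also have "\<dots> < \<infinity>" using finL emeasure_bounded_finite[OF \<Omega>(2)] by (simp add: ennreal_mult_less_top)
    finally show ?thesis .
  qed
  have fW: "(\<integral>\<^sup>+x. \<integral>\<^sup>+y. indicator \<Omega> x * indicator \<Omega>' y * ennreal (G \<bar>Ds s ?a x y\<bar> / norm (x - y) ^ DIM('a)) \<partial>lborel \<partial>lborel) < \<infinity>"
  proof (rule le_less_trans[OF _ finW], intro nn_integral_mono mult_left_mono ennreal_leI divide_right_mono G_mono)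
    fix x y
    have "\<bar>?a x - ?a y\<bar> \<le> \<bar>U x - U y\<bar>" by (auto simp: max_def)
    thus "\<bar>Ds s ?a x y\<bar> \<le> \<bar>Ds s U x y\<bar>" by (simp add: Ds_def divide_right_mono)
  qed auto
  note T = MW_cutoff[OF s _ _ \<Omega>m _ _ r(3) sub z B Lp fa fW]
  show "MW s G w < \<infinity>" unfolding w_def by (rule T(1)) measurable
  show "(\<integral>\<^sup>+x. ennreal (G \<bar>w x\<bar>) \<partial>lborel) < \<infinity>" unfolding w_def by (rule T(2)) measurable
qed

text \<open>A crude bound without smallness; local boundedness is obtained from it by taking the
  height H large instead of the excess small.\<close>

lemma excess_bound:
  fixes U u :: "'a::euclidean_space \<Rightarrow> real"
  assumes [measurable]: "u \<in> borel_measurable borel" "\<Omega> \<in> sets borel"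
    and Uu: "\<And>x. U x \<le> \<bar>u x\<bar>" and l: "0 \<le> l" and R: "0 < R" and sub: "ball x0 R \<subseteq> \<Omega>"
  shows "excess s x0 R l U \<le> ennreal ((max 1 (1 / R powr s)) ^ N) * (\<integral>\<^sup>+x. indicator \<Omega> x * ennreal (G \<bar>u x\<bar>) \<partial>lborel)"
proof -
  define c where "c = max 1 (1 / R powr s)"
  have "excess s x0 R l U \<le> (\<integral>\<^sup>+x. ennreal (c ^ N) * (indicator \<Omega> x * ennreal (G \<bar>u x\<bar>)) \<partial>lborel)"
    unfolding excess_def
  proof (rule nn_integral_mono)
    fix x
    have "max 0 (U x - l) / R powr s \<le> c * \<bar>u x\<bar>"
    proof -
      have "max 0 (U x - l) / R powr s \<le> \<bar>u x\<bar> / R powr s" using Uu[of x] l by (intro divide_right_mono) auto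
      also have "\<dots> = (1 / R powr s) * \<bar>u x\<bar>" by simp
      also have "\<dots> \<le> c * \<bar>u x\<bar>" by (intro mult_right_mono) (auto simp: c_def)
      finally show ?thesis .
    qed
    hence "G \<bar>max 0 (U x - l) / R powr s\<bar> \<le> G (c * \<bar>u x\<bar>)" by (intro G_mono) auto
    also have "\<dots> \<le> c ^ N * G \<bar>u x\<bar>" by (intro G_scale_upper) (auto simp: c_def)
    finally have "ennreal (G \<bar>max 0 (U x - l) / R powr s\<bar>) \<le> ennreal (c ^ N) * ennreal (G \<bar>u x\<bar>)"
      by (subst ennreal_mult'[symmetric]) (auto simp: c_def intro!: ennreal_leI)
    thus "indicator (ball x0 R) x * ennreal (G \<bar>max 0 (U x - l) / R powr s\<bar>) \<le> ennreal (c ^ N) * (indicator \<Omega> x * ennreal (G \<bar>u x\<bar>))"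
      using sub by (auto simp: indicator_def)
  qed
  also have "\<dots> = ennreal (c ^ N) * (\<integral>\<^sup>+x. indicator \<Omega> x * ennreal (G \<bar>u x\<bar>) \<partial>lborel)" by (rule nn_integral_cmult) measurable
  finally show ?thesis by (simp add: c_def)
qed

text \<open>For y at distance at least r from x0, the weight 1 + |y| is at most \<Theta> |y - x0|,
  so the global tail condition dominates every tail centred in a bounded set, uniformly.\<close>

lemma uniform_tail:
  fixes u :: "'a::euclidean_space \<Rightarrow> real"
  assumes s: "0 < s" "s < 1" and [measurable]: "u \<in> borel_measurable borel" and r: "0 < r" and D: "0 \<le> D"
    and fin: "(\<integral>\<^sup>+x. ennreal (g \<bar>\<bar>u x\<bar> / (1 + norm x) powr s\<bar> * (1 + norm x) powr (- (real DIM('a) + s))) \<partial>lborel) < \<infinity>"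
  shows "\<exists>T\<ge>0. \<forall>x0. norm x0 \<le> D \<longrightarrow> (\<integral>\<^sup>+y. indicator (- ball x0 r) y * ennreal (g \<bar>u y / norm (y - x0) powr s\<bar> / (norm (y - x0) powr s * norm (y - x0) ^ DIM('a))) \<partial>lborel) \<le> ennreal T"
proof -
  let ?n = "DIM('a)"
  \<comment> \<open>1 + |y| \<le> (1 + D) + |y - x0|, and 1 + D is at most (1 + D)/r times |y -
    x0|.\<close>
  define \<Theta> where "\<Theta> = (1 + D) / r + 1"
  have \<Theta>: "1 \<le> \<Theta>" using r D by (simp add: \<Theta>_def)
  define c where "c = real N * \<Theta> ^ N * \<Theta> ^ (?n + 1)"
  have c: "0 \<le> c" using \<Theta> by (simp add: c_def)
  define F where "F x = ennreal (g \<bar>\<bar>u x\<bar> / (1 + norm x) powr s\<bar> * (1 + norm x) powr (- (real ?n + s)))" for x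
  have [measurable]: "F \<in> borel_measurable borel" unfolding F_def by measurable
  obtain T where T: "0 \<le> T" "ennreal c * (\<integral>\<^sup>+x. F x \<partial>lborel) = ennreal T"
  proof -
    have "ennreal c * (\<integral>\<^sup>+x. F x \<partial>lborel) < \<infinity>" using fin by (simp add: F_def ennreal_mult_less_top)
    thus ?thesis using that by (cases "ennreal c * (\<integral>\<^sup>+x. F x \<partial>lborel)") auto
  qed
  show ?thesis
  proof (intro exI[of _ T] conjI T allI impI)
    fix x0 :: 'a assume x0: "norm x0 \<le> D"
    have "(\<integral>\<^sup>+y. indicator (- ball x0 r) y * ennreal (g \<bar>u y / norm (y - x0) powr s\<bar> / (norm (y - x0) powr s * norm (y - x0) ^ ?n)) \<partial>lborel)
      \<le> (\<integral>\<^sup>+y. ennreal c * F y \<partial>lborel)"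
    proof (rule nn_integral_mono)
      fix y
      show "indicator (- ball x0 r) y * ennreal (g \<bar>u y / norm (y - x0) powr s\<bar> / (norm (y - x0) powr s * norm (y - x0) ^ ?n)) \<le> ennreal c * F y"
      proof (cases "y \<in> ball x0 r")
        case False
        define d where "d = norm (y - x0)"
        define e where "e = 1 + norm y"
        have d: "r \<le> d" "0 < d" using False r by (auto simp: d_def dist_norm norm_minus_commute)
        have e: "1 \<le> e" by (simp add: e_def)
        have "norm y \<le> d + norm x0" unfolding d_def using norm_triangle_ineq[of "y - x0" x0] by simp
        hence "e \<le> (1 + D) + d" using x0 by (simp add: e_def)
        also have "(1 + D) \<le> (1 + D) / r * d"
          using mult_left_mono[OF d(1), of "(1 + D) / r"] r D by simp
        finally have ed: "e \<le> \<Theta> * d" by (simp add: \<Theta>_def distrib_right)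
        have es: "e powr s \<le> \<Theta> * d powr s"
        proof -
          have "e powr s \<le> (\<Theta> * d) powr s" using ed e s by (intro powr_mono2) auto
          also have "\<dots> = \<Theta> powr s * d powr s" using \<Theta> d by (simp add: powr_mult)
          also have "\<dots> \<le> \<Theta> powr 1 * d powr s" using \<Theta> s by (intro mult_right_mono powr_mono) auto
          finally show ?thesis using \<Theta> by simp
        qed
        have en: "e ^ ?n \<le> \<Theta> ^ ?n * d ^ ?n" unfolding power_mult_distrib[symmetric] using ed e by (intro power_mono) auto
        have "g (\<bar>u y\<bar> / d powr s) \<le> g (\<Theta> * (\<bar>u y\<bar> / e powr s))"
        proof (rule g_mono)
          have "\<bar>u y\<bar> * e powr s \<le> \<bar>u y\<bar> * (\<Theta> * d powr s)" using es by (intro mult_left_mono) auto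
          thus "\<bar>u y\<bar> / d powr s \<le> \<Theta> * (\<bar>u y\<bar> / e powr s)" using d e by (simp add: field_simps)
        qed simp
        also have "\<dots> \<le> real N * \<Theta> ^ N * g (\<bar>u y\<bar> / e powr s)" using \<Theta> by (intro g_scale_upper) auto
        finally have gb: "g (\<bar>u y\<bar> / d powr s) \<le> real N * \<Theta> ^ N * g (\<bar>u y\<bar> / e powr s)" .
        have den: "1 / (d powr s * d ^ ?n) \<le> \<Theta> ^ (?n + 1) / (e powr s * e ^ ?n)"
        proof -
          have "e powr s * e ^ ?n \<le> (\<Theta> * d powr s) * (\<Theta> ^ ?n * d ^ ?n)" using es en \<Theta> e by (intro mult_mono) auto
          thus ?thesis using d e by (simp add: field_simps)
        qed
        have "g (\<bar>u y\<bar> / d powr s) / (d powr s * d ^ ?n) = g (\<bar>u y\<bar> / d powr s) * (1 / (d powr s * d ^ ?n))" by simp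
        also have "\<dots> \<le> (real N * \<Theta> ^ N * g (\<bar>u y\<bar> / e powr s)) * (\<Theta> ^ (?n + 1) / (e powr s * e ^ ?n))"
          using gb den \<Theta> d by (intro mult_mono) (auto intro!: mult_nonneg_nonneg g_nonneg)
        also have "\<dots> = c * (g (\<bar>u y\<bar> / e powr s) / (e powr s * e ^ ?n))" by (simp add: c_def)
        also have "g (\<bar>u y\<bar> / e powr s) / (e powr s * e ^ ?n) = g \<bar>\<bar>u y\<bar> / e powr s\<bar> * e powr (- (real ?n + s))"
        proof -
          have "e powr (- (real ?n + s)) = 1 / e powr (real ?n + s)" by (rule powr_minus_divide)
          also have "e powr (real ?n + s) = e powr s * e ^ ?n" using e by (simp add: powr_add powr_realpow mult.commute)
          finally show ?thesis by simp
        qed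
        finally have "ennreal (g (\<bar>u y\<bar> / d powr s) / (d powr s * d ^ ?n)) \<le> ennreal c * F y"
          unfolding F_def e_def[symmetric] using c by (subst ennreal_mult'[symmetric]) (auto intro: ennreal_leI)
        thus ?thesis using False by (simp add: d_def[symmetric])
      qed simp
    qed
    also have "\<dots> = ennreal c * (\<integral>\<^sup>+y. F y \<partial>lborel)" by (rule nn_integral_cmult) measurable
    also have "\<dots> = ennreal T" by (rule T(2))
    finally show "(\<integral>\<^sup>+y. indicator (- ball x0 r) y * ennreal (g \<bar>u y / norm (y - x0) powr s\<bar> / (norm (y - x0) powr s * norm (y - x0) ^ ?n)) \<partial>lborel) \<le> ennreal T" .
  qed
qed

lemma tail_le_abs:
  fixes U u :: "'a::euclidean_space \<Rightarrow> real"
  assumes Uu: "\<And>x. U x \<le> \<bar>u x\<bar>" and l: "0 \<le> l"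
  shows "tail s x0 r l U \<le> (\<integral>\<^sup>+y. indicator (- ball x0 r) y * ennreal (g \<bar>u y / norm (y - x0) powr s\<bar> / (norm (y - x0) powr s * norm (y - x0) ^ DIM('a))) \<partial>lborel)"
  unfolding tail_def
proof (intro nn_integral_mono mult_left_mono ennreal_leI divide_right_mono g_mono)
  fix y
  have "max 0 (U y - l) \<le> \<bar>u y\<bar>" using Uu[of y] l by auto
  thus "\<bar>max 0 (U y - l) / norm (y - x0) powr s\<bar> \<le> \<bar>u y / norm (y - x0) powr s\<bar>"
    by (simp add: divide_right_mono)
qed auto

end

text \<open>A single point where \<psi> falls below l - A R^\<beta> forces \<psi> \<le> l on the
  whole ball by Hoelder continuity; otherwise the obstacle is bounded below there. This dichotomy
  decides whether a level is admissible for u.\<close>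

lemma obstacle_alternative:
  fixes \<psi> :: "'a::euclidean_space \<Rightarrow> ereal"
  assumes psi: "(\<forall>x\<in>\<Omega>. \<bar>\<psi> x\<bar> \<noteq> \<infinity>) \<and> locally_holder_on \<Omega> (\<lambda>x. real_of_ereal (\<psi> x)) \<or> (\<forall>x\<in>\<Omega>. \<psi> x = -\<infinity>)"
    and K: "compact K" "K \<subseteq> \<Omega>"
  shows "\<exists>L \<beta> A. 0 \<le> L \<and> 0 < \<beta> \<and> 0 \<le> A \<and> (\<forall>x\<in>K. \<psi> x \<le> ereal L) \<and>
    (\<forall>x0 R l. 0 < R \<longrightarrow> ball x0 R \<subseteq> K \<longrightarrow> (\<forall>x\<in>ball x0 R. \<psi> x \<le> ereal l) \<or> (\<forall>x\<in>ball x0 R. ereal (l - A * R powr \<beta>) \<le> \<psi> x))"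
proof (cases "\<forall>x\<in>\<Omega>. \<psi> x = -\<infinity>")
  case True
  hence "\<forall>x\<in>K. \<psi> x = -\<infinity>" using K by blast
  thus ?thesis by (intro exI[of _ 0] exI[of _ 1]) (auto simp: subset_iff)
next
  case False
  define f where "f x = real_of_ereal (\<psi> x)" for x
  have psi': "\<forall>x\<in>\<Omega>. \<bar>\<psi> x\<bar> \<noteq> \<infinity>" and lh: "locally_holder_on \<Omega> f"
    using psi False unfolding f_def[abs_def] by simp_all
  have fin: "\<psi> x = ereal (f x)" if "x \<in> K" for x
  proof -
    have "\<bar>\<psi> x\<bar> \<noteq> \<infinity>" by (rule bspec[OF psi' subsetD[OF K(2) that]])
    thus ?thesis unfolding f_def by (simp add: ereal_real)
  qed
  have "\<exists>\<beta> C. 0 < \<beta> \<and> \<beta> \<le> 1 \<and> (\<forall>x\<in>K. \<forall>y\<in>K. \<bar>f x - f y\<bar> \<le> C * norm (x - y) powr \<beta>)"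
    by (rule lh[unfolded locally_holder_on_def, rule_format]) (use K in simp)
  then obtain \<beta> C where \<beta>: "0 < \<beta>" "\<beta> \<le> 1" and C: "\<And>x y. x \<in> K \<Longrightarrow> y \<in> K \<Longrightarrow> \<bar>f x - f y\<bar> \<le> C * norm (x - y) powr \<beta>"
    by (elim exE conjE) blast
  \<comment> \<open>Two points of a ball of radius R are at most 2 R apart, hence the factor
    2^\<beta>.\<close>
  define A where "A = \<bar>C\<bar> * 2 powr \<beta>"
  have A: "0 \<le> A" by (simp add: A_def)
  obtain D where D: "\<And>x y. x \<in> K \<Longrightarrow> y \<in> K \<Longrightarrow> norm (x - y) \<le> D"
  proof -
    obtain B where B: "\<forall>x\<in>K. norm x \<le> B" using compact_imp_bounded[OF K(1)] unfolding bounded_iff by blast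
    have "norm (x - y) \<le> 2 * B" if "x \<in> K" "y \<in> K" for x y
      using bspec[OF B that(1)] bspec[OF B that(2)] norm_triangle_ineq4[of x y] by linarith
    thus ?thesis using that by blast
  qed
  have "\<exists>L\<ge>0. \<forall>x\<in>K. f x \<le> L"
  proof (cases "K = {}")
    case False
    then obtain z where z: "z \<in> K" by blast
    have "f x \<le> \<bar>f z\<bar> + \<bar>C\<bar> * D powr \<beta>" if "x \<in> K" for x
    proof -
      have "C * norm (x - z) powr \<beta> \<le> \<bar>C\<bar> * D powr \<beta>"
        using D[OF that z] \<beta> by (intro mult_mono powr_mono2) auto
      thus ?thesis using C[OF that z] by linarith
    qed
    thus ?thesis by (intro exI[of _ "\<bar>f z\<bar> + \<bar>C\<bar> * D powr \<beta>"]) auto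
  qed auto
  then obtain L where L: "0 \<le> L" "\<And>x. x \<in> K \<Longrightarrow> f x \<le> L" by blast
  have alt: "(\<forall>x\<in>ball x0 R. \<psi> x \<le> ereal l) \<or> (\<forall>x\<in>ball x0 R. ereal (l - A * R powr \<beta>) \<le> \<psi> x)"
    if R: "0 < R" "ball x0 R \<subseteq> K" for x0 R l
  proof (rule disjCI)
    assume "\<not> (\<forall>x\<in>ball x0 R. ereal (l - A * R powr \<beta>) \<le> \<psi> x)"
    then obtain z where z: "z \<in> ball x0 R" "\<not> ereal (l - A * R powr \<beta>) \<le> \<psi> z" by blast
    hence zK: "z \<in> K" "f z < l - A * R powr \<beta>" using fin R by auto
    show "\<forall>x\<in>ball x0 R. \<psi> x \<le> ereal l"
    proof
      fix x assume x: "x \<in> ball x0 R"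
      hence xK: "x \<in> K" using R by blast
      have "dist x z \<le> dist x0 x + dist x0 z" by (metis dist_commute dist_triangle)
      hence "norm (x - z) \<le> 2 * R" using x z by (simp add: dist_norm[symmetric])
      hence "C * norm (x - z) powr \<beta> \<le> \<bar>C\<bar> * (2 * R) powr \<beta>" using \<beta> by (intro mult_mono powr_mono2) auto
      also have "\<dots> = A * R powr \<beta>" using R by (simp add: A_def powr_mult)
      finally have "f x \<le> l" using C[OF xK zK(1)] zK(2) by linarith
      thus "\<psi> x \<le> ereal l" using fin[OF xK] by simp
    qed
  qed
  show ?thesis
    by (rule exI[of _ L], rule exI[of _ \<beta>], rule exI[of _ A]) (use L \<beta> A fin alt in auto)
qed

section \<open>Local oscillation of solutions and finiteness of their tails\<close>

context growth
begin

definition obstacle_const :: "real \<Rightarrow> real \<Rightarrow> nat \<Rightarrow> real" where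
  "obstacle_const s \<Lambda> n = \<Lambda>\<^sup>2 * cacc_const s n * 4 ^ (N + n + 1)"

lemma obstacle_const_nonneg: assumes "0 < s" "s < 1" shows "0 \<le> obstacle_const s \<Lambda> n"
proof -
  have "2 powr (-((1 - s) * p)) < 1" using assms p_gt_1 by (simp add: powr_less_one)
  hence "0 \<le> cacc_const s n"
    unfolding cacc_const_def by (auto intro!: add_nonneg_nonneg mult_nonneg_nonneg divide_nonneg_nonneg)
  thus ?thesis by (simp add: obstacle_const_def)
qed

text \<open>The factor 4 in the Caccioppoli ratio is moved into the constant, so that
  \<open>dg_class\<close> carries the plain ratio R / (R - r).\<close>

lemma dg_classI:
  fixes U :: "'a::euclidean_space \<Rightarrow> real"
  assumes s: "0 < s" "s < 1" and L: "1 \<le> \<Lambda>" and U: "U \<in> borel_measurable borel"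
    and k_bounds: "AE z in lebesgue \<Otimes>\<^sub>M lebesgue. 1 / \<Lambda> \<le> k (fst z) (snd z) \<and> k (fst z) (snd z) \<le> \<Lambda>"
    and en: "\<And>l r R. k0 \<le> l \<Longrightarrow> 0 < r \<Longrightarrow> r < R \<Longrightarrow> R \<le> R0 \<Longrightarrow>
       integrable (lebesgue \<Otimes>\<^sub>M lebesgue) (energy_integrand s g k U (\<lambda>x. cutoff x0 r ((r + R) / 2) x ^ N * max 0 (U x - l)))
       \<and> energy s g k U (\<lambda>x. cutoff x0 r ((r + R) / 2) x ^ N * max 0 (U x - l)) \<le> 0"
  shows "dg_class s (obstacle_const s \<Lambda> DIM('a)) x0 R0 k0 U"
  unfolding dg_class_def
proof (intro conjI U allI impI)
  fix l r R assume a: "k0 \<le> l" "0 < r \<and> r < R \<and> R \<le> R0"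
  have "(4 * R / (R - r)) ^ (N + DIM('a) + 1) = 4 ^ (N + DIM('a) + 1) * (R / (R - r)) ^ (N + DIM('a) + 1)"
    unfolding power_mult_distrib[symmetric] by simp
  hence eq: "\<Lambda>\<^sup>2 * cacc_const s DIM('a) * (4 * R / (R - r)) ^ (N + DIM('a) + 1)
     = obstacle_const s \<Lambda> DIM('a) * (R / (R - r)) ^ (N + DIM('a) + 1)"
    by (simp only: obstacle_const_def mult.assoc)
  show "(\<integral>\<^sup>+x. \<integral>\<^sup>+y. ennreal (cross s x0 r R l U x y) \<partial>lborel \<partial>lborel)
       \<le> ennreal (obstacle_const s \<Lambda> DIM('a) * (R / (R - r)) ^ (N + DIM('a) + 1)) * (excess s x0 R l U + mass x0 R l U * tail s x0 R l U)"
    unfolding eq[symmetric] using en[of l r R] a by (intro caccioppoli[OF s _ _ L U k_bounds]) auto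
qed

text \<open>The hypothesis \<open>min\<close> isolates what is used of minimality: the energy paired
  with an admissible perturbation is nonnegative. Local boundedness comes first, since the
  oscillation iteration needs a bound on an initial ball; all constants are uniform over K.\<close>

lemma obstacle_local_oscillation:
  fixes u :: "'a::euclidean_space \<Rightarrow> real"
  assumes s: "0 < s" "s < 1" and L: "1 \<le> \<Lambda>"
    and k_bounds: "AE z in lebesgue \<Otimes>\<^sub>M lebesgue. 1 / \<Lambda> \<le> k (fst z) (snd z) \<and> k (fst z) (snd z) \<le> \<Lambda>"
    and \<Omega>: "open \<Omega>" "bounded \<Omega>" and \<Omega>': "\<Omega>' \<in> sets borel" and sub: "\<Omega> \<subseteq> \<Omega>'"
    and psi: "(\<forall>x\<in>\<Omega>. \<bar>\<psi> x\<bar> \<noteq> \<infinity>) \<and> locally_holder_on \<Omega> (\<lambda>x. real_of_ereal (\<psi> x)) \<or> (\<forall>x\<in>\<Omega>. \<psi> x = -\<infinity>)"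
    and um[measurable]: "u \<in> borel_measurable borel"
    and finL: "(\<integral>\<^sup>+x. indicator \<Omega> x * ennreal (G \<bar>u x\<bar>) \<partial>lborel) < \<infinity>"
    and finW: "(\<integral>\<^sup>+x. \<integral>\<^sup>+y. indicator \<Omega> x * indicator \<Omega>' y * ennreal (G \<bar>Ds s u x y\<bar> / norm (x - y) ^ DIM('a)) \<partial>lborel \<partial>lborel) < \<infinity>"
    and finT: "(\<integral>\<^sup>+x. ennreal (g \<bar>\<bar>u x\<bar> / (1 + norm x) powr s\<bar> * (1 + norm x) powr (- (real DIM('a) + s))) \<partial>lborel) < \<infinity>"
    and above: "AE x in lborel. x \<in> \<Omega> \<longrightarrow> \<psi> x \<le> ereal (u x)"
    and min: "\<And>w K. w \<in> borel_measurable borel \<Longrightarrow> compact K \<Longrightarrow> K \<subseteq> \<Omega> \<Longrightarrow> (\<And>x. x \<notin> K \<Longrightarrow> w x = 0) \<Longrightarrow>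
       (\<integral>\<^sup>+x. ennreal (G \<bar>w x\<bar>) \<partial>lborel) < \<infinity> \<Longrightarrow> MW s G w < \<infinity> \<Longrightarrow>
       (AE x in lborel. x \<in> \<Omega> \<longrightarrow> \<psi> x \<le> ereal (u x + w x)) \<Longrightarrow>
       integrable (lebesgue \<Otimes>\<^sub>M lebesgue) (energy_integrand s g k u w) \<and> 0 \<le> energy s g k u w"
    and K: "compact K" "K \<subseteq> \<Omega>"
  shows "\<exists>\<alpha> C R0. 0 < \<alpha> \<and> \<alpha> \<le> 1 \<and> 0 \<le> C \<and> 0 < R0 \<and>
      (\<forall>x\<in>K. \<forall>r. 0 < r \<longrightarrow> r \<le> R0 \<longrightarrow> (\<exists>m. AE y in lborel. y \<in> ball x r \<longrightarrow> \<bar>u y - m\<bar> \<le> C * r powr \<alpha>))"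
proof -
  let ?n = "DIM('a)"
  define CC where "CC = obstacle_const s \<Lambda> ?n"
  have CC: "0 \<le> CC" unfolding CC_def by (rule obstacle_const_nonneg[OF s])
  have \<Omega>m[measurable]: "\<Omega> \<in> sets borel" using \<Omega> by simp
  have finL': "(\<integral>\<^sup>+x. indicator \<Omega> x * ennreal (G \<bar>- u x\<bar>) \<partial>lborel) < \<infinity>" using finL by simp
  have finW': "(\<integral>\<^sup>+x. \<integral>\<^sup>+y. indicator \<Omega> x * indicator \<Omega>' y * ennreal (G \<bar>Ds s (\<lambda>x. - u x) x y\<bar> / norm (x - y) ^ ?n) \<partial>lborel \<partial>lborel) < \<infinity>"
    using finW by (simp add: Ds_def abs_minus_commute)
  \<comment> \<open>The perturbation raises u, so it stays above the obstacle at every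
    level.\<close>
  have dg_super: "dg_class s CC x0 R0 k0 (\<lambda>x. - u x)" if ball: "cball x0 R0 \<subseteq> \<Omega>" for x0 R0 k0
    unfolding CC_def
  proof (rule dg_classI[OF s L _ k_bounds])
    fix l r R assume a: "k0 \<le> l" "0 < r" "r < R" "R \<le> R0"
    have cb: "cball x0 R \<subseteq> \<Omega>" using ball a by (meson order_trans subset_cball)
    define w where "w = (\<lambda>x. cutoff x0 r ((r + R) / 2) x ^ N * max 0 (- u x - l))"
    have rr: "r < (r + R) / 2" using a by simp
    have "(\<lambda>x. - u x) \<in> borel_measurable borel" by measurable
    note T0 = truncation_total[OF s \<Omega> \<Omega>' sub this a(2,3) cb finL' finW', where l = l]
    have T: "w \<in> borel_measurable borel" "(\<integral>\<^sup>+x. ennreal (G \<bar>w x\<bar>) \<partial>lborel) < \<infinity>" "MW s G w < \<infinity>"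
      "\<And>x. x \<notin> cball x0 R \<Longrightarrow> w x = 0"
      unfolding w_def by (rule T0 | assumption)+
    have "AE x in lborel. x \<in> \<Omega> \<longrightarrow> \<psi> x \<le> ereal (u x + w x)" using above
    proof (rule eventually_mono, intro impI)
      fix x assume x: "x \<in> \<Omega> \<longrightarrow> \<psi> x \<le> ereal (u x)" "x \<in> \<Omega>"
      have "0 \<le> w x" unfolding w_def using cutoff_props(1)[OF rr] by (intro mult_nonneg_nonneg zero_le_power) auto
      hence "ereal (u x) \<le> ereal (u x + w x)" by simp
      thus "\<psi> x \<le> ereal (u x + w x)" using x order_trans by blast
    qed
    hence "integrable (lebesgue \<Otimes>\<^sub>M lebesgue) (energy_integrand s g k u w) \<and> 0 \<le> energy s g k u w"
      by (intro min[OF T(1) compact_cball cb T(4) T(2,3)])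
    thus "integrable (lebesgue \<Otimes>\<^sub>M lebesgue) (energy_integrand s g k (\<lambda>x. - u x) (\<lambda>x. cutoff x0 r ((r + R) / 2) x ^ N * max 0 (- u x - l)))
       \<and> energy s g k (\<lambda>x. - u x) (\<lambda>x. cutoff x0 r ((r + R) / 2) x ^ N * max 0 (- u x - l)) \<le> 0"
      unfolding w_def[symmetric] energy_def energy_integrand_uminus_left[abs_def] by simp
  qed measurable
  \<comment> \<open>Subtracting a fraction of the part of u above l leaves u at least l wherever it
    was changed, and l dominates the obstacle on the ball.\<close>
  have dg_sub: "dg_class s CC x0 R0 k0 u" if ball: "cball x0 R0 \<subseteq> \<Omega>" and ob: "\<forall>x\<in>ball x0 R0. \<psi> x \<le> ereal k0" for x0 R0 k0
    unfolding CC_def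
  proof (rule dg_classI[OF s L _ k_bounds])
    fix l r R assume a: "k0 \<le> l" "0 < r" "r < R" "R \<le> R0"
    have cb: "cball x0 R \<subseteq> \<Omega>" using ball a by (meson order_trans subset_cball)
    define w where "w = (\<lambda>x. cutoff x0 r ((r + R) / 2) x ^ N * max 0 (u x - l))"
    have rr: "r < (r + R) / 2" using a by simp
    note cp = cutoff_props[OF rr, where ?x0.0 = x0]
    note T0 = truncation_total[OF s \<Omega> \<Omega>' sub um a(2,3) cb finL finW, where l = l]
    have T: "w \<in> borel_measurable borel" "(\<integral>\<^sup>+x. ennreal (G \<bar>w x\<bar>) \<partial>lborel) < \<infinity>" "MW s G w < \<infinity>"
      "\<And>x. x \<notin> cball x0 R \<Longrightarrow> w x = 0"
      unfolding w_def by (rule T0 | assumption)+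
    have "AE x in lborel. x \<in> \<Omega> \<longrightarrow> \<psi> x \<le> ereal (u x + - w x)" using above
    proof (rule eventually_mono, intro impI)
      fix x assume x: "x \<in> \<Omega> \<longrightarrow> \<psi> x \<le> ereal (u x)" "x \<in> \<Omega>"
      show "\<psi> x \<le> ereal (u x + - w x)"
      proof (cases "x \<in> ball x0 R0 \<and> l < u x")
        case True
        have "cutoff x0 r ((r + R) / 2) x ^ N \<le> 1" using cp(1,2) by (intro power_le_one)
        hence "w x \<le> 1 * max 0 (u x - l)" unfolding w_def by (intro mult_right_mono) auto
        hence "l \<le> u x + - w x" using True by simp
        moreover have "\<psi> x \<le> ereal k0" using True ob by blast
        ultimately show ?thesis using a(1) by (meson ereal_less_eq(3) order_trans)
      next
        case False
        have "w x = 0"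
        proof (cases "l < u x")
          case True
          hence "R0 \<le> norm (x - x0)" using False by (simp add: dist_norm norm_minus_commute)
          hence "cutoff x0 r ((r + R) / 2) x = 0" using a by (intro cp(4)) simp
          thus ?thesis by (simp add: w_def zero_power)
        qed (simp add: w_def max_def)
        thus ?thesis using x by simp
      qed
    qed
    moreover have "(\<lambda>x. - w x) \<in> borel_measurable borel" using T(1) by measurable
    moreover have "MW s G (\<lambda>x. - w x) < \<infinity>" using T(3) by (simp add: MW_def Ds_def abs_minus_commute)
    moreover have "(\<integral>\<^sup>+x. ennreal (G \<bar>- w x\<bar>) \<partial>lborel) < \<infinity>" using T(2) by simp
    ultimately have "integrable (lebesgue \<Otimes>\<^sub>M lebesgue) (energy_integrand s g k u (\<lambda>x. - w x)) \<and> 0 \<le> energy s g k u (\<lambda>x. - w x)"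
      using T(4) by (intro min[OF _ compact_cball cb]) auto
    thus "integrable (lebesgue \<Otimes>\<^sub>M lebesgue) (energy_integrand s g k u (\<lambda>x. cutoff x0 r ((r + R) / 2) x ^ N * max 0 (u x - l)))
       \<and> energy s g k u (\<lambda>x. cutoff x0 r ((r + R) / 2) x ^ N * max 0 (u x - l)) \<le> 0"
      unfolding w_def[symmetric] energy_def energy_integrand_uminus_right[abs_def] by simp
  qed measurable
  obtain \<rho> where \<rho>: "0 < \<rho>" "(\<Union>x\<in>K. cball x \<rho>) \<subseteq> \<Omega>"
    using compact_subset_open_imp_cball_epsilon_subset[OF K(1) \<Omega>(1) K(2)] by metis
  \<comment> \<open>A compact neighbourhood of K, giving one upper bound and one Hoelder exponent of
    the obstacle for all balls used.\<close>
  define K' where "K' = {x + y |x y. x \<in> K \<and> y \<in> cball 0 \<rho>}"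
  have K'c: "compact K'" unfolding K'_def by (rule compact_sums[OF K(1) compact_cball])
  have cbK': "cball x \<rho> \<subseteq> K'" if "x \<in> K" for x
  proof
    fix y assume "y \<in> cball x \<rho>"
    thus "y \<in> K'" unfolding K'_def using that
      by (intro CollectI exI[of _ x] exI[of _ "y - x"]) (auto simp: dist_norm norm_minus_commute)
  qed
  have K'\<Omega>: "K' \<subseteq> \<Omega>"
  proof
    fix z assume "z \<in> K'"
    then obtain x y where "z = x + y" "x \<in> K" "y \<in> cball 0 \<rho>" by (auto simp: K'_def)
    hence "x \<in> K" "z \<in> cball x \<rho>" by (auto simp: dist_norm)
    thus "z \<in> \<Omega>" using \<rho> by blast
  qed
  obtain B \<beta> A where B: "0 \<le> B" "\<And>x. x \<in> K' \<Longrightarrow> \<psi> x \<le> ereal B" and \<beta>: "0 < \<beta>" and A: "0 \<le> A"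
    and alt: "\<And>x0 R l. 0 < R \<Longrightarrow> ball x0 R \<subseteq> K' \<Longrightarrow> (\<forall>x\<in>ball x0 R. \<psi> x \<le> ereal l) \<or> (\<forall>x\<in>ball x0 R. ereal (l - A * R powr \<beta>) \<le> \<psi> x)"
    using obstacle_alternative[OF psi K'c K'\<Omega>] by blast
  obtain D where D: "0 \<le> D" "\<And>x. x \<in> K \<Longrightarrow> norm x \<le> D"
  proof -
    obtain D where "\<forall>x\<in>K. norm x \<le> D" using compact_imp_bounded[OF K(1)] unfolding bounded_iff by blast
    thus ?thesis using that[of "max 0 D"] by fastforce
  qed
  \<comment> \<open>Local boundedness holds on half of the ball of radius \<rho>, and the iteration
    starts there.\<close>
  define R0 where "R0 = \<rho> / 2"
  have R0: "0 < R0" using \<rho> by (simp add: R0_def)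
  obtain T where T: "0 \<le> T" "\<And>x0. norm x0 \<le> D \<Longrightarrow> (\<integral>\<^sup>+y. indicator (- ball x0 R0) y * ennreal (g \<bar>u y / norm (y - x0) powr s\<bar> / (norm (y - x0) powr s * norm (y - x0) ^ ?n)) \<partial>lborel) \<le> ennreal T"
    using uniform_tail[OF s um R0 D(1) finT] by blast
  obtain \<epsilon> where \<epsilon>: "0 < \<epsilon>" and DG: "\<And>(x0::'a) R k0 U l H. 0 < R \<Longrightarrow> 0 < H \<Longrightarrow> k0 \<le> l \<Longrightarrow> dg_class s CC x0 R k0 U
     \<Longrightarrow> tail s x0 (R/2) l U \<le> ennreal (1 * g (H / R powr s) / R powr s)
     \<Longrightarrow> excess s x0 R l U \<le> ennreal (\<epsilon> * R ^ ?n * G (H / R powr s))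
     \<Longrightarrow> (AE x in lborel. x \<in> ball x0 (R/2) \<longrightarrow> U x \<le> l + H)"
    using de_giorgi[OF s CC zero_le_one, where 'a = 'a] by blast
  define Q where "Q = \<rho> powr s"
  have Q: "0 < Q" using \<rho> by (simp add: Q_def)
  obtain E where E: "0 \<le> E" "ennreal ((max 1 (1 / Q)) ^ N) * (\<integral>\<^sup>+x. indicator \<Omega> x * ennreal (G \<bar>u x\<bar>) \<partial>lborel) = ennreal E"
  proof -
    have "ennreal ((max 1 (1 / Q)) ^ N) * (\<integral>\<^sup>+x. indicator \<Omega> x * ennreal (G \<bar>u x\<bar>) \<partial>lborel) < \<infinity>"
      using finL by (simp add: ennreal_mult_less_top)
    thus ?thesis using that by (cases "ennreal ((max 1 (1 / Q)) ^ N) * (\<integral>\<^sup>+x. indicator \<Omega> x * ennreal (G \<bar>u x\<bar>) \<partial>lborel)") auto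
  qed
  obtain t0 where t0: "0 < t0" "\<And>t. t0 \<le> t \<Longrightarrow> T * Q \<le> g t" using g_unbounded by blast
  \<comment> \<open>The three entries absorb the tail, give t \<le> G t, and absorb the initial
    excess E.\<close>
  define t where "t = max t0 (max 1 (E / (\<epsilon> * \<rho> ^ ?n)))"
  have t: "t0 \<le> t" "1 \<le> t" "E / (\<epsilon> * \<rho> ^ ?n) \<le> t" by (auto simp: t_def)
  define H where "H = t * Q"
  have H: "0 < H" "H / Q = t" using t Q by (auto simp: H_def)
  have gT: "T \<le> 1 * g (H / Q) / Q" using t0(2)[OF t(1)] H Q by (simp add: le_divide_eq)
  have GE: "E \<le> \<epsilon> * \<rho> ^ ?n * G (H / Q)"
  proof -
    have "E \<le> \<epsilon> * \<rho> ^ ?n * t" using t(3) \<epsilon> \<rho> by (simp add: divide_le_eq mult_ac)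
    also have "\<dots> \<le> \<epsilon> * \<rho> ^ ?n * G t" using \<epsilon> \<rho> G_ge_self[OF t(2)] by (intro mult_left_mono) auto
    finally show ?thesis by (simp add: H)
  qed
  have bound: "AE x in lborel. x \<in> ball x0 R0 \<longrightarrow> U x \<le> l + H"
    if x0: "x0 \<in> K" and Uu: "\<And>x. U x \<le> \<bar>u x\<bar>" and l: "0 \<le> l" and dg: "dg_class s CC x0 \<rho> l U" for x0 U l
    unfolding R0_def
  proof (rule DG[OF \<rho>(1) H(1) order_refl dg])
    have "tail s x0 (\<rho>/2) l U \<le> ennreal T" using tail_le_abs[of U u l s x0 "\<rho>/2"] T(2)[OF D(2)[OF x0]] Uu l
      unfolding R0_def by (meson order_trans)
    thus "tail s x0 (\<rho>/2) l U \<le> ennreal (1 * g (H / \<rho> powr s) / \<rho> powr s)"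
      using gT unfolding Q_def by (meson ennreal_leI order_trans)
    have "ball x0 \<rho> \<subseteq> \<Omega>" using cbK'[OF x0] K'\<Omega> ball_subset_cball[of x0 \<rho>] by blast
    hence "excess s x0 \<rho> l U \<le> ennreal E"
      using excess_bound[OF um \<Omega>m Uu l \<rho>(1), of x0 s] E(2) unfolding Q_def by simp
    thus "excess s x0 \<rho> l U \<le> ennreal (\<epsilon> * \<rho> ^ ?n * G (H / \<rho> powr s))"
      using GE unfolding Q_def by (meson ennreal_leI order_trans)
  qed
  define A0 where "A0 = B + H"
  have A0: "0 \<le> A0" using B H by (simp add: A0_def)
  obtain \<alpha> C where \<alpha>: "0 < \<alpha>" "\<alpha> \<le> 1" "0 \<le> C" and HI: "\<And>(x0::'a) u. u \<in> borel_measurable borel \<Longrightarrow>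
     (\<And>R l. 0 < R \<Longrightarrow> R \<le> R0 \<Longrightarrow> dg_class s CC x0 R l (\<lambda>x. - u x)) \<Longrightarrow>
     (\<And>R l. 0 < R \<Longrightarrow> R \<le> R0 \<Longrightarrow> dg_class s CC x0 R l u \<or> (AE x in lborel. x \<in> ball x0 R \<longrightarrow> l - A * R powr \<beta> \<le> u x)) \<Longrightarrow>
     (AE x in lborel. x \<in> ball x0 R0 \<longrightarrow> \<bar>u x\<bar> \<le> A0) \<Longrightarrow>
     (\<integral>\<^sup>+y. indicator (- ball x0 R0) y * ennreal (g \<bar>u y / norm (y - x0) powr s\<bar> / (norm (y - x0) powr s * norm (y - x0) ^ ?n)) \<partial>lborel) \<le> ennreal T \<Longrightarrow>
     (\<forall>r. 0 < r \<longrightarrow> r \<le> R0 \<longrightarrow> (\<exists>m. AE x in lborel. x \<in> ball x0 r \<longrightarrow> \<bar>u x - m\<bar> \<le> C * r powr \<alpha>))"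
    using holder_iteration[OF s CC A \<beta> R0 A0, of T, where 'a = 'a] by blast
  have "\<forall>r. 0 < r \<longrightarrow> r \<le> R0 \<longrightarrow> (\<exists>m. AE y in lborel. y \<in> ball x r \<longrightarrow> \<bar>u y - m\<bar> \<le> C * r powr \<alpha>)" if x: "x \<in> K" for x
  proof (rule HI[OF um])
    have sub\<rho>: "cball x \<rho> \<subseteq> \<Omega>" using cbK'[OF x] K'\<Omega> by blast
    have cb: "cball x R \<subseteq> \<Omega>" if "R \<le> R0" for R
    proof -
      have "R \<le> \<rho>" using that \<rho> by (simp add: R0_def)
      thus ?thesis using sub\<rho> subset_cball[of R \<rho> x] by blast
    qed
    show "dg_class s CC x R l (\<lambda>x. - u x)" if "R \<le> R0" for R l by (rule dg_super[OF cb[OF that]])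
    show "dg_class s CC x R l u \<or> (AE y in lborel. y \<in> ball x R \<longrightarrow> l - A * R powr \<beta> \<le> u y)" if R: "0 < R" "R \<le> R0" for R l
    proof -
      have "R \<le> \<rho>" using R \<rho> by (simp add: R0_def)
      hence bK: "ball x R \<subseteq> K'" using cbK'[OF x] ball_subset_cball[of x R] subset_cball[of R \<rho> x] by blast
      from alt[OF R(1) bK, of l] show ?thesis
      proof
        assume "\<forall>y\<in>ball x R. \<psi> y \<le> ereal l"
        thus ?thesis using dg_sub[OF cb[OF R(2)]] by blast
      next
        assume lo: "\<forall>y\<in>ball x R. ereal (l - A * R powr \<beta>) \<le> \<psi> y"
        have "AE y in lborel. y \<in> ball x R \<longrightarrow> l - A * R powr \<beta> \<le> u y" using above
        proof (rule eventually_mono, intro impI)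
          fix y assume y: "y \<in> \<Omega> \<longrightarrow> \<psi> y \<le> ereal (u y)" "y \<in> ball x R"
          hence "\<psi> y \<le> ereal (u y)" using bK K'\<Omega> by blast
          moreover have "ereal (l - A * R powr \<beta>) \<le> \<psi> y" using lo y(2) by blast
          ultimately have "ereal (l - A * R powr \<beta>) \<le> ereal (u y)" by (rule order_trans[rotated])
          thus "l - A * R powr \<beta> \<le> u y" by simp
        qed
        thus ?thesis ..
      qed
    qed
    have "\<forall>y\<in>ball x \<rho>. \<psi> y \<le> ereal B" using B(2) cbK'[OF x] ball_subset_cball[of x \<rho>] by blast
    hence up: "AE y in lborel. y \<in> ball x R0 \<longrightarrow> u y \<le> B + H"
      by (intro bound[OF x _ B(1)] dg_sub[OF sub\<rho>]) auto
    have lo: "AE y in lborel. y \<in> ball x R0 \<longrightarrow> - u y \<le> 0 + H"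
      by (rule bound[OF x _ order_refl dg_super[OF sub\<rho>]]) auto
    show "AE y in lborel. y \<in> ball x R0 \<longrightarrow> \<bar>u y\<bar> \<le> A0"
      using up lo by eventually_elim (use B(1) in \<open>auto simp: A0_def\<close>)
    show "(\<integral>\<^sup>+y. indicator (- ball x R0) y * ennreal (g \<bar>u y / norm (y - x) powr s\<bar> / (norm (y - x) powr s * norm (y - x) ^ ?n)) \<partial>lborel) \<le> ennreal T"
      by (rule T(2)[OF D(2)[OF x]])
  qed
  thus ?thesis using \<alpha> R0 by (intro exI[of _ \<alpha>] exI[of _ C] exI[of _ R0]) auto
qed

text \<open>Inside \<Omega> the integrand is at most N (1 + G |u|), integrable because \<Omega> is
  bounded; outside, u coincides with \<theta>, whose tail is finite.\<close>

lemma obstacle_tail_finite: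
  fixes u u0 \<theta> :: "'a::euclidean_space \<Rightarrow> real"
  assumes s: "0 < s" "s < 1" and [measurable]: "\<Omega> \<in> sets borel" and um[measurable]: "u \<in> borel_measurable borel"
    and bd: "bounded \<Omega>"
    and finL: "(\<integral>\<^sup>+x. indicator \<Omega> x * ennreal (G \<bar>u x\<bar>) \<partial>lborel) < \<infinity>"
    and \<theta>: "in_tail g s \<theta>" and eq: "AE x in lebesgue. x \<notin> \<Omega> \<longrightarrow> u x = \<theta> x"
  shows "(\<integral>\<^sup>+x. ennreal (g \<bar>\<bar>u x\<bar> / (1 + norm x) powr s\<bar> * (1 + norm x) powr (- (real DIM('a) + s))) \<partial>lborel) < \<infinity>"
proof -
  define F where "F v x = ennreal (g (\<bar>v x\<bar> / (1 + norm x) powr s) * (1 + norm x) powr (- (real DIM('a) + s)))" for v and x :: 'a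
  have \<theta>F: "(\<integral>\<^sup>+x. F \<theta> x \<partial>lebesgue) < \<infinity>" using \<theta> by (simp add: in_tail_def F_def)
  have [measurable]: "\<theta> \<in> borel_measurable lebesgue" using \<theta> by (simp add: in_tail_def)
  define P where "P x = ennreal (real N) * indicator \<Omega> x + ennreal (real N) * (indicator \<Omega> x * ennreal (G \<bar>u x\<bar>))" for x
  have Pm[measurable]: "P \<in> borel_measurable borel" unfolding P_def by measurable
  have m1: "(\<lambda>x. ennreal (real N) * indicator \<Omega> x) \<in> borel_measurable lborel" by measurable
  have m3: "(\<lambda>x. indicator \<Omega> x * ennreal (G \<bar>u x\<bar>)) \<in> borel_measurable lborel" by measurable
  have m2: "(\<lambda>x. ennreal (real N) * (indicator \<Omega> x * ennreal (G \<bar>u x\<bar>))) \<in> borel_measurable lborel" by measurable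
  have PI: "(\<integral>\<^sup>+x. P x \<partial>lborel) = ennreal (real N) * emeasure lborel \<Omega> + ennreal (real N) * (\<integral>\<^sup>+x. indicator \<Omega> x * ennreal (G \<bar>u x\<bar>) \<partial>lborel)"
    unfolding P_def nn_integral_add[OF m1 m2] nn_integral_cmult[OF m3] by (simp add: nn_integral_cmult_indicator)
  note id_measurable_lebesgue[measurable]
  have "F \<theta> = (\<lambda>x. ennreal (g \<bar>\<bar>\<theta> x\<bar> / (1 + norm x) powr s\<bar> * (1 + norm x) powr (- (real DIM('a) + s))))"
    by (simp add: F_def fun_eq_iff)
  also have "\<dots> \<in> borel_measurable lebesgue" by measurable
  finally have F\<theta>m: "F \<theta> \<in> borel_measurable lebesgue" .
  have "(\<integral>\<^sup>+x. F u x \<partial>lebesgue) \<le> (\<integral>\<^sup>+x. P x + F \<theta> x \<partial>lebesgue)"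
  proof (rule nn_integral_mono_AE)
    show "AE x in lebesgue. F u x \<le> P x + F \<theta> x"
      using eq
    proof (rule eventually_mono)
      fix x assume x: "x \<notin> \<Omega> \<longrightarrow> u x = \<theta> x"
      show "F u x \<le> P x + F \<theta> x"
      proof (cases "x \<in> \<Omega>")
        case False
        thus ?thesis using x by (simp add: F_def)
      next
        case True
        have e1: "1 \<le> (1 + norm x) powr s" using s by (intro ge_one_powr_ge_zero) auto
        have e2: "(1 + norm x) powr (- (real DIM('a) + s)) \<le> 1"
        proof -
          have "(1 + norm x) powr (- (real DIM('a) + s)) \<le> (1 + norm x) powr 0" using s by (intro powr_mono) auto
          thus ?thesis by (simp split: if_splits)
        qed
        have "\<bar>u x\<bar> / (1 + norm x) powr s \<le> \<bar>u x\<bar> / 1" using e1 by (intro divide_left_mono) auto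
        hence "g (\<bar>u x\<bar> / (1 + norm x) powr s) \<le> g \<bar>u x\<bar>" by (intro g_mono) auto
        also have "\<dots> \<le> real N * (1 + G \<bar>u x\<bar>)" by (rule g_le_G) simp
        finally have "g (\<bar>u x\<bar> / (1 + norm x) powr s) * (1 + norm x) powr (- (real DIM('a) + s)) \<le> real N * (1 + G \<bar>u x\<bar>) * 1"
          using e2 by (intro mult_mono) (auto intro!: mult_nonneg_nonneg add_nonneg_nonneg G_nonneg)
        hence "F u x \<le> ennreal (real N + real N * G \<bar>u x\<bar>)" unfolding F_def by (intro ennreal_leI) (simp add: algebra_simps)
        also have "\<dots> = P x" unfolding P_def using True by (simp add: ennreal_plus ennreal_mult' G_nonneg)
        finally show ?thesis by (rule order_trans) simp
      qed
    qed
  qed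
  also have "\<dots> = (\<integral>\<^sup>+x. P x \<partial>lebesgue) + (\<integral>\<^sup>+x. F \<theta> x \<partial>lebesgue)"
    by (rule nn_integral_add[OF measurable_lebesgueI[OF Pm] F\<theta>m])
  also have "(\<integral>\<^sup>+x. P x \<partial>lebesgue) = (\<integral>\<^sup>+x. P x \<partial>lborel)" by (rule nn_integral_completion)
  also have "\<dots> = ennreal (real N) * emeasure lborel \<Omega> + ennreal (real N) * (\<integral>\<^sup>+x. indicator \<Omega> x * ennreal (G \<bar>u x\<bar>) \<partial>lborel)"
    by (rule PI)
  also have "\<dots> + (\<integral>\<^sup>+x. F \<theta> x \<partial>lebesgue) < \<infinity>"
    using finL \<theta>F emeasure_bounded_finite[OF bd] by (simp add: ennreal_mult_less_top)
  finally have "(\<integral>\<^sup>+x. F u x \<partial>lebesgue) < \<infinity>" .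
  thus ?thesis by (simp add: F_def nn_integral_completion)
qed

end

theorem theorem4p7:
  fixes s \<Lambda> p q :: real
    and G g :: "real \<Rightarrow> real"
    and k :: "'a::euclidean_space \<Rightarrow> 'a \<Rightarrow> real"
    and \<Omega> \<Omega>' :: "'a set"
    and \<psi> :: "'a \<Rightarrow> ereal"
    and \<theta> u :: "'a \<Rightarrow> real"
  assumes s: "0 < s" "s < 1"
    and Lam: "\<Lambda> \<ge> 1"
    and G: "growth_fun G g p q"
    and k_meas: "(\<lambda>z. k (fst z) (snd z)) \<in> borel_measurable (lebesgue \<Otimes>\<^sub>M lebesgue)"
    and k_bounds: "AE z in lebesgue \<Otimes>\<^sub>M lebesgue.
                     1 / \<Lambda> \<le> k (fst z) (snd z) \<and> k (fst z) (snd z) \<le> \<Lambda> \<and>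
                     k (fst z) (snd z) = k (snd z) (fst z)"
    and Omega: "open \<Omega>" "bounded \<Omega>" "open \<Omega>'" "bounded \<Omega>'" "closure \<Omega> \<subseteq> \<Omega>'"
    and theta: "in_W s G \<Omega> \<Omega>' \<theta>" "in_tail g s \<theta>"
    and psi: "(\<forall>x\<in>\<Omega>. \<bar>\<psi> x\<bar> \<noteq> \<infinity>) \<and> locally_holder_on \<Omega> (\<lambda>x. real_of_ereal (\<psi> x))
              \<or> (\<forall>x\<in>\<Omega>. \<psi> x = -\<infinity>)"
    and sol: "obstacle_solution s G g k \<Omega> \<Omega>' \<psi> \<theta> u"
  shows "\<exists>w. (AE x in lebesgue. u x = w x) \<and> locally_holder_on \<Omega> w"
proof -
  interpret growth G g p "nat \<lceil>q\<rceil>" using G by (rule growth_fun_imp_growth)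
  have \<Omega>m[measurable]: "\<Omega> \<in> sets borel" and \<Omega>'m[measurable]: "\<Omega>' \<in> sets borel" using Omega by simp_all
  have sub: "\<Omega> \<subseteq> \<Omega>'" using Omega(5) closure_subset by blast
  have uW: "in_W s G \<Omega> \<Omega>' u" and above: "AE x in lebesgue. x \<in> \<Omega> \<longrightarrow> \<psi> x \<le> ereal (u x)"
    and uW0: "in_W0 s G \<Omega> \<Omega>' (\<lambda>x. u x - \<theta> x)"
    using sol by (auto simp: obstacle_solution_def obstacle_set_def)
  have ul: "u \<in> borel_measurable lebesgue" using uW by (simp add: in_W_def)
  \<comment> \<open>Modulars, constraint and energy see u only up to null sets, while the estimates
    integrate Borel functions iteratively; everything is therefore transferred to v.\<close>
  obtain v where v[measurable]: "v \<in> borel_measurable borel" and "AE x in lborel. u x = v x"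
    using completion_ex_borel_measurable_real[OF ul] by auto
  hence uv: "AE x in lebesgue. u x = v x" by (intro AE_completion)
  have uv2: "AE z in (lebesgue :: 'a measure) \<Otimes>\<^sub>M (lebesgue :: 'a measure). u (fst z) = v (fst z) \<and> u (snd z) = v (snd z)"
    by (rule AE_lebesgue_pair[OF uv])
  have finL: "(\<integral>\<^sup>+x. indicator \<Omega> x * ennreal (G \<bar>v x\<bar>) \<partial>lborel) < \<infinity>"
  proof -
    have "(\<integral>\<^sup>+x. indicator \<Omega> x * ennreal (G \<bar>v x\<bar>) \<partial>lborel) = (\<integral>\<^sup>+x. indicator \<Omega> x * ennreal (G \<bar>v x\<bar>) \<partial>lebesgue)"
      by (rule nn_integral_completion[symmetric])
    also have "\<dots> = modular_L G \<Omega> u" unfolding modular_L_def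
      by (rule nn_integral_cong_AE) (use uv in \<open>auto elim!: eventually_mono\<close>)
    finally show ?thesis using uW by (simp add: in_W_def)
  qed
  have finW: "(\<integral>\<^sup>+x. \<integral>\<^sup>+y. indicator \<Omega> x * indicator \<Omega>' y * ennreal (G \<bar>Ds s v x y\<bar> / norm (x - y) ^ DIM('a)) \<partial>lborel \<partial>lborel) < \<infinity>"
  proof -
    have "modular_W s G \<Omega> \<Omega>' v = (\<integral>\<^sup>+x. \<integral>\<^sup>+y. indicator \<Omega> x * indicator \<Omega>' y * ennreal (G \<bar>Ds s v x y\<bar> / norm (x - y) ^ DIM('a)) \<partial>lborel \<partial>lborel)"
      by (rule modular_W_borel) (unfold Ds_def, measurable)
    moreover have "modular_W s G \<Omega> \<Omega>' v = modular_W s G \<Omega> \<Omega>' u" unfolding modular_W_def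
      by (rule nn_integral_cong_AE, rule eventually_mono[OF uv2]) (simp add: Ds_def)
    ultimately show ?thesis using uW by (simp add: in_W_def)
  qed
  have finT: "(\<integral>\<^sup>+x. ennreal (g \<bar>\<bar>v x\<bar> / (1 + norm x) powr s\<bar> * (1 + norm x) powr (- (real DIM('a) + s))) \<partial>lborel) < \<infinity>"
  proof (rule obstacle_tail_finite[OF s \<Omega>m v Omega(2) finL theta(2)])
    have "AE x in lebesgue. x \<notin> \<Omega> \<longrightarrow> u x - \<theta> x = 0" using uW0 by (simp add: in_W0_def)
    with uv show "AE x in lebesgue. x \<notin> \<Omega> \<longrightarrow> v x = \<theta> x" by eventually_elim auto
  qed
  have above_v: "AE x in lborel. x \<in> \<Omega> \<longrightarrow> \<psi> x \<le> ereal (v x)"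
  proof -
    have "AE x in lebesgue. x \<in> \<Omega> \<longrightarrow> \<psi> x \<le> ereal (v x)" using above uv by eventually_elim auto
    thus ?thesis by (simp add: AE_completion_iff)
  qed
  have k2: "AE z in lebesgue \<Otimes>\<^sub>M lebesgue. 1 / \<Lambda> \<le> k (fst z) (snd z) \<and> k (fst z) (snd z) \<le> \<Lambda>"
    using k_bounds by (rule eventually_mono) auto
  have min: "integrable (lebesgue \<Otimes>\<^sub>M lebesgue) (energy_integrand s g k v w) \<and> 0 \<le> energy s g k v w"
    if w: "w \<in> borel_measurable borel" "compact K" "K \<subseteq> \<Omega>" "\<And>x. x \<notin> K \<Longrightarrow> w x = 0"
       "(\<integral>\<^sup>+x. ennreal (G \<bar>w x\<bar>) \<partial>lborel) < \<infinity>" "MW s G w < \<infinity>"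
      and ob: "AE x in lborel. x \<in> \<Omega> \<longrightarrow> \<psi> x \<le> ereal (v x + w x)" for w K
  proof -
    have "AE x in lebesgue. x \<in> \<Omega> \<longrightarrow> \<psi> x \<le> ereal (u x + w x)"
      using AE_completion[OF ob] uv by eventually_elim auto
    note P = obstacle_perturbation[OF s Omega(1,2) \<Omega>'m sol w this]
    \<comment> \<open>The values of u are replaced by those of v at both points, which alters the
      integrand only on a null set of the product.\<close>
    have ae: "AE z in lebesgue \<Otimes>\<^sub>M lebesgue. energy_integrand s g k u w z = energy_integrand s g k v w z"
      using uv2 by (rule eventually_mono) (simp add: energy_integrand_def Ds_def)
    have vm: "energy_integrand s g k v w \<in> borel_measurable (lebesgue \<Otimes>\<^sub>M lebesgue)"
    proof -
      have d: "(\<lambda>z. Ds s v (fst z) (snd z)) \<in> borel_measurable (lebesgue \<Otimes>\<^sub>M lebesgue)"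
        "(\<lambda>z. Ds s w (fst z) (snd z)) \<in> borel_measurable (lebesgue \<Otimes>\<^sub>M lebesgue)"
        using v w(1) by (auto intro!: Ds_measurable_lebesgue measurable_lebesgueI)
      have n: "(\<lambda>z. norm (fst z - snd z) ^ DIM('a)) \<in> borel_measurable ((lebesgue :: 'a measure) \<Otimes>\<^sub>M (lebesgue :: 'a measure))"
        by (rule measurable_lebesgue_pairI) measurable
      show ?thesis unfolding energy_integrand_def using d n k_meas by measurable
    qed
    have "integrable (lebesgue \<Otimes>\<^sub>M lebesgue) (energy_integrand s g k v w)"
      using P(1) integrable_cong_AE[OF borel_measurable_integrable[OF P(1)] vm ae] by blast
    moreover have "energy s g k v w = energy s g k u w" unfolding energy_def
      using integral_cong_AE[OF borel_measurable_integrable[OF P(1)] vm ae] by simp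
    ultimately show ?thesis using P(2) by simp
  qed
  have "\<exists>w. (AE x in lborel. v x = w x) \<and> locally_holder_on \<Omega> w"
    by (rule holder_representative[OF Omega(1)],
        rule obstacle_local_oscillation[OF s Lam k2 Omega(1,2) \<Omega>'m sub psi v finL finW finT above_v min])
  then obtain w where w: "AE x in lborel. v x = w x" "locally_holder_on \<Omega> w" by blast
  have "AE x in lebesgue. u x = w x" using AE_completion[OF w(1)] uv by eventually_elim simp
  thus ?thesis using w(2) by blast
qed

end
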